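(* Let $\mathcal{M}$ be a von Neumann algebra acting on a separable Hilbert space $\mathcal{H}$ and let $\mathcal{N}$ be a von Neumann subalgebra of $\mathcal{M}$. Then the following conditions are equivalent: (1) $\mathcal{N}$ is completely singular in $\mathcal{M}$; (2) $\mathcal{N}\bar\otimes\mathcal{B}(l^2(\mathbb{N}))$ is singular in $\mathcal{M}\bar\otimes\mathcal{B}(l^2(\mathbb{N}))$; (3) for every $\theta\in\operatorname{Aut}(\mathcal{N}')$, if $\theta(X)=X$ for all $X\in\mathcal{M}'$, then $\theta(Y)=Y$ for all $Y\in\mathcal{N}'$.
   Context: $\bar\otimes$ denotes the von Neumann algebra tensor product, and von Neumann subalgebras contain the identity of the ambient algebra. $\mathcal{M}'$ and $\mathcal{N}'$ are the commutants in $\mathcal{B}(\mathcal{H})$ (so $\mathcal{M}'\subseteq\mathcal{N}'$), and $\operatorname{Aut}(\mathcal{N}')$ is the group of $*$-automorphisms of $\mathcal{N}'$. A von Neumann subalgebra $\mathcal{N}$ of a von Neumann algebra $\mathcal{M}$ is singular in $\mathcal{M}$ if every unitary $U\in\mathcal{M}$ with $U\mathcal{N}U^*=\mathcal{N}$ belongs to $\mathcal{N}$. $\mathcal{N}$ is completely singular in $\mathcal{M}$ if $\mathcal{N}\bar\otimes\mathcal{B}(\mathcal{K})$ is singular in $\mathcal{M}\bar\otimes\mathcal{B}(\mathcal{K})$ for every Hilbert space $\mathcal{K}$. *)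

theory Defs
  imports "HOL-Analysis.Analysis" "HOL-Algebra.Module"
begin

section \<open>Complex Hilbert spaces\<close>

text \<open>Hilbert spaces are records over explicit carriers, because the spaces \<open>K\<close> in the
  definition of complete singularity have to be quantified inside a formula.  The multiplicative
  fields inherited by the record type of modules are not used.\<close>

definition complex_field :: "complex ring" where
  "complex_field = \<lparr>carrier = UNIV, monoid.mult = (*), one = 1, zero = 0, add = (+)\<rparr>"

record 'a hilbert = "(complex, 'a) module" +
  cinner :: "'a \<Rightarrow> 'a \<Rightarrow> complex"

locale complex_inner_product_space = Module.module complex_field H
  for H :: "'a hilbert" (structure) +
  assumes cinner_add_left:
      "\<lbrakk>x \<in> carrier H; y \<in> carrier H; z \<in> carrier H\<rbrakk>
        \<Longrightarrow> cinner H (x \<oplus> y) z = cinner H x z + cinner H y z"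
    and cinner_smult_left:
      "\<lbrakk>x \<in> carrier H; y \<in> carrier H\<rbrakk> \<Longrightarrow> cinner H (c \<odot> x) y = c * cinner H x y"
    and cinner_commute:
      "\<lbrakk>x \<in> carrier H; y \<in> carrier H\<rbrakk> \<Longrightarrow> cinner H x y = cnj (cinner H y x)"
    and cinner_pos:
      "\<lbrakk>x \<in> carrier H; x \<noteq> \<zero>\<rbrakk> \<Longrightarrow> 0 < Re (cinner H x x)"

definition hnorm :: "'a hilbert \<Rightarrow> 'a \<Rightarrow> real" where
  "hnorm H x = sqrt (Re (cinner H x x))"

text \<open>The locale \<open>Metric_space\<close> wants a nonnegative symmetric distance on the whole type, hence
  the value \<open>0\<close> off the carrier.\<close>

definition hdist :: "'a hilbert \<Rightarrow> 'a \<Rightarrow> 'a \<Rightarrow> real" where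
  "hdist H x y =
    (if x \<in> carrier H \<and> y \<in> carrier H then hnorm H (x \<ominus>\<^bsub>H\<^esub> y) else 0)"

lemma complex_field_simps [simp]:
  "carrier complex_field = UNIV" "x \<otimes>\<^bsub>complex_field\<^esub> y = x * y" "\<one>\<^bsub>complex_field\<^esub> = 1"
  "\<zero>\<^bsub>complex_field\<^esub> = 0" "x \<oplus>\<^bsub>complex_field\<^esub> y = x + y"
  by (simp_all add: complex_field_def)

lemma cring_complex_field: "cring complex_field"
proof (rule cringI)
  show "abelian_group complex_field"
  proof (rule abelian_groupI)
    fix x assume "x \<in> carrier complex_field"
    show "\<exists>y\<in>carrier complex_field. y \<oplus>\<^bsub>complex_field\<^esub> x = \<zero>\<^bsub>complex_field\<^esub>"
      by (rule bexI[of _ "- x"]) auto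
  qed auto
  show "comm_monoid complex_field"
    by (rule comm_monoidI) auto
qed (auto simp: algebra_simps)

context complex_inner_product_space
begin

lemma cinner_zero_left: "y \<in> carrier H \<Longrightarrow> cinner H \<zero> y = 0"
  using cinner_add_left[of \<zero> \<zero> y] by simp

lemma cinner_self_nonneg: "x \<in> carrier H \<Longrightarrow> 0 \<le> Re (cinner H x x)"
  by (metis cinner_pos cinner_zero_left less_eq_real_def zero_complex.sel(1))

lemma cinner_self_real: "x \<in> carrier H \<Longrightarrow> cinner H x x = of_real ((hnorm H x)\<^sup>2)"
  using cinner_commute[of x x] cinner_self_nonneg[of x]
  by (simp add: hnorm_def complex_eq_iff)

lemma cinner_add_right:
  "\<lbrakk>x \<in> carrier H; y \<in> carrier H; z \<in> carrier H\<rbrakk>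
    \<Longrightarrow> cinner H z (x \<oplus> y) = cinner H z x + cinner H z y"
  using cinner_commute[of z "x \<oplus> y"] cinner_commute[of z x] cinner_commute[of z y]
  by (simp add: cinner_add_left)

lemma cinner_smult_right:
  "\<lbrakk>x \<in> carrier H; y \<in> carrier H\<rbrakk> \<Longrightarrow> cinner H x (c \<odot> y) = cnj c * cinner H x y"
  using cinner_commute[of x "c \<odot> y"] cinner_commute[of x y]
  by (simp add: cinner_smult_left)

lemma hnorm_nonneg: "x \<in> carrier H \<Longrightarrow> 0 \<le> hnorm H x"
  by (simp add: hnorm_def cinner_self_nonneg)

lemma hnorm_eq_0: "x \<in> carrier H \<Longrightarrow> hnorm H x = 0 \<longleftrightarrow> x = \<zero>"
  using cinner_pos[of x] cinner_zero_left[of \<zero>] by (force simp: hnorm_def)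

lemma hnorm_smult: "x \<in> carrier H \<Longrightarrow> hnorm H (c \<odot> x) = cmod c * hnorm H x"
proof -
  assume x: "x \<in> carrier H"
  have "cinner H (c \<odot> x) (c \<odot> x) = of_real ((cmod c)\<^sup>2 * (hnorm H x)\<^sup>2)"
    using x complex_norm_square[of c] cinner_self_real[OF x]
    by (simp add: cinner_smult_left cinner_smult_right)
  then have "Re (cinner H (c \<odot> x) (c \<odot> x)) = (cmod c * hnorm H x)\<^sup>2"
    by (simp add: power_mult_distrib)
  then show ?thesis
    using hnorm_nonneg[OF x] by (simp add: hnorm_def[of H "c \<odot> x"])
qed

lemma hnorm_add_sq:
  assumes "x \<in> carrier H" "y \<in> carrier H"
  shows "(hnorm H (x \<oplus> y))\<^sup>2 = (hnorm H x)\<^sup>2 + 2 * Re (cinner H x y) + (hnorm H y)\<^sup>2"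
proof -
  have "Re (cinner H y x) = Re (cinner H x y)"
    using cinner_commute[of x y] assms by simp
  moreover have "x \<oplus> y \<in> carrier H" using assms by simp
  moreover have "(hnorm H z)\<^sup>2 = Re (cinner H z z)" if "z \<in> carrier H" for z
    using that by (simp add: hnorm_def cinner_self_nonneg)
  ultimately show ?thesis
    using assms by (simp add: cinner_add_left cinner_add_right)
qed

lemma Cauchy_Schwarz:
  assumes x: "x \<in> carrier H" and y: "y \<in> carrier H"
  shows "cmod (cinner H x y) \<le> hnorm H x * hnorm H y"
proof (cases "y = \<zero>")
  case True
  have "cinner H x y = cnj (cinner H y x)"
    using x y by (rule cinner_commute)
  then show ?thesis
    using True x hnorm_eq_0[of y] y by (simp add: cinner_zero_left)
next
  case False
  define p where "p = cinner H x y"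
  define r where "r = hnorm H y"
  have r: "r > 0"
    using False y hnorm_eq_0[of y] hnorm_nonneg[of y] by (simp add: r_def)
  define c where "c = - p / of_real (r\<^sup>2)"
  have cp: "Re (cinner H x (c \<odot> y)) = - (cmod p)\<^sup>2 / r\<^sup>2"
  proof -
    have "cinner H x (c \<odot> y) = - (cnj p * p) / of_real (r\<^sup>2)"
      using x y by (simp add: cinner_smult_right p_def c_def)
    also have "cnj p * p = of_real ((cmod p)\<^sup>2)"
      using complex_norm_square[of p] by (simp add: mult.commute)
    finally have "cinner H x (c \<odot> y) = of_real (- (cmod p)\<^sup>2 / r\<^sup>2)" by simp
    then show ?thesis by (metis Re_complex_of_real)
  qed
  have "cmod c = cmod p / r\<^sup>2"
    using r by (simp add: c_def norm_divide norm_power)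
  then have n: "(hnorm H (c \<odot> y))\<^sup>2 = (cmod p)\<^sup>2 / r\<^sup>2"
    using r y by (simp add: hnorm_smult r_def[symmetric] power_mult_distrib power_divide)
      (simp add: field_simps eval_nat_numeral)
  have "0 \<le> (hnorm H (x \<oplus> c \<odot> y))\<^sup>2" by simp
  also have "\<dots> = (hnorm H x)\<^sup>2 - (cmod p)\<^sup>2 / r\<^sup>2"
    using x y by (simp add: hnorm_add_sq cp n)
  finally have "(cmod p)\<^sup>2 \<le> (hnorm H x * r)\<^sup>2"
    using r by (simp add: field_simps power_mult_distrib)
  then show ?thesis
    using hnorm_nonneg[OF x] r power2_le_imp_le by (simp add: p_def r_def)
qed

lemma hnorm_triangle:
  assumes x: "x \<in> carrier H" and y: "y \<in> carrier H"
  shows "hnorm H (x \<oplus> y) \<le> hnorm H x + hnorm H y"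
proof (rule power2_le_imp_le)
  have "Re (cinner H x y) \<le> hnorm H x * hnorm H y"
    using Cauchy_Schwarz[OF x y] complex_Re_le_cmod order_trans by blast
  then show "(hnorm H (x \<oplus> y))\<^sup>2 \<le> (hnorm H x + hnorm H y)\<^sup>2"
    using hnorm_add_sq[OF x y] by (simp add: power2_sum)
  show "0 \<le> hnorm H x + hnorm H y"
    using x y by (simp add: hnorm_nonneg)
qed

lemma hnorm_minus_commute:
  assumes x: "x \<in> carrier H" and y: "y \<in> carrier H"
  shows "hnorm H (x \<ominus> y) = hnorm H (y \<ominus> x)"
proof -
  have "\<ominus>\<^bsub>complex_field\<^esub> 1 = (- 1 :: complex)"
    using cring.cring_simprules(17)[OF cring_complex_field, of 1]
    by (metis R.add.inv_equality UNIV_I add.left_inverse complex_field_simps(1,4,5))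
  then have "(- 1) \<odot> (x \<ominus> y) = \<ominus> (x \<ominus> y)"
    using smult_l_minus[of 1 "x \<ominus> y"] smult_one[of "x \<ominus> y"] x y by simp
  also have "\<dots> = y \<ominus> x"
    using x y by (simp add: a_minus_def M.minus_add M.a_comm)
  finally show ?thesis
    using hnorm_smult[of "x \<ominus> y" "- 1"] x y by simp
qed

sublocale Metric_space "carrier H" "hdist H"
proof
  show "0 \<le> hdist H x y" for x y
    by (simp add: hdist_def hnorm_nonneg)
  show "hdist H x y = hdist H y x" for x y
    by (simp add: hdist_def hnorm_minus_commute)
  show "hdist H x y = 0 \<longleftrightarrow> x = y" if "x \<in> carrier H" "y \<in> carrier H" for x y
  proof -
    have "x \<ominus> y = \<zero> \<longleftrightarrow> x = y"
      using that by (metis M.minus_closed M.minus_eq M.minus_equality M.minus_minus M.r_neg M.a_inv_closed)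
    then show ?thesis
      using that hnorm_eq_0[of "x \<ominus> y"] by (simp add: hdist_def)
  qed
  show "hdist H x z \<le> hdist H x y + hdist H y z"
    if "x \<in> carrier H" "y \<in> carrier H" "z \<in> carrier H" for x y z
  proof -
    have "x \<ominus> z = (x \<ominus> y) \<oplus> (y \<ominus> z)"
      using that by (simp add: a_minus_def M.a_assoc M.r_neg1)
    then show ?thesis
      using that hnorm_triangle[of "x \<ominus> y" "y \<ominus> z"] by (simp add: hdist_def)
  qed
qed

end

locale hilbert_space = complex_inner_product_space +
  assumes complete: "Metric_space.mcomplete (carrier H) (hdist H)"

definition separable_hilbert :: "'a hilbert \<Rightarrow> bool" where
  "separable_hilbert H \<longleftrightarrow> separable_space (Metric_space.mtopology (carrier H) (hdist H))"

definition ell2 :: "(nat \<Rightarrow> complex) hilbert" where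
  "ell2 = \<lparr>carrier = {f. summable (\<lambda>n. (cmod (f n))\<^sup>2)},
           monoid.mult = undefined, one = undefined,
           zero = (\<lambda>n. 0), add = (\<lambda>f g n. f n + g n),
           smult = (\<lambda>c f n. c * f n),
           cinner = (\<lambda>f g. \<Sum>n. f n * cnj (g n))\<rparr>"


section \<open>Bounded operators\<close>

text \<open>Operators are extensional functions on the carrier, so that equality of operators is
  equality of functions.\<close>

definition bounded_ops :: "'a hilbert \<Rightarrow> ('a \<Rightarrow> 'a) set" where
  "bounded_ops H = {T \<in> carrier H \<rightarrow>\<^sub>E carrier H.
     (\<forall>x\<in>carrier H. \<forall>y\<in>carrier H. T (x \<oplus>\<^bsub>H\<^esub> y) = T x \<oplus>\<^bsub>H\<^esub> T y) \<and>
     (\<forall>c. \<forall>x\<in>carrier H. T (c \<odot>\<^bsub>H\<^esub> x) = c \<odot>\<^bsub>H\<^esub> T x) \<and>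
     (\<exists>C. \<forall>x\<in>carrier H. hnorm H (T x) \<le> C * hnorm H x)}"

definition op_one :: "'a hilbert \<Rightarrow> 'a \<Rightarrow> 'a" where
  "op_one H = (\<lambda>x\<in>carrier H. x)"

definition op_mult :: "'a hilbert \<Rightarrow> ('a \<Rightarrow> 'a) \<Rightarrow> ('a \<Rightarrow> 'a) \<Rightarrow> 'a \<Rightarrow> 'a" where
  "op_mult H S T = compose (carrier H) S T"

definition op_add :: "'a hilbert \<Rightarrow> ('a \<Rightarrow> 'a) \<Rightarrow> ('a \<Rightarrow> 'a) \<Rightarrow> 'a \<Rightarrow> 'a" where
  "op_add H S T = (\<lambda>x\<in>carrier H. S x \<oplus>\<^bsub>H\<^esub> T x)"

definition op_smult :: "'a hilbert \<Rightarrow> complex \<Rightarrow> ('a \<Rightarrow> 'a) \<Rightarrow> 'a \<Rightarrow> 'a" where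
  "op_smult H c T = (\<lambda>x\<in>carrier H. c \<odot>\<^bsub>H\<^esub> T x)"

definition op_adj :: "'a hilbert \<Rightarrow> ('a \<Rightarrow> 'a) \<Rightarrow> 'a \<Rightarrow> 'a" where
  "op_adj H T = (THE S. S \<in> bounded_ops H \<and>
     (\<forall>x\<in>carrier H. \<forall>y\<in>carrier H. cinner H (T x) y = cinner H x (S y)))"

definition unitary_op :: "'a hilbert \<Rightarrow> ('a \<Rightarrow> 'a) \<Rightarrow> bool" where
  "unitary_op H U \<longleftrightarrow> U \<in> bounded_ops H \<and>
     op_mult H (op_adj H U) U = op_one H \<and> op_mult H U (op_adj H U) = op_one H"

text \<open>The weak operator topology: the coarsest topology on the bounded operators for which all
  the functions \<open>T \<mapsto> \<langle>T x, y\<rangle>\<close> are continuous.\<close>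

definition weak_operator_topology :: "'a hilbert \<Rightarrow> ('a \<Rightarrow> 'a) topology" where
  "weak_operator_topology H =
     pullback_topology (bounded_ops H)
       (\<lambda>T. \<lambda>(x, y) \<in> carrier H \<times> carrier H. cinner H (T x) y)
       (product_topology (\<lambda>_. euclidean) (carrier H \<times> carrier H))"


section \<open>Von Neumann algebras\<close>

definition von_neumann_algebra :: "'a hilbert \<Rightarrow> ('a \<Rightarrow> 'a) set \<Rightarrow> bool" where
  "von_neumann_algebra H M \<longleftrightarrow>
     M \<subseteq> bounded_ops H \<and> op_one H \<in> M \<and>
     (\<forall>S\<in>M. \<forall>T\<in>M. op_add H S T \<in> M \<and> op_mult H S T \<in> M) \<and>
     (\<forall>c. \<forall>T\<in>M. op_smult H c T \<in> M) \<and>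
     (\<forall>T\<in>M. op_adj H T \<in> M) \<and>
     closedin (weak_operator_topology H) M"

definition von_neumann_subalgebra ::
    "'a hilbert \<Rightarrow> ('a \<Rightarrow> 'a) set \<Rightarrow> ('a \<Rightarrow> 'a) set \<Rightarrow> bool" where
  "von_neumann_subalgebra H N M \<longleftrightarrow> von_neumann_algebra H N \<and> N \<subseteq> M"

definition commutant :: "'a hilbert \<Rightarrow> ('a \<Rightarrow> 'a) set \<Rightarrow> ('a \<Rightarrow> 'a) set" where
  "commutant H M = {T \<in> bounded_ops H. \<forall>S\<in>M. op_mult H T S = op_mult H S T}"

definition generated_von_neumann_algebra ::
    "'a hilbert \<Rightarrow> ('a \<Rightarrow> 'a) set \<Rightarrow> ('a \<Rightarrow> 'a) set" where
  "generated_von_neumann_algebra H G = \<Inter> {A. von_neumann_algebra H A \<and> G \<subseteq> A}"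

text \<open>The values of \<open>\<theta>\<close> outside \<open>A\<close> are arbitrary.\<close>

definition star_automorphism ::
    "'a hilbert \<Rightarrow> ('a \<Rightarrow> 'a) set \<Rightarrow> (('a \<Rightarrow> 'a) \<Rightarrow> 'a \<Rightarrow> 'a) \<Rightarrow> bool" where
  "star_automorphism H A \<theta> \<longleftrightarrow>
     bij_betw \<theta> A A \<and>
     (\<forall>S\<in>A. \<forall>T\<in>A. \<theta> (op_add H S T) = op_add H (\<theta> S) (\<theta> T)) \<and>
     (\<forall>c. \<forall>T\<in>A. \<theta> (op_smult H c T) = op_smult H c (\<theta> T)) \<and>
     (\<forall>S\<in>A. \<forall>T\<in>A. \<theta> (op_mult H S T) = op_mult H (\<theta> S) (\<theta> T)) \<and>
     (\<forall>T\<in>A. \<theta> (op_adj H T) = op_adj H (\<theta> T))"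


section \<open>Tensor products\<close>

definition orthonormal_basis :: "'a hilbert \<Rightarrow> 'a set \<Rightarrow> bool" where
  "orthonormal_basis H E \<longleftrightarrow> E \<subseteq> carrier H \<and>
     (\<forall>e\<in>E. \<forall>f\<in>E. cinner H e f = (if e = f then 1 else 0)) \<and>
     (\<forall>x\<in>carrier H. (\<forall>e\<in>E. cinner H x e = 0) \<longrightarrow> x = \<zero>\<^bsub>H\<^esub>)"

definition some_onb :: "'a hilbert \<Rightarrow> 'a set" where
  "some_onb H = (SOME E. orthonormal_basis H E)"

text \<open>The Hilbert space tensor product in the construction of Kadison and Ringrose (Fundamentals of
  the Theory of Operator Algebras I, Section 2.6): the space of bounded Hilbert-Schmidt functionals
  that are conjugate-linear in each variable (with value \<open>0\<close> off the carriers), where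
  \<open>x \<otimes> y\<close> is the functional \<open>(u, v) \<mapsto> \<langle>x, u\<rangle> \<langle>y, v\<rangle>\<close>.  Neither the space nor its inner
  product depends on the orthonormal bases used to write them down.\<close>

definition hs_functionals :: "'a hilbert \<Rightarrow> 'b hilbert \<Rightarrow> ('a \<Rightarrow> 'b \<Rightarrow> complex) set" where
  "hs_functionals H K = {\<phi>.
     (\<forall>u v. u \<notin> carrier H \<or> v \<notin> carrier K \<longrightarrow> \<phi> u v = 0) \<and>
     (\<forall>u\<in>carrier H. \<forall>u'\<in>carrier H. \<forall>v\<in>carrier K. \<phi> (u \<oplus>\<^bsub>H\<^esub> u') v = \<phi> u v + \<phi> u' v) \<and>
     (\<forall>u\<in>carrier H. \<forall>v\<in>carrier K. \<forall>v'\<in>carrier K. \<phi> u (v \<oplus>\<^bsub>K\<^esub> v') = \<phi> u v + \<phi> u v') \<and>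
     (\<forall>c. \<forall>u\<in>carrier H. \<forall>v\<in>carrier K. \<phi> (c \<odot>\<^bsub>H\<^esub> u) v = cnj c * \<phi> u v) \<and>
     (\<forall>c. \<forall>u\<in>carrier H. \<forall>v\<in>carrier K. \<phi> u (c \<odot>\<^bsub>K\<^esub> v) = cnj c * \<phi> u v) \<and>
     (\<exists>C. \<forall>u\<in>carrier H. \<forall>v\<in>carrier K. cmod (\<phi> u v) \<le> C * hnorm H u * hnorm K v) \<and>
     (\<lambda>(e, f). (cmod (\<phi> e f))\<^sup>2) summable_on (some_onb H \<times> some_onb K)}"

definition hilbert_tensor ::
    "'a hilbert \<Rightarrow> 'b hilbert \<Rightarrow> ('a \<Rightarrow> 'b \<Rightarrow> complex) hilbert" where
  "hilbert_tensor H K = \<lparr>carrier = hs_functionals H K,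
     monoid.mult = undefined, one = undefined,
     zero = (\<lambda>u v. 0), add = (\<lambda>\<phi> \<psi> u v. \<phi> u v + \<psi> u v),
     smult = (\<lambda>c \<phi> u v. c * \<phi> u v),
     cinner = (\<lambda>\<phi> \<psi>. \<Sum>\<^sub>\<infinity>(e, f)\<in>some_onb H \<times> some_onb K. \<phi> e f * cnj (\<psi> e f))\<rparr>"

definition tensor_vec :: "'a hilbert \<Rightarrow> 'b hilbert \<Rightarrow> 'a \<Rightarrow> 'b \<Rightarrow> 'a \<Rightarrow> 'b \<Rightarrow> complex" where
  "tensor_vec H K x y = (\<lambda>u v. if u \<in> carrier H \<and> v \<in> carrier K
     then cinner H x u * cinner K y v else 0)"

definition tensor_op :: "'a hilbert \<Rightarrow> 'b hilbert \<Rightarrow> ('a \<Rightarrow> 'a) \<Rightarrow> ('b \<Rightarrow> 'b)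
    \<Rightarrow> ('a \<Rightarrow> 'b \<Rightarrow> complex) \<Rightarrow> 'a \<Rightarrow> 'b \<Rightarrow> complex" where
  "tensor_op H K X Y = (THE T. T \<in> bounded_ops (hilbert_tensor H K) \<and>
     (\<forall>x\<in>carrier H. \<forall>y\<in>carrier K. T (tensor_vec H K x y) = tensor_vec H K (X x) (Y y)))"

definition von_neumann_tensor :: "'a hilbert \<Rightarrow> 'b hilbert \<Rightarrow> ('a \<Rightarrow> 'a) set \<Rightarrow> ('b \<Rightarrow> 'b) set
    \<Rightarrow> (('a \<Rightarrow> 'b \<Rightarrow> complex) \<Rightarrow> 'a \<Rightarrow> 'b \<Rightarrow> complex) set" where
  "von_neumann_tensor H K M N =
     generated_von_neumann_algebra (hilbert_tensor H K) {tensor_op H K X Y |X Y. X \<in> M \<and> Y \<in> N}"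


section \<open>Singular and completely singular subalgebras\<close>

definition singular_in :: "'a hilbert \<Rightarrow> ('a \<Rightarrow> 'a) set \<Rightarrow> ('a \<Rightarrow> 'a) set \<Rightarrow> bool" where
  "singular_in H N M \<longleftrightarrow>
     (\<forall>U\<in>M. unitary_op H U \<longrightarrow> (\<lambda>X. op_mult H (op_mult H U X) (op_adj H U)) ` N = N \<longrightarrow> U \<in> N)"

text \<open>HOL cannot quantify over all types inside a formula, so the underlying sets of the Hilbert
  spaces \<open>K\<close> are the subsets of a given type \<open>'k\<close>.  Using the types \<open>'k + (nat \<Rightarrow> complex)\<close> with
  \<open>'k\<close> arbitrary reaches every Hilbert space, and always leaves room for a copy of \<open>\<ell>\<^sup>2\<close>.\<close>

definition completely_singular_in ::
    "'k itself \<Rightarrow> 'h hilbert \<Rightarrow> ('h \<Rightarrow> 'h) set \<Rightarrow> ('h \<Rightarrow> 'h) set \<Rightarrow> bool" where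
  "completely_singular_in _ H N M \<longleftrightarrow>
     (\<forall>K :: 'k hilbert. hilbert_space K \<longrightarrow>
        singular_in (hilbert_tensor H K)
          (von_neumann_tensor H K N (bounded_ops K)) (von_neumann_tensor H K M (bounded_ops K)))"

end

theory Submission
  imports Defs
begin

text \<open>If a unitary \<open>U\<close> in \<open>M \<otimes> B(K)\<close> normalises \<open>N \<otimes> B(K)\<close>, then \<open>Ad U\<close> acts on the commutant \<open>N' \<otimes> 1\<close> and
  fixes \<open>M' \<otimes> 1\<close>; if this automorphism of \<open>N'\<close> is trivial, \<open>U\<close> lies in the double commutant \<open>N \<otimes> B(K)\<close>.
  Conversely, for infinite-dimensional \<open>K\<close> every automorphism \<open>\<theta>\<close> of \<open>N'\<close> becomes spatial on \<open>H \<otimes> K\<close>: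
  below small positive elements the vector functionals \<open>\<langle>\<theta>(\<cdot>) \<xi>, \<xi>\<rangle>\<close> are dominated by vector functionals
  \<open>\<langle>\<cdot> \<eta>, \<eta>\<rangle>\<close>, which by separability yields a
  countable separating family of bounded maps \<open>D\<close> with \<open>D \<theta>(z) = z D\<close>.
  Assembled over copies of \<open>H\<close>, they give an injective intertwiner of \<open>z \<otimes> 1\<close> and
  \<open>\<theta>(z) \<otimes> 1\<close> in each direction, hence isometric ones by polar decomposition, hence a unitary one by a
  Cantor--Bernstein argument.  If \<open>\<theta>\<close> fixes \<open>M'\<close>, this unitary lies in \<open>M \<otimes> B(K)\<close> and normalises
  \<open>N \<otimes> B(K)\<close>, so singularity puts it in \<open>N \<otimes> B(K)\<close> and \<open>\<theta>\<close> is trivial.\<close>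

section \<open>Hilbert space geometry\<close>

text \<open>The obstacle is that \<open>\<theta>\<close> is given only as an algebraic isomorphism,
  with no continuity. Order takes its place: positive elements of a commutant have their square
  roots there, so \<open>\<theta>\<close> and its inverse preserve order and hence least upper
  bounds of chains, and this is all the continuity that the Zorn arguments use. The cut to a small
  positive element stands in for the representation of normal functionals by vectors. Tensor
  products are handled in coordinates: an orthonormal basis of \<open>K\<close> turns
  \<open>H \<otimes> K\<close> into copies of \<open>H\<close>, operators into matrices, and the
  tensor product of \<open>N\<close> with all operators on \<open>K\<close> into
  \<open>mats N\<close>, the matrices with entries in \<open>N\<close>. That description rests on
  \<open>N\<close> being its own double commutant. Since von Neumann algebras are defined by weak
  closedness, this is proved too, again in an infinite amplification. The same infinite index set
  \<open>F\<close> later absorbs a countable family of intertwiners, because \<open>F\<close> and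
  \<open>nat \<times> F\<close> are equipotent.\<close>

context complex_inner_product_space
begin

lemma a_inv_eq_smult: "x \<in> carrier H \<Longrightarrow> \<ominus> x = (- 1) \<odot> x"
  by (metis M.minus_equality UNIV_I add.left_inverse complex_field_simps smult_closed
      smult_l_distr smult_l_null smult_one)

lemma a_minus_eq_smult: "\<lbrakk>x \<in> carrier H; y \<in> carrier H\<rbrakk> \<Longrightarrow> x \<ominus> y = x \<oplus> (- 1) \<odot> y"
  by (simp add: a_minus_def a_inv_eq_smult)

lemma cinner_zero_right: "x \<in> carrier H \<Longrightarrow> cinner H x \<zero> = 0"
  using cinner_commute[of x \<zero>] by (simp add: cinner_zero_left)

lemma cinner_diff_left:
  "\<lbrakk>x \<in> carrier H; y \<in> carrier H; z \<in> carrier H\<rbrakk>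
    \<Longrightarrow> cinner H (x \<ominus> y) z = cinner H x z - cinner H y z"
  by (simp add: a_minus_eq_smult cinner_add_left cinner_smult_left)

lemma cinner_diff_right:
  "\<lbrakk>x \<in> carrier H; y \<in> carrier H; z \<in> carrier H\<rbrakk>
    \<Longrightarrow> cinner H z (x \<ominus> y) = cinner H z x - cinner H z y"
  by (simp add: a_minus_eq_smult cinner_add_right cinner_smult_right)

lemmas cinner_simps = cinner_zero_left cinner_zero_right cinner_add_left cinner_add_right
  cinner_smult_left cinner_smult_right cinner_diff_left cinner_diff_right

lemma hnorm_power2: "x \<in> carrier H \<Longrightarrow> (hnorm H x)\<^sup>2 = Re (cinner H x x)"
  by (simp add: hnorm_def cinner_self_nonneg)

lemma cinner_eq_0_iff_self: "x \<in> carrier H \<Longrightarrow> cinner H x x = 0 \<longleftrightarrow> x = \<zero>"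
  by (simp add: cinner_self_real hnorm_eq_0)

lemma minus_eq_zero_iff: "\<lbrakk>x \<in> carrier H; y \<in> carrier H\<rbrakk> \<Longrightarrow> x \<ominus> y = \<zero> \<longleftrightarrow> x = y"
  by (metis M.minus_closed M.minus_eq M.minus_equality M.minus_minus M.r_neg M.a_inv_closed)

lemma cinner_extl:
  assumes "x \<in> carrier H" "y \<in> carrier H"
    and "\<And>z. z \<in> carrier H \<Longrightarrow> cinner H x z = cinner H y z"
  shows "x = y"
proof -
  have "cinner H (x \<ominus> y) (x \<ominus> y) = 0"
    using assms(3)[of "x \<ominus> y"] assms(1,2) by (simp add: cinner_diff_left)
  then show ?thesis
    using assms(1,2) by (simp add: cinner_eq_0_iff_self minus_eq_zero_iff)
qed

lemma cinner_extr:
  assumes "x \<in> carrier H" "y \<in> carrier H"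
    and "\<And>z. z \<in> carrier H \<Longrightarrow> cinner H z x = cinner H z y"
  shows "x = y"
  using cinner_extl[OF assms(1,2)] assms cinner_commute by metis

lemma hnorm_diff_sq:
  assumes "x \<in> carrier H" "y \<in> carrier H"
  shows "(hnorm H (x \<ominus> y))\<^sup>2 = (hnorm H x)\<^sup>2 - 2 * Re (cinner H x y) + (hnorm H y)\<^sup>2"
  using assms cinner_commute[of y x] by (simp add: hnorm_power2 cinner_simps)

lemma cinner_tendsto_left:
  assumes "\<And>n::nat. s n \<in> carrier H" "x \<in> carrier H" "z \<in> carrier H"
    and "(\<lambda>n. hnorm H (s n \<ominus> x)) \<longlonglongrightarrow> 0"
  shows "(\<lambda>n. cinner H (s n) z) \<longlonglongrightarrow> cinner H x z"
proof -
  have "(\<lambda>n. hnorm H (s n \<ominus> x) * hnorm H z) \<longlonglongrightarrow> 0"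
    using tendsto_mult_right[OF assms(4)] by simp
  then have "(\<lambda>n. cinner H (s n) z - cinner H x z) \<longlonglongrightarrow> 0"
    by (rule Lim_null_comparison[rotated])
      (use Cauchy_Schwarz assms(1-3) in \<open>simp flip: cinner_diff_left\<close>)
  then show ?thesis
    by (rule LIM_zero_cancel)
qed

lemma hnorm_tendsto:
  assumes "\<And>n::nat. s n \<in> carrier H" "x \<in> carrier H"
    and "(\<lambda>n. hnorm H (s n \<ominus> x)) \<longlonglongrightarrow> 0"
  shows "(\<lambda>n. hnorm H (s n)) \<longlonglongrightarrow> hnorm H x"
proof -
  have tri: "\<bar>hnorm H a - hnorm H b\<bar> \<le> hnorm H (a \<ominus> b)" if "a \<in> carrier H" "b \<in> carrier H" for a b
  proof -
    have *: "hnorm H c \<le> hnorm H d + hnorm H (c \<ominus> d)" if "c \<in> carrier H" "d \<in> carrier H" for c d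
    proof -
      have "c = d \<oplus> (c \<ominus> d)"
        using that by (intro cinner_extl) (simp_all add: cinner_simps)
      then show ?thesis
        using hnorm_triangle[of d "c \<ominus> d"] that by simp
    qed
    show ?thesis
      using *[of a b] *[of b a] that hnorm_minus_commute[of a b] by simp
  qed
  have "(\<lambda>n. hnorm H (s n) - hnorm H x) \<longlonglongrightarrow> 0"
    by (rule Lim_null_comparison[OF _ assms(3)]) (use tri assms in simp)
  then show ?thesis
    by (rule LIM_zero_cancel)
qed

end

text \<open>No predicate for closed subspaces is introduced: \<open>orth H (orth H S)\<close> plays
  the role of the closed linear span of \<open>S\<close>, and density of a subspace is expressed by
  a trivial \<open>orth\<close>.\<close>

definition orth :: "'a hilbert \<Rightarrow> 'a set \<Rightarrow> 'a set" where
  "orth H S = {x \<in> carrier H. \<forall>s\<in>S. cinner H x s = 0}"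

lemma orth_antimono: "S \<subseteq> S' \<Longrightarrow> orth H S' \<subseteq> orth H S"
  by (auto simp: orth_def)

lemma orth_subset: "orth H S \<subseteq> carrier H"
  by (auto simp: orth_def)

context complex_inner_product_space
begin

lemma orthD: "x \<in> orth H S \<Longrightarrow> s \<in> S \<Longrightarrow> cinner H x s = 0"
  by (simp add: orth_def)

lemma orthD': "x \<in> orth H S \<Longrightarrow> s \<in> S \<Longrightarrow> s \<in> carrier H \<Longrightarrow> cinner H s x = 0"
  using cinner_commute[of s x] by (simp add: orth_def)

lemma orth_add: "S \<subseteq> carrier H \<Longrightarrow> x \<in> orth H S \<Longrightarrow> y \<in> orth H S \<Longrightarrow> x \<oplus> y \<in> orth H S"
  by (auto simp: orth_def cinner_simps subset_eq)

lemma orth_smult: "S \<subseteq> carrier H \<Longrightarrow> x \<in> orth H S \<Longrightarrow> c \<odot> x \<in> orth H S"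
  by (auto simp: orth_def cinner_simps subset_eq)

lemma orth_zero: "S \<subseteq> carrier H \<Longrightarrow> \<zero> \<in> orth H S"
  by (auto simp: orth_def cinner_simps subset_eq)

lemma orth_orth_superset: "S \<subseteq> carrier H \<Longrightarrow> S \<subseteq> orth H (orth H S)"
  using orthD' by (auto simp: orth_def subset_eq) 

lemma orth_closed:
  assumes "S \<subseteq> carrier H" "\<And>n::nat. s n \<in> orth H S" "x \<in> carrier H"
    and "(\<lambda>n. hnorm H (s n \<ominus> x)) \<longlonglongrightarrow> 0"
  shows "x \<in> orth H S"
proof -
  have "cinner H x z = 0" if z: "z \<in> S" for z
  proof -
    have "(\<lambda>n. cinner H (s n) z) \<longlonglongrightarrow> cinner H x z"
      by (rule cinner_tendsto_left) (use assms z in \<open>auto simp: orth_def\<close>)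
    moreover have "cinner H (s n) z = 0" for n
      using assms(2)[of n] z by (rule orthD)
    ultimately show ?thesis
      by (simp add: LIMSEQ_const_iff)
  qed
  then show ?thesis
    using assms(3) by (simp add: orth_def)
qed

end

section \<open>Riesz representation and orthogonal decomposition\<close>

context hilbert_space
begin

lemma complete_seq:
  assumes "\<And>n::nat. s n \<in> carrier H"
    and "\<And>e. e > 0 \<Longrightarrow> \<exists>N. \<forall>m\<ge>N. \<forall>n\<ge>N. hnorm H (s m \<ominus> s n) < e"
  shows "\<exists>x\<in>carrier H. (\<lambda>n. hnorm H (s n \<ominus> x)) \<longlonglongrightarrow> 0"
proof -
  have "MCauchy s"
    unfolding MCauchy_def using assms by (auto simp: hdist_def)
  then obtain x where "limitin mtopology s x sequentially"
    using complete by (auto simp: mcomplete_def)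
  then have x: "x \<in> carrier H" and "(\<lambda>n. hdist H (s n) x) \<longlonglongrightarrow> 0"
    by (auto simp: limitin_metric_dist_null)
  then show ?thesis
    using assms(1) by (auto simp: hdist_def)
qed

text \<open>The representing vector is the limit of a minimising sequence of \<open>\<parallel>x\<parallel>\<^sup>2 - 2 Re (f x)\<close> on \<open>S\<close>.\<close>

lemma riesz_approx:
  assumes S: "S \<subseteq> carrier H" "\<zero> \<in> S" "\<And>x y. x \<in> S \<Longrightarrow> y \<in> S \<Longrightarrow> x \<oplus> y \<in> S"
      "\<And>c x. x \<in> S \<Longrightarrow> c \<odot> x \<in> S"
    and f: "\<And>x y. x \<in> S \<Longrightarrow> y \<in> S \<Longrightarrow> f (x \<oplus> y) = f x + f y"
      "\<And>c x. x \<in> S \<Longrightarrow> f (c \<odot> x) = c * f x"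
      "\<And>x. x \<in> S \<Longrightarrow> cmod (f x) \<le> C * hnorm H x"
  shows "\<exists>y\<in>carrier H. (\<exists>s. (\<forall>n::nat. s n \<in> S) \<and> (\<lambda>n. hnorm H (s n \<ominus> y)) \<longlonglongrightarrow> 0)
           \<and> (\<forall>x\<in>S. f x = cinner H x y)"
proof -
  define J where "J x = (hnorm H x)\<^sup>2 - 2 * Re (f x)" for x
  have Sc[simp]: "x \<in> carrier H" if "x \<in> S" for x using S(1) that by auto
  have J_lower: "- C\<^sup>2 \<le> J x" if "x \<in> S" for x
  proof -
    have "Re (f x) \<le> C * hnorm H x"
      using f(3)[OF that] complex_Re_le_cmod order_trans by blast
    moreover have "0 \<le> (hnorm H x - C)\<^sup>2" by simp
    ultimately show ?thesis
      by (simp add: J_def power2_diff algebra_simps)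
  qed
  define m where "m = Inf (J ` S)"
  have bdd: "bdd_below (J ` S)"
    using J_lower by (auto intro!: bdd_belowI2)
  have m_le: "m \<le> J x" if "x \<in> S" for x
    unfolding m_def using bdd that by (auto intro: cINF_lower)
  have "\<exists>x\<in>S. J x < m + 1 / real (Suc n)" for n
    using cInf_lessD[of "J ` S" "m + 1 / real (Suc n)"] S(2) by (force simp: m_def)
  then obtain s where s: "\<And>n. s n \<in> S" "\<And>n. J (s n) < m + 1 / real (Suc n)"
    by metis
  \<comment> \<open>Parallelogram identity: \<open>J\<close> at the midpoint of \<open>a\<close> and
    \<open>b\<close> is the mean of \<open>J a\<close> and \<open>J b\<close> less a quarter of the
    squared distance, and it is at least \<open>m\<close>.\<close>
  have par: "(hnorm H (a \<ominus> b))\<^sup>2 \<le> 2 * (J a - m) + 2 * (J b - m)" if "a \<in> S" "b \<in> S" for a b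
  proof -
    have "m \<le> J ((1/2) \<odot> (a \<oplus> b))"
      by (intro m_le S(3,4) that)
    also have "\<dots> = ((hnorm H a)\<^sup>2 + 2 * Re (cinner H a b) + (hnorm H b)\<^sup>2) / 4 - (Re (f a) + Re (f b))"
      using that S hnorm_add_sq[of a b] by (simp add: J_def f hnorm_smult power2_eq_square field_simps)
    finally show ?thesis
      using that by (simp add: J_def hnorm_diff_sq) (simp add: algebra_simps)
  qed
  have cauchy: "\<exists>N. \<forall>m\<ge>N. \<forall>n\<ge>N. hnorm H (s m \<ominus> s n) < e" if e: "e > 0" for e
  proof -
    obtain N where N: "1 / real (Suc N) < e\<^sup>2 / 4"
      using e nat_approx_posE[of "e\<^sup>2 / 4"] by auto
    have "hnorm H (s p \<ominus> s q) < e" if "p \<ge> N" "q \<ge> N" for p q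
    proof -
      define r where "r k = 1 / real (Suc k)" for k
      have mono: "r k \<le> r N" if "k \<ge> N" for k
        unfolding r_def using that by (intro divide_left_mono) auto
      have "(hnorm H (s p \<ominus> s q))\<^sup>2 < e\<^sup>2"
      proof -
        have 1: "J (s p) - m < r N"
          using s(2)[of p] mono[OF that(1)] by (simp add: r_def)
        have 2: "J (s q) - m < r N"
          using s(2)[of q] mono[OF that(2)] by (simp add: r_def)
        have 3: "4 * r N < e\<^sup>2"
          using N by (simp add: r_def)
        have *: "X < E" if "X \<le> 2 * a + 2 * b" "a < c" "b < c" "4 * c < E" for X a b c E :: real
          using that by linarith
        show ?thesis
          by (rule *[OF par[OF s(1)[of p] s(1)[of q]] 1 2 3])
      qed
      then show ?thesis
        using e by (auto intro: power_less_imp_less_base)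
    qed
    then show ?thesis by blast
  qed
  obtain y where y: "y \<in> carrier H" and lim: "(\<lambda>n. hnorm H (s n \<ominus> y)) \<longlonglongrightarrow> 0"
    using complete_seq[OF Sc[OF s(1)] cauchy] by blast
  \<comment> \<open>First variation of \<open>J\<close> at the minimiser. As \<open>S\<close> need
    not be closed, \<open>y\<close> may lie outside \<open>S\<close>, where nothing is known about
    \<open>f\<close>; so the inequality in \<open>t\<close> is proved at \<open>s n\<close> with
    error \<open>1 / real (Suc n)\<close> and then passed to the limit.\<close>
  have Re_eq: "Re (f x) = Re (cinner H y x)" if x: "x \<in> S" for x
  proof -
    have quad: "0 \<le> 2 * t * (Re (cinner H y x) - Re (f x)) + t\<^sup>2 * (hnorm H x)\<^sup>2" for t :: real
    proof -
      have "m \<le> J (s n) + (2 * t * (Re (cinner H (s n) x) - Re (f x)) + t\<^sup>2 * (hnorm H x)\<^sup>2)" for n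
      proof -
        have "m \<le> J (s n \<oplus> (complex_of_real t) \<odot> x)"
          by (intro m_le S(3,4) s(1) x)
        also have "\<dots> = J (s n) + (2 * t * (Re (cinner H (s n) x) - Re (f x)) + t\<^sup>2 * (hnorm H x)\<^sup>2)"
        proof -
          have "(hnorm H (s n \<oplus> (complex_of_real t) \<odot> x))\<^sup>2
              = (hnorm H (s n))\<^sup>2 + 2 * (t * Re (cinner H (s n) x)) + t\<^sup>2 * (hnorm H x)\<^sup>2"
            using s(1)[of n] x by (simp add: hnorm_add_sq cinner_smult_right hnorm_smult power_mult_distrib)
          moreover have "Re (f (s n \<oplus> (complex_of_real t) \<odot> x)) = Re (f (s n)) + t * Re (f x)"
            using s(1)[of n] x S(4) by (simp add: f)
          ultimately show ?thesis
            unfolding J_def by (simp add: algebra_simps)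
        qed
        finally show ?thesis .
      qed
      then have "- 1 / real (Suc n) \<le> 2 * t * (Re (cinner H (s n) x) - Re (f x)) + t\<^sup>2 * (hnorm H x)\<^sup>2" for n
        using s(2)[of n] by (smt (verit) minus_divide_left)
      moreover have "(\<lambda>n. 2 * t * (Re (cinner H (s n) x) - Re (f x)) + t\<^sup>2 * (hnorm H x)\<^sup>2)
          \<longlonglongrightarrow> 2 * t * (Re (cinner H y x) - Re (f x)) + t\<^sup>2 * (hnorm H x)\<^sup>2"
        using cinner_tendsto_left[OF _ y Sc[OF x] lim] s(1) by (intro tendsto_intros) auto
      moreover have "(\<lambda>n. - 1 / real (Suc n)) \<longlonglongrightarrow> 0"
        by (rule LIMSEQ_Suc) (use lim_const_over_n[of "-1"] in simp)
      ultimately show ?thesis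
        by (intro LIMSEQ_le[of "\<lambda>n. - 1 / real (Suc n)" 0]) auto
    qed
    define d where "d = Re (cinner H y x) - Re (f x)"
    define h where "h = (hnorm H x)\<^sup>2"
    have h: "h \<ge> 0" by (simp add: h_def)
    \<comment> \<open>The quadratic would be minimal at \<open>t = - d / h\<close>; the extra
      \<open>1\<close> in the denominator covers \<open>x = \<zero>\<close> and still makes the
      value negative unless \<open>d = 0\<close>.\<close>
    have "0 \<le> 2 * (- d / (h + 1)) * d + (- d / (h + 1))\<^sup>2 * h"
      using quad[of "- d / (h + 1)"] by (simp add: d_def h_def)
    also have "\<dots> = - (d\<^sup>2 * (h + 2)) / (h + 1)\<^sup>2"
      using h by (simp add: divide_simps power2_eq_square) (simp add: algebra_simps)
    finally have "d\<^sup>2 * (h + 2) \<le> 0"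
      using h by (auto simp: divide_le_0_iff)
    then have "d = 0"
      using h by (smt (verit) mult_pos_pos zero_less_power2)
    then show ?thesis by (simp add: d_def)
  qed
  have "f x = cinner H x y" if x: "x \<in> S" for x
  proof (rule complex_eqI)
    show "Re (f x) = Re (cinner H x y)"
      using Re_eq[OF x] cinner_commute[of y x] x y by simp
    have "Re (f (\<i> \<odot> x)) = Re (cinner H y (\<i> \<odot> x))"
      using Re_eq S(4)[OF x] by blast
    then show "Im (f x) = Im (cinner H x y)"
      using x y cinner_commute[of y x] by (simp add: f cinner_simps)
  qed
  then show ?thesis
    using y s(1) lim by blast
qed

lemma riesz:
  assumes "\<And>x y. x \<in> carrier H \<Longrightarrow> y \<in> carrier H \<Longrightarrow> f (x \<oplus> y) = f x + f y"
    and "\<And>c x. x \<in> carrier H \<Longrightarrow> f (c \<odot> x) = c * f x"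
    and "\<And>x. x \<in> carrier H \<Longrightarrow> cmod (f x) \<le> C * hnorm H x"
  shows "\<exists>y\<in>carrier H. \<forall>x\<in>carrier H. f x = cinner H x y"
  using riesz_approx[of "carrier H" f C] assms by auto

text \<open>\<open>riesz_approx\<close> on the subspace \<open>orth H S\<close>, applied to the
  functional given by \<open>v\<close>, yields the projection \<open>y\<close> of \<open>v\<close>:
  it stays in \<open>orth H S\<close> because that set is closed, and \<open>v \<ominus> y\<close>
  is orthogonal to it.\<close>

lemma orth_decomp:
  assumes S: "S \<subseteq> carrier H" and v: "v \<in> carrier H"
  shows "\<exists>p\<in>orth H (orth H S). \<exists>q\<in>orth H S. v = p \<oplus> q"
proof -
  have *: "x \<in> carrier H" if "x \<in> orth H S" for x
    using that by (simp add: orth_def)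
  have "\<exists>y\<in>carrier H. (\<exists>s. (\<forall>n::nat. s n \<in> orth H S) \<and> (\<lambda>n. hnorm H (s n \<ominus> y)) \<longlonglongrightarrow> 0)
      \<and> (\<forall>x\<in>orth H S. cinner H x v = cinner H x y)"
    by (rule riesz_approx[of _ _ "hnorm H v"])
      (use v Cauchy_Schwarz[OF _ v] orth_add[OF S] orth_smult[OF S] orth_zero[OF S] orth_subset[of H S] *
        in \<open>auto simp: cinner_simps mult.commute\<close>)
  then obtain y s where y: "y \<in> carrier H" "\<And>n::nat. s n \<in> orth H S"
    "(\<lambda>n. hnorm H (s n \<ominus> y)) \<longlonglongrightarrow> 0" "\<And>x. x \<in> orth H S \<Longrightarrow> cinner H x v = cinner H x y"
    by blast
  have yS: "y \<in> orth H S"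
    using orth_closed[OF S y(2,1,3)] .
  have "v \<ominus> y \<in> orth H (orth H S)"
    using y(1,4) v cinner_commute[of v] cinner_commute[of y] by (auto simp: orth_def cinner_simps)
  moreover have "v = (v \<ominus> y) \<oplus> y"
    using v y(1) by (intro cinner_extl) (simp_all add: cinner_simps)
  ultimately show ?thesis
    using yS by blast
qed

text \<open>Converts membership in the closed span into norm approximation. The vector
  \<open>y\<close> that represents the functional of \<open>p\<close> on \<open>S\<close> is a limit
  of elements of \<open>S\<close>, and \<open>p \<ominus> y\<close> is orthogonal to
  \<open>S\<close> while lying in its double complement, hence zero.\<close>

lemma orth_orth_approx:
  assumes S: "S \<subseteq> carrier H" "\<zero> \<in> S" "\<And>x y. x \<in> S \<Longrightarrow> y \<in> S \<Longrightarrow> x \<oplus> y \<in> S"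
      "\<And>c x. x \<in> S \<Longrightarrow> c \<odot> x \<in> S"
    and p: "p \<in> orth H (orth H S)"
  shows "\<exists>s. (\<forall>n::nat. s n \<in> S) \<and> (\<lambda>n. hnorm H (s n \<ominus> p)) \<longlonglongrightarrow> 0"
proof -
  have pc: "p \<in> carrier H" using p by (simp add: orth_def)
  have "\<exists>y\<in>carrier H. (\<exists>s. (\<forall>n::nat. s n \<in> S) \<and> (\<lambda>n. hnorm H (s n \<ominus> y)) \<longlonglongrightarrow> 0)
      \<and> (\<forall>x\<in>S. cinner H x p = cinner H x y)"
    by (rule riesz_approx[of _ _ "hnorm H p"])
      (use S Cauchy_Schwarz[OF _ pc] pc in \<open>auto simp: cinner_simps mult.commute subset_eq\<close>)
  then obtain y s where y: "y \<in> carrier H" "\<And>n::nat. s n \<in> S"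
    "(\<lambda>n. hnorm H (s n \<ominus> y)) \<longlonglongrightarrow> 0" "\<And>x. x \<in> S \<Longrightarrow> cinner H x p = cinner H x y"
    by blast
  have "y \<in> orth H (orth H S)"
    using orth_closed[OF orth_subset _ y(1,3), of S] y(2) orth_orth_superset[OF S(1)] by blast
  then have "p \<ominus> y \<in> orth H (orth H S)"
    using p orth_add[OF orth_subset] orth_smult[OF orth_subset] pc y(1) by (simp add: a_minus_eq_smult)
  moreover have "p \<ominus> y \<in> orth H S"
    using y(1,4) pc S(1) cinner_commute[of p] cinner_commute[of y]
    by (auto simp: orth_def cinner_simps subset_eq)
  ultimately have "cinner H (p \<ominus> y) (p \<ominus> y) = 0"
    by (rule orthD)
  then have "p = y"
    using pc y(1) by (simp add: cinner_eq_0_iff_self minus_eq_zero_iff)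
  then show ?thesis
    using y(2,3) by blast
qed

end

section \<open>Bounded operators\<close>

definition selfadj :: "'a hilbert \<Rightarrow> ('a \<Rightarrow> 'a) \<Rightarrow> bool" where
  "selfadj H A \<longleftrightarrow> A \<in> bounded_ops H \<and> op_adj H A = A"

text \<open>Selfadjointness is not built in, and only real parts of the forms are compared;
  antisymmetry therefore holds among selfadjoint operators only
  (\<open>selfadj_antisym\<close>).\<close>

definition op_le :: "'a hilbert \<Rightarrow> ('a \<Rightarrow> 'a) \<Rightarrow> ('a \<Rightarrow> 'a) \<Rightarrow> bool" where
  "op_le H A B \<longleftrightarrow> (\<forall>x\<in>carrier H. Re (cinner H (A x) x) \<le> Re (cinner H (B x) x))"

definition op_pos :: "'a hilbert \<Rightarrow> ('a \<Rightarrow> 'a) \<Rightarrow> bool" where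
  "op_pos H A \<longleftrightarrow> selfadj H A \<and> (\<forall>x\<in>carrier H. 0 \<le> Re (cinner H (A x) x))"

definition op_minus :: "'a hilbert \<Rightarrow> ('a \<Rightarrow> 'a) \<Rightarrow> ('a \<Rightarrow> 'a) \<Rightarrow> 'a \<Rightarrow> 'a" where
  "op_minus H A B = op_add H A (op_smult H (- 1) B)"

lemma op_apply [simp]:
  "x \<in> carrier H \<Longrightarrow> op_one H x = x"
  "x \<in> carrier H \<Longrightarrow> op_mult H S T x = S (T x)"
  "x \<in> carrier H \<Longrightarrow> op_add H S T x = S x \<oplus>\<^bsub>H\<^esub> T x"
  "x \<in> carrier H \<Longrightarrow> op_smult H c T x = c \<odot>\<^bsub>H\<^esub> T x"
  by (simp_all add: op_one_def op_mult_def op_add_def op_smult_def compose_def)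

lemma bounded_ops_closed [simp]: "T \<in> bounded_ops H \<Longrightarrow> x \<in> carrier H \<Longrightarrow> T x \<in> carrier H"
  by (auto simp: bounded_ops_def)

lemma bounded_ops_add:
  "T \<in> bounded_ops H \<Longrightarrow> x \<in> carrier H \<Longrightarrow> y \<in> carrier H \<Longrightarrow> T (x \<oplus>\<^bsub>H\<^esub> y) = T x \<oplus>\<^bsub>H\<^esub> T y"
  by (auto simp: bounded_ops_def)

lemma bounded_ops_smult:
  "T \<in> bounded_ops H \<Longrightarrow> x \<in> carrier H \<Longrightarrow> T (c \<odot>\<^bsub>H\<^esub> x) = c \<odot>\<^bsub>H\<^esub> T x"
  by (auto simp: bounded_ops_def)

lemma bounded_ops_eqI:
  assumes "S \<in> bounded_ops H" "T \<in> bounded_ops H" "\<And>x. x \<in> carrier H \<Longrightarrow> S x = T x"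
  shows "S = T"
  using assms by (auto simp: bounded_ops_def intro: PiE_ext)

context complex_inner_product_space
begin

lemma smult_0_1 [simp]: "x \<in> carrier H \<Longrightarrow> 0 \<odot> x = \<zero>" "x \<in> carrier H \<Longrightarrow> 1 \<odot> x = x"
  using smult_l_null[of x] smult_one[of x] by simp_all

lemmas ops_eqI = bounded_ops_eqI[where H = H]

lemma bounded_ops_bound:
  assumes "T \<in> bounded_ops H"
  obtains C where "C > 0" "\<And>x. x \<in> carrier H \<Longrightarrow> hnorm H (T x) \<le> C * hnorm H x"
proof -
  obtain C where C: "\<And>x. x \<in> carrier H \<Longrightarrow> hnorm H (T x) \<le> C * hnorm H x"
    using assms unfolding bounded_ops_def by blast
  have "hnorm H (T x) \<le> (\<bar>C\<bar> + 1) * hnorm H x" if "x \<in> carrier H" for x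
    by (rule order_trans[OF C[OF that] mult_right_mono]) (use hnorm_nonneg[OF that] in auto)
  then show thesis
    by (intro that[of "\<bar>C\<bar> + 1"]) auto
qed

lemma bounded_ops_zero: "T \<in> bounded_ops H \<Longrightarrow> T \<zero> = \<zero>"
  using bounded_ops_smult[of T H \<zero> 0] by simp

lemma bounded_ops_diff:
  "T \<in> bounded_ops H \<Longrightarrow> x \<in> carrier H \<Longrightarrow> y \<in> carrier H \<Longrightarrow> T (x \<ominus> y) = T x \<ominus> T y"
  by (simp add: a_minus_eq_smult bounded_ops_add bounded_ops_smult)

lemma bounded_ops_eqI_cinner:
  assumes "S \<in> bounded_ops H" "T \<in> bounded_ops H"
    and "\<And>x y. x \<in> carrier H \<Longrightarrow> y \<in> carrier H \<Longrightarrow> cinner H (S x) y = cinner H (T x) y"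
  shows "S = T"
  using assms by (intro ops_eqI cinner_extl) auto

lemma bounded_opsI:
  assumes "\<And>x. x \<in> carrier H \<Longrightarrow> f x \<in> carrier H"
    and "\<And>x y. x \<in> carrier H \<Longrightarrow> y \<in> carrier H \<Longrightarrow> f (x \<oplus> y) = f x \<oplus> f y"
    and "\<And>c x. x \<in> carrier H \<Longrightarrow> f (c \<odot> x) = c \<odot> f x"
    and "\<And>x. x \<in> carrier H \<Longrightarrow> hnorm H (f x) \<le> C * hnorm H x"
  shows "(\<lambda>x\<in>carrier H. f x) \<in> bounded_ops H"
  unfolding bounded_ops_def using assms by (auto intro!: exI[of _ C])

text \<open>A formal adjoint forces linearity: tested against any vector, \<open>f\<close> moves to
  \<open>g\<close> on the other side, where linearity in the first argument is that of the inner
  product.\<close>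

lemma bounded_opsI_adj:
  assumes f: "\<And>x. x \<in> carrier H \<Longrightarrow> f x \<in> carrier H"
    and g: "\<And>x. x \<in> carrier H \<Longrightarrow> g x \<in> carrier H"
    and fg: "\<And>x y. x \<in> carrier H \<Longrightarrow> y \<in> carrier H \<Longrightarrow> cinner H (f x) y = cinner H x (g y)"
    and C: "\<And>x. x \<in> carrier H \<Longrightarrow> hnorm H (f x) \<le> C * hnorm H x"
  shows "(\<lambda>x\<in>carrier H. f x) \<in> bounded_ops H"
  by (rule bounded_opsI[of _ C])
    (auto simp: f g fg C cinner_simps intro!: cinner_extl)

lemma op_one_closed [simp]: "op_one H \<in> bounded_ops H"
  unfolding op_one_def by (rule bounded_opsI[of _ 1]) auto

lemma op_mult_closed [simp]:
  assumes "S \<in> bounded_ops H" "T \<in> bounded_ops H"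
  shows "op_mult H S T \<in> bounded_ops H"
proof -
  obtain C where C: "C > 0" "\<And>x. x \<in> carrier H \<Longrightarrow> hnorm H (S x) \<le> C * hnorm H x"
    using bounded_ops_bound[OF assms(1)] by blast
  obtain D where D: "D > 0" "\<And>x. x \<in> carrier H \<Longrightarrow> hnorm H (T x) \<le> D * hnorm H x"
    using bounded_ops_bound[OF assms(2)] by blast
  have "hnorm H (S (T x)) \<le> C * D * hnorm H x" if "x \<in> carrier H" for x
    using C(2)[of "T x"] D(2)[of x] assms that C(1)
    by (smt (verit) bounded_ops_closed mult.assoc mult_left_mono)
  then show ?thesis
    unfolding op_mult_def compose_def
    by (intro bounded_opsI[of _ "C * D"]) (auto simp: assms bounded_ops_add bounded_ops_smult)
qed

lemma op_add_closed [simp]: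
  assumes "S \<in> bounded_ops H" "T \<in> bounded_ops H"
  shows "op_add H S T \<in> bounded_ops H"
proof -
  obtain C where C: "C > 0" "\<And>x. x \<in> carrier H \<Longrightarrow> hnorm H (S x) \<le> C * hnorm H x"
    using bounded_ops_bound[OF assms(1)] by blast
  obtain D where D: "D > 0" "\<And>x. x \<in> carrier H \<Longrightarrow> hnorm H (T x) \<le> D * hnorm H x"
    using bounded_ops_bound[OF assms(2)] by blast
  have "hnorm H (S x \<oplus> T x) \<le> (C + D) * hnorm H x" if "x \<in> carrier H" for x
    using C(2)[of x] D(2)[of x] assms that hnorm_triangle[of "S x" "T x"]
    by (simp add: distrib_right)
  then show ?thesis
    unfolding op_add_def
    by (intro bounded_opsI[of _ "C + D"]; (intro cinner_extl)?)
      (auto simp: assms bounded_ops_add bounded_ops_smult cinner_simps algebra_simps)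
qed

lemma op_smult_closed [simp]:
  assumes "T \<in> bounded_ops H"
  shows "op_smult H c T \<in> bounded_ops H"
proof -
  obtain D where D: "D > 0" "\<And>x. x \<in> carrier H \<Longrightarrow> hnorm H (T x) \<le> D * hnorm H x"
    using bounded_ops_bound[OF assms(1)] by blast
  have "hnorm H (c \<odot> T x) \<le> (cmod c * D) * hnorm H x" if "x \<in> carrier H" for x
    using D(2)[of x] assms that by (simp add: hnorm_smult mult.assoc mult_left_mono)
  then show ?thesis
    unfolding op_smult_def
    by (intro bounded_opsI[of _ "cmod c * D"]; (intro cinner_extl)?)
      (auto simp: assms bounded_ops_add bounded_ops_smult cinner_simps algebra_simps)
qed

lemma op_minus_closed [simp]:
  "S \<in> bounded_ops H \<Longrightarrow> T \<in> bounded_ops H \<Longrightarrow> op_minus H S T \<in> bounded_ops H"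
  by (simp add: op_minus_def)

lemma op_minus_apply [simp]:
  "S \<in> bounded_ops H \<Longrightarrow> T \<in> bounded_ops H \<Longrightarrow> x \<in> carrier H \<Longrightarrow> op_minus H S T x = S x \<ominus> T x"
  by (simp add: op_minus_def a_minus_eq_smult)

lemma op_mult_assoc:
  "\<lbrakk>R \<in> bounded_ops H; S \<in> bounded_ops H; T \<in> bounded_ops H\<rbrakk>
    \<Longrightarrow> op_mult H (op_mult H R S) T = op_mult H R (op_mult H S T)"
  by (rule ops_eqI) auto

lemma op_mult_one [simp]:
  "T \<in> bounded_ops H \<Longrightarrow> op_mult H T (op_one H) = T"
  "T \<in> bounded_ops H \<Longrightarrow> op_mult H (op_one H) T = T"
  by (auto intro!: ops_eqI)

end

section \<open>Adjoints, operator order and limits of positive operators\<close>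

context hilbert_space
begin

text \<open>For fixed \<open>x\<close>, Riesz is applied to the complex conjugate of the form, which
  is linear in \<open>y\<close>. Both adjoints and weak limits are obtained from this lemma.\<close>

lemma op_of_form:
  assumes add_l: "\<And>x y z. \<lbrakk>x \<in> carrier H; y \<in> carrier H; z \<in> carrier H\<rbrakk> \<Longrightarrow> B (x \<oplus> y) z = B x z + B y z"
    and smult_l: "\<And>c x z. \<lbrakk>x \<in> carrier H; z \<in> carrier H\<rbrakk> \<Longrightarrow> B (c \<odot> x) z = c * B x z"
    and add_r: "\<And>x y z. \<lbrakk>x \<in> carrier H; y \<in> carrier H; z \<in> carrier H\<rbrakk> \<Longrightarrow> B z (x \<oplus> y) = B z x + B z y"
    and smult_r: "\<And>c x z. \<lbrakk>x \<in> carrier H; z \<in> carrier H\<rbrakk> \<Longrightarrow> B z (c \<odot> x) = cnj c * B z x"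
    and bound: "\<And>x y. \<lbrakk>x \<in> carrier H; y \<in> carrier H\<rbrakk> \<Longrightarrow> cmod (B x y) \<le> C * hnorm H x * hnorm H y"
    and C: "C \<ge> 0"
  shows "\<exists>T\<in>bounded_ops H. (\<forall>x\<in>carrier H. \<forall>y\<in>carrier H. cinner H (T x) y = B x y)
    \<and> (\<forall>x\<in>carrier H. hnorm H (T x) \<le> C * hnorm H x)"
proof -
  have "\<exists>t\<in>carrier H. \<forall>y\<in>carrier H. cnj (B x y) = cinner H y t" if x: "x \<in> carrier H" for x
    by (rule riesz[of "\<lambda>y. cnj (B x y)" "C * hnorm H x"]) (use x in \<open>auto simp: add_r smult_r bound\<close>)
  then obtain t where t: "\<And>x. x \<in> carrier H \<Longrightarrow> t x \<in> carrier H"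
    "\<And>x y. x \<in> carrier H \<Longrightarrow> y \<in> carrier H \<Longrightarrow> cnj (B x y) = cinner H y (t x)"
    by metis
  have tB: "cinner H (t x) y = B x y" if "x \<in> carrier H" "y \<in> carrier H" for x y
    using t(2)[OF that] cinner_commute[of "t x" y] t(1) that by (metis complex_cnj_cnj)
  have tb: "hnorm H (t x) \<le> C * hnorm H x" if x: "x \<in> carrier H" for x
  proof (cases "hnorm H (t x) = 0")
    case False
    have "(hnorm H (t x))\<^sup>2 = Re (B x (t x))"
      using x t(1) by (simp add: hnorm_power2 tB)
    also have "\<dots> \<le> C * hnorm H x * hnorm H (t x)"
      using bound[OF x t(1)[OF x]] complex_Re_le_cmod order_trans by blast
    finally show ?thesis
      using False hnorm_nonneg[OF t(1)[OF x]] by (simp add: power2_eq_square)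
  qed (use C hnorm_nonneg[OF x] in simp)
  have "(\<lambda>x\<in>carrier H. t x) \<in> bounded_ops H"
    by (rule bounded_opsI[of _ C]) (auto simp: t(1) tB tb add_l smult_l cinner_simps intro!: cinner_extl)
  then show ?thesis
    by (intro bexI[of _ "\<lambda>x\<in>carrier H. t x"]) (auto simp: tB tb)
qed

text \<open>\<open>op_adj\<close> is a definite description, so existence and uniqueness are both
  owed before it means anything. The form \<open>\<langle>x, T y\<rangle>\<close> supplies the
  adjoint.\<close>

lemma adj_ex1:
  assumes "T \<in> bounded_ops H"
  shows "\<exists>!S. S \<in> bounded_ops H \<and> (\<forall>x\<in>carrier H. \<forall>y\<in>carrier H. cinner H (T x) y = cinner H x (S y))"
proof -
  obtain C where C: "C > 0" "\<And>x. x \<in> carrier H \<Longrightarrow> hnorm H (T x) \<le> C * hnorm H x"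
    using bounded_ops_bound[OF assms] by blast
  have bd: "cmod (cinner H x (T y)) \<le> C * hnorm H x * hnorm H y" if "x \<in> carrier H" "y \<in> carrier H" for x y
    using Cauchy_Schwarz[of x "T y"] C(2)[OF that(2)] mult_left_mono[OF C(2)[OF that(2)] hnorm_nonneg[OF that(1)]]
      that assms by (simp add: mult.commute mult.left_commute)
  have "\<exists>S\<in>bounded_ops H. (\<forall>x\<in>carrier H. \<forall>y\<in>carrier H. cinner H (S x) y = cinner H x (T y))
    \<and> (\<forall>x\<in>carrier H. hnorm H (S x) \<le> C * hnorm H x)"
    by (rule op_of_form) (use assms C bd in \<open>auto simp: cinner_simps bounded_ops_add bounded_ops_smult\<close>)
  then obtain S where S: "S \<in> bounded_ops H"
    "\<And>x y. x \<in> carrier H \<Longrightarrow> y \<in> carrier H \<Longrightarrow> cinner H (S x) y = cinner H x (T y)" by blast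
  have "cinner H (T x) y = cinner H x (S y)" if "x \<in> carrier H" "y \<in> carrier H" for x y
    using S(2)[OF that(2,1)] cinner_commute[of "S y" x] cinner_commute[of "T x" y] S(1) assms that
    by (metis bounded_ops_closed complex_cnj_cnj)
  moreover have "S' = S''" if "S' \<in> bounded_ops H" "S'' \<in> bounded_ops H"
    "\<forall>x\<in>carrier H. \<forall>y\<in>carrier H. cinner H (T x) y = cinner H x (S' y)"
    "\<forall>x\<in>carrier H. \<forall>y\<in>carrier H. cinner H (T x) y = cinner H x (S'' y)" for S' S''
    using that by (intro ops_eqI cinner_extr) auto
  ultimately show ?thesis
    using S(1) by blast
qed

lemma adj_spec:
  assumes "T \<in> bounded_ops H"
  shows "op_adj H T \<in> bounded_ops H
    \<and> (\<forall>x\<in>carrier H. \<forall>y\<in>carrier H. cinner H (T x) y = cinner H x (op_adj H T y))"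
  unfolding op_adj_def by (rule theI'[OF adj_ex1[OF assms]])

lemma adj_closed [simp]: "T \<in> bounded_ops H \<Longrightarrow> op_adj H T \<in> bounded_ops H"
  using adj_spec by blast

lemma cinner_adj:
  "\<lbrakk>T \<in> bounded_ops H; x \<in> carrier H; y \<in> carrier H\<rbrakk> \<Longrightarrow> cinner H x (op_adj H T y) = cinner H (T x) y"
  using adj_spec by simp

lemma cinner_adj':
  "\<lbrakk>T \<in> bounded_ops H; x \<in> carrier H; y \<in> carrier H\<rbrakk> \<Longrightarrow> cinner H (op_adj H T x) y = cinner H x (T y)"
  by (metis adj_closed bounded_ops_closed cinner_adj cinner_commute)

lemma adj_eqI:
  assumes "T \<in> bounded_ops H" "S \<in> bounded_ops H"
    and "\<And>x y. \<lbrakk>x \<in> carrier H; y \<in> carrier H\<rbrakk> \<Longrightarrow> cinner H (T x) y = cinner H x (S y)"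
  shows "op_adj H T = S"
  using assms by (intro ops_eqI cinner_extr) (auto simp: cinner_adj)

lemma adj_adj [simp]: "T \<in> bounded_ops H \<Longrightarrow> op_adj H (op_adj H T) = T"
  by (rule adj_eqI) (auto simp: cinner_adj')

lemma adj_mult: "S \<in> bounded_ops H \<Longrightarrow> T \<in> bounded_ops H
    \<Longrightarrow> op_adj H (op_mult H S T) = op_mult H (op_adj H T) (op_adj H S)"
  by (rule adj_eqI) (auto simp: cinner_adj)

lemma adj_add: "S \<in> bounded_ops H \<Longrightarrow> T \<in> bounded_ops H
    \<Longrightarrow> op_adj H (op_add H S T) = op_add H (op_adj H S) (op_adj H T)"
  by (rule adj_eqI) (auto simp: cinner_adj cinner_simps)

lemma adj_smult: "T \<in> bounded_ops H \<Longrightarrow> op_adj H (op_smult H c T) = op_smult H (cnj c) (op_adj H T)"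
  by (rule adj_eqI) (auto simp: cinner_adj cinner_simps)

lemma adj_one [simp]: "op_adj H (op_one H) = op_one H"
  by (rule adj_eqI) auto

lemma selfadj_closed [simp]: "selfadj H A \<Longrightarrow> A \<in> bounded_ops H"
  by (simp add: selfadj_def)

lemma selfadj_cinner: "\<lbrakk>selfadj H A; x \<in> carrier H; y \<in> carrier H\<rbrakk> \<Longrightarrow> cinner H (A x) y = cinner H x (A y)"
  using cinner_adj[of A x y] by (simp add: selfadj_def)

lemma selfadjI: "\<lbrakk>A \<in> bounded_ops H; \<And>x y. \<lbrakk>x \<in> carrier H; y \<in> carrier H\<rbrakk>
    \<Longrightarrow> cinner H (A x) y = cinner H x (A y)\<rbrakk> \<Longrightarrow> selfadj H A"
  unfolding selfadj_def using adj_eqI[of A A] by blast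

lemma selfadj_one [simp]: "selfadj H (op_one H)"
  by (simp add: selfadj_def)

lemma selfadj_add [simp]: "selfadj H A \<Longrightarrow> selfadj H B \<Longrightarrow> selfadj H (op_add H A B)"
  by (simp add: selfadj_def adj_add)

lemma selfadj_smult [simp]: "selfadj H A \<Longrightarrow> selfadj H (op_smult H (complex_of_real r) A)"
  by (simp add: selfadj_def adj_smult)

lemma selfadj_minus [simp]: "selfadj H A \<Longrightarrow> selfadj H B \<Longrightarrow> selfadj H (op_minus H A B)"
  using selfadj_smult[of B "- 1"] by (simp add: op_minus_def)

lemma op_pos_selfadj [simp]: "op_pos H A \<Longrightarrow> selfadj H A"
  by (simp add: op_pos_def)

lemma op_pos_minus_iff: "selfadj H A \<Longrightarrow> selfadj H B \<Longrightarrow> op_pos H (op_minus H B A) \<longleftrightarrow> op_le H A B"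
  by (auto simp: op_pos_def op_le_def cinner_simps)

lemma op_pos_adj_mult: "T \<in> bounded_ops H \<Longrightarrow> op_pos H (op_mult H (op_adj H T) T)"
  by (auto simp: op_pos_def selfadj_def adj_mult cinner_adj' cinner_self_nonneg)

text \<open>Polarisation: it reduces equality and convergence of selfadjoint operators to their
  quadratic forms. The imaginary part is the real part at \<open>\<i> \<odot> y\<close>, the inner
  product being conjugate-linear in its second argument.\<close>

lemma selfadj_polar:
  assumes A: "selfadj H A" and x: "x \<in> carrier H" and y: "y \<in> carrier H"
  defines "q z \<equiv> Re (cinner H (A z) z)"
  shows "Re (cinner H (A x) y) = (q (x \<oplus> y) - q x - q y) / 2"
    and "Im (cinner H (A x) y) = (q (x \<oplus> \<i> \<odot> y) - q x - q (\<i> \<odot> y)) / 2"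
proof -
  have *: "Re (cinner H (A x) y) = (q (x \<oplus> y) - q x - q y) / 2" if y: "y \<in> carrier H" for y
  proof -
    have "Re (cinner H (A y) x) = Re (cinner H (A x) y)"
      using selfadj_cinner[OF A y x] cinner_commute[of y "A x"] A x y by simp
    then show ?thesis
      using A x y by (simp add: q_def bounded_ops_add cinner_simps)
  qed
  show "Re (cinner H (A x) y) = (q (x \<oplus> y) - q x - q y) / 2"
    using y by (rule *)
  show "Im (cinner H (A x) y) = (q (x \<oplus> \<i> \<odot> y) - q x - q (\<i> \<odot> y)) / 2"
    using *[of "\<i> \<odot> y"] A x y by (simp add: cinner_simps)
qed

lemma selfadj_antisym:
  assumes "selfadj H A" "selfadj H B" "op_le H A B" "op_le H B A"
  shows "A = B"
proof (rule bounded_ops_eqI_cinner)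
  fix x y assume "x \<in> carrier H" "y \<in> carrier H"
  moreover have "Re (cinner H (A z) z) = Re (cinner H (B z) z)" if "z \<in> carrier H" for z
    using assms(3,4) that by (simp add: op_le_def order_antisym)
  ultimately show "cinner H (A x) y = cinner H (B x) y"
    using selfadj_polar[OF assms(1), of x y] selfadj_polar[OF assms(2), of x y]
    by (simp add: complex_eq_iff)
qed (use assms in auto)

lemma op_le_refl: "op_le H A A"
  by (simp add: op_le_def)

lemma op_le_trans: "op_le H A B \<Longrightarrow> op_le H B C \<Longrightarrow> op_le H A C"
  by (force simp: op_le_def)

text \<open>Expand \<open>0 \<le> \<langle>A z, z\<rangle>\<close> at \<open>z = x - A x / c\<close>.\<close>

lemma op_pos_bound:
  assumes A: "op_pos H A" and c: "c > 0" and x: "x \<in> carrier H"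
    and Ac: "\<And>x. x \<in> carrier H \<Longrightarrow> Re (cinner H (A x) x) \<le> c * (hnorm H x)\<^sup>2"
  shows "(hnorm H (A x))\<^sup>2 \<le> c * Re (cinner H (A x) x)" and "hnorm H (A x) \<le> c * hnorm H x"
proof -
  define t where "t = 1 / c"
  have [simp]: "A \<in> bounded_ops H" using A by simp
  define n where "n = (hnorm H (A x))\<^sup>2"
  have n: "n = Re (cinner H (A x) (A x))"
    using x by (simp add: n_def hnorm_power2)
  have n': "Re (cinner H (A (A x)) x) = n"
    using selfadj_cinner[of A "A x" x] A x by (simp add: n)
  have "0 \<le> Re (cinner H (A (x \<ominus> complex_of_real t \<odot> A x)) (x \<ominus> complex_of_real t \<odot> A x))"
    using A x by (simp add: op_pos_def)
  also have "\<dots> = Re (cinner H (A x) x) - 2 * t * n + t\<^sup>2 * Re (cinner H (A (A x)) (A x))"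
    using x by (simp add: bounded_ops_diff bounded_ops_smult cinner_simps n' n[symmetric] power2_eq_square algebra_simps)
  also have "\<dots> \<le> Re (cinner H (A x) x) - 2 * t * n + t\<^sup>2 * (c * n)"
    using Ac[of "A x"] x by (intro add_left_mono mult_left_mono) (auto simp: n_def)
  also have "\<dots> = Re (cinner H (A x) x) - n / c"
    using c by (simp add: t_def power2_eq_square field_simps)
  finally show 1: "(hnorm H (A x))\<^sup>2 \<le> c * Re (cinner H (A x) x)"
    using c by (simp add: n_def field_simps)
  have "(hnorm H (A x))\<^sup>2 \<le> (c * hnorm H x)\<^sup>2"
    using order_trans[OF 1 mult_left_mono[OF Ac[OF x], of c]] c by (simp add: power2_eq_square mult_ac)
  then show "hnorm H (A x) \<le> c * hnorm H x"
    using c hnorm_nonneg[OF x] by (auto intro: power2_le_imp_le)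
qed

lemma bounded_ops_Re_bound:
  assumes "T \<in> bounded_ops H"
  obtains C where "C > 0" "\<And>x. x \<in> carrier H \<Longrightarrow> \<bar>Re (cinner H (T x) x)\<bar> \<le> C * (hnorm H x)\<^sup>2"
proof -
  obtain C where C: "C > 0" "\<And>x. x \<in> carrier H \<Longrightarrow> hnorm H (T x) \<le> C * hnorm H x"
    using bounded_ops_bound[OF assms] by blast
  have "\<bar>Re (cinner H (T x) x)\<bar> \<le> C * (hnorm H x)\<^sup>2" if x: "x \<in> carrier H" for x
  proof -
    have "\<bar>Re (cinner H (T x) x)\<bar> \<le> hnorm H (T x) * hnorm H x"
      using Cauchy_Schwarz[of "T x" x] abs_Re_le_cmod assms x order_trans by (metis bounded_ops_closed)
    also have "\<dots> \<le> C * (hnorm H x)\<^sup>2"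
      using mult_right_mono[OF C(2)[OF x] hnorm_nonneg[OF x]] by (simp add: power2_eq_square mult_ac)
    finally show ?thesis .
  qed
  then show thesis
    using that C(1) by blast
qed

text \<open>By polarisation, convergence of the quadratic forms gives convergence of all matrix
  coefficients, and \<open>op_pos_bound\<close> makes the limiting form bounded by \<open>c\<close>.
  The filter is general because the limit is taken along sequences for square roots and along
  possibly uncountable chains in the Zorn arguments.\<close>

lemma op_pos_limit:
  assumes F: "F \<noteq> bot" and c: "c > 0"
    and A: "\<And>i. i \<in> I \<Longrightarrow> op_pos H (A i)" 
      "\<And>i x. i \<in> I \<Longrightarrow> x \<in> carrier H \<Longrightarrow> Re (cinner H (A i x) x) \<le> c * (hnorm H x)\<^sup>2"
    and I: "eventually (\<lambda>i. i \<in> I) F"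
    and lim: "\<And>x. x \<in> carrier H \<Longrightarrow> \<exists>l. ((\<lambda>i. Re (cinner H (A i x) x)) \<longlongrightarrow> l) F"
  shows "\<exists>B. op_pos H B \<and> (\<forall>x\<in>carrier H. Re (cinner H (B x) x) \<le> c * (hnorm H x)\<^sup>2)
    \<and> (\<forall>x\<in>carrier H. \<forall>y\<in>carrier H. ((\<lambda>i. cinner H (A i x) y) \<longlongrightarrow> cinner H (B x) y) F)"
proof -
  have lim': "\<exists>l. ((\<lambda>i. cinner H (A i x) y) \<longlongrightarrow> l) F" if x: "x \<in> carrier H" and y: "y \<in> carrier H" for x y
  proof -
    define q where "q i z = Re (cinner H (A i z) z)" for i z
    obtain l where l: "\<And>z. z \<in> carrier H \<Longrightarrow> ((\<lambda>i. q i z) \<longlongrightarrow> l z) F"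
      using lim unfolding q_def by metis
    have 1: "((\<lambda>i. Complex ((q i (x \<oplus> y) - q i x - q i y) / 2)
        ((q i (x \<oplus> \<i> \<odot> y) - q i x - q i (\<i> \<odot> y)) / 2)) \<longlongrightarrow>
        Complex ((l (x \<oplus> y) - l x - l y) / 2) ((l (x \<oplus> \<i> \<odot> y) - l x - l (\<i> \<odot> y)) / 2)) F"
      using x y by (intro tendsto_intros l) auto
    have 2: "eventually (\<lambda>i. Complex ((q i (x \<oplus> y) - q i x - q i y) / 2)
        ((q i (x \<oplus> \<i> \<odot> y) - q i x - q i (\<i> \<odot> y)) / 2) = cinner H (A i x) y) F"
      using I
    proof eventually_elim
      case (elim i)
      show ?case
        using selfadj_polar[of "A i" x y] A(1)[OF elim] x y by (simp add: complex_eq_iff q_def)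
    qed
    show ?thesis
      by (rule exI, rule Lim_transform_eventually[OF 1 2])
  qed
  then obtain B where B: "\<And>x y. x \<in> carrier H \<Longrightarrow> y \<in> carrier H \<Longrightarrow> ((\<lambda>i. cinner H (A i x) y) \<longlongrightarrow> B x y) F"
    by metis
  have uniq: "B x y = l" if "x \<in> carrier H" "y \<in> carrier H" "((\<lambda>i. cinner H (A i x) y) \<longlongrightarrow> l) F" for x y l
    using tendsto_unique[OF F B[OF that(1,2)] that(3)] .
  have cong: "((\<lambda>i. f i) \<longlongrightarrow> l) F" if "((\<lambda>i. g i) \<longlongrightarrow> l) F" "\<And>i. i \<in> I \<Longrightarrow> g i = f i" for f g :: "'b \<Rightarrow> complex" and l
  proof (rule Lim_transform_eventually[OF that(1)])
    show "eventually (\<lambda>i. g i = f i) F"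
      using I by eventually_elim (rule that(2))
  qed
  have "\<exists>T\<in>bounded_ops H. (\<forall>x\<in>carrier H. \<forall>y\<in>carrier H. cinner H (T x) y = B x y)
    \<and> (\<forall>x\<in>carrier H. hnorm H (T x) \<le> c * hnorm H x)"
  proof (rule op_of_form)
    fix x y z assume xyz: "x \<in> carrier H" "y \<in> carrier H" "z \<in> carrier H"
    show "B (x \<oplus> y) z = B x z + B y z"
      by (rule uniq, use xyz in simp, use xyz in simp, rule cong[OF tendsto_add[OF B B]])
        (use xyz A(1) in \<open>auto simp: bounded_ops_add cinner_simps\<close>)
    show "B z (x \<oplus> y) = B z x + B z y"
      by (rule uniq, use xyz in simp, use xyz in simp, rule cong[OF tendsto_add[OF B B]])
        (use xyz A(1) in \<open>auto simp: cinner_simps\<close>)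
  next
    fix c x z assume xz: "x \<in> carrier H" "z \<in> carrier H"
    show "B (c \<odot> x) z = c * B x z"
      by (rule uniq, use xz in simp, use xz in simp, rule cong[OF tendsto_mult_left[OF B]])
        (use xz A(1) in \<open>auto simp: bounded_ops_smult cinner_simps\<close>)
    show "B z (c \<odot> x) = cnj c * B z x"
      by (rule uniq, use xz in simp, use xz in simp, rule cong[OF tendsto_mult_left[OF B]])
        (use xz A(1) in \<open>auto simp: cinner_simps\<close>)
  next
    fix x y assume xy: "x \<in> carrier H" "y \<in> carrier H"
    have "cmod (cinner H (A i x) y) \<le> c * hnorm H x * hnorm H y" if "i \<in> I" for i
    proof -
      have "cmod (cinner H (A i x) y) \<le> hnorm H (A i x) * hnorm H y"
        using Cauchy_Schwarz A(1)[OF that] xy by auto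
      also have "\<dots> \<le> c * hnorm H x * hnorm H y"
        using op_pos_bound(2)[OF A(1)[OF that] c xy(1)] A(2)[OF that] hnorm_nonneg[OF xy(2)]
        by (intro mult_right_mono) auto
      finally show ?thesis .
    qed
    then have "eventually (\<lambda>i. cmod (cinner H (A i x) y) \<le> c * hnorm H x * hnorm H y) F"
      using I by (auto elim: eventually_mono)
    then show "cmod (B x y) \<le> c * hnorm H x * hnorm H y"
      using tendsto_upperbound[OF tendsto_norm[OF B[OF xy]] _ F] by blast
  qed (use c in auto)
  then obtain T where T: "T \<in> bounded_ops H" "\<And>x y. x \<in> carrier H \<Longrightarrow> y \<in> carrier H \<Longrightarrow> cinner H (T x) y = B x y"
    by blast
  have "selfadj H T"
  proof (rule selfadjI[OF T(1)])
    fix x y assume xy: "x \<in> carrier H" "y \<in> carrier H"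
    have "((\<lambda>i. cinner H (A i x) y) \<longlongrightarrow> cnj (B y x)) F"
    proof (rule cong[OF tendsto_cnj[OF B[OF xy(2,1)]]])
      fix i assume "i \<in> I"
      then show "cnj (cinner H (A i y) x) = cinner H (A i x) y"
        using selfadj_cinner[of "A i" x y] A(1)[of i] xy cinner_commute[of x "A i y"] by simp
    qed
    then show "cinner H (T x) y = cinner H x (T y)"
      using uniq[OF xy] xy T cinner_commute[of x "T y"] by simp
  qed
  moreover have "0 \<le> Re (B x x) \<and> Re (B x x) \<le> c * (hnorm H x)\<^sup>2" if x: "x \<in> carrier H" for x
  proof
    have ev: "eventually (\<lambda>i. 0 \<le> Re (cinner H (A i x) x) \<and> Re (cinner H (A i x) x) \<le> c * (hnorm H x)\<^sup>2) F"
      using I by eventually_elim (use A x in \<open>auto simp: op_pos_def\<close>)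
    show "0 \<le> Re (B x x)"
      using ev by (intro tendsto_lowerbound[OF tendsto_Re[OF B[OF x x]] _ F]) (auto elim: eventually_mono)
    show "Re (B x x) \<le> c * (hnorm H x)\<^sup>2"
      using ev by (intro tendsto_upperbound[OF tendsto_Re[OF B[OF x x]] _ F]) (auto elim: eventually_mono)
  qed
  ultimately show ?thesis
    using T B by (intro exI[of _ T]) (auto simp: op_pos_def)
qed

end

section \<open>Commutants and the weak operator topology\<close>

lemma topspace_weak_operator_topology [simp]: "topspace (weak_operator_topology H) = bounded_ops H"
  by (auto simp: weak_operator_topology_def topspace_pullback_topology PiE_def restrict_def extensional_def)

lemma continuous_map_weak_operator:
  assumes "x \<in> carrier H" "y \<in> carrier H"
  shows "continuous_map (weak_operator_topology H) euclidean (\<lambda>T. cinner H (T x) y)"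
proof -
  have "continuous_map (product_topology (\<lambda>_. euclidean) (carrier H \<times> carrier H)) euclidean
      (\<lambda>f. f (x, y) :: complex)"
    using continuous_map_product_projection[of "(x, y)" "carrier H \<times> carrier H"
        "\<lambda>_. euclidean :: complex topology"] assms by simp
  from continuous_map_pullback[OF this, of "bounded_ops H" "\<lambda>T. \<lambda>(x, y) \<in> carrier H \<times> carrier H. cinner H (T x) y"]
  show ?thesis
    using assms by (simp add: o_def weak_operator_topology_def)
qed

text \<open>If \<open>T\<close> were outside \<open>A\<close>, the open complement would contain a
  basic box around the coefficients of \<open>T\<close>. Such a box constrains only finitely many
  pairs of vectors, and these form the set \<open>Q\<close> to which the approximation is
  applied.\<close>

lemma weak_operator_closedI:
  assumes A: "closedin (weak_operator_topology H) A" and T: "T \<in> bounded_ops H"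
    and approx: "\<And>Q e. \<lbrakk>finite Q; Q \<subseteq> carrier H \<times> carrier H; e > 0\<rbrakk>
      \<Longrightarrow> \<exists>Z\<in>A. \<forall>(x, y)\<in>Q. cmod (cinner H (Z x) y - cinner H (T x) y) < e"
  shows "T \<in> A"
proof (rule ccontr)
  assume "T \<notin> A"
  define f where "f = (\<lambda>T. \<lambda>(x, y) \<in> carrier H \<times> carrier H. cinner H (T x) y)"
  define I where "I = carrier H \<times> carrier H"
  have "openin (weak_operator_topology H) (bounded_ops H - A)"
    using A by (simp add: closedin_def)
  then obtain U where U: "openin (product_topology (\<lambda>_. euclidean) I) U" "bounded_ops H - A = f -` U \<inter> bounded_ops H"
    unfolding weak_operator_topology_def openin_pullback_topology f_def I_def by blast
  have "f T \<in> U"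
    using U(2) T \<open>T \<notin> A\<close> by blast
  with U(1) obtain W where W: "finite {i \<in> I. W i \<noteq> UNIV}" "\<And>i. i \<in> I \<Longrightarrow> open (W i)"
    "f T \<in> Pi\<^sub>E I W" "Pi\<^sub>E I W \<subseteq> U"
    unfolding openin_product_topology_alt by (auto simp flip: open_openin)
  define Q where "Q = {i \<in> I. W i \<noteq> UNIV}"
  have Q: "finite Q" "Q \<subseteq> carrier H \<times> carrier H"
    using W(1) by (auto simp: Q_def I_def)
  have "\<forall>i\<in>Q. \<exists>d. d > 0 \<and> ball (f T i) d \<subseteq> W i"
  proof
    fix i assume i: "i \<in> Q"
    then have "open (W i)" "f T i \<in> W i"
      using W(2,3) by (auto simp: Q_def PiE_iff)
    then show "\<exists>d. d > 0 \<and> ball (f T i) d \<subseteq> W i"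
      by (rule openE) blast
  qed
  from bchoice[OF this] obtain d where d: "\<And>i. i \<in> Q \<Longrightarrow> d i > 0" "\<And>i. i \<in> Q \<Longrightarrow> ball (f T i) (d i) \<subseteq> W i"
    by blast
  \<comment> \<open>The inserted \<open>1\<close> keeps the minimum meaningful when \<open>Q\<close>
    is empty.\<close>
  define e where "e = Min (insert 1 (d ` Q))"
  have e: "e > 0" "\<And>i. i \<in> Q \<Longrightarrow> e \<le> d i"
    using Q(1) d(1) by (auto simp: e_def)
  obtain Z where Z: "Z \<in> A" "\<And>x y. (x, y) \<in> Q \<Longrightarrow> cmod (cinner H (Z x) y - cinner H (T x) y) < e"
    using approx[OF Q e(1)] by blast
  have "f Z i \<in> W i" if i: "i \<in> I" for i
  proof (cases "i \<in> Q")
    case True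
    obtain x y where xy: "i = (x, y)" by (cases i)
    have "dist (f T i) (f Z i) < d i"
      using Z(2)[of x y] e(2)[OF True] True Q(2) xy
      by (auto simp: f_def dist_norm norm_minus_commute)
    then show ?thesis
      using d(2)[OF True] by auto
  qed (use i in \<open>auto simp: Q_def\<close>)
  then have "f Z \<in> Pi\<^sub>E I W"
    by (auto simp: PiE_def f_def I_def)
  moreover have "Z \<in> bounded_ops H"
    using closedin_subset[OF A] Z(1) by auto
  ultimately show False
    using W(4) U(2) Z(1) by blast
qed

lemma weak_operator_closed_limit:
  assumes A: "closedin (weak_operator_topology H) A" and T: "T \<in> bounded_ops H"
    and F: "F \<noteq> bot" "eventually (\<lambda>i. Z i \<in> A) F"
    and lim: "\<And>x y. \<lbrakk>x \<in> carrier H; y \<in> carrier H\<rbrakk>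
      \<Longrightarrow> ((\<lambda>i. cinner H (Z i x) y) \<longlongrightarrow> cinner H (T x) y) F"
  shows "T \<in> A"
proof (rule weak_operator_closedI[OF A T])
  fix Q :: "('a \<times> 'a) set" and e :: real
  assume Q: "finite Q" "Q \<subseteq> carrier H \<times> carrier H" and e: "e > 0"
  have "eventually (\<lambda>i. \<forall>p\<in>Q. cmod (cinner H (Z i (fst p)) (snd p) - cinner H (T (fst p)) (snd p)) < e) F"
    using Q(2) e tendstoD[OF lim] by (intro eventually_ball_finite[OF Q(1)]) (auto simp: dist_norm)
  then have "eventually (\<lambda>i. Z i \<in> A \<and> (\<forall>p\<in>Q. cmod (cinner H (Z i (fst p)) (snd p) - cinner H (T (fst p)) (snd p)) < e)) F"
    using F(2) by (rule eventually_conj[rotated])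
  then show "\<exists>Z\<in>A. \<forall>(x, y)\<in>Q. cmod (cinner H (Z x) y - cinner H (T x) y) < e"
    using eventually_happens[of _ F] F(1) by fastforce
qed

lemma op_mult_eqD:
  assumes "op_mult H S T = op_mult H S' T'" "x \<in> carrier H"
  shows "S (T x) = S' (T' x)"
  using fun_cong[OF assms(1), of x] assms(2) by simp

lemma commutantD:
  "\<lbrakk>T \<in> commutant H S; s \<in> S; x \<in> carrier H\<rbrakk> \<Longrightarrow> T (s x) = s (T x)"
  by (rule op_mult_eqD) (auto simp: commutant_def)

lemma commutant_bounded [simp]: "T \<in> commutant H S \<Longrightarrow> T \<in> bounded_ops H"
  by (simp add: commutant_def)

lemma commutant_antimono: "S \<subseteq> S' \<Longrightarrow> commutant H S' \<subseteq> commutant H S"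
  unfolding commutant_def by blast

lemma commutant_commutant: "S \<subseteq> bounded_ops H \<Longrightarrow> S \<subseteq> commutant H (commutant H S)"
  unfolding commutant_def by (blast intro: sym)

context complex_inner_product_space
begin

lemma commutantI:
  assumes "T \<in> bounded_ops H" "S \<subseteq> bounded_ops H"
    and "\<And>s x. \<lbrakk>s \<in> S; x \<in> carrier H\<rbrakk> \<Longrightarrow> T (s x) = s (T x)"
  shows "T \<in> commutant H S"
proof -
  have "op_mult H T s = op_mult H s T" if s: "s \<in> S" for s
  proof (rule ops_eqI)
    fix x assume "x \<in> carrier H"
    then show "op_mult H T s x = op_mult H s T x"
      using assms(3)[OF s] by simp
  qed (use assms(1,2) s in auto)
  then show ?thesis
    using assms(1) unfolding commutant_def by blast
qed

end

definition adj_closed_set :: "'a hilbert \<Rightarrow> ('a \<Rightarrow> 'a) set \<Rightarrow> bool" where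
  "adj_closed_set H S \<longleftrightarrow> S \<subseteq> bounded_ops H \<and> (\<forall>T\<in>S. op_adj H T \<in> S)"

lemma von_neumann_algebra_adj_closed: "von_neumann_algebra H M \<Longrightarrow> adj_closed_set H M"
  by (simp add: von_neumann_algebra_def adj_closed_set_def)

context hilbert_space
begin

lemma commutant_adj:
  assumes S: "adj_closed_set H S" and T: "T \<in> commutant H S"
  shows "op_adj H T \<in> commutant H S"
proof (rule commutantI)
  fix s x assume s: "s \<in> S" and x: "x \<in> carrier H"
  have s': "op_adj H s \<in> S" "s \<in> bounded_ops H"
    using S s by (auto simp: adj_closed_set_def)
  show "op_adj H T (s x) = s (op_adj H T x)"
  proof (rule cinner_extl)
    fix z assume z: "z \<in> carrier H"
    have "cinner H (op_adj H T (s x)) z = cinner H x (op_adj H s (T z))"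
      using T s' x z by (simp add: cinner_adj' cinner_adj)
    also have "\<dots> = cinner H x (T (op_adj H s z))"
      using commutantD[OF T s'(1) z] by simp
    also have "\<dots> = cinner H (s (op_adj H T x)) z"
      using T s' x z cinner_adj[of s "op_adj H T x" z] by (simp add: cinner_adj')
    finally show "cinner H (op_adj H T (s x)) z = cinner H (s (op_adj H T x)) z" .
  qed (use T s' x in auto)
qed (use S T in \<open>auto simp: adj_closed_set_def\<close>)

text \<open>Commuting with \<open>s\<close> is tested on the coefficients
  \<open>cinner H (T (s x)) y\<close> and \<open>cinner H (T x) (op_adj H s y)\<close>. Moving
  \<open>s\<close> to the right-hand vector makes both sides weakly continuous in \<open>T\<close>,
  so the commutant is an intersection of closed sets.\<close>

lemma closedin_commutant:
  assumes S: "S \<subseteq> bounded_ops H"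
  shows "closedin (weak_operator_topology H) (commutant H S)"
proof -
  define E where "E = (\<lambda>(s, x, y). {T \<in> topspace (weak_operator_topology H).
    cinner H (T (s x)) y = cinner H (T x) (op_adj H s y)})"
  have clo: "closedin (weak_operator_topology H) (E i)" if i0: "i \<in> S \<times> carrier H \<times> carrier H" for i
  proof -
    obtain s x y where i: "i = (s, x, y)" "s \<in> S" "x \<in> carrier H" "y \<in> carrier H"
      using i0 by auto
    show ?thesis
      unfolding E_def i(1) prod.case using i(2-) S
      by (intro closedin_continuous_maps_eq[where Y = euclidean] continuous_map_weak_operator) auto
  qed
  \<comment> \<open>\<open>bounded_ops H\<close> is added so that the intersection is still correct
    when \<open>S\<close> is empty.\<close>
  have eq: "commutant H S = \<Inter> (insert (bounded_ops H) (E ` (S \<times> carrier H \<times> carrier H)))"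
  proof (rule equalityI; rule subsetI)
    fix T assume "T \<in> commutant H S"
    then show "T \<in> \<Inter> (insert (bounded_ops H) (E ` (S \<times> carrier H \<times> carrier H)))"
      using S commutantD[of T H S] by (auto simp: E_def cinner_adj subset_eq)
  next
    fix T assume *: "T \<in> \<Inter> (insert (bounded_ops H) (E ` (S \<times> carrier H \<times> carrier H)))"
    then have T: "T \<in> bounded_ops H" by simp
    have TE: "T \<in> E (s, x, y)" if "s \<in> S" "x \<in> carrier H" "y \<in> carrier H" for s x y
      using * that by simp
    show "T \<in> commutant H S"
    proof (rule commutantI[OF T S])
      fix s x assume s: "s \<in> S" and x: "x \<in> carrier H"
      have "cinner H (T (s x)) y = cinner H (s (T x)) y" if "y \<in> carrier H" for y
      proof -
        have "T \<in> E (s, x, y)" using TE s x that by simp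
        then show ?thesis using s x that S T by (auto simp: E_def cinner_adj)
      qed
      then show "T (s x) = s (T x)"
        using s x S T by (intro cinner_extl) auto
    qed
  qed
  have top: "closedin (weak_operator_topology H) (bounded_ops H)"
    using closedin_topspace[of "weak_operator_topology H"] by simp
  show ?thesis
    unfolding eq by (rule closedin_Inter) (use clo top in blast)+
qed

lemma von_neumann_algebra_commutant:
  assumes S: "adj_closed_set H S"
  shows "von_neumann_algebra H (commutant H S)"
proof -
  have Sb: "S \<subseteq> bounded_ops H" using S by (simp add: adj_closed_set_def)
  have "op_one H \<in> commutant H S"
    by (rule commutantI) (use Sb in auto)
  moreover have "op_add H T T' \<in> commutant H S" "op_mult H T T' \<in> commutant H S"
    if "T \<in> commutant H S" "T' \<in> commutant H S" for T T'
    by (rule commutantI;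
        use that Sb commutantD[OF that(1)] commutantD[OF that(2)] in \<open>auto simp: bounded_ops_add subset_eq\<close>)+
  moreover have "op_smult H c T \<in> commutant H S" if "T \<in> commutant H S" for c T
    by (rule commutantI;
        use that Sb commutantD[OF that] in \<open>auto simp: bounded_ops_smult subset_eq\<close>)
  moreover have "op_adj H T \<in> commutant H S" if "T \<in> commutant H S" for T
    using commutant_adj[OF S that] .
  moreover have "commutant H S \<subseteq> bounded_ops H" by auto
  ultimately show ?thesis
    using closedin_commutant[OF Sb] by (simp add: von_neumann_algebra_def)
qed

lemma commutant_ops:
  assumes "adj_closed_set H S" "A \<in> commutant H S" "B \<in> commutant H S"
  shows "op_one H \<in> commutant H S" "op_add H A B \<in> commutant H S" "op_mult H A B \<in> commutant H S"
    "op_smult H c A \<in> commutant H S" "op_adj H A \<in> commutant H S" "op_minus H A B \<in> commutant H S"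
  using von_neumann_algebra_commutant[OF assms(1)] assms(2,3)
  unfolding von_neumann_algebra_def op_minus_def by blast+

text \<open>Along a chain the quadratic forms increase to their supremum, so
  \<open>op_pos_limit\<close> gives a weak limit, which is the least upper bound. The filter is part
  of the conclusion so that membership in weakly closed sets can be transferred to the
  limit.\<close>

lemma chain_limit:
  assumes C: "C \<noteq> {}" and c: "c > 0" and pos: "\<And>A. A \<in> C \<Longrightarrow> op_pos H A"
    and le: "\<And>A x. A \<in> C \<Longrightarrow> x \<in> carrier H \<Longrightarrow> Re (cinner H (A x) x) \<le> c * (hnorm H x)\<^sup>2"
    and chain: "\<And>A B. A \<in> C \<Longrightarrow> B \<in> C \<Longrightarrow> op_le H A B \<or> op_le H B A"
  shows "\<exists>B F. op_pos H B \<and> (\<forall>x\<in>carrier H. Re (cinner H (B x) x) \<le> c * (hnorm H x)\<^sup>2)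
    \<and> F \<noteq> bot \<and> eventually (\<lambda>A. A \<in> C) F
    \<and> (\<forall>x\<in>carrier H. \<forall>y\<in>carrier H. ((\<lambda>A. cinner H (A x) y) \<longlongrightarrow> cinner H (B x) y) F)
    \<and> (\<forall>A\<in>C. op_le H A B) \<and> (\<forall>U. (\<forall>A\<in>C. op_le H A U) \<longrightarrow> op_le H B U)"
proof -
  \<comment> \<open>Generated by the tails of the chain; a chain need not have a cofinal
    sequence.\<close>
  define F where "F = (INF A\<in>C. principal {A' \<in> C. op_le H A A'})"
  have ev: "eventually P F \<longleftrightarrow> (\<exists>A\<in>C. \<forall>A'\<in>C. op_le H A A' \<longrightarrow> P A')" for P
  proof -
    have "\<exists>D\<in>C. principal {A' \<in> C. op_le H D A'} \<le> inf (principal {A' \<in> C. op_le H A A'}) (principal {A' \<in> C. op_le H B A'})"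
      if "A \<in> C" "B \<in> C" for A B
      using chain[OF that] that op_le_trans by (auto simp: subset_eq; blast)
    then show ?thesis
      unfolding F_def using C by (subst eventually_INF_base) (auto simp: eventually_principal)
  qed
  have F: "F \<noteq> bot"
    using ev[of "\<lambda>_. False"] op_le_refl by (auto simp: trivial_limit_def)
  have evC: "eventually (\<lambda>A. A \<in> C) F"
    using ev C by auto
  define q where "q A x = Re (cinner H (A x) x)" for A :: "'a \<Rightarrow> 'a" and x
  have sup: "((\<lambda>A. q A x) \<longlongrightarrow> (SUP A\<in>C. q A x)) F" if x: "x \<in> carrier H" for x
  proof -
    have bdd: "bdd_above ((\<lambda>A. q A x) ` C)"
      using le[OF _ x] by (auto intro!: bdd_aboveI2 simp: q_def)
    show ?thesis
    proof (rule order_tendstoI)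
      fix a assume "a < (SUP A\<in>C. q A x)"
      then obtain A where "A \<in> C" "a < q A x"
        using less_cSUP_iff[OF C bdd] by blast
      then show "eventually (\<lambda>A. a < q A x) F"
        unfolding ev using x by (auto simp: op_le_def q_def intro: less_le_trans)
    next
      fix a assume "(SUP A\<in>C. q A x) < a"
      then show "eventually (\<lambda>A. q A x < a) F"
        using cSUP_upper[OF _ bdd] C unfolding ev by (meson ex_in_conv le_less_trans)
    qed
  qed
  obtain B where B: "op_pos H B" "\<And>x. x \<in> carrier H \<Longrightarrow> Re (cinner H (B x) x) \<le> c * (hnorm H x)\<^sup>2"
    "\<And>x y. x \<in> carrier H \<Longrightarrow> y \<in> carrier H \<Longrightarrow> ((\<lambda>A. cinner H (A x) y) \<longlongrightarrow> cinner H (B x) y) F"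
  proof -
    have "\<exists>B. op_pos H B \<and> (\<forall>x\<in>carrier H. Re (cinner H (B x) x) \<le> c * (hnorm H x)\<^sup>2)
      \<and> (\<forall>x\<in>carrier H. \<forall>y\<in>carrier H. ((\<lambda>A. cinner H (A x) y) \<longlongrightarrow> cinner H (B x) y) F)"
    proof (rule op_pos_limit[OF F c pos le evC])
      fix x assume "x \<in> carrier H"
      then show "\<exists>l. ((\<lambda>A. Re (cinner H (A x) x)) \<longlongrightarrow> l) F"
        using sup[unfolded q_def] by blast
    qed
    then show ?thesis using that by blast
  qed
  have qB: "((\<lambda>A. q A x) \<longlongrightarrow> q B x) F" if "x \<in> carrier H" for x
    unfolding q_def using tendsto_Re[OF B(3)[OF that that]] .
  have "op_le H A B" if A: "A \<in> C" for A
    unfolding op_le_def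
  proof
    fix x assume x: "x \<in> carrier H"
    have "eventually (\<lambda>A'. q A x \<le> q A' x) F"
      unfolding ev using A x by (auto simp: op_le_def q_def)
    then show "Re (cinner H (A x) x) \<le> Re (cinner H (B x) x)"
      using tendsto_lowerbound[OF qB[OF x] _ F] by (simp add: q_def)
  qed
  moreover have "op_le H B U" if U: "\<forall>A\<in>C. op_le H A U" for U
    unfolding op_le_def
  proof
    fix x assume x: "x \<in> carrier H"
    have "eventually (\<lambda>A'. q A' x \<le> q U x) F"
      using evC by eventually_elim (use U x in \<open>auto simp: op_le_def q_def\<close>)
    then show "Re (cinner H (B x) x) \<le> Re (cinner H (U x) x)"
      using tendsto_upperbound[OF qB[OF x] _ F] by (simp add: q_def)
  qed
  ultimately show ?thesis
    using B F evC by (intro exI[of _ B] exI[of _ F]) blast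
qed

end

section \<open>Square roots\<close>

text \<open>Polynomials in \<open>c\<close> with nonnegative coefficients. The successive
  differences of the square root approximants are of this kind, and for positive \<open>c\<close>
  all such polynomials are positive operators; this is why the approximants increase.\<close>

inductive_set nonneg_polys :: "'a hilbert \<Rightarrow> ('a \<Rightarrow> 'a) \<Rightarrow> ('a \<Rightarrow> 'a) set" for H c where
  one: "op_one H \<in> nonneg_polys H c"
| add: "S \<in> nonneg_polys H c \<Longrightarrow> T \<in> nonneg_polys H c \<Longrightarrow> op_add H S T \<in> nonneg_polys H c"
| smult: "S \<in> nonneg_polys H c \<Longrightarrow> 0 \<le> r \<Longrightarrow> op_smult H (complex_of_real r) S \<in> nonneg_polys H c"
| mult: "S \<in> nonneg_polys H c \<Longrightarrow> op_mult H c S \<in> nonneg_polys H c"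

text \<open>The approximants satisfy \<open>y\<^sub>n\<^sub>+\<^sub>1 = (c + y\<^sub>n\<^sup>2) / 2\<close>, so their limit \<open>y\<close> satisfies \<open>(1 - y)\<^sup>2 = 1 - c\<close>.\<close>

primrec sqrt_approx :: "'a hilbert \<Rightarrow> ('a \<Rightarrow> 'a) \<Rightarrow> nat \<Rightarrow> 'a \<Rightarrow> 'a" where
  "sqrt_approx H c 0 = op_smult H (complex_of_real 0) (op_one H)"
| "sqrt_approx H c (Suc n) =
    op_smult H (complex_of_real (1/2)) (op_add H c (op_mult H (sqrt_approx H c n) (sqrt_approx H c n)))"

context hilbert_space
begin

lemma nonneg_polys_bounded:
  assumes c: "c \<in> bounded_ops H" and S: "S \<in> nonneg_polys H c"
  shows "S \<in> bounded_ops H"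
  using S by induction (simp_all add: c)

lemma nonneg_polys_commute:
  assumes c: "c \<in> bounded_ops H" and Z: "Z \<in> bounded_ops H"
    and Zc: "\<And>x. x \<in> carrier H \<Longrightarrow> Z (c x) = c (Z x)"
    and S: "S \<in> nonneg_polys H c" and x: "x \<in> carrier H"
  shows "Z (S x) = S (Z x)"
proof -
  note b = nonneg_polys_bounded[OF c]
  have "\<forall>x\<in>carrier H. Z (S x) = S (Z x)"
    using S
  proof induction
    case one
    then show ?case using Z by simp
  next
    case (add S T)
    then show ?case using Z b[OF add.hyps(1)] b[OF add.hyps(2)] by (simp add: bounded_ops_add)
  next
    case (smult S r)
    then show ?case using Z b[OF smult.hyps(1)] by (simp add: bounded_ops_smult)
  next
    case (mult S)
    show ?case
    proof
      fix x assume x: "x \<in> carrier H"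
      have "Z (c (S x)) = c (Z (S x))"
        by (rule Zc) (use b[OF mult.hyps] x in simp)
      also have "Z (S x) = S (Z x)"
        using mult.IH x by blast
      finally show "Z (op_mult H c S x) = op_mult H c S (Z x)"
        using Z x by simp
    qed
  qed
  then show ?thesis using x by blast
qed

text \<open>Positivity of \<open>S\<close> alone does not yield positivity of \<open>c S\<close>, so
  the induction carries \<open>S\<close> and \<open>c S\<close> together: multiplying once more by
  \<open>c\<close> gives \<open>c c S\<close>, whose form at \<open>x\<close> is that of
  \<open>S\<close> at \<open>c x\<close>.\<close>

lemma nonneg_polys_pos:
  assumes c: "op_pos H c" and S: "S \<in> nonneg_polys H c"
  shows "selfadj H S" and "\<And>x. x \<in> carrier H \<Longrightarrow> 0 \<le> Re (cinner H (S x) x) \<and> 0 \<le> Re (cinner H (c (S x)) x)"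
proof -
  have cb: "c \<in> bounded_ops H" and cs: "selfadj H c" using c by auto
  have "selfadj H S \<and> (\<forall>x\<in>carrier H. 0 \<le> Re (cinner H (S x) x) \<and> 0 \<le> Re (cinner H (c (S x)) x))"
    using S
  proof induction
    case one
    show ?case using c by (auto simp: op_pos_def cinner_self_nonneg)
  next
    case (add S T)
    then show ?case using cb by (auto simp: cinner_simps bounded_ops_add)
  next
    case (smult S r)
    then show ?case using cb by (auto simp: cinner_simps bounded_ops_smult)
  next
    case (mult S)
    have Sb: "S \<in> bounded_ops H" using mult by simp
    have comm: "c (S x) = S (c x)" if "x \<in> carrier H" for x
      by (rule nonneg_polys_commute[OF cb cb _ mult.hyps that]) simp
    have "selfadj H (op_mult H c S)"
    proof (rule selfadjI)
      fix x y assume xy: "x \<in> carrier H" "y \<in> carrier H"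
      have "cinner H (c (S x)) y = cinner H (S x) (c y)"
        using selfadj_cinner[OF cs, of "S x" y] Sb xy by simp
      also have "\<dots> = cinner H x (S (c y))"
        using selfadj_cinner[of S x "c y"] mult cb xy by simp
      finally show "cinner H (op_mult H c S x) y = cinner H x (op_mult H c S y)"
        using xy comm by simp
    qed (use cb Sb in auto)
    moreover have "cinner H (c (c (S x))) x = cinner H (S (c x)) (c x)" if "x \<in> carrier H" for x
      using selfadj_cinner[OF cs, of "c (S x)" x] comm[OF that] Sb cb that by simp
    ultimately show ?case using mult cb by auto
  qed
  then show "selfadj H S" and "\<And>x. x \<in> carrier H \<Longrightarrow> 0 \<le> Re (cinner H (S x) x) \<and> 0 \<le> Re (cinner H (c (S x)) x)"
    by auto
qed

lemma nonneg_polys_mult: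
  assumes c: "c \<in> bounded_ops H" and S: "S \<in> nonneg_polys H c" and T: "T \<in> nonneg_polys H c"
  shows "op_mult H S T \<in> nonneg_polys H c"
proof -
  have Tb: "T \<in> bounded_ops H" using nonneg_polys_bounded[OF c T] .
  show ?thesis
    using S
  proof induction
    case one
    then show ?case using T Tb by simp
  next
    case (add S S')
    have "op_mult H (op_add H S S') T = op_add H (op_mult H S T) (op_mult H S' T)"
      using nonneg_polys_bounded[OF c] add Tb by (intro ops_eqI) auto
    then show ?case using add by (simp add: nonneg_polys.add)
  next
    case (smult S r)
    have "op_mult H (op_smult H (complex_of_real r) S) T = op_smult H (complex_of_real r) (op_mult H S T)"
      using nonneg_polys_bounded[OF c] smult Tb by (intro ops_eqI) auto
    then show ?case using smult by (simp add: nonneg_polys.smult)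
  next
    case (mult S)
    have "op_mult H (op_mult H c S) T = op_mult H c (op_mult H S T)"
      using nonneg_polys_bounded[OF c] mult Tb c by (intro op_mult_assoc) auto
    then show ?case using mult by (simp add: nonneg_polys.mult)
  qed
qed

lemma sqrt_approx_poly:
  assumes c: "c \<in> bounded_ops H"
  shows "sqrt_approx H c n \<in> nonneg_polys H c"
proof (induction n)
  case 0
  show ?case by (auto intro: nonneg_polys.smult nonneg_polys.one simp del: of_real_0)
next
  case (Suc n)
  have "c \<in> nonneg_polys H c"
    using nonneg_polys.mult[OF nonneg_polys.one, of H c] c by simp
  then show ?case
    using Suc nonneg_polys_mult[OF c Suc Suc]
    by (auto intro!: nonneg_polys.smult nonneg_polys.add simp del: of_real_divide)
qed

text \<open>If \<open>y\<close> and \<open>y + d\<close> are consecutive, then \<open>c\<close>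
  cancels in the next difference, which is half of \<open>y d + d y + d d\<close>. Nonnegative
  coefficients therefore propagate.\<close>

lemma sqrt_approx_step:
  assumes c: "c \<in> bounded_ops H"
  shows "\<exists>d\<in>nonneg_polys H c. sqrt_approx H c (Suc n) = op_add H (sqrt_approx H c n) d"
proof (induction n)
  case 0
  define d where "d = op_smult H (complex_of_real (1/2)) (op_mult H c (op_one H))"
  have "d \<in> nonneg_polys H c"
    unfolding d_def by (intro nonneg_polys.smult nonneg_polys.mult nonneg_polys.one) auto
  moreover have "sqrt_approx H c (Suc 0) = op_add H (sqrt_approx H c 0) d"
    using c by (intro ops_eqI) (auto simp: d_def)
  ultimately show ?case by blast
next
  case (Suc n)
  then obtain d where d: "d \<in> nonneg_polys H c" "sqrt_approx H c (Suc n) = op_add H (sqrt_approx H c n) d"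
    by blast
  define y where "y = sqrt_approx H c n"
  have y: "y \<in> nonneg_polys H c"
    using sqrt_approx_poly[OF c] by (simp add: y_def)
  define e where "e = op_smult H (complex_of_real (1/2))
    (op_add H (op_add H (op_mult H y d) (op_mult H d y)) (op_mult H d d))"
  have "e \<in> nonneg_polys H c"
    unfolding e_def using y d(1)
    by (intro nonneg_polys.smult nonneg_polys.add nonneg_polys_mult[OF c]) auto
  moreover have "sqrt_approx H c (Suc (Suc n)) = op_add H (sqrt_approx H c (Suc n)) e"
  proof (rule ops_eqI)
    note b = nonneg_polys_bounded[OF c y] nonneg_polys_bounded[OF c d(1)]
    fix x assume x: "x \<in> carrier H"
    have l: "sqrt_approx H c (Suc (Suc n)) =
      op_smult H (complex_of_real (1/2)) (op_add H c (op_mult H (op_add H y d) (op_add H y d)))"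
      using d(2) by (simp only: sqrt_approx.simps(2)[of H c "Suc n"] y_def)
    have r: "sqrt_approx H c (Suc n) = op_smult H (complex_of_real (1/2)) (op_add H c (op_mult H y y))"
      by (simp only: sqrt_approx.simps(2)[of H c n] y_def)
    show "sqrt_approx H c (Suc (Suc n)) x = op_add H (sqrt_approx H c (Suc n)) e x"
      unfolding l r e_def using b c x
      by (intro cinner_extl) (auto simp: bounded_ops_add cinner_simps algebra_simps)
  qed (use nonneg_polys_bounded[OF c sqrt_approx_poly[OF c]] nonneg_polys_bounded[OF c \<open>e \<in> _\<close>] in
      \<open>auto simp del: sqrt_approx.simps\<close>)
  ultimately show ?case by blast
qed

text \<open>The approximants are run for \<open>c = 1 - A\<close>, and the root is one minus their
  limit. The commutation clause later puts the root of a positive element of a commutant back into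
  that commutant.\<close>

lemma op_sqrt_contraction:
  assumes A: "op_pos H A" and A1: "\<And>x. x \<in> carrier H \<Longrightarrow> Re (cinner H (A x) x) \<le> (hnorm H x)\<^sup>2"
  shows "\<exists>S. op_pos H S \<and> op_mult H S S = A \<and>
    (\<forall>Z\<in>bounded_ops H. op_mult H Z A = op_mult H A Z \<longrightarrow> op_mult H Z S = op_mult H S Z)"
proof -
  define c where "c = op_minus H (op_one H) A"
  have Ab[simp]: "A \<in> bounded_ops H" and As: "selfadj H A" using A by auto
  have cs: "selfadj H c" unfolding c_def using As by simp
  have cp: "op_pos H c"
    using cs A1 by (simp add: op_pos_def c_def cinner_simps flip: hnorm_power2)
  have cb[simp]: "c \<in> bounded_ops H" using cs by simp
  have c1: "Re (cinner H (c x) x) \<le> (hnorm H x)\<^sup>2" if "x \<in> carrier H" for x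
    using A that by (simp add: op_pos_def c_def cinner_simps flip: hnorm_power2)
  define y where "y = sqrt_approx H c"
  have yp: "op_pos H (y n)" for n
    using nonneg_polys_pos[OF cp sqrt_approx_poly[OF cb]] by (simp add: op_pos_def y_def)
  have yb[simp]: "y n \<in> bounded_ops H" for n using yp by simp
  have ySuc: "y (Suc n) = op_smult H (complex_of_real (1/2)) (op_add H c (op_mult H (y n) (y n)))" for n
    by (simp add: y_def)
  have ystep: "Re (cinner H (y (Suc n) x) x) = (Re (cinner H (c x) x) + (hnorm H (y n x))\<^sup>2) / 2"
    if x: "x \<in> carrier H" for n x
    using selfadj_cinner[OF op_pos_selfadj[OF yp], of "y n x" x n] x
    by (simp add: ySuc cinner_simps hnorm_power2)
  have y1: "(\<forall>x\<in>carrier H. Re (cinner H (y n x) x) \<le> 1 * (hnorm H x)\<^sup>2)" for n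
  proof (induction n)
    case 0
    show ?case by (simp add: y_def cinner_simps cinner_zero_left)
  next
    case (Suc n)
    have "hnorm H (y n x) \<le> hnorm H x" if "x \<in> carrier H" for x
      using op_pos_bound(2)[OF yp[of n] zero_less_one that] Suc by simp
    then have "(hnorm H (y n x))\<^sup>2 \<le> (hnorm H x)\<^sup>2" if "x \<in> carrier H" for x
      using that hnorm_nonneg by (simp add: power_mono)
    then have "(Re (cinner H (c x) x) + (hnorm H (y n x))\<^sup>2) / 2 \<le> (hnorm H x)\<^sup>2" if "x \<in> carrier H" for x
      using c1[OF that] that by force
    then show ?case
      by (auto simp: ystep simp del: divide_le_eq_numeral1 le_divide_eq_numeral1)
  qed
  have inc: "incseq (\<lambda>n. Re (cinner H (y n x) x))" if x: "x \<in> carrier H" for x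
  proof (rule incseq_SucI)
    fix n
    obtain d where d: "d \<in> nonneg_polys H c" "y (Suc n) = op_add H (y n) d"
      using sqrt_approx_step[OF cb] by (auto simp: y_def simp del: sqrt_approx.simps)
    show "Re (cinner H (y n x) x) \<le> Re (cinner H (y (Suc n) x) x)"
      using nonneg_polys_pos[OF cp d(1)] x d(2) by (simp add: cinner_simps)
  qed
  have "\<exists>B. op_pos H B \<and> (\<forall>x\<in>carrier H. Re (cinner H (B x) x) \<le> 1 * (hnorm H x)\<^sup>2)
    \<and> (\<forall>x\<in>carrier H. \<forall>z\<in>carrier H. ((\<lambda>n. cinner H (y n x) z) \<longlongrightarrow> cinner H (B x) z) sequentially)"
  proof (rule op_pos_limit[where I = UNIV])
    fix x assume x: "x \<in> carrier H"
    then show "\<exists>l. (\<lambda>n. Re (cinner H (y n x) x)) \<longlonglongrightarrow> l"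
      using incseq_convergent[OF inc[OF x]] y1 by metis
  qed (use yp y1 in auto)
  then obtain B where B: "op_pos H B" "\<And>x. x \<in> carrier H \<Longrightarrow> Re (cinner H (B x) x) \<le> (hnorm H x)\<^sup>2"
    "\<And>x z. x \<in> carrier H \<Longrightarrow> z \<in> carrier H \<Longrightarrow> (\<lambda>n. cinner H (y n x) z) \<longlonglongrightarrow> cinner H (B x) z"
    by auto
  have Bb[simp]: "B \<in> bounded_ops H" using B(1) by simp
  \<comment> \<open>Weak convergence would not control the square of \<open>y n\<close>. Since
    \<open>B - y n\<close> is positive and at most one, \<open>op_pos_bound\<close> bounds the
    squared norm of \<open>B x \<ominus> y n x\<close> by the form of \<open>B - y n\<close> at
    \<open>x\<close>, which tends to zero.\<close>
  have strong: "(\<lambda>n. hnorm H (y n x \<ominus> B x)) \<longlonglongrightarrow> 0" if x: "x \<in> carrier H" for x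
  proof -
    define r where "r n = Re (cinner H (B x) x) - Re (cinner H (y n x) x)" for n
    have le: "(hnorm H (y n x \<ominus> B x))\<^sup>2 \<le> r n" for n
    proof -
      have "op_le H (y n) B"
        unfolding op_le_def using incseq_le[OF inc tendsto_Re[OF B(3)]] by blast
      then have "op_pos H (op_minus H B (y n))"
        using op_pos_minus_iff[of "y n" B] B(1) yp by simp
      moreover have "Re (cinner H (op_minus H B (y n) z) z) \<le> 1 * (hnorm H z)\<^sup>2" if "z \<in> carrier H" for z
        using B(2)[OF that] yp[of n] that by (simp add: op_pos_def cinner_simps) (smt (verit))
      ultimately have "(hnorm H (op_minus H B (y n) x))\<^sup>2 \<le> 1 * Re (cinner H (op_minus H B (y n) x) x)"
        using op_pos_bound(1) x zero_less_one by blast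
      then show ?thesis
        using x hnorm_minus_commute[of "B x" "y n x"] by (simp add: r_def cinner_simps)
    qed
    have r0: "r \<longlonglongrightarrow> 0"
      unfolding r_def using tendsto_diff[OF tendsto_const[of "Re (cinner H (B x) x)"] tendsto_Re[OF B(3)[OF x x]]] by simp
    have "(\<lambda>n. (hnorm H (y n x \<ominus> B x))\<^sup>2) \<longlonglongrightarrow> 0"
      by (rule Lim_null_comparison[OF _ r0]) (simp add: le)
    from tendsto_real_sqrt[OF this] have "(\<lambda>n. \<bar>hnorm H (y n x \<ominus> B x)\<bar>) \<longlonglongrightarrow> 0"
      by simp
    then show ?thesis
      by (rule tendsto_rabs_zero_cancel)
  qed
  \<comment> \<open>Both sides are selfadjoint, so the recursion is passed to the limit in the
    quadratic form only, where the square of \<open>y n\<close> becomes the squared norm of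
    \<open>y n x\<close>.\<close>
  have Bsq: "op_smult H (complex_of_real (1/2)) (op_add H c (op_mult H B B)) = B" (is "?L = B")
  proof -
    have Ls: "selfadj H ?L"
      by (intro selfadj_smult selfadj_add cs) 
        (use B(1) adj_mult[of B B] in \<open>simp add: selfadj_def op_pos_def\<close>)
    have "Re (cinner H (?L x) x) = Re (cinner H (B x) x)" if x: "x \<in> carrier H" for x
    proof -
      have "(\<lambda>n. hnorm H (y n x)) \<longlonglongrightarrow> hnorm H (B x)"
        by (rule hnorm_tendsto[OF _ _ strong[OF x]]) (use x in auto)
      then have 1: "(\<lambda>n. (Re (cinner H (c x) x) + (hnorm H (y n x))\<^sup>2) / 2)
          \<longlonglongrightarrow> (Re (cinner H (c x) x) + (hnorm H (B x))\<^sup>2) / 2"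
        by (intro tendsto_intros) auto
      have 2: "(\<lambda>n. Re (cinner H (y (Suc n) x) x)) \<longlonglongrightarrow> Re (cinner H (B x) x)"
        using LIMSEQ_Suc[OF tendsto_Re[OF B(3)[OF x x]]] .
      have "(Re (cinner H (c x) x) + (hnorm H (B x))\<^sup>2) / 2 = Re (cinner H (B x) x)"
        using LIMSEQ_unique[OF 1 2[unfolded ystep[OF x]]] .
      then show ?thesis
        using x selfadj_cinner[OF op_pos_selfadj[OF B(1)], of "B x" x] by (simp add: cinner_simps hnorm_power2)
    qed
    then show ?thesis
      using selfadj_antisym[OF Ls op_pos_selfadj[OF B(1)]] by (simp add: op_le_def)
  qed
  define S where "S = op_minus H (op_one H) B"
  have "op_pos H S"
    unfolding S_def by (subst op_pos_minus_iff) (use B in \<open>auto simp: op_le_def hnorm_power2\<close>)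
  moreover have "op_mult H S S = A"
  proof (rule bounded_ops_eqI_cinner)
    fix x z assume xz: "x \<in> carrier H" "z \<in> carrier H"
    have "cinner H (?L x) z = cinner H (B x) z" unfolding Bsq ..
    then have *: "cinner H x z - cinner H (A x) z + cinner H (B (B x)) z = 2 * cinner H (B x) z"
      using xz by (simp add: cinner_simps c_def)
    show "cinner H (op_mult H S S x) z = cinner H (A x) z"
      using xz by (simp add: S_def bounded_ops_diff cinner_simps) (simp flip: *)
  qed (auto simp: S_def)
  moreover have "op_mult H Z S = op_mult H S Z" if Z: "Z \<in> bounded_ops H" "op_mult H Z A = op_mult H A Z" for Z
  proof -
    have ZA: "Z (A x) = A (Z x)" if "x \<in> carrier H" for x
      using op_mult_eqD[OF Z(2) that] .
    have Zc: "Z (c x) = c (Z x)" if "x \<in> carrier H" for x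
      using that Z(1) ZA by (simp add: c_def bounded_ops_diff)
    have ZB: "Z (B x) = B (Z x)" if x: "x \<in> carrier H" for x
    proof (rule cinner_extl)
      fix w assume w: "w \<in> carrier H"
      have "(\<lambda>n. cinner H (y n x) (op_adj H Z w)) \<longlonglongrightarrow> cinner H (B x) (op_adj H Z w)"
        using x w Z(1) by (intro B(3)) auto
      moreover have "(\<lambda>n. cinner H (y n (Z x)) w) \<longlonglongrightarrow> cinner H (B (Z x)) w"
        using x w Z(1) by (intro B(3)) auto
      moreover have "Z (y n x) = y n (Z x)" for n
        unfolding y_def by (rule nonneg_polys_commute[OF cb Z(1) Zc sqrt_approx_poly[OF cb] x])
      ultimately have "cinner H (B x) (op_adj H Z w) = cinner H (B (Z x)) w"
        using x w Z(1) by (simp add: cinner_adj LIMSEQ_unique)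
      then show "cinner H (Z (B x)) w = cinner H (B (Z x)) w"
        using x w Z(1) by (simp add: cinner_adj)
    qed (use x Z in auto)
    show ?thesis
      using Z(1) ZB by (intro ops_eqI) (auto simp: S_def bounded_ops_diff)
  qed
  ultimately show ?thesis by blast
qed

text \<open>Division by a bound \<open>C\<close> of the quadratic form reduces to the contractive
  case; the factor \<open>sqrt C\<close> restores the scale.\<close>

lemma op_sqrt:
  assumes A: "op_pos H A"
  shows "\<exists>S. op_pos H S \<and> op_mult H S S = A \<and>
    (\<forall>Z\<in>bounded_ops H. op_mult H Z A = op_mult H A Z \<longrightarrow> op_mult H Z S = op_mult H S Z)"
proof -
  have Ab[simp]: "A \<in> bounded_ops H" using A by simp
  obtain C where C: "C > 0" "\<And>x. x \<in> carrier H \<Longrightarrow> \<bar>Re (cinner H (A x) x)\<bar> \<le> C * (hnorm H x)\<^sup>2"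
    using bounded_ops_Re_bound[OF Ab] by blast
  define A1 where "A1 = op_smult H (complex_of_real (1 / C)) A"
  have "op_pos H A1"
    using A C(1) unfolding A1_def op_pos_def by (auto simp: cinner_simps simp del: of_real_divide)
  moreover have "Re (cinner H (A1 x) x) \<le> (hnorm H x)\<^sup>2" if "x \<in> carrier H" for x
    using C(1) C(2)[OF that] that by (simp add: A1_def cinner_simps field_simps del: of_real_divide)
  ultimately obtain S where S: "op_pos H S" "op_mult H S S = A1"
    "\<And>Z. Z \<in> bounded_ops H \<Longrightarrow> op_mult H Z A1 = op_mult H A1 Z \<Longrightarrow> op_mult H Z S = op_mult H S Z"
    using op_sqrt_contraction by blast
  have Sb[simp]: "S \<in> bounded_ops H" using S(1) by simp
  define S' where "S' = op_smult H (complex_of_real (sqrt C)) S"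
  have SS: "S (S x) = complex_of_real (1 / C) \<odot> A x" if "x \<in> carrier H" for x
    using fun_cong[OF S(2), of x] that by (simp add: A1_def del: of_real_divide)
  have sq: "complex_of_real (sqrt C) * complex_of_real (sqrt C) = complex_of_real C"
    using C(1) by (simp flip: of_real_mult)
  have "op_pos H S'"
    using S(1) C(1) unfolding S'_def op_pos_def by (auto simp: cinner_simps)
  moreover have "op_mult H S' S' = A"
  proof (rule bounded_ops_eqI_cinner)
    fix x z assume xz: "x \<in> carrier H" "z \<in> carrier H"
    have "cinner H (op_mult H S' S' x) z = complex_of_real (sqrt C) * complex_of_real (sqrt C) * cinner H (S (S x)) z"
      using xz by (simp add: S'_def bounded_ops_smult cinner_simps)
    also have "\<dots> = cinner H (A x) z"
      unfolding sq using C(1) xz by (simp add: SS cinner_simps)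
    finally show "cinner H (op_mult H S' S' x) z = cinner H (A x) z" .
  qed (auto simp: S'_def)
  moreover have "op_mult H Z S' = op_mult H S' Z" if Z: "Z \<in> bounded_ops H" "op_mult H Z A = op_mult H A Z" for Z
  proof -
    have ZA: "Z (A x) = A (Z x)" if "x \<in> carrier H" for x
      using op_mult_eqD[OF Z(2) that] .
    have "op_mult H Z A1 = op_mult H A1 Z"
      using Z(1) ZA by (intro ops_eqI) (auto simp: A1_def bounded_ops_smult)
    note eq = S(3)[OF Z(1) this]
    have ZS: "Z (S x) = S (Z x)" if "x \<in> carrier H" for x
      by (rule op_mult_eqD[OF eq that])
    show ?thesis
      using Z(1) ZS by (intro ops_eqI) (auto simp: S'_def bounded_ops_smult)
  qed
  ultimately show ?thesis by blast
qed

end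

section \<open>Square-summable families and orthonormal bases\<close>

lemma (in complex_inner_product_space) mcompleteI:
  assumes "\<And>s. \<lbrakk>\<And>n::nat. s n \<in> carrier H;
      \<And>e. e > 0 \<Longrightarrow> \<exists>N. \<forall>m\<ge>N. \<forall>n\<ge>N. hnorm H (s m \<ominus> s n) < e\<rbrakk>
      \<Longrightarrow> \<exists>x\<in>carrier H. (\<lambda>n. hnorm H (s n \<ominus> x)) \<longlonglongrightarrow> 0"
  shows mcomplete
  unfolding mcomplete_def
proof (intro allI impI)
  fix s assume s: "MCauchy s"
  then have sc: "s n \<in> carrier H" for n
    by (auto simp: MCauchy_def)
  have "\<exists>N. \<forall>m\<ge>N. \<forall>n\<ge>N. hnorm H (s m \<ominus> s n) < e" if "e > 0" for e
    using s that sc by (auto simp: MCauchy_def hdist_def)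
  from assms[OF sc this] obtain x where "x \<in> carrier H" "(\<lambda>n. hnorm H (s n \<ominus> x)) \<longlonglongrightarrow> 0"
    by blast
  then have "limitin mtopology s x sequentially"
    using sc by (simp add: limitin_metric_dist_null hdist_def)
  then show "\<exists>x. limitin mtopology s x sequentially" ..
qed

text \<open>\<open>ell2\<close>, copies of spaces on other types and the tensor product all inherit
  their structure by transport. The algebraic axioms are pulled back along the injection
  \<open>\<Phi>\<close>, and completeness uses that it is onto.\<close>

lemma hilbert_space_iso:
  assumes L: "hilbert_space L" and bij: "bij_betw \<Phi> (carrier T) (carrier L)"
    and cl: "\<And>x y. \<lbrakk>x \<in> carrier T; y \<in> carrier T\<rbrakk> \<Longrightarrow> x \<oplus>\<^bsub>T\<^esub> y \<in> carrier T"
      "\<And>c x. x \<in> carrier T \<Longrightarrow> c \<odot>\<^bsub>T\<^esub> x \<in> carrier T" "\<zero>\<^bsub>T\<^esub> \<in> carrier T"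
    and hom: "\<And>x y. \<lbrakk>x \<in> carrier T; y \<in> carrier T\<rbrakk> \<Longrightarrow> \<Phi> (x \<oplus>\<^bsub>T\<^esub> y) = \<Phi> x \<oplus>\<^bsub>L\<^esub> \<Phi> y"
      "\<And>c x. x \<in> carrier T \<Longrightarrow> \<Phi> (c \<odot>\<^bsub>T\<^esub> x) = c \<odot>\<^bsub>L\<^esub> \<Phi> x" "\<Phi> \<zero>\<^bsub>T\<^esub> = \<zero>\<^bsub>L\<^esub>"
    and inner: "\<And>x y. \<lbrakk>x \<in> carrier T; y \<in> carrier T\<rbrakk> \<Longrightarrow> cinner T x y = cinner L (\<Phi> x) (\<Phi> y)"
  shows "hilbert_space T"
proof -
  interpret L: hilbert_space L by fact
  have \<Phi>[simp]: "\<Phi> x \<in> carrier L" if "x \<in> carrier T" for x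
    using bij that by (auto simp: bij_betw_def)
  have inj: "x = y" if "\<Phi> x = \<Phi> y" "x \<in> carrier T" "y \<in> carrier T" for x y
    using bij that by (auto simp: bij_betw_def inj_on_def)
  have "abelian_group T"
  proof (rule abelian_groupI)
    fix x assume x: "x \<in> carrier T"
    have "(- 1) \<odot>\<^bsub>T\<^esub> x \<oplus>\<^bsub>T\<^esub> x = \<zero>\<^bsub>T\<^esub>"
      by (rule inj) (use x in \<open>auto simp: cl hom L.M.l_neg simp flip: L.a_inv_eq_smult\<close>)
    then show "\<exists>y\<in>carrier T. y \<oplus>\<^bsub>T\<^esub> x = \<zero>\<^bsub>T\<^esub>"
      using cl(2)[OF x] by blast
  qed (auto intro!: inj simp: cl hom L.M.a_ac)
  then have "Module.module complex_field T"
    by (rule moduleI[OF cring_complex_field])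
      (auto intro!: inj simp: cl hom L.smult_r_distr L.smult_l_distr[simplified] L.smult_assoc1[simplified])
  then have T: "complex_inner_product_space T"
  proof (rule complex_inner_product_space.intro)
    show "complex_inner_product_space_axioms T"
    proof
      fix x y assume "x \<in> carrier T" "y \<in> carrier T"
      then show "cinner T x y = cnj (cinner T y x)"
        using L.cinner_commute[of "\<Phi> x" "\<Phi> y"] by (simp add: inner)
    next
      fix x assume x: "x \<in> carrier T" "x \<noteq> \<zero>\<^bsub>T\<^esub>"
      then have "\<Phi> x \<noteq> \<zero>\<^bsub>L\<^esub>"
        using inj[of x "\<zero>\<^bsub>T\<^esub>"] cl(3) hom(3) by auto
      then show "0 < Re (cinner T x x)"
        using x by (simp add: inner L.cinner_pos)
    qed (auto simp: inner cl hom L.cinner_simps)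
  qed
  interpret T: complex_inner_product_space T by fact
  have diff: "hnorm T (x \<ominus>\<^bsub>T\<^esub> y) = hnorm L (\<Phi> x \<ominus>\<^bsub>L\<^esub> \<Phi> y)" if "x \<in> carrier T" "y \<in> carrier T" for x y
    using that by (simp add: hnorm_def inner T.a_minus_eq_smult L.a_minus_eq_smult hom cl)
  have "T.mcomplete"
  proof (rule T.mcompleteI)
    fix s :: "nat \<Rightarrow> _"
    assume s: "\<And>n. s n \<in> carrier T" "\<And>e. e > 0 \<Longrightarrow> \<exists>N. \<forall>m\<ge>N. \<forall>n\<ge>N. hnorm T (s m \<ominus>\<^bsub>T\<^esub> s n) < e"
    have "\<exists>z\<in>carrier L. (\<lambda>n. hnorm L (\<Phi> (s n) \<ominus>\<^bsub>L\<^esub> z)) \<longlonglongrightarrow> 0"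
      by (rule L.complete_seq) (use s in \<open>simp_all add: diff\<close>)
    then obtain z where "z \<in> carrier L" "(\<lambda>n. hnorm L (\<Phi> (s n) \<ominus>\<^bsub>L\<^esub> z)) \<longlonglongrightarrow> 0"
      by blast
    moreover have "z \<in> \<Phi> ` carrier T"
      using bij \<open>z \<in> carrier L\<close> by (simp add: bij_betw_def)
    then obtain x where "x \<in> carrier T" "\<Phi> x = z"
      by blast
    ultimately show "\<exists>x\<in>carrier T. (\<lambda>n. hnorm T (s n \<ominus>\<^bsub>T\<^esub> x)) \<longlonglongrightarrow> 0"
      using s(1) by (intro bexI[of _ x]) (simp_all add: diff)
  qed
  then show ?thesis
    by (intro hilbert_space.intro T hilbert_space_axioms.intro)
qed

text \<open>Unordered sums permit index sets of any cardinality, as bases of a nonseparable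
  \<open>K\<close> require. The value \<open>0\<close> off \<open>I\<close> makes equality of
  vectors the same as equality of functions.\<close>

definition l2 :: "'i set \<Rightarrow> ('i \<Rightarrow> complex) hilbert" where
  "l2 I = \<lparr>carrier = {c. (\<forall>i. i \<notin> I \<longrightarrow> c i = 0) \<and> (\<lambda>i. (cmod (c i))\<^sup>2) summable_on I},
     monoid.mult = undefined, one = undefined,
     zero = (\<lambda>i. 0), add = (\<lambda>c d i. c i + d i),
     smult = (\<lambda>a c i. a * c i),
     cinner = (\<lambda>c d. \<Sum>\<^sub>\<infinity>i\<in>I. c i * cnj (d i))\<rparr>"

lemma l2_sel [simp]:
  "\<zero>\<^bsub>l2 I\<^esub> = (\<lambda>i. 0)" "c \<oplus>\<^bsub>l2 I\<^esub> d = (\<lambda>i. c i + d i)" "a \<odot>\<^bsub>l2 I\<^esub> c = (\<lambda>i. a * c i)"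
  "cinner (l2 I) c d = (\<Sum>\<^sub>\<infinity>i\<in>I. c i * cnj (d i))"
  by (simp_all add: l2_def)

lemma in_l2_iff: "c \<in> carrier (l2 I) \<longleftrightarrow> (\<forall>i. i \<notin> I \<longrightarrow> c i = 0) \<and> (\<lambda>i. (cmod (c i))\<^sup>2) summable_on I"
  by (simp add: l2_def)

lemma l2_mult_summable:
  assumes "c \<in> carrier (l2 I)" "d \<in> carrier (l2 I)"
  shows "(\<lambda>i. c i * cnj (d i)) summable_on I"
proof -
  have "(\<lambda>i. norm (c i * cnj (d i))) summable_on I"
    by (rule abs_summable_product) (use assms in \<open>simp_all add: in_l2_iff norm_mult power2_eq_square\<close>)
  then show ?thesis
    by (rule abs_summable_summable)
qed

lemma l2_add_closed:
  assumes "c \<in> carrier (l2 I)" "d \<in> carrier (l2 I)"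
  shows "(\<lambda>i. c i + d i) \<in> carrier (l2 I)"
proof -
  have le: "(cmod (c i + d i))\<^sup>2 \<le> 2 * (cmod (c i))\<^sup>2 + 2 * (cmod (d i))\<^sup>2" for i
  proof -
    have "(cmod (c i + d i))\<^sup>2 \<le> (cmod (c i) + cmod (d i))\<^sup>2"
      by (intro power_mono norm_triangle_ineq) auto
    also have "\<dots> \<le> 2 * (cmod (c i))\<^sup>2 + 2 * (cmod (d i))\<^sup>2"
      using zero_le_power2[of "cmod (c i) - cmod (d i)"] by (simp add: power2_sum power2_diff)
    finally show ?thesis .
  qed
  have "(\<lambda>i. 2 * (cmod (c i))\<^sup>2 + 2 * (cmod (d i))\<^sup>2) summable_on I"
    using assms by (intro summable_on_add summable_on_cmult_right) (auto simp: in_l2_iff)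
  then have "(\<lambda>i. (cmod (c i + d i))\<^sup>2) summable_on I"
    by (rule summable_on_comparison_test) (use le in auto)
  then show ?thesis
    using assms by (simp add: in_l2_iff)
qed

lemma l2_smult_closed: "c \<in> carrier (l2 I) \<Longrightarrow> (\<lambda>i. a * c i) \<in> carrier (l2 I)"
  by (simp add: in_l2_iff norm_mult power_mult_distrib summable_on_cmult_right)

lemma l2_has_sum:
  assumes "c \<in> carrier (l2 I)"
  shows "((\<lambda>i. (cmod (c i))\<^sup>2) has_sum (hnorm (l2 I) c)\<^sup>2) I"
proof -
  define s where "s = (\<Sum>\<^sub>\<infinity>i\<in>I. (cmod (c i))\<^sup>2)"
  have s: "((\<lambda>i. (cmod (c i))\<^sup>2) has_sum s) I"
    using assms by (simp add: in_l2_iff s_def)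
  have "s \<ge> 0"
    unfolding s_def by (rule infsum_nonneg) simp
  have "((\<lambda>i. c i * cnj (c i)) has_sum complex_of_real s) I"
    using has_sum_of_real[OF s, where 'a = complex] by (simp only: complex_norm_square)
  then have "cinner (l2 I) c c = complex_of_real s"
    by (simp add: infsumI)
  then have "(hnorm (l2 I) c)\<^sup>2 = s"
    using \<open>s \<ge> 0\<close> by (simp add: hnorm_def del: l2_sel)
  then show ?thesis using s by simp
qed

lemma complex_inner_product_space_l2: "complex_inner_product_space (l2 I)"
proof (rule complex_inner_product_space.intro)
  have "abelian_group (l2 I)"
  proof (rule abelian_groupI)
    fix c assume "c \<in> carrier (l2 I)"
    then show "\<exists>d\<in>carrier (l2 I). d \<oplus>\<^bsub>l2 I\<^esub> c = \<zero>\<^bsub>l2 I\<^esub>"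
      using l2_smult_closed[of c I "- 1"] by (intro bexI[of _ "\<lambda>i. - 1 * c i"]) auto
  qed (auto simp: l2_add_closed in_l2_iff[of "\<lambda>i. 0"] add_ac)
  then show "Module.module complex_field (l2 I)"
    by (rule moduleI[OF cring_complex_field]) (auto simp: l2_smult_closed algebra_simps)
  show "complex_inner_product_space_axioms (l2 I)"
  proof
    fix x y z a assume xyz: "x \<in> carrier (l2 I)" "y \<in> carrier (l2 I)" "z \<in> carrier (l2 I)"
    show "cinner (l2 I) (x \<oplus>\<^bsub>l2 I\<^esub> y) z = cinner (l2 I) x z + cinner (l2 I) y z"
      using xyz by (simp add: distrib_right infsum_add l2_mult_summable)
  next
    fix x y a assume xy: "x \<in> carrier (l2 I)" "y \<in> carrier (l2 I)"
    show "cinner (l2 I) (a \<odot>\<^bsub>l2 I\<^esub> x) y = a * cinner (l2 I) x y"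
      using xy by (simp add: mult.assoc infsum_cmult_right l2_mult_summable)
    show "cinner (l2 I) x y = cnj (cinner (l2 I) y x)"
      by (simp flip: infsum_cnj add: mult.commute)
  next
    fix x assume x: "x \<in> carrier (l2 I)" "x \<noteq> \<zero>\<^bsub>l2 I\<^esub>"
    then obtain i where i: "i \<in> I" "x i \<noteq> 0"
      by (auto simp: in_l2_iff fun_eq_iff)
    have le: "(\<Sum>j\<in>{i}. (cmod (x j))\<^sup>2) \<le> (hnorm (l2 I) x)\<^sup>2"
      using i(1) by (intro finite_sum_le_has_sum[OF l2_has_sum[OF x(1)]]) auto
    have "(cmod (x i))\<^sup>2 > 0"
      using i(2) by simp
    then have pos: "0 < (hnorm (l2 I) x)\<^sup>2"
      by (rule less_le_trans) (use le in simp)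
    show "0 < Re (cinner (l2 I) x x)"
    proof -
      have "Re (cinner (l2 I) x x) = (\<Sum>\<^sub>\<infinity>i\<in>I. (cmod (x i))\<^sup>2)"
        using infsum_Re[OF l2_mult_summable[OF x(1) x(1)]] by (simp flip: complex_norm_square)
      also have "\<dots> = (hnorm (l2 I) x)\<^sup>2"
        by (rule infsumI[OF l2_has_sum[OF x(1)]])
      finally show ?thesis using pos by simp
    qed
  qed
qed

lemma hilbert_space_l2: "hilbert_space (l2 I)"
proof -
  interpret complex_inner_product_space "l2 I"
    by (rule complex_inner_product_space_l2)
  have minus: "c \<ominus>\<^bsub>l2 I\<^esub> d = (\<lambda>i. c i - d i)" if "c \<in> carrier (l2 I)" "d \<in> carrier (l2 I)" for c d
    using that by (simp add: a_minus_eq_smult)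
  have fin: "(\<Sum>i\<in>G. (cmod (c i))\<^sup>2) \<le> (hnorm (l2 I) c)\<^sup>2"
    if "c \<in> carrier (l2 I)" "finite G" "G \<subseteq> I" for c G
    using that by (intro finite_sum_le_has_sum[OF l2_has_sum]) auto
  have mcomplete
  proof (rule mcompleteI)
    fix s :: "nat \<Rightarrow> 'a \<Rightarrow> complex"
    assume s: "\<And>n. s n \<in> carrier (l2 I)"
      and cauchy: "\<And>e. e > 0 \<Longrightarrow> \<exists>N. \<forall>m\<ge>N. \<forall>n\<ge>N. hnorm (l2 I) (s m \<ominus>\<^bsub>l2 I\<^esub> s n) < e"
    have sG: "(\<Sum>i\<in>G. (cmod (s m i - s n i))\<^sup>2) \<le> e\<^sup>2"
      if "finite G" "G \<subseteq> I" "hnorm (l2 I) (s m \<ominus>\<^bsub>l2 I\<^esub> s n) < e" for G m n e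
    proof -
      have "(\<Sum>i\<in>G. (cmod (s m i - s n i))\<^sup>2) \<le> (hnorm (l2 I) (s m \<ominus>\<^bsub>l2 I\<^esub> s n))\<^sup>2"
      proof -
        have "s m \<ominus>\<^bsub>l2 I\<^esub> s n \<in> carrier (l2 I)" using s by simp
        from fin[OF this that(1,2)] show ?thesis using s by (simp add: minus)
      qed
      also have "\<dots> \<le> e\<^sup>2"
        using that(3) hnorm_nonneg s by (intro power_mono) auto
      finally show ?thesis .
    qed
    have "\<exists>l. (\<lambda>n. s n i) \<longlonglongrightarrow> l" for i
    proof (cases "i \<in> I")
      case True
      have "Cauchy (\<lambda>n. s n i)"
      proof (rule CauchyI)
        fix e :: real assume e: "e > 0"
        then obtain N where N: "\<And>m n. m \<ge> N \<Longrightarrow> n \<ge> N \<Longrightarrow> hnorm (l2 I) (s m \<ominus>\<^bsub>l2 I\<^esub> s n) < e / 2"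
          using cauchy[of "e / 2"] by auto
        have "cmod (s m i - s n i) < e" if "m \<ge> N" "n \<ge> N" for m n
        proof -
          have "(cmod (s m i - s n i))\<^sup>2 \<le> (e / 2)\<^sup>2"
            using sG[of "{i}" m n "e / 2"] N[OF that] True by simp
          then have "cmod (s m i - s n i) \<le> e / 2"
            using e by (auto intro: power2_le_imp_le)
          then show ?thesis using e by simp
        qed
        then show "\<exists>M. \<forall>m\<ge>M. \<forall>n\<ge>M. cmod (s m i - s n i) < e" by blast
      qed
      then show ?thesis
        by (simp add: Cauchy_convergent_iff convergent_def)
    next
      case False
      then have "s n i = 0" for n
        using s by (auto simp: in_l2_iff)
      then show ?thesis by auto
    qed
    then obtain x where x: "\<And>i. (\<lambda>n. s n i) \<longlonglongrightarrow> x i"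
      by metis
    \<comment> \<open>For a fixed finite \<open>G\<close> the limit in \<open>n\<close> is
      coordinatewise; the bound does not depend on \<open>G\<close>, so it survives the passage to
      the full sum.\<close>
    have xG: "(\<Sum>i\<in>G. (cmod (s m i - x i))\<^sup>2) \<le> e\<^sup>2"
      if "finite G" "G \<subseteq> I" "\<And>n. n \<ge> N \<Longrightarrow> hnorm (l2 I) (s m \<ominus>\<^bsub>l2 I\<^esub> s n) < e" for G m N e
    proof (rule LIMSEQ_le_const2)
      show "(\<lambda>n. \<Sum>i\<in>G. (cmod (s m i - s n i))\<^sup>2) \<longlonglongrightarrow> (\<Sum>i\<in>G. (cmod (s m i - x i))\<^sup>2)"
        by (intro tendsto_intros x)
      show "\<exists>N. \<forall>n\<ge>N. (\<Sum>i\<in>G. (cmod (s m i - s n i))\<^sup>2) \<le> e\<^sup>2"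
        using sG[OF that(1,2) that(3)] by blast
    qed
    have x0: "x i = 0" if "i \<notin> I" for i
    proof -
      have "s n i = 0" for n using s that by (auto simp: in_l2_iff)
      then show ?thesis using LIMSEQ_unique[OF x[of i], of 0] by simp
    qed
    have mem: "(\<lambda>i. s m i - x i) \<in> carrier (l2 I) \<and> hnorm (l2 I) (\<lambda>i. s m i - x i) \<le> e"
      if N: "\<And>n. n \<ge> N \<Longrightarrow> hnorm (l2 I) (s m \<ominus>\<^bsub>l2 I\<^esub> s n) < e" and e: "e > 0" for m N e
    proof -
      have "(\<lambda>i. (cmod (s m i - x i))\<^sup>2) summable_on I"
        using xG[OF _ _ N] by (intro nonneg_bdd_above_summable_on bdd_aboveI[of _ "e\<^sup>2"]) auto
      then have m: "(\<lambda>i. s m i - x i) \<in> carrier (l2 I)"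
        using s[of m] x0 by (auto simp: in_l2_iff)
      have "(hnorm (l2 I) (\<lambda>i. s m i - x i))\<^sup>2 \<le> e\<^sup>2"
        by (rule has_sum_le_finite_sums[OF l2_has_sum[OF m]]) (use xG[OF _ _ N] in auto)
      then show ?thesis
        using m e by (auto intro: power2_le_imp_le)
    qed
    have xmem: "x \<in> carrier (l2 I)"
    proof -
      obtain N where N: "\<And>m n. m \<ge> N \<Longrightarrow> n \<ge> N \<Longrightarrow> hnorm (l2 I) (s m \<ominus>\<^bsub>l2 I\<^esub> s n) < 1"
        using cauchy[of 1] by auto
      have "(\<lambda>i. s N i - x i) \<in> carrier (l2 I)"
        using mem[of N N 1] N by auto
      from l2_add_closed[OF s[of N] l2_smult_closed[OF this, of "- 1"]] show ?thesis by simp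
    qed
    have "(\<lambda>n. hnorm (l2 I) (s n \<ominus>\<^bsub>l2 I\<^esub> x)) \<longlonglongrightarrow> 0"
    proof (rule LIMSEQ_I)
      fix e :: real assume e: "e > 0"
      then obtain N where N: "\<And>m n. m \<ge> N \<Longrightarrow> n \<ge> N \<Longrightarrow> hnorm (l2 I) (s m \<ominus>\<^bsub>l2 I\<^esub> s n) < e / 2"
        using cauchy[of "e / 2"] by auto
      have "hnorm (l2 I) (s n \<ominus>\<^bsub>l2 I\<^esub> x) < e" if "n \<ge> N" for n
        using mem[of N n "e / 2"] N[OF that] e s xmem by (auto simp: minus)
      then show "\<exists>N. \<forall>n\<ge>N. norm (hnorm (l2 I) (s n \<ominus>\<^bsub>l2 I\<^esub> x) - 0) < e"
        using hnorm_nonneg s xmem by (intro exI[of _ N]) auto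
    qed
    then show "\<exists>x\<in>carrier (l2 I). (\<lambda>n. hnorm (l2 I) (s n \<ominus>\<^bsub>l2 I\<^esub> x)) \<longlonglongrightarrow> 0"
      using xmem by blast
  qed
  then show ?thesis
    by (intro hilbert_space.intro complex_inner_product_space_l2 hilbert_space_axioms.intro)
qed

text \<open>\<open>ell2\<close> is written with ordered series and \<open>l2 UNIV\<close> with
  unordered sums; the two agree on square-summable sequences, so the identity map transports the
  structure.\<close>

lemma hilbert_space_ell2: "hilbert_space ell2"
proof (rule hilbert_space_iso[OF hilbert_space_l2[of UNIV], of "\<lambda>x. x"])
  have car: "carrier ell2 = carrier (l2 UNIV)"
    by (auto simp: ell2_def in_l2_iff summable_on_UNIV_nonneg_real_iff)
  show "bij_betw (\<lambda>x. x) (carrier ell2) (carrier (l2 UNIV))"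
    by (simp add: car bij_betw_def)
  fix x y :: "nat \<Rightarrow> complex" and c :: complex
  assume x: "x \<in> carrier ell2"
  show "c \<odot>\<^bsub>ell2\<^esub> x \<in> carrier ell2"
    using l2_smult_closed[of x UNIV c] x unfolding car by (simp add: ell2_def)
  assume y: "y \<in> carrier ell2"
  show "x \<oplus>\<^bsub>ell2\<^esub> y \<in> carrier ell2"
    using l2_add_closed[of x UNIV y] x y unfolding car by (simp add: ell2_def)
  have "((\<lambda>i. x i * cnj (y i)) has_sum cinner (l2 UNIV) x y) UNIV"
    using l2_mult_summable[of x UNIV y] x y by (simp add: car)
  from has_sum_imp_sums[OF this] show "cinner ell2 x y = cinner (l2 UNIV) x y"
    by (simp add: ell2_def sums_iff del: l2_sel)
next
  show "\<zero>\<^bsub>ell2\<^esub> \<in> carrier ell2"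
    by (simp add: ell2_def)
qed (simp_all add: ell2_def)

text \<open>Meant for an injection \<open>f\<close> with left inverse \<open>g\<close>; its use is
  to place a copy of \<open>ell2\<close> in the sum type over which complete singularity
  ranges.\<close>

definition copy_hilbert :: "('a \<Rightarrow> 'b) \<Rightarrow> ('b \<Rightarrow> 'a) \<Rightarrow> 'a hilbert \<Rightarrow> 'b hilbert" where
  "copy_hilbert f g H = \<lparr>carrier = f ` carrier H, monoid.mult = undefined, one = undefined,
     zero = f \<zero>\<^bsub>H\<^esub>, add = (\<lambda>x y. f (g x \<oplus>\<^bsub>H\<^esub> g y)), smult = (\<lambda>c x. f (c \<odot>\<^bsub>H\<^esub> g x)),
     cinner = (\<lambda>x y. cinner H (g x) (g y))\<rparr>"

lemma hilbert_space_copy: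
  assumes "hilbert_space H" and gf: "\<And>x. g (f x) = x"
  shows "hilbert_space (copy_hilbert f g H)"
proof -
  interpret hilbert_space H by fact
  show ?thesis
    by (rule hilbert_space_iso[OF assms(1), of g])
      (auto simp: copy_hilbert_def gf intro!: bij_betwI[where g = f])
qed

definition orthonormal :: "'a hilbert \<Rightarrow> 'a set \<Rightarrow> bool" where
  "orthonormal H E \<longleftrightarrow> E \<subseteq> carrier H \<and> (\<forall>e\<in>E. \<forall>f\<in>E. cinner H e f = (if e = f then 1 else 0))"

definition onb_coeff :: "'a hilbert \<Rightarrow> 'a set \<Rightarrow> 'a \<Rightarrow> 'a \<Rightarrow> complex" where
  "onb_coeff H E x = (\<lambda>e. if e \<in> E then cinner H x e else 0)"

lemma orthonormal_basis_iff:
  "orthonormal_basis H E \<longleftrightarrow> orthonormal H E \<and> (\<forall>x\<in>carrier H. (\<forall>e\<in>E. cinner H x e = 0) \<longrightarrow> x = \<zero>\<^bsub>H\<^esub>)"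
  by (auto simp: orthonormal_basis_def orthonormal_def)

section \<open>Bessel, Riesz-Fischer, Parseval and orthonormal bases\<close>

context hilbert_space
begin

text \<open>Removing the component along one vector of \<open>G\<close> lowers the squared norm by
  the squared modulus of its coefficient and leaves the coefficients along the other vectors
  unchanged.\<close>

lemma bessel_finite:
  assumes "finite G" "orthonormal H G" "x \<in> carrier H"
  shows "(\<Sum>e\<in>G. (cmod (cinner H x e))\<^sup>2) \<le> (hnorm H x)\<^sup>2"
  using assms
proof (induction G arbitrary: x rule: finite_induct)
  case empty
  then show ?case by simp
next
  case (insert e G)
  have e: "e \<in> carrier H" "cinner H e e = 1"
    and G: "\<And>g. g \<in> G \<Longrightarrow> g \<in> carrier H \<and> cinner H e g = 0" "orthonormal H G"
    using insert by (auto simp: orthonormal_def)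
  define a where "a = cinner H x e"
  define x' where "x' = x \<ominus> a \<odot> e"
  have x': "x' \<in> carrier H"
    using e insert by (simp add: x'_def)
  have ex: "cinner H e x = cnj a"
    using cinner_commute[of e x] e insert by (simp add: a_def)
  have aa: "a * cnj a = complex_of_real ((cmod a)\<^sup>2)"
    by (rule complex_norm_square[symmetric])
  have "cinner H x' x' = cinner H x x - a * cnj a"
    using e insert ex by (simp add: x'_def cinner_simps a_def[symmetric])
  then have "(hnorm H x')\<^sup>2 = (hnorm H x)\<^sup>2 - (cmod a)\<^sup>2"
    using x' insert.prems by (simp add: hnorm_power2 aa)
  moreover have "cinner H x' g = cinner H x g" if "g \<in> G" for g
    using e G(1)[OF that] insert by (simp add: x'_def cinner_simps)
  ultimately show ?case
    using insert.IH[OF G(2) x'] insert.hyps by (simp add: a_def)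
qed

lemma onb_coeff_l2:
  assumes E: "orthonormal H E" and x: "x \<in> carrier H"
  shows "onb_coeff H E x \<in> carrier (l2 E)" "hnorm (l2 E) (onb_coeff H E x) \<le> hnorm H x"
proof -
  have b: "(\<Sum>e\<in>G. (cmod (onb_coeff H E x e))\<^sup>2) \<le> (hnorm H x)\<^sup>2" if "finite G" "G \<subseteq> E" for G
  proof -
    have "orthonormal H G"
      using E that by (auto simp: orthonormal_def subset_eq)
    moreover have "(\<Sum>e\<in>G. (cmod (onb_coeff H E x e))\<^sup>2) = (\<Sum>e\<in>G. (cmod (cinner H x e))\<^sup>2)"
      using that by (intro sum.cong) (auto simp: onb_coeff_def)
    ultimately show ?thesis
      using bessel_finite[OF that(1) _ x] by simp
  qed
  have "(\<lambda>e. (cmod (onb_coeff H E x e))\<^sup>2) summable_on E"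
    using b by (intro nonneg_bdd_above_summable_on bdd_aboveI[of _ "(hnorm H x)\<^sup>2"]) auto
  then show m: "onb_coeff H E x \<in> carrier (l2 E)"
    by (simp add: in_l2_iff) (simp add: onb_coeff_def)
  have "(hnorm (l2 E) (onb_coeff H E x))\<^sup>2 \<le> (hnorm H x)\<^sup>2"
    by (rule has_sum_le_finite_sums[OF l2_has_sum[OF m]]) (use b in auto)
  then show "hnorm (l2 E) (onb_coeff H E x) \<le> hnorm H x"
    using hnorm_nonneg[OF x] by (rule power2_le_imp_le)
qed

text \<open>The vector is obtained not as the sum of a series but as the representative of the
  functional that pairs the coefficients of \<open>x\<close> with \<open>c\<close>, which is bounded
  by Bessel.\<close>

lemma riesz_fischer:
  assumes E: "orthonormal H E" and c: "c \<in> carrier (l2 E)"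
  shows "\<exists>y\<in>carrier H. (\<forall>e\<in>E. cinner H y e = c e)
    \<and> (\<forall>x\<in>carrier H. cinner H x y = cinner (l2 E) (onb_coeff H E x) c)"
proof -
  interpret L: hilbert_space "l2 E" by (rule hilbert_space_l2)
  note co = onb_coeff_l2[OF E]
  have Ec: "e \<in> carrier H" if "e \<in> E" for e using E that by (auto simp: orthonormal_def)
  have "\<exists>y\<in>carrier H. \<forall>x\<in>carrier H. cinner (l2 E) (onb_coeff H E x) c = cinner H x y"
  proof (rule riesz[where C = "hnorm (l2 E) c"])
    fix x y assume xy: "x \<in> carrier H" "y \<in> carrier H"
    have "onb_coeff H E (x \<oplus> y) = onb_coeff H E x \<oplus>\<^bsub>l2 E\<^esub> onb_coeff H E y"
      using xy by (auto simp: onb_coeff_def cinner_simps Ec)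
    then show "cinner (l2 E) (onb_coeff H E (x \<oplus> y)) c
        = cinner (l2 E) (onb_coeff H E x) c + cinner (l2 E) (onb_coeff H E y) c"
      using L.cinner_add_left[OF co(1)[OF xy(1)] co(1)[OF xy(2)] c] by simp
  next
    fix a x assume x: "x \<in> carrier H"
    have "onb_coeff H E (a \<odot> x) = a \<odot>\<^bsub>l2 E\<^esub> onb_coeff H E x"
      using x by (auto simp: onb_coeff_def cinner_simps Ec)
    then show "cinner (l2 E) (onb_coeff H E (a \<odot> x)) c = a * cinner (l2 E) (onb_coeff H E x) c"
      using L.cinner_smult_left[OF co(1)[OF x] c, of a] by simp
  next
    fix x assume x: "x \<in> carrier H"
    have "cmod (cinner (l2 E) (onb_coeff H E x) c) \<le> hnorm (l2 E) (onb_coeff H E x) * hnorm (l2 E) c"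
      using L.Cauchy_Schwarz[OF co(1)[OF x] c] .
    also have "\<dots> \<le> hnorm (l2 E) c * hnorm H x"
      using mult_right_mono[OF co(2)[OF x] L.hnorm_nonneg[OF c]] by (simp only: mult.commute)
    finally show "cmod (cinner (l2 E) (onb_coeff H E x) c) \<le> hnorm (l2 E) c * hnorm H x" .
  qed
  then obtain y where y: "y \<in> carrier H" "\<And>x. x \<in> carrier H \<Longrightarrow> cinner (l2 E) (onb_coeff H E x) c = cinner H x y"
    by blast
  have "cinner H y e = c e" if e: "e \<in> E" for e
  proof -
    have "cinner H e y = (\<Sum>\<^sub>\<infinity>i\<in>E. onb_coeff H E e i * cnj (c i))"
      using y(2)[OF Ec[OF e]] by simp
    also have "\<dots> = (\<Sum>\<^sub>\<infinity>i\<in>{e}. cnj (c e))"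
      by (rule infsum_cong_neutral) (use e E in \<open>auto simp: onb_coeff_def orthonormal_def\<close>)
    finally have "cinner H e y = cnj (c e)" by simp
    then show ?thesis
      using cinner_commute[of y e] y(1) Ec[OF e] by simp
  qed
  then show ?thesis
    using y by (intro bexI[of _ y]) auto
qed

text \<open>Riesz-Fischer applied to the coefficients of \<open>y\<close> returns a vector with
  these same coefficients, which totality of the basis identifies with \<open>y\<close>.\<close>

lemma parseval:
  assumes E: "orthonormal_basis H E" and x: "x \<in> carrier H" and y: "y \<in> carrier H"
  shows "cinner H x y = cinner (l2 E) (onb_coeff H E x) (onb_coeff H E y)"
proof -
  have E': "orthonormal H E" using E by (simp add: orthonormal_basis_iff)
  then have Ec: "e \<in> carrier H" if "e \<in> E" for e using that by (auto simp: orthonormal_def)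
  obtain z where z: "z \<in> carrier H" "\<And>e. e \<in> E \<Longrightarrow> cinner H z e = onb_coeff H E y e"
    "\<And>x. x \<in> carrier H \<Longrightarrow> cinner H x z = cinner (l2 E) (onb_coeff H E x) (onb_coeff H E y)"
    using riesz_fischer[OF E' onb_coeff_l2(1)[OF E' y]] by blast
  have "cinner H (z \<ominus> y) e = 0" if "e \<in> E" for e
    using z(1,2) y Ec that by (simp add: cinner_simps onb_coeff_def)
  then have "z \<ominus> y = \<zero>"
    using E z(1) y by (simp add: orthonormal_basis_iff)
  then have "z = y"
    using z(1) y minus_eq_zero_iff by blast
  then show ?thesis using z(3)[OF x] by simp
qed

lemma parseval_norm:
  assumes E: "orthonormal_basis H E" and x: "x \<in> carrier H"
  shows "((\<lambda>e. (cmod (cinner H x e))\<^sup>2) has_sum (hnorm H x)\<^sup>2) E"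
proof -
  have E': "orthonormal H E" using E by (simp add: orthonormal_basis_iff)
  have "hnorm (l2 E) (onb_coeff H E x) = hnorm H x"
    using parseval[OF E x x] by (simp add: hnorm_def)
  then have "((\<lambda>e. (cmod (onb_coeff H E x e))\<^sup>2) has_sum (hnorm H x)\<^sup>2) E"
    using l2_has_sum[OF onb_coeff_l2(1)[OF E' x]] by simp
  then show ?thesis
    by (rule has_sum_cong[THEN iffD1, rotated]) (simp add: onb_coeff_def)
qed

text \<open>A maximal orthonormal set is total, since a nonzero vector orthogonal to it could be
  normalised and added. This existence gives the choice in \<open>some_onb\<close> its
  meaning.\<close>

lemma some_onb: "orthonormal_basis H (some_onb H)"
proof -
  have "\<exists>M\<in>{E. orthonormal H E}. \<forall>X\<in>{E. orthonormal H E}. M \<subseteq> X \<longrightarrow> X = M"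
  proof (rule subset_Zorn_nonempty)
    show "{E. orthonormal H E} \<noteq> {}"
      by (auto simp: orthonormal_def intro: exI[of _ "{}"])
    fix C assume "C \<noteq> {}" and C: "subset.chain {E. orthonormal H E} C"
    have on: "orthonormal H E" if "E \<in> C" for E
      using C that by (auto simp: subset_chain_def)
    have common: "\<exists>E\<in>C. e \<in> E \<and> f \<in> E" if ef: "e \<in> \<Union> C" "f \<in> \<Union> C" for e f
    proof -
      obtain E E' where "E \<in> C" "e \<in> E" "E' \<in> C" "f \<in> E'"
        using ef by blast
      moreover from this have "E \<subseteq> E' \<or> E' \<subseteq> E"
        using C by (simp add: subset_chain_def)
      ultimately show ?thesis by blast
    qed
    have "orthonormal H (\<Union> C)"
      unfolding orthonormal_def
    proof (intro conjI ballI)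
      show "\<Union> C \<subseteq> carrier H"
        using on by (auto simp: orthonormal_def)
      fix e f assume "e \<in> \<Union> C" "f \<in> \<Union> C"
      then obtain E where "E \<in> C" "e \<in> E" "f \<in> E"
        using common by blast
      then show "cinner H e f = (if e = f then 1 else 0)"
        using on[of E] by (simp add: orthonormal_def)
    qed
    then show "\<Union> C \<in> {E. orthonormal H E}" by simp
  qed
  then obtain M where M: "orthonormal H M" "\<And>X. orthonormal H X \<Longrightarrow> M \<subseteq> X \<Longrightarrow> X = M"
    by blast
  have "x = \<zero>" if x: "x \<in> carrier H" "\<forall>e\<in>M. cinner H x e = 0" for x
  proof (rule ccontr)
    assume "x \<noteq> \<zero>"
    then have n: "hnorm H x > 0"
      using hnorm_nonneg[OF x(1)] hnorm_eq_0[OF x(1)] by simp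
    define e where "e = complex_of_real (1 / hnorm H x) \<odot> x"
    have e: "e \<in> carrier H" "\<And>f. f \<in> M \<Longrightarrow> cinner H e f = 0"
      using x M(1) by (auto simp: e_def cinner_simps orthonormal_def subset_eq)
    have ee: "cinner H e e = 1"
    proof -
      have "hnorm H e = 1"
        using x(1) n by (simp add: e_def hnorm_smult norm_divide)
      then show ?thesis using cinner_self_real[OF e(1)] by simp
    qed
    have e': "cinner H f e = 0" if "f \<in> M" for f
      using e that M(1) cinner_commute[of f e] by (auto simp: orthonormal_def)
    have "e \<notin> M"
      using e(2)[of e] ee by auto
    have "orthonormal H (insert e M)"
      using M(1) e ee e' unfolding orthonormal_def by auto
    from M(2)[OF this] \<open>e \<notin> M\<close> show False by auto
  qed
  then have "orthonormal_basis H M"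
    using M(1) by (simp add: orthonormal_basis_iff)
  then show ?thesis
    unfolding some_onb_def by (rule someI)
qed

text \<open>Double counting of the squared moduli of the inner products between the two families: by
  Parseval each vector of \<open>D'\<close> contributes exactly one, by Bessel each vector of
  \<open>F\<close> at most one.\<close>

lemma infinite_onb:
  assumes D: "orthonormal H D" "infinite D" and F: "orthonormal_basis H F"
  shows "infinite F"
proof
  assume fin: "finite F"
  have F': "orthonormal H F" using F by (simp add: orthonormal_basis_iff)
  obtain D' where D': "D' \<subseteq> D" "finite D'" "card D' = Suc (card F)"
    using infinite_arbitrarily_large[OF D(2)] by blast
  have oD': "orthonormal H D'"
    using D(1) D'(1) by (auto simp: orthonormal_def subset_eq)
  have 1: "(hnorm H e)\<^sup>2 = 1" if "orthonormal H E" "e \<in> E" for e E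
    using that by (auto simp: orthonormal_def hnorm_power2 subset_eq)
  have "real (card D') = (\<Sum>d\<in>D'. (hnorm H d)\<^sup>2)"
    using 1[OF oD'] by simp
  also have "\<dots> = (\<Sum>d\<in>D'. \<Sum>f\<in>F. (cmod (cinner H d f))\<^sup>2)"
    using parseval_norm[OF F] oD' fin
    by (intro sum.cong refl) (auto simp: orthonormal_def subset_eq has_sum_finite_iff)
  also have "\<dots> = (\<Sum>f\<in>F. \<Sum>d\<in>D'. (cmod (cinner H d f))\<^sup>2)"
    by (rule sum.swap)
  also have "\<dots> = (\<Sum>f\<in>F. \<Sum>d\<in>D'. (cmod (cinner H f d))\<^sup>2)"
  proof (intro sum.cong refl)
    fix f d assume "f \<in> F" "d \<in> D'"
    then have "cinner H d f = cnj (cinner H f d)"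
      using oD' F' by (intro cinner_commute) (auto simp: orthonormal_def)
    then show "(cmod (cinner H d f))\<^sup>2 = (cmod (cinner H f d))\<^sup>2" by simp
  qed
  also have "\<dots> \<le> (\<Sum>f\<in>F. (hnorm H f)\<^sup>2)"
    using bessel_finite[OF D'(2) oD'] F' by (intro sum_mono) (auto simp: orthonormal_def)
  also have "\<dots> = real (card F)"
    using 1[OF F'] by simp
  finally show False
    using D'(3) by simp
qed

end

text \<open>\<open>some_onb\<close> is an unspecified basis, so its infinitude is inferred from the
  infinite orthonormal family of unit sequences.\<close>

lemma infinite_some_onb_ell2: "infinite (some_onb ell2)"
  and infinite_some_onb_copy_ell2: "\<And>f g. (\<And>x. g (f x) = x) \<Longrightarrow> infinite (some_onb (copy_hilbert f g ell2))"
proof -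
  define d :: "nat \<Rightarrow> nat \<Rightarrow> complex" where "d n = (\<lambda>i. if i = n then 1 else 0)" for n
  have inj: "inj d"
    by (auto simp: inj_def d_def fun_eq_iff split: if_splits)
  have on: "d n \<in> carrier ell2" "cinner ell2 (d n) (d m) = (if d n = d m then 1 else 0)" for n m
  proof -
    have "(\<lambda>i. (cmod (d n i))\<^sup>2) sums (cmod (d n n))\<^sup>2"
      using sums_single[of n "\<lambda>i. (cmod (d n i))\<^sup>2"] by (rule sums_cong[THEN iffD1, rotated]) (simp add: d_def)
    then show "d n \<in> carrier ell2"
      by (simp add: ell2_def sums_iff)
    have "(\<lambda>i. d n i * cnj (d m i)) sums (d n n * cnj (d m n))"
      using sums_single[of n "\<lambda>i. d n i * cnj (d m i)"] by (rule sums_cong[THEN iffD1, rotated]) (simp add: d_def)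
    then have "cinner ell2 (d n) (d m) = d n n * cnj (d m n)"
      by (simp add: ell2_def sums_iff)
    also have "\<dots> = (if n = m then 1 else 0)"
      by (simp add: d_def)
    finally show "cinner ell2 (d n) (d m) = (if d n = d m then 1 else 0)"
      by (simp add: inj_eq[OF inj])
  qed
  show "infinite (some_onb ell2)"
    by (rule hilbert_space.infinite_onb[OF hilbert_space_ell2 _ _ hilbert_space.some_onb[OF hilbert_space_ell2],
          where D = "range d"]) (use on inj in \<open>auto simp: orthonormal_def range_inj_infinite\<close>)
  fix f g assume gf: "\<And>x. g (f x) = (x :: nat \<Rightarrow> complex)"
  note cp = hilbert_space_copy[OF hilbert_space_ell2 gf]
  have "f a = f b \<longleftrightarrow> a = b" for a b using gf by metis
  then have "inj (\<lambda>n. f (d n))" using inj by (auto simp: inj_def)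
  moreover have "orthonormal (copy_hilbert f g ell2) (range (\<lambda>n. f (d n)))"
    using on \<open>\<And>a b. f a = f b \<longleftrightarrow> a = b\<close> by (auto simp: orthonormal_def copy_hilbert_def gf)
  ultimately show "infinite (some_onb (copy_hilbert f g ell2))"
    using hilbert_space.infinite_onb[OF cp _ _ hilbert_space.some_onb[OF cp]] range_inj_infinite by blast
qed

section \<open>Amplifications and the double commutant theorem\<close>

context hilbert_space
begin

lemma orth_diff: "S \<subseteq> carrier H \<Longrightarrow> x \<in> orth H S \<Longrightarrow> y \<in> orth H S \<Longrightarrow> x \<ominus> y \<in> orth H S"
  using orth_add[of S x "(- 1) \<odot> y"] orth_smult[of S y "- 1"] orth_subset[of H S]
  by (simp add: a_minus_eq_smult subset_eq)

lemma orth_orth_inter: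
  assumes "x \<in> orth H S" "x \<in> orth H (orth H S)"
  shows "x = \<zero>"
  using orthD[OF assms(2,1)] assms(1) by (simp add: orth_def cinner_eq_0_iff_self)

lemma projection_ex:
  assumes S: "S \<subseteq> carrier H"
  shows "\<exists>E. selfadj H E \<and> (\<forall>x\<in>carrier H. E x \<in> orth H (orth H S) \<and> x \<ominus> E x \<in> orth H S)"
proof -
  have "\<exists>p. p \<in> orth H (orth H S) \<and> x \<ominus> p \<in> orth H S" if x: "x \<in> carrier H" for x
  proof -
    obtain p q where pq: "p \<in> orth H (orth H S)" "q \<in> orth H S" "x = p \<oplus> q"
      using orth_decomp[OF S x] by blast
    then have "p \<in> carrier H" "q \<in> carrier H"
      by (simp_all add: orth_def)
    then have "x \<ominus> p = q"
      unfolding pq(3) by (intro cinner_extl) (simp_all add: cinner_simps)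
    then show ?thesis using pq by blast
  qed
  then obtain p where p: "\<And>x. x \<in> carrier H \<Longrightarrow> p x \<in> orth H (orth H S)"
    "\<And>x. x \<in> carrier H \<Longrightarrow> x \<ominus> p x \<in> orth H S"
    by metis
  have pc[simp]: "p x \<in> carrier H" if "x \<in> carrier H" for x
    using p(1)[OF that] by (simp add: orth_def)
  have pp: "cinner H (p x) y = cinner H (p x) (p y)" if "x \<in> carrier H" "y \<in> carrier H" for x y
    using orthD[OF p(1)[OF that(1)] p(2)[OF that(2)]] that by (simp add: cinner_simps)
  have pp': "cinner H (p x) y = cinner H x (p y)" if "x \<in> carrier H" "y \<in> carrier H" for x y
    using pp[OF that] pp[OF that(2,1)] that cinner_commute[of x "p y"] cinner_commute[of "p x" "p y"] by simp
  have "hnorm H (p x) \<le> 1 * hnorm H x" if x: "x \<in> carrier H" for x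
  proof (cases "hnorm H (p x) = 0")
    case False
    have "(hnorm H (p x))\<^sup>2 = Re (cinner H (p x) x)"
      using pp[OF x x] x by (simp add: hnorm_power2)
    also have "\<dots> \<le> hnorm H (p x) * hnorm H x"
      using Cauchy_Schwarz[OF pc[OF x] x] complex_Re_le_cmod order_trans by blast
    finally show ?thesis
      using False hnorm_nonneg[OF pc[OF x]] by (simp add: power2_eq_square)
  qed (use hnorm_nonneg[OF x] in simp)
  then have E: "(\<lambda>x\<in>carrier H. p x) \<in> bounded_ops H"
    using pp' by (intro bounded_opsI_adj[of p p 1]) auto
  show ?thesis
    by (intro exI[of _ "\<lambda>x\<in>carrier H. p x"] conjI selfadjI[OF E]) (use p pp' in auto)
qed

lemma projection_id:
  assumes "selfadj H E" "\<And>x. x \<in> carrier H \<Longrightarrow> E x \<in> orth H (orth H S)"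
    "\<And>x. x \<in> carrier H \<Longrightarrow> x \<ominus> E x \<in> orth H S" and x: "x \<in> orth H (orth H S)"
  shows "E x = x"
proof -
  have xc: "x \<in> carrier H" using x by (simp add: orth_def)
  have "x \<ominus> E x \<in> orth H (orth H S)"
    by (rule orth_diff[OF orth_subset x assms(2)[OF xc]])
  then have "x \<ominus> E x = \<zero>"
    using orth_orth_inter assms(3)[OF xc] by blast
  then show ?thesis
    using xc assms(1) minus_eq_zero_iff[of x "E x"] by simp
qed

lemma orth_invariant:
  assumes "A \<in> bounded_ops H" "S \<subseteq> carrier H" "\<And>s. s \<in> S \<Longrightarrow> op_adj H A s \<in> S" "x \<in> orth H S"
  shows "A x \<in> orth H S"
  using assms unfolding orth_def by (auto simp flip: cinner_adj)

text \<open>\<open>S\<close> is invariant under \<open>A\<close> and its adjoint, so the closed span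
  of \<open>S\<close> and its complement are both invariant under \<open>A\<close>; the difference
  \<open>E (A x) \<ominus> A (E x)\<close> lies in both and vanishes.\<close>

lemma projection_commute:
  assumes S: "S \<subseteq> carrier H" and E: "selfadj H E" "\<And>x. x \<in> carrier H \<Longrightarrow> E x \<in> orth H (orth H S)"
    "\<And>x. x \<in> carrier H \<Longrightarrow> x \<ominus> E x \<in> orth H S"
    and A: "A \<in> bounded_ops H" "\<And>s. s \<in> S \<Longrightarrow> A s \<in> S" "\<And>s. s \<in> S \<Longrightarrow> op_adj H A s \<in> S"
    and x: "x \<in> carrier H"
  shows "E (A x) = A (E x)"
proof -
  have inv: "A y \<in> orth H S" "op_adj H A y \<in> orth H S" if "y \<in> orth H S" for y
    using orth_invariant[OF A(1) S A(3) that] orth_invariant[OF adj_closed[OF A(1)] S _ that] A(1,2) by auto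
  have inv2: "A y \<in> orth H (orth H S)" if "y \<in> orth H (orth H S)" for y
    using orth_invariant[OF A(1) orth_subset inv(2) that] by auto
  have [simp]: "E \<in> bounded_ops H" using E(1) by simp
  have "E (A x) \<ominus> A (E x) \<in> orth H (orth H S)"
    by (rule orth_diff[OF orth_subset]) (use E(2) A(1) x inv2 in auto)
  moreover have "E (A x) \<ominus> A (E x) = A (x \<ominus> E x) \<ominus> (A x \<ominus> E (A x))"
    using A(1) x by (intro cinner_extl) (simp_all add: cinner_simps bounded_ops_diff)
  moreover have "A (x \<ominus> E x) \<ominus> (A x \<ominus> E (A x)) \<in> orth H S"
    by (rule orth_diff[OF S]) (use E(3) A(1) x inv in auto)
  ultimately have "E (A x) \<ominus> A (E x) = \<zero>"
    using orth_orth_inter by metis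
  then show ?thesis
    using minus_eq_zero_iff[of "E (A x)" "A (E x)"] A(1) x by simp
qed

text \<open>The sum is described by its matrix coefficients because that is the form in which weak
  limits of partial sums are tested.\<close>

lemma finite_op_sum:
  assumes A: "A \<subseteq> bounded_ops H" "op_one H \<in> A" "\<And>S T. S \<in> A \<Longrightarrow> T \<in> A \<Longrightarrow> op_add H S T \<in> A"
      "\<And>c S. S \<in> A \<Longrightarrow> op_smult H c S \<in> A"
    and P: "finite P" "\<And>p. p \<in> P \<Longrightarrow> Z p \<in> A"
  shows "\<exists>W\<in>A. \<forall>v\<in>carrier H. \<forall>w\<in>carrier H. cinner H (W v) w = (\<Sum>p\<in>P. cinner H (Z p v) w)"
  using P
proof (induction P rule: finite_induct)
  case empty
  show ?case
    using A(4)[OF A(2), of 0] by (intro bexI[of _ "op_smult H 0 (op_one H)"]) (auto simp: cinner_simps)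
next
  case (insert p P)
  then obtain W where W: "W \<in> A" "\<And>v w. v \<in> carrier H \<Longrightarrow> w \<in> carrier H \<Longrightarrow> cinner H (W v) w = (\<Sum>p\<in>P. cinner H (Z p v) w)"
    by auto
  have Zp: "Z p \<in> A" using insert.prems by simp
  have "op_add H (Z p) W \<in> A"
    using A(3) Zp W(1) by blast
  moreover have "cinner H (op_add H (Z p) W v) w = (\<Sum>p\<in>insert p P. cinner H (Z p v) w)"
    if "v \<in> carrier H" "w \<in> carrier H" for v w
    using that W Zp A(1) insert.hyps by (simp add: cinner_simps subset_eq)
  ultimately show ?case by blast
qed

end

text \<open>\<open>T\<close> is the Hilbert space sum of copies of \<open>H\<close> indexed by \<open>F\<close>, with inclusions \<open>J f\<close> and
  coordinate maps \<open>C f\<close>.\<close>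

locale amplification = H: hilbert_space H + T: hilbert_space T
  for H :: "'h hilbert" and T :: "'t hilbert" +
  fixes F :: "'f set" and J :: "'f \<Rightarrow> 'h \<Rightarrow> 't" and C :: "'f \<Rightarrow> 't \<Rightarrow> 'h"
  assumes J_closed [simp]: "f \<in> F \<Longrightarrow> x \<in> carrier H \<Longrightarrow> J f x \<in> carrier T"
    and C_closed [simp]: "f \<in> F \<Longrightarrow> w \<in> carrier T \<Longrightarrow> C f w \<in> carrier H"
    and J_C: "\<lbrakk>f \<in> F; x \<in> carrier H; w \<in> carrier T\<rbrakk> \<Longrightarrow> cinner T (J f x) w = cinner H x (C f w)"
    and C_J: "\<lbrakk>f \<in> F; g \<in> F; x \<in> carrier H\<rbrakk> \<Longrightarrow> C f (J g x) = (if f = g then x else \<zero>\<^bsub>H\<^esub>)"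
    and C_total: "\<lbrakk>w \<in> carrier T; \<And>f. f \<in> F \<Longrightarrow> C f w = \<zero>\<^bsub>H\<^esub>\<rbrakk> \<Longrightarrow> w = \<zero>\<^bsub>T\<^esub>"
begin

lemma C_J': "\<lbrakk>f \<in> F; x \<in> carrier H; w \<in> carrier T\<rbrakk> \<Longrightarrow> cinner T w (J f x) = cinner H (C f w) x"
  using J_C[of f x w] T.cinner_commute[of w "J f x"] H.cinner_commute[of "C f w" x] by simp

lemma J_add: "\<lbrakk>f \<in> F; x \<in> carrier H; y \<in> carrier H\<rbrakk> \<Longrightarrow> J f (x \<oplus>\<^bsub>H\<^esub> y) = J f x \<oplus>\<^bsub>T\<^esub> J f y"
  by (rule T.cinner_extl) (simp_all add: J_C H.cinner_simps T.cinner_simps)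

lemma J_smult: "\<lbrakk>f \<in> F; x \<in> carrier H\<rbrakk> \<Longrightarrow> J f (c \<odot>\<^bsub>H\<^esub> x) = c \<odot>\<^bsub>T\<^esub> J f x"
  by (rule T.cinner_extl) (simp_all add: J_C H.cinner_simps T.cinner_simps)

lemma C_add: "\<lbrakk>f \<in> F; v \<in> carrier T; w \<in> carrier T\<rbrakk> \<Longrightarrow> C f (v \<oplus>\<^bsub>T\<^esub> w) = C f v \<oplus>\<^bsub>H\<^esub> C f w"
  by (rule H.cinner_extr) (simp_all add: J_C[symmetric] H.cinner_simps T.cinner_simps)

lemma C_smult: "\<lbrakk>f \<in> F; w \<in> carrier T\<rbrakk> \<Longrightarrow> C f (c \<odot>\<^bsub>T\<^esub> w) = c \<odot>\<^bsub>H\<^esub> C f w"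
  by (rule H.cinner_extr) (simp_all add: J_C[symmetric] H.cinner_simps T.cinner_simps)

lemma C_diff: "\<lbrakk>f \<in> F; v \<in> carrier T; w \<in> carrier T\<rbrakk> \<Longrightarrow> C f (v \<ominus>\<^bsub>T\<^esub> w) = C f v \<ominus>\<^bsub>H\<^esub> C f w"
  by (simp add: T.a_minus_eq_smult H.a_minus_eq_smult C_add C_smult)

lemma hnorm_J: "\<lbrakk>f \<in> F; x \<in> carrier H\<rbrakk> \<Longrightarrow> hnorm T (J f x) = hnorm H x"
  by (simp add: hnorm_def J_C C_J)

lemma C_ext:
  assumes "v \<in> carrier T" "w \<in> carrier T" "\<And>f. f \<in> F \<Longrightarrow> C f v = C f w"
  shows "v = w"
proof -
  have "v \<ominus>\<^bsub>T\<^esub> w = \<zero>\<^bsub>T\<^esub>"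
    by (rule C_total) (use assms in \<open>simp_all add: C_diff H.minus_eq_zero_iff\<close>)
  then show ?thesis using assms T.minus_eq_zero_iff by blast
qed

lemma bessel:
  assumes "finite G" "G \<subseteq> F" "w \<in> carrier T"
  shows "(\<Sum>f\<in>G. (hnorm H (C f w))\<^sup>2) \<le> (hnorm T w)\<^sup>2"
  using assms
proof (induction G arbitrary: w rule: finite_induct)
  case empty
  then show ?case by simp
next
  case (insert f G)
  define w' where "w' = w \<ominus>\<^bsub>T\<^esub> J f (C f w)"
  have f: "f \<in> F" and w': "w' \<in> carrier T"
    using insert by (auto simp: w'_def)
  have "C g w' = C g w" if "g \<in> G" for g
  proof -
    have "g \<in> F" "g \<noteq> f" using that insert by auto
    then have "C g w' = C g w \<ominus>\<^bsub>H\<^esub> \<zero>\<^bsub>H\<^esub>"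
      using insert f by (simp add: w'_def C_diff C_J)
    also have "\<dots> = C g w"
      using \<open>g \<in> F\<close> insert by (intro H.cinner_extl) (simp_all add: H.cinner_simps)
    finally show ?thesis .
  qed
  moreover have "(hnorm T w')\<^sup>2 = (hnorm T w)\<^sup>2 - (hnorm H (C f w))\<^sup>2"
    using f insert.prems(2) by (simp add: w'_def T.hnorm_diff_sq C_J' hnorm_J H.hnorm_power2)
  ultimately show ?case
    using insert.IH[OF _ w'] insert.hyps insert.prems by simp
qed

lemma family_bound:
  assumes h: "\<And>f. f \<in> F \<Longrightarrow> h f \<in> carrier H"
    and b: "\<And>G. finite G \<Longrightarrow> G \<subseteq> F \<Longrightarrow> (\<Sum>f\<in>G. (hnorm H (h f))\<^sup>2) \<le> b\<^sup>2" and "b \<ge> 0"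
    and w: "w \<in> carrier T"
  shows "(\<lambda>f. norm (cinner H (C f w) (h f))) summable_on F"
    and "norm (\<Sum>\<^sub>\<infinity>f\<in>F. cinner H (C f w) (h f)) \<le> b * hnorm T w"
proof -
  have fin: "(\<Sum>f\<in>G. norm (cinner H (C f w) (h f))) \<le> b * hnorm T w" if "finite G" "G \<subseteq> F" for G
  proof -
    have "(\<Sum>f\<in>G. norm (cinner H (C f w) (h f))) \<le> (\<Sum>f\<in>G. \<bar>hnorm H (C f w)\<bar> * \<bar>hnorm H (h f)\<bar>)"
      using that h w H.hnorm_nonneg by (intro sum_mono) (auto intro!: H.Cauchy_Schwarz simp: subset_eq)
    also have "\<dots> \<le> L2_set (\<lambda>f. hnorm H (C f w)) G * L2_set (\<lambda>f. hnorm H (h f)) G"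
      by (rule L2_set_mult_ineq)
    also have "\<dots> \<le> hnorm T w * b"
      unfolding L2_set_def using bessel[OF that w] b[OF that] T.hnorm_nonneg[OF w] \<open>b \<ge> 0\<close>
      by (intro mult_mono real_le_lsqrt) (auto intro: sum_nonneg)
    finally show ?thesis by (simp add: mult.commute)
  qed
  show s: "(\<lambda>f. norm (cinner H (C f w) (h f))) summable_on F"
    using fin by (intro nonneg_bdd_above_summable_on bdd_aboveI[of _ "b * hnorm T w"]) auto
  have "norm (\<Sum>\<^sub>\<infinity>f\<in>F. cinner H (C f w) (h f)) \<le> (\<Sum>\<^sub>\<infinity>f\<in>F. norm (cinner H (C f w) (h f)))"
    by (rule norm_infsum_bound[OF s])
  also have "\<dots> \<le> b * hnorm T w"
    by (rule infsum_le_finite_sums[OF s fin])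
  finally show "norm (\<Sum>\<^sub>\<infinity>f\<in>F. cinner H (C f w) (h f)) \<le> b * hnorm T w" .
qed

text \<open>The assembled vector represents the functional
  \<open>w \<mapsto> \<Sum> \<langle>C f w, h f\<rangle>\<close>, bounded by Cauchy-Schwarz over the
  coordinates; testing it on \<open>J f x\<close> recovers \<open>h f\<close>.\<close>

lemma family_ex:
  assumes h: "\<And>f. f \<in> F \<Longrightarrow> h f \<in> carrier H"
    and b: "\<And>G. finite G \<Longrightarrow> G \<subseteq> F \<Longrightarrow> (\<Sum>f\<in>G. (hnorm H (h f))\<^sup>2) \<le> b\<^sup>2" and "b \<ge> 0"
  shows "\<exists>y\<in>carrier T. (\<forall>f\<in>F. C f y = h f)
    \<and> (\<forall>w\<in>carrier T. ((\<lambda>f. cinner H (C f w) (h f)) has_sum cinner T w y) F) \<and> hnorm T y \<le> b"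
proof -
  have fb: "norm (\<Sum>\<^sub>\<infinity>f\<in>F. cinner H (C f w) (h f)) \<le> b * hnorm T w" if "w \<in> carrier T" for w
    by (rule family_bound(2)[OF h b \<open>b \<ge> 0\<close> that])
  have s: "(\<lambda>f. cinner H (C f w) (h f)) summable_on F" if "w \<in> carrier T" for w
    by (rule abs_summable_summable[OF family_bound(1)[OF h b \<open>b \<ge> 0\<close> that]])
  have "\<exists>y\<in>carrier T. \<forall>w\<in>carrier T. (\<Sum>\<^sub>\<infinity>f\<in>F. cinner H (C f w) (h f)) = cinner T w y"
  proof (rule T.riesz)
    fix v w assume vw: "v \<in> carrier T" "w \<in> carrier T"
    have "(\<Sum>\<^sub>\<infinity>f\<in>F. cinner H (C f (v \<oplus>\<^bsub>T\<^esub> w)) (h f)) = (\<Sum>\<^sub>\<infinity>f\<in>F. cinner H (C f v) (h f) + cinner H (C f w) (h f))"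
      using vw h by (intro infsum_cong) (simp add: C_add H.cinner_simps)
    then show "(\<Sum>\<^sub>\<infinity>f\<in>F. cinner H (C f (v \<oplus>\<^bsub>T\<^esub> w)) (h f))
        = (\<Sum>\<^sub>\<infinity>f\<in>F. cinner H (C f v) (h f)) + (\<Sum>\<^sub>\<infinity>f\<in>F. cinner H (C f w) (h f))"
      using infsum_add[OF s s] vw by simp
  next
    fix c w assume w: "w \<in> carrier T"
    have "(\<Sum>\<^sub>\<infinity>f\<in>F. cinner H (C f (c \<odot>\<^bsub>T\<^esub> w)) (h f)) = (\<Sum>\<^sub>\<infinity>f\<in>F. c * cinner H (C f w) (h f))"
      using w h by (intro infsum_cong) (simp add: C_smult H.cinner_simps)
    then show "(\<Sum>\<^sub>\<infinity>f\<in>F. cinner H (C f (c \<odot>\<^bsub>T\<^esub> w)) (h f)) = c * (\<Sum>\<^sub>\<infinity>f\<in>F. cinner H (C f w) (h f))"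
      using infsum_cmult_right[OF s[OF w]] by simp
  next
    fix w assume w: "w \<in> carrier T"
    show "cmod (\<Sum>\<^sub>\<infinity>f\<in>F. cinner H (C f w) (h f)) \<le> b * hnorm T w"
      using fb[OF w] by simp
  qed
  then obtain y where y: "y \<in> carrier T" "\<And>w. w \<in> carrier T \<Longrightarrow> (\<Sum>\<^sub>\<infinity>f\<in>F. cinner H (C f w) (h f)) = cinner T w y"
    by blast
  have hs: "((\<lambda>f. cinner H (C f w) (h f)) has_sum cinner T w y) F" if "w \<in> carrier T" for w
    using has_sum_infsum[OF s[OF that]] y(2)[OF that] by simp
  have "C f y = h f" if f: "f \<in> F" for f
  proof (rule H.cinner_extr)
    fix x assume x: "x \<in> carrier H"
    have "((\<lambda>g. cinner H (C g (J f x)) (h g)) has_sum cinner H x (h f)) F"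
      by (rule has_sum_finite_neutralI[of "{f}"]) (use f x h in \<open>auto simp: C_J H.cinner_simps\<close>)
    then have "cinner T (J f x) y = cinner H x (h f)"
      using hs[of "J f x"] f x has_sum_unique by (metis J_closed)
    then show "cinner H x (C f y) = cinner H x (h f)"
      using f x y(1) by (simp add: J_C)
  qed (use f h y in auto)
  moreover have "hnorm T y \<le> b"
  proof (cases "hnorm T y = 0")
    case False
    have "(hnorm T y)\<^sup>2 = Re (cinner T y y)"
      using y(1) by (simp add: T.hnorm_power2)
    also have "\<dots> \<le> cmod (\<Sum>\<^sub>\<infinity>f\<in>F. cinner H (C f y) (h f))"
      unfolding y(2)[OF y(1)] by (rule complex_Re_le_cmod)
    also have "\<dots> \<le> b * hnorm T y"
      using fb[OF y(1)] by simp
    finally show ?thesis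
      using False T.hnorm_nonneg[OF y(1)] by (simp add: power2_eq_square)
  qed (use \<open>b \<ge> 0\<close> in simp)
  ultimately show ?thesis
    using y(1) hs by blast
qed

lemma parseval_C:
  assumes v: "v \<in> carrier T" and w: "w \<in> carrier T"
  shows "((\<lambda>f. cinner H (C f v) (C f w)) has_sum cinner T v w) F"
proof -
  obtain y where y: "y \<in> carrier T" "\<And>f. f \<in> F \<Longrightarrow> C f y = C f w"
    "((\<lambda>f. cinner H (C f v) (C f w)) has_sum cinner T v y) F"
    using family_ex[of "\<lambda>f. C f w" "hnorm T w"] bessel[OF _ _ w] T.hnorm_nonneg[OF w] w v by auto
  have "y = w"
    by (rule C_ext[OF y(1) w y(2)])
  then show ?thesis using y(3) by simp
qed

lemma op_ex:
  assumes cl: "\<And>f w. f \<in> F \<Longrightarrow> w \<in> carrier T \<Longrightarrow> \<phi> f w \<in> carrier H"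
    and add: "\<And>f v w. \<lbrakk>f \<in> F; v \<in> carrier T; w \<in> carrier T\<rbrakk> \<Longrightarrow> \<phi> f (v \<oplus>\<^bsub>T\<^esub> w) = \<phi> f v \<oplus>\<^bsub>H\<^esub> \<phi> f w"
    and smult: "\<And>f c w. \<lbrakk>f \<in> F; w \<in> carrier T\<rbrakk> \<Longrightarrow> \<phi> f (c \<odot>\<^bsub>T\<^esub> w) = c \<odot>\<^bsub>H\<^esub> \<phi> f w"
    and b: "\<And>G w. \<lbrakk>finite G; G \<subseteq> F; w \<in> carrier T\<rbrakk> \<Longrightarrow> (\<Sum>f\<in>G. (hnorm H (\<phi> f w))\<^sup>2) \<le> (b * hnorm T w)\<^sup>2"
    and "b \<ge> 0"
  shows "\<exists>A\<in>bounded_ops T. \<forall>w\<in>carrier T. \<forall>f\<in>F. C f (A w) = \<phi> f w"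
proof -
  have "\<exists>y\<in>carrier T. (\<forall>f\<in>F. C f y = \<phi> f w) \<and> hnorm T y \<le> b * hnorm T w" if w: "w \<in> carrier T" for w
    using family_ex[of "\<lambda>f. \<phi> f w" "b * hnorm T w"] cl b w \<open>b \<ge> 0\<close> T.hnorm_nonneg[OF w] by auto
  then obtain a where a: "\<And>w. w \<in> carrier T \<Longrightarrow> a w \<in> carrier T"
    "\<And>w f. w \<in> carrier T \<Longrightarrow> f \<in> F \<Longrightarrow> C f (a w) = \<phi> f w"
    "\<And>w. w \<in> carrier T \<Longrightarrow> hnorm T (a w) \<le> b * hnorm T w"
    by metis
  have "(\<lambda>w\<in>carrier T. a w) \<in> bounded_ops T"
    by (rule T.bounded_opsI[of a b]) (auto simp: a C_add C_smult add smult intro!: C_ext)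
  then show ?thesis
    using a(2) by (intro bexI[of _ "\<lambda>w\<in>carrier T. a w"]) auto
qed

text \<open>This is \<open>X \<otimes> 1\<close>. The choice is unambiguous because the coordinates
  determine a vector (\<open>C_ext\<close>) and operators are extensional.\<close>

definition amp :: "('h \<Rightarrow> 'h) \<Rightarrow> 't \<Rightarrow> 't" where
  "amp X = (SOME A. A \<in> bounded_ops T \<and> (\<forall>w\<in>carrier T. \<forall>f\<in>F. C f (A w) = X (C f w)))"

lemma amp_spec:
  assumes X: "X \<in> bounded_ops H"
  shows "amp X \<in> bounded_ops T \<and> (\<forall>w\<in>carrier T. \<forall>f\<in>F. C f (amp X w) = X (C f w))"
proof -
  obtain b where b: "b > 0" "\<And>x. x \<in> carrier H \<Longrightarrow> hnorm H (X x) \<le> b * hnorm H x"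
    using H.bounded_ops_bound[OF X] by blast
  have "\<exists>A\<in>bounded_ops T. \<forall>w\<in>carrier T. \<forall>f\<in>F. C f (A w) = X (C f w)"
  proof (rule op_ex[of _ b])
    fix G w assume G: "finite G" "G \<subseteq> F" and w: "w \<in> carrier T"
    have "(\<Sum>f\<in>G. (hnorm H (X (C f w)))\<^sup>2) \<le> (\<Sum>f\<in>G. (b * hnorm H (C f w))\<^sup>2)"
      using G w X b by (intro sum_mono power_mono) (auto simp: H.hnorm_nonneg subset_eq)
    also have "\<dots> = b\<^sup>2 * (\<Sum>f\<in>G. (hnorm H (C f w))\<^sup>2)"
      by (simp add: power_mult_distrib sum_distrib_left)
    also have "\<dots> \<le> (b * hnorm T w)\<^sup>2"
      using bessel[OF G w] by (simp add: power_mult_distrib mult_left_mono)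
    finally show "(\<Sum>f\<in>G. (hnorm H (X (C f w)))\<^sup>2) \<le> (b * hnorm T w)\<^sup>2" .
  qed (use X b in \<open>auto simp: C_add C_smult bounded_ops_add bounded_ops_smult\<close>)
  then show ?thesis
    unfolding amp_def by (rule someI2_bex) blast
qed

lemma amp_closed [simp]: "X \<in> bounded_ops H \<Longrightarrow> amp X \<in> bounded_ops T"
  using amp_spec by blast

lemma C_amp [simp]: "\<lbrakk>X \<in> bounded_ops H; w \<in> carrier T; f \<in> F\<rbrakk> \<Longrightarrow> C f (amp X w) = X (C f w)"
  using amp_spec by blast

lemma amp_J [simp]: "\<lbrakk>X \<in> bounded_ops H; x \<in> carrier H; f \<in> F\<rbrakk> \<Longrightarrow> amp X (J f x) = J f (X x)"
  by (rule C_ext) (simp_all add: C_J H.bounded_ops_zero)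

lemma op_eqI_C:
  assumes "A \<in> bounded_ops T" "B \<in> bounded_ops T"
    "\<And>f w. f \<in> F \<Longrightarrow> w \<in> carrier T \<Longrightarrow> C f (A w) = C f (B w)"
  shows "A = B"
  using assms by (intro T.ops_eqI C_ext) auto

text \<open>The vectors \<open>J f x\<close> span only a dense subspace. Passing to adjoints turns
  agreement on them into equality of all coordinates of the adjoints.\<close>

lemma op_eqI_J:
  assumes A: "A \<in> bounded_ops T" "B \<in> bounded_ops T"
    and eq: "\<And>f x. f \<in> F \<Longrightarrow> x \<in> carrier H \<Longrightarrow> A (J f x) = B (J f x)"
  shows "A = B"
proof -
  have "op_adj T A = op_adj T B"
  proof (rule op_eqI_C)
    fix f w assume fw: "f \<in> F" "w \<in> carrier T"
    show "C f (op_adj T A w) = C f (op_adj T B w)"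
      by (rule H.cinner_extr) (use fw A eq in \<open>simp_all add: J_C[symmetric] T.cinner_adj\<close>)
  qed (use A in auto)
  from arg_cong[OF this, of "op_adj T"] show ?thesis
    using A by simp
qed

lemma amp_one: "amp (op_one H) = op_one T"
  by (rule op_eqI_C) auto

lemma amp_add: "\<lbrakk>X \<in> bounded_ops H; Y \<in> bounded_ops H\<rbrakk> \<Longrightarrow> amp (op_add H X Y) = op_add T (amp X) (amp Y)"
  by (rule op_eqI_C) (auto simp: C_add)

lemma amp_mult: "\<lbrakk>X \<in> bounded_ops H; Y \<in> bounded_ops H\<rbrakk> \<Longrightarrow> amp (op_mult H X Y) = op_mult T (amp X) (amp Y)"
  by (rule op_eqI_C) auto

lemma amp_smult: "X \<in> bounded_ops H \<Longrightarrow> amp (op_smult H c X) = op_smult T c (amp X)"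
  by (rule op_eqI_C) (auto simp: C_smult)

lemma amp_adj: "X \<in> bounded_ops H \<Longrightarrow> amp (op_adj H X) = op_adj T (amp X)"
proof (rule op_eqI_C)
  fix f w assume X: "X \<in> bounded_ops H" and fw: "f \<in> F" "w \<in> carrier T"
  show "C f (amp (op_adj H X) w) = C f (op_adj T (amp X) w)"
  proof (rule H.cinner_extr)
    fix z assume z: "z \<in> carrier H"
    have "cinner H z (C f (op_adj T (amp X) w)) = cinner T (J f z) (op_adj T (amp X) w)"
      using fw X z by (simp add: J_C)
    also have "\<dots> = cinner T (amp X (J f z)) w"
      using fw X z by (intro T.cinner_adj) auto
    also have "\<dots> = cinner H (X z) (C f w)"
      using fw X z by (simp add: J_C)
    also have "\<dots> = cinner H z (C f (amp (op_adj H X) w))"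
      using fw X z by (simp add: H.cinner_adj)
    finally show "cinner H z (C f (amp (op_adj H X) w)) = cinner H z (C f (op_adj T (amp X) w))" ..
  qed (use fw X in auto)
qed auto

lemma amp_inj:
  assumes "F \<noteq> {}" "X \<in> bounded_ops H" "Y \<in> bounded_ops H" "amp X = amp Y"
  shows "X = Y"
proof (rule H.ops_eqI[OF assms(2,3)])
  fix x assume x: "x \<in> carrier H"
  obtain f where f: "f \<in> F" using assms(1) by blast
  have "C f (amp X (J f x)) = C f (amp Y (J f x))" using assms(4) by simp
  then show "X x = Y x" using f x assms(2,3) by (simp add: C_J)
qed

definition entry :: "'f \<Rightarrow> 'f \<Rightarrow> ('t \<Rightarrow> 't) \<Rightarrow> 'h \<Rightarrow> 'h" where
  "entry f g S = (\<lambda>x\<in>carrier H. C f (S (J g x)))"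

text \<open>A concrete substitute for the tensor product of \<open>N\<close> with all bounded
  operators on \<open>K\<close>, to which it is later proved equal for the amplification
  \<open>H \<otimes> K\<close> when \<open>N\<close> is its own double commutant.\<close>

definition mats :: "('h \<Rightarrow> 'h) set \<Rightarrow> ('t \<Rightarrow> 't) set" where
  "mats N = {S \<in> bounded_ops T. \<forall>f\<in>F. \<forall>g\<in>F. entry f g S \<in> N}"

lemma entry_apply [simp]: "x \<in> carrier H \<Longrightarrow> entry f g S x = C f (S (J g x))"
  by (simp add: entry_def)

lemma hnorm_C_le: "f \<in> F \<Longrightarrow> w \<in> carrier T \<Longrightarrow> hnorm H (C f w) \<le> hnorm T w"
  using bessel[of "{f}" w] T.hnorm_nonneg[of w] by (auto intro: power2_le_imp_le)

lemma entry_closed [simp]: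
  assumes f: "f \<in> F" "g \<in> F" and S: "S \<in> bounded_ops T"
  shows "entry f g S \<in> bounded_ops H"
proof -
  obtain b where b: "b > 0" "\<And>x. x \<in> carrier T \<Longrightarrow> hnorm T (S x) \<le> b * hnorm T x"
    using T.bounded_ops_bound[OF S] by blast
  show ?thesis
    unfolding entry_def
  proof (rule H.bounded_opsI[of _ b])
    fix x assume x: "x \<in> carrier H"
    show "hnorm H (C f (S (J g x))) \<le> b * hnorm H x"
      using hnorm_C_le[OF f(1), of "S (J g x)"] b(2)[of "J g x"] f S x by (simp add: hnorm_J)
  qed (use f S in \<open>auto simp: J_add J_smult C_add C_smult bounded_ops_add bounded_ops_smult\<close>)
qed

lemma mats_commute:
  assumes S: "S \<in> bounded_ops T" and X: "X \<in> bounded_ops H"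
  shows "op_mult T S (amp X) = op_mult T (amp X) S
    \<longleftrightarrow> (\<forall>f\<in>F. \<forall>g\<in>F. op_mult H (entry f g S) X = op_mult H X (entry f g S))"
proof
  assume eq: "op_mult T S (amp X) = op_mult T (amp X) S"
  show "\<forall>f\<in>F. \<forall>g\<in>F. op_mult H (entry f g S) X = op_mult H X (entry f g S)"
  proof (intro ballI)
    fix f g assume fg: "f \<in> F" "g \<in> F"
    show "op_mult H (entry f g S) X = op_mult H X (entry f g S)"
    proof (rule H.ops_eqI)
      fix x assume x: "x \<in> carrier H"
      have "S (amp X (J g x)) = amp X (S (J g x))"
        by (rule op_mult_eqD[OF eq]) (use fg x in simp)
      then show "op_mult H (entry f g S) X x = op_mult H X (entry f g S) x"
        using fg x S X C_amp[of X "S (J g x)" f] by simp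
    qed (use fg S X in auto)
  qed
next
  assume eq: "\<forall>f\<in>F. \<forall>g\<in>F. op_mult H (entry f g S) X = op_mult H X (entry f g S)"
  show "op_mult T S (amp X) = op_mult T (amp X) S"
  proof (rule op_eqI_J)
    fix g x assume gx: "g \<in> F" "x \<in> carrier H"
    show "op_mult T S (amp X) (J g x) = op_mult T (amp X) S (J g x)"
    proof (rule C_ext)
      fix f assume f: "f \<in> F"
      have "entry f g S (X x) = X (entry f g S x)"
        by (rule op_mult_eqD) (use eq f gx in auto)
      then show "C f (op_mult T S (amp X) (J g x)) = C f (op_mult T (amp X) S (J g x))"
        using gx f S X by simp
    qed (use gx S X in auto)
  qed (use S X in auto)
qed

text \<open>\<open>amp X\<close> acts by \<open>X\<close> in every coordinate, so a matrix commutes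
  with it exactly when each entry commutes with \<open>X\<close>. This elementary case of the
  commutation theorem lets normalisers be studied through commutants.\<close>

lemma mats_commutant:
  assumes "R \<subseteq> bounded_ops H"
  shows "mats (commutant H R) = commutant T (amp ` R)"
  unfolding mats_def commutant_def using assms mats_commute by (auto simp: subset_eq)

lemma amp_adj_closed_set: "adj_closed_set H R \<Longrightarrow> adj_closed_set T (amp ` R)"
  unfolding adj_closed_set_def by (auto simp: subset_eq simp flip: amp_adj)

text \<open>A weak neighbourhood of \<open>X\<close> involves finitely many vectors, and the
  infinite amplification has room to make them coordinates of one vector \<open>\<xi>\<close>. The
  projection \<open>E\<close> onto the closure of the orbit of \<open>\<xi>\<close> under
  \<open>amp\<close> of \<open>N\<close> has entries in the commutant of \<open>N\<close>, so it
  commutes with \<open>amp X\<close>; hence \<open>amp X \<xi>\<close> is a limit of vectors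
  \<open>amp A \<xi>\<close>.\<close>

lemma double_commutant:
  assumes N: "von_neumann_algebra H N" and inf: "infinite F"
  shows "commutant H (commutant H N) = N"
proof
  have Nb: "N \<subseteq> bounded_ops H" and N1: "op_one H \<in> N"
    and Nops: "\<And>A B. A \<in> N \<Longrightarrow> B \<in> N \<Longrightarrow> op_add H A B \<in> N" "\<And>A B. A \<in> N \<Longrightarrow> B \<in> N \<Longrightarrow> op_mult H A B \<in> N"
      "\<And>c A. A \<in> N \<Longrightarrow> op_smult H c A \<in> N" "\<And>A. A \<in> N \<Longrightarrow> op_adj H A \<in> N"
    and Ncl: "closedin (weak_operator_topology H) N"
    using N by (auto simp: von_neumann_algebra_def)
  show "N \<subseteq> commutant H (commutant H N)"
    by (rule commutant_commutant[OF Nb])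
  show "commutant H (commutant H N) \<subseteq> N"
  proof
    fix X assume X: "X \<in> commutant H (commutant H N)"
    then have Xb: "X \<in> bounded_ops H" by simp
    show "X \<in> N"
    proof (rule weak_operator_closedI[OF Ncl Xb])
      fix Q :: "('h \<times> 'h) set" and e :: real
      assume Q: "finite Q" "Q \<subseteq> carrier H \<times> carrier H" and e: "e > 0"
      obtain F' where F': "F' \<subseteq> F" "finite F'" "card F' = card Q"
        using infinite_arbitrarily_large[OF inf] by blast
      then obtain \<iota> where \<iota>: "bij_betw \<iota> Q F'"
        using finite_same_card_bij[OF Q(1) F'(2)] by auto
      have \<iota>F: "\<iota> q \<in> F" if "q \<in> Q" for q
        using \<iota> F'(1) that by (auto simp: bij_betw_def)
      \<comment> \<open>Coordinates outside \<open>F'\<close> are zero, so the family is finitely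
        supported and square-summable.\<close>
      define h where "h f = (if f \<in> F' then fst (inv_into Q \<iota> f) else \<zero>\<^bsub>H\<^esub>)" for f
      have inv: "inv_into Q \<iota> f \<in> Q" if "f \<in> F'" for f
        using \<iota> that by (metis bij_betw_def inv_into_into)
      have hc: "h f \<in> carrier H" for f
        using inv[of f] Q(2) by (auto simp: h_def subset_eq mem_Times_iff)
      define b where "b = sqrt (\<Sum>f\<in>F'. (hnorm H (h f))\<^sup>2)"
      have "(\<Sum>f\<in>G. (hnorm H (h f))\<^sup>2) \<le> b\<^sup>2" if "finite G" "G \<subseteq> F" for G
      proof -
        have "(\<Sum>f\<in>G. (hnorm H (h f))\<^sup>2) = (\<Sum>f\<in>G \<inter> F'. (hnorm H (h f))\<^sup>2)"
          using that H.hnorm_eq_0[of "\<zero>\<^bsub>H\<^esub>"] by (intro sum.mono_neutral_right) (auto simp: h_def)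
        also have "\<dots> \<le> (\<Sum>f\<in>F'. (hnorm H (h f))\<^sup>2)"
          using F'(2) by (intro sum_mono2) auto
        also have "\<dots> = b\<^sup>2"
          by (simp add: b_def sum_nonneg)
        finally show ?thesis .
      qed
      moreover have "b \<ge> 0" by (simp add: b_def sum_nonneg)
      ultimately obtain \<xi> where \<xi>: "\<xi> \<in> carrier T" "\<And>f. f \<in> F \<Longrightarrow> C f \<xi> = h f"
        using family_ex[of h b] hc by blast
      have C\<xi>: "C (\<iota> q) \<xi> = fst q" if "q \<in> Q" for q
        using \<iota> that \<xi>(2)[OF \<iota>F[OF that]] by (auto simp: h_def bij_betw_def)
      define S where "S = (\<lambda>A. amp A \<xi>) ` N"
      have Sc: "S \<subseteq> carrier T"
        using Nb \<xi>(1) by (auto simp: S_def)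
      obtain E where E: "selfadj T E" "\<And>x. x \<in> carrier T \<Longrightarrow> E x \<in> orth T (orth T S)"
        "\<And>x. x \<in> carrier T \<Longrightarrow> x \<ominus>\<^bsub>T\<^esub> E x \<in> orth T S"
        using T.projection_ex[OF Sc] by blast
      have Sinv: "amp A s \<in> S" if A: "A \<in> N" and s: "s \<in> S" for A s
      proof -
        obtain B where "B \<in> N" "s = amp B \<xi>" using s by (auto simp: S_def)
        moreover from this have "amp A s = amp (op_mult H A B) \<xi>"
          using A Nb \<xi>(1) by (simp add: amp_mult subset_eq)
        ultimately show ?thesis using Nops(2)[OF A] by (auto simp: S_def)
      qed
      have "E \<in> commutant T (amp ` N)"
      proof (rule T.commutantI)
        fix s x assume s: "s \<in> amp ` N" and x: "x \<in> carrier T"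
        then obtain A where A: "A \<in> N" "s = amp A" by blast
        have "op_adj T (amp A) = amp (op_adj H A)"
          using A Nb by (auto simp: amp_adj)
        then show "E (s x) = s (E x)"
          using A Nops(4) Nb x by (intro T.projection_commute[OF Sc E]) (auto simp: Sinv)
      qed (use E Nb in auto)
      then have "E \<in> mats (commutant H N)"
        using mats_commutant[OF Nb] by simp
      then have ent: "entry f g E \<in> commutant H N" if "f \<in> F" "g \<in> F" for f g
        using that by (simp add: mats_def)
      have "op_mult T E (amp X) = op_mult T (amp X) E"
        unfolding mats_commute[OF T.selfadj_closed[OF E(1)] Xb]
      proof (intro ballI)
        fix f g assume "f \<in> F" "g \<in> F"
        then show "op_mult H (entry f g E) X = op_mult H X (entry f g E)"
          using X ent unfolding commutant_def by auto
      qed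
      from op_mult_eqD[OF this \<xi>(1)] have EX: "E (amp X \<xi>) = amp X (E \<xi>)" .
      \<comment> \<open>The identity of \<open>N\<close> puts \<open>\<xi>\<close> in its own orbit,
        so \<open>E\<close> fixes it; commutation then places \<open>amp X \<xi>\<close> in the
        range of \<open>E\<close>.\<close>
      have "\<xi> \<in> S"
        unfolding S_def using N1 \<xi>(1) amp_one by (intro image_eqI[of _ _ "op_one H"]) auto
      then have "E \<xi> = \<xi>"
        using T.projection_id[OF E] T.orth_orth_superset[OF Sc] by blast
      then have mem: "amp X \<xi> \<in> orth T (orth T S)"
        using E(2)[of "amp X \<xi>"] EX Xb \<xi>(1) by simp
      have "\<exists>s. (\<forall>n::nat. s n \<in> S) \<and> (\<lambda>n. hnorm T (s n \<ominus>\<^bsub>T\<^esub> amp X \<xi>)) \<longlonglongrightarrow> 0"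
      proof (rule T.orth_orth_approx[OF Sc _ _ _ mem])
        show "\<zero>\<^bsub>T\<^esub> \<in> S"
          unfolding S_def using Nops(3)[OF N1, of 0] \<xi>(1)
          by (intro image_eqI[of _ _ "op_smult H 0 (op_one H)"]) (auto simp: amp_smult amp_one)
        show "x \<oplus>\<^bsub>T\<^esub> y \<in> S" if xy: "x \<in> S" "y \<in> S" for x y
        proof -
          obtain A B where AB: "A \<in> N" "x = amp A \<xi>" "B \<in> N" "y = amp B \<xi>" using xy by (auto simp: S_def)
          then have "x \<oplus>\<^bsub>T\<^esub> y = amp (op_add H A B) \<xi>"
            using Nb \<xi>(1) by (simp add: amp_add subset_eq)
          then show ?thesis using Nops(1)[OF AB(1,3)] by (auto simp: S_def)
        qed
        show "c \<odot>\<^bsub>T\<^esub> x \<in> S" if x: "x \<in> S" for c x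
        proof -
          obtain A where A: "A \<in> N" "x = amp A \<xi>" using x by (auto simp: S_def)
          then have "c \<odot>\<^bsub>T\<^esub> x = amp (op_smult H c A) \<xi>"
            using Nb \<xi>(1) by (simp add: amp_smult subset_eq)
          then show ?thesis using Nops(3)[OF A(1)] by (auto simp: S_def)
        qed
      qed
      then obtain s where s: "\<And>n::nat. s n \<in> S" "(\<lambda>n. hnorm T (s n \<ominus>\<^bsub>T\<^esub> amp X \<xi>)) \<longlonglongrightarrow> 0"
        by blast
      have "\<forall>n. \<exists>A. A \<in> N \<and> s n = amp A \<xi>"
        using s(1) by (auto simp: S_def)
      then obtain A where A: "\<And>n. A n \<in> N" "\<And>n. s n = amp (A n) \<xi>"
        by metis
      have Ab: "A n \<in> bounded_ops H" for n using A(1) Nb by blast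
      have sc: "s n \<in> carrier T" for n using s(1) Sc by blast
      have lim: "(\<lambda>n. cinner H (A n (fst q)) (snd q)) \<longlonglongrightarrow> cinner H (X (fst q)) (snd q)" if q: "q \<in> Q" for q
      proof -
        have q': "fst q \<in> carrier H" "snd q \<in> carrier H" using q Q(2) by auto
        have "(\<lambda>n. cinner T (s n) (J (\<iota> q) (snd q))) \<longlonglongrightarrow> cinner T (amp X \<xi>) (J (\<iota> q) (snd q))"
          using q' \<iota>F[OF q] Xb \<xi>(1) sc s(2) by (intro T.cinner_tendsto_left) auto
        then show ?thesis
          using q' \<iota>F[OF q] Xb \<xi>(1) Ab by (simp add: A(2) C_J' C\<xi>[OF q])
      qed
      have "eventually (\<lambda>n. \<forall>q\<in>Q. cmod (cinner H (A n (fst q)) (snd q) - cinner H (X (fst q)) (snd q)) < e) sequentially"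
        using tendstoD[OF lim e] by (intro eventually_ball_finite[OF Q(1)]) (auto simp: dist_norm)
      then obtain n where "\<forall>q\<in>Q. cmod (cinner H (A n (fst q)) (snd q) - cinner H (X (fst q)) (snd q)) < e"
        by (auto simp: eventually_sequentially)
      then show "\<exists>Z\<in>N. \<forall>(x, y)\<in>Q. cmod (cinner H (Z x) y - cinner H (X x) y) < e"
        using A(1)[of n] by (intro bexI[of _ "A n"]) auto
    qed
  qed
qed

text \<open>\<open>S\<close> is recovered from its blocks by two successive weak limits, first over
  the columns within a row and then over the rows, each staying in \<open>A\<close> by closedness.
  Iterating the limits sidesteps the convergence of a double sum.\<close>

lemma mats_subset_closed:
  assumes A: "von_neumann_algebra T A" and S: "S \<in> bounded_ops T"
    and sub: "\<And>f g. \<lbrakk>f \<in> F; g \<in> F\<rbrakk> \<Longrightarrow> (\<lambda>w\<in>carrier T. J f (entry f g S (C g w))) \<in> A"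
  shows "S \<in> A"
proof -
  have Ab: "A \<subseteq> bounded_ops T" and A1: "op_one T \<in> A"
    and Aops: "\<And>X Y. X \<in> A \<Longrightarrow> Y \<in> A \<Longrightarrow> op_add T X Y \<in> A" "\<And>c X. X \<in> A \<Longrightarrow> op_smult T c X \<in> A"
    and Acl: "closedin (weak_operator_topology T) A"
    using A by (auto simp: von_neumann_algebra_def)
  have JC: "(\<lambda>w\<in>carrier T. J f (C f w)) \<in> bounded_ops T" if "f \<in> F" for f
    by (rule T.bounded_opsI[of _ 1])
      (use that in \<open>auto simp: J_add J_smult C_add C_smult hnorm_J hnorm_C_le\<close>)
  have row: "op_mult T (\<lambda>w\<in>carrier T. J f (C f w)) S \<in> A" if f: "f \<in> F" for f
  proof -
    define Z where "Z g = (\<lambda>w\<in>carrier T. J f (entry f g S (C g w)))" for g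
    have ZA: "Z g \<in> A" if "g \<in> F" for g
      unfolding Z_def by (rule sub[OF f that])
    have "\<exists>W\<in>A. \<forall>v\<in>carrier T. \<forall>w\<in>carrier T. cinner T (W v) w = (\<Sum>g\<in>G. cinner T (Z g v) w)"
      if "finite G" "G \<subseteq> F" for G
      by (rule T.finite_op_sum[OF Ab A1 Aops that(1)]) (use ZA that(2) in auto)
    then obtain W where W: "\<And>G. \<lbrakk>finite G; G \<subseteq> F\<rbrakk> \<Longrightarrow> W G \<in> A"
      "\<And>G v w. \<lbrakk>finite G; G \<subseteq> F; v \<in> carrier T; w \<in> carrier T\<rbrakk> \<Longrightarrow> cinner T (W G v) w = (\<Sum>g\<in>G. cinner T (Z g v) w)"
      by metis
    show ?thesis
    proof (rule weak_operator_closed_limit[OF Acl])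
    show "finite_subsets_at_top F \<noteq> bot" by simp
    show "eventually (\<lambda>G. W G \<in> A) (finite_subsets_at_top F)"
      by (rule eventually_finite_subsets_at_top_weakI) (rule W(1))
    fix v w assume vw: "v \<in> carrier T" "w \<in> carrier T"
    define u where "u = op_adj T S (J f (C f w))"
    have u: "u \<in> carrier T" using S f vw by (simp add: u_def)
    have hs: "((\<lambda>g. cinner H (C g v) (C g u)) has_sum cinner T v u) F"
      by (rule parseval_C[OF vw(1) u])
    have eq: "cinner T v u = cinner T (op_mult T (\<lambda>w\<in>carrier T. J f (C f w)) S v) w"
      using vw S f by (simp add: u_def T.cinner_adj J_C C_J')
    have cong: "cinner H (C g v) (C g u) = cinner T (Z g v) w" if "g \<in> F" for g
      using vw S f that u by (simp add: Z_def J_C[symmetric]) (simp add: u_def T.cinner_adj J_C C_J')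
    have "((\<lambda>g. cinner T (Z g v) w) has_sum cinner T (op_mult T (\<lambda>w\<in>carrier T. J f (C f w)) S v) w) F"
      by (rule has_sum_cong[OF cong, THEN iffD1, OF _ hs[unfolded eq]])
    then have "(sum (\<lambda>g. cinner T (Z g v) w) \<longlongrightarrow> cinner T (op_mult T (\<lambda>w\<in>carrier T. J f (C f w)) S v) w) (finite_subsets_at_top F)"
      by (simp add: has_sum_def)
    then show "((\<lambda>G. cinner T (W G v) w) \<longlongrightarrow> cinner T (op_mult T (\<lambda>w\<in>carrier T. J f (C f w)) S v) w) (finite_subsets_at_top F)"
      by (rule Lim_transform_eventually)
        (rule eventually_finite_subsets_at_top_weakI, use W(2) vw in simp)
    qed (use S JC f in auto)
  qed
  show ?thesis
  proof -
    define Z where "Z f = op_mult T (\<lambda>w\<in>carrier T. J f (C f w)) S" for f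
    have ZA: "Z f \<in> A" if "f \<in> F" for f
      unfolding Z_def by (rule row[OF that])
    have "\<exists>W\<in>A. \<forall>v\<in>carrier T. \<forall>w\<in>carrier T. cinner T (W v) w = (\<Sum>g\<in>G. cinner T (Z g v) w)"
      if "finite G" "G \<subseteq> F" for G
      by (rule T.finite_op_sum[OF Ab A1 Aops that(1)]) (use ZA that(2) in auto)
    then obtain W where W: "\<And>G. \<lbrakk>finite G; G \<subseteq> F\<rbrakk> \<Longrightarrow> W G \<in> A"
      "\<And>G v w. \<lbrakk>finite G; G \<subseteq> F; v \<in> carrier T; w \<in> carrier T\<rbrakk> \<Longrightarrow> cinner T (W G v) w = (\<Sum>g\<in>G. cinner T (Z g v) w)"
      by metis
    show ?thesis
    proof (rule weak_operator_closed_limit[OF Acl S])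
    show "finite_subsets_at_top F \<noteq> bot" by simp
    show "eventually (\<lambda>G. W G \<in> A) (finite_subsets_at_top F)"
      by (rule eventually_finite_subsets_at_top_weakI) (rule W(1))
    fix v w assume vw: "v \<in> carrier T" "w \<in> carrier T"
    have "((\<lambda>g. cinner H (C g (S v)) (C g w)) has_sum cinner T (S v) w) F"
      by (rule parseval_C) (use vw S in auto)
    moreover have "cinner H (C g (S v)) (C g w) = cinner T (Z g v) w" if "g \<in> F" for g
      using vw S that by (simp add: Z_def J_C)
    ultimately have "((\<lambda>g. cinner T (Z g v) w) has_sum cinner T (S v) w) F"
      by (simp cong: has_sum_cong)
    then have "(sum (\<lambda>g. cinner T (Z g v) w) \<longlongrightarrow> cinner T (S v) w) (finite_subsets_at_top F)"
      by (simp add: has_sum_def)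
    then show "((\<lambda>G. cinner T (W G v) w) \<longlongrightarrow> cinner T (S v) w) (finite_subsets_at_top F)"
      by (rule Lim_transform_eventually)
        (rule eventually_finite_subsets_at_top_weakI, use W(2) vw in simp)
    qed
  qed
qed

end

section \<open>The tensor product as an amplification\<close>

lemma orthonormal_subset: "orthonormal H E \<Longrightarrow> G \<subseteq> E \<Longrightarrow> orthonormal H G"
  unfolding orthonormal_def by blast

locale two_hilbert_spaces = H: hilbert_space H + K: hilbert_space K
  for H :: "'h hilbert" and K :: "'k hilbert"
begin

abbreviation "E \<equiv> some_onb H"
abbreviation "F \<equiv> some_onb K"

definition prod_coeff :: "'h \<Rightarrow> 'k \<Rightarrow> 'h \<times> 'k \<Rightarrow> complex" where
  "prod_coeff x y = (\<lambda>(e, f). if e \<in> E \<and> f \<in> F then cinner H x e * cinner K y f else 0)"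

definition tensor_coeff :: "('h \<Rightarrow> 'k \<Rightarrow> complex) \<Rightarrow> 'h \<times> 'k \<Rightarrow> complex" where
  "tensor_coeff \<phi> = (\<lambda>(e, f). if e \<in> E \<and> f \<in> F then \<phi> e f else 0)"

lemma E: "orthonormal_basis H E" "orthonormal H E" "e \<in> E \<Longrightarrow> e \<in> carrier H"
  using H.some_onb by (auto simp: orthonormal_basis_iff orthonormal_def)

lemma F: "orthonormal_basis K F" "orthonormal K F" "f \<in> F \<Longrightarrow> f \<in> carrier K"
  using K.some_onb by (auto simp: orthonormal_basis_iff orthonormal_def)

lemma EE: "e \<in> E \<Longrightarrow> a \<in> E \<Longrightarrow> cinner H e a = (if e = a then 1 else 0)"
  using E(2) by (simp add: orthonormal_def)

lemma FF: "f \<in> F \<Longrightarrow> b \<in> F \<Longrightarrow> cinner K f b = (if f = b then 1 else 0)"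
  using F(2) by (simp add: orthonormal_def)

text \<open>A finite set of index pairs lies in the rectangle of its two projections, over which the
  sum factors; Bessel in each variable bounds the factors.\<close>

lemma prod_coeff_l2:
  assumes x: "x \<in> carrier H" and y: "y \<in> carrier K"
  shows "prod_coeff x y \<in> carrier (l2 (E \<times> F))"
    and "hnorm (l2 (E \<times> F)) (prod_coeff x y) \<le> hnorm H x * hnorm K y"
proof -
  have b: "(\<Sum>p\<in>G. (cmod (prod_coeff x y p))\<^sup>2) \<le> (hnorm H x * hnorm K y)\<^sup>2"
    if G: "finite G" "G \<subseteq> E \<times> F" for G
  proof -
    have sub: "G \<subseteq> fst ` G \<times> snd ` G" by force
    have "(\<Sum>p\<in>G. (cmod (prod_coeff x y p))\<^sup>2) \<le> (\<Sum>p\<in>fst ` G \<times> snd ` G. (cmod (prod_coeff x y p))\<^sup>2)"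
      using G sub by (intro sum_mono2) auto
    also have "\<dots> = (\<Sum>p\<in>fst ` G \<times> snd ` G. (cmod (cinner H x (fst p)))\<^sup>2 * (cmod (cinner K y (snd p)))\<^sup>2)"
      using G by (intro sum.cong) (auto simp: prod_coeff_def norm_mult power_mult_distrib)
    also have "\<dots> = (\<Sum>e\<in>fst ` G. (cmod (cinner H x e))\<^sup>2) * (\<Sum>f\<in>snd ` G. (cmod (cinner K y f))\<^sup>2)"
      by (simp add: sum_product sum.cartesian_product case_prod_beta)
    also have "\<dots> \<le> (hnorm H x)\<^sup>2 * (hnorm K y)\<^sup>2"
    proof (rule mult_mono)
      show "(\<Sum>e\<in>fst ` G. (cmod (cinner H x e))\<^sup>2) \<le> (hnorm H x)\<^sup>2"
        using G x by (intro H.bessel_finite orthonormal_subset[OF E(2)]) auto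
      show "(\<Sum>f\<in>snd ` G. (cmod (cinner K y f))\<^sup>2) \<le> (hnorm K y)\<^sup>2"
        using G y by (intro K.bessel_finite orthonormal_subset[OF F(2)]) auto
    qed (auto intro: sum_nonneg)
    finally show ?thesis by (simp add: power_mult_distrib)
  qed
  have "(\<lambda>p. (cmod (prod_coeff x y p))\<^sup>2) summable_on E \<times> F"
    using b by (intro nonneg_bdd_above_summable_on bdd_aboveI[of _ "(hnorm H x * hnorm K y)\<^sup>2"]) auto
  then show m: "prod_coeff x y \<in> carrier (l2 (E \<times> F))"
    by (simp add: in_l2_iff) (auto simp: prod_coeff_def)
  have "(hnorm (l2 (E \<times> F)) (prod_coeff x y))\<^sup>2 \<le> (hnorm H x * hnorm K y)\<^sup>2"
    by (rule has_sum_le_finite_sums[OF l2_has_sum[OF m]]) (use b in auto)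
  then show "hnorm (l2 (E \<times> F)) (prod_coeff x y) \<le> hnorm H x * hnorm K y"
    by (rule power2_le_imp_le) (use H.hnorm_nonneg[OF x] K.hnorm_nonneg[OF y] in simp)
qed

lemma hsI:
  assumes "\<And>u v. u \<notin> carrier H \<or> v \<notin> carrier K \<Longrightarrow> \<phi> u v = 0"
    and "\<And>u u' v. \<lbrakk>u \<in> carrier H; u' \<in> carrier H; v \<in> carrier K\<rbrakk> \<Longrightarrow> \<phi> (u \<oplus>\<^bsub>H\<^esub> u') v = \<phi> u v + \<phi> u' v"
    and "\<And>u v v'. \<lbrakk>u \<in> carrier H; v \<in> carrier K; v' \<in> carrier K\<rbrakk> \<Longrightarrow> \<phi> u (v \<oplus>\<^bsub>K\<^esub> v') = \<phi> u v + \<phi> u v'"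
    and "\<And>c u v. \<lbrakk>u \<in> carrier H; v \<in> carrier K\<rbrakk> \<Longrightarrow> \<phi> (c \<odot>\<^bsub>H\<^esub> u) v = cnj c * \<phi> u v"
    and "\<And>c u v. \<lbrakk>u \<in> carrier H; v \<in> carrier K\<rbrakk> \<Longrightarrow> \<phi> u (c \<odot>\<^bsub>K\<^esub> v) = cnj c * \<phi> u v"
    and "\<And>u v. \<lbrakk>u \<in> carrier H; v \<in> carrier K\<rbrakk> \<Longrightarrow> cmod (\<phi> u v) \<le> C * hnorm H u * hnorm K v"
    and "tensor_coeff \<phi> \<in> carrier (l2 (E \<times> F))"
  shows "\<phi> \<in> hs_functionals H K"
proof -
  have "(\<lambda>p. (cmod (tensor_coeff \<phi> p))\<^sup>2) summable_on E \<times> F"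
    using assms(7) by (simp add: in_l2_iff)
  then have "(\<lambda>(e, f). (cmod (\<phi> e f))\<^sup>2) summable_on E \<times> F"
    by (rule summable_on_cong[THEN iffD1, rotated]) (auto simp: tensor_coeff_def)
  moreover have "\<exists>C. \<forall>u\<in>carrier H. \<forall>v\<in>carrier K. cmod (\<phi> u v) \<le> C * hnorm H u * hnorm K v"
    using assms(6) by blast
  ultimately show ?thesis
    unfolding hs_functionals_def using assms(1-5) by simp
qed

lemma hsD:
  assumes "\<phi> \<in> hs_functionals H K"
  shows "u \<notin> carrier H \<or> v \<notin> carrier K \<Longrightarrow> \<phi> u v = 0"
    and "\<lbrakk>u \<in> carrier H; u' \<in> carrier H; v \<in> carrier K\<rbrakk> \<Longrightarrow> \<phi> (u \<oplus>\<^bsub>H\<^esub> u') v = \<phi> u v + \<phi> u' v"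
    and "\<lbrakk>u \<in> carrier H; v \<in> carrier K; v' \<in> carrier K\<rbrakk> \<Longrightarrow> \<phi> u (v \<oplus>\<^bsub>K\<^esub> v') = \<phi> u v + \<phi> u v'"
    and "\<lbrakk>u \<in> carrier H; v \<in> carrier K\<rbrakk> \<Longrightarrow> \<phi> (c \<odot>\<^bsub>H\<^esub> u) v = cnj c * \<phi> u v"
    and "\<lbrakk>u \<in> carrier H; v \<in> carrier K\<rbrakk> \<Longrightarrow> \<phi> u (c \<odot>\<^bsub>K\<^esub> v) = cnj c * \<phi> u v"
    and "\<exists>C. \<forall>u\<in>carrier H. \<forall>v\<in>carrier K. cmod (\<phi> u v) \<le> C * hnorm H u * hnorm K v"
    and "tensor_coeff \<phi> \<in> carrier (l2 (E \<times> F))"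
proof -
  have "(\<lambda>(e, f). (cmod (\<phi> e f))\<^sup>2) summable_on E \<times> F"
    using assms unfolding hs_functionals_def by simp
  then have "(\<lambda>p. (cmod (tensor_coeff \<phi> p))\<^sup>2) summable_on E \<times> F"
    by (rule summable_on_cong[THEN iffD1, rotated]) (auto simp: tensor_coeff_def)
  then show "tensor_coeff \<phi> \<in> carrier (l2 (E \<times> F))"
    by (simp add: in_l2_iff) (auto simp: tensor_coeff_def)
qed (use assms in \<open>simp_all add: hs_functionals_def\<close>)

lemma hs_left:
  assumes \<phi>: "\<phi> \<in> hs_functionals H K" and v: "v \<in> carrier K"
  shows "\<exists>y\<in>carrier H. \<forall>u\<in>carrier H. \<phi> u v = cinner H y u"
proof -
  obtain C where C: "\<And>u v. \<lbrakk>u \<in> carrier H; v \<in> carrier K\<rbrakk> \<Longrightarrow> cmod (\<phi> u v) \<le> C * hnorm H u * hnorm K v"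
    using hsD(6)[OF \<phi>] by blast
  have "\<exists>y\<in>carrier H. \<forall>u\<in>carrier H. cnj (\<phi> u v) = cinner H u y"
    by (rule H.riesz[of _ "C * hnorm K v"]) (use C v hsD[OF \<phi>] in \<open>auto simp: mult_ac\<close>)
  then obtain y where y: "y \<in> carrier H" "\<And>u. u \<in> carrier H \<Longrightarrow> cnj (\<phi> u v) = cinner H u y"
    by blast
  have "\<phi> u v = cinner H y u" if u: "u \<in> carrier H" for u
    using arg_cong[OF y(2)[OF u], of cnj] H.cinner_commute[OF y(1) u] by simp
  then show ?thesis using y(1) by blast
qed

lemma hs_right:
  assumes \<phi>: "\<phi> \<in> hs_functionals H K" and u: "u \<in> carrier H"
  shows "\<exists>y\<in>carrier K. \<forall>v\<in>carrier K. \<phi> u v = cinner K y v"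
proof -
  obtain C where C: "\<And>u v. \<lbrakk>u \<in> carrier H; v \<in> carrier K\<rbrakk> \<Longrightarrow> cmod (\<phi> u v) \<le> C * hnorm H u * hnorm K v"
    using hsD(6)[OF \<phi>] by blast
  have "\<exists>y\<in>carrier K. \<forall>v\<in>carrier K. cnj (\<phi> u v) = cinner K v y"
    by (rule K.riesz[of _ "C * hnorm H u"]) (use C u hsD[OF \<phi>] in \<open>auto simp: mult_ac\<close>)
  then obtain y where y: "y \<in> carrier K" "\<And>v. v \<in> carrier K \<Longrightarrow> cnj (\<phi> u v) = cinner K v y"
    by blast
  have "\<phi> u v = cinner K y v" if v: "v \<in> carrier K" for v
    using arg_cong[OF y(2)[OF v], of cnj] K.cinner_commute[OF y(1) v] by simp
  then show ?thesis using y(1) by blast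
qed

lemma onb_ext_H:
  "\<lbrakk>x \<in> carrier H; y \<in> carrier H; \<And>e. e \<in> E \<Longrightarrow> cinner H x e = cinner H y e\<rbrakk> \<Longrightarrow> x = y"
  using E(1) H.minus_eq_zero_iff[of x y] E(3) by (auto simp: orthonormal_basis_iff H.cinner_simps)

lemma onb_ext_K:
  "\<lbrakk>x \<in> carrier K; y \<in> carrier K; \<And>f. f \<in> F \<Longrightarrow> cinner K x f = cinner K y f\<rbrakk> \<Longrightarrow> x = y"
  using F(1) K.minus_eq_zero_iff[of x y] F(3) by (auto simp: orthonormal_basis_iff K.cinner_simps)

text \<open>Boundedness in each variable represents the slices of a functional by vectors, so
  agreement on the bases spreads to all arguments one variable at a time.\<close>

lemma hs_ext:
  assumes \<phi>: "\<phi> \<in> hs_functionals H K" and \<psi>: "\<psi> \<in> hs_functionals H K"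
    and eq: "\<And>e f. e \<in> E \<Longrightarrow> f \<in> F \<Longrightarrow> \<phi> e f = \<psi> e f"
  shows "\<phi> = \<psi>"
proof -
  have 1: "\<phi> u f = \<psi> u f" if u: "u \<in> carrier H" and f: "f \<in> F" for u f
  proof -
    obtain x y where x: "x \<in> carrier H" "\<And>u. u \<in> carrier H \<Longrightarrow> \<phi> u f = cinner H x u"
      and y: "y \<in> carrier H" "\<And>u. u \<in> carrier H \<Longrightarrow> \<psi> u f = cinner H y u"
      using hs_left[OF \<phi> F(3)[OF f]] hs_left[OF \<psi> F(3)[OF f]] by blast
    have "x = y"
    proof (rule onb_ext_H[OF x(1) y(1)])
      fix e assume e: "e \<in> E"
      show "cinner H x e = cinner H y e"
        unfolding x(2)[OF E(3)[OF e], symmetric] y(2)[OF E(3)[OF e], symmetric] by (rule eq[OF e f])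
    qed
    then show ?thesis using x(2) y(2) u by simp
  qed
  have 2: "\<phi> u v = \<psi> u v" if u: "u \<in> carrier H" and v: "v \<in> carrier K" for u v
  proof -
    obtain x y where x: "x \<in> carrier K" "\<And>v. v \<in> carrier K \<Longrightarrow> \<phi> u v = cinner K x v"
      and y: "y \<in> carrier K" "\<And>v. v \<in> carrier K \<Longrightarrow> \<psi> u v = cinner K y v"
      using hs_right[OF \<phi> u] hs_right[OF \<psi> u] by blast
    have "x = y"
    proof (rule onb_ext_K[OF x(1) y(1)])
      fix f assume f: "f \<in> F"
      show "cinner K x f = cinner K y f"
        unfolding x(2)[OF F(3)[OF f], symmetric] y(2)[OF F(3)[OF f], symmetric] by (rule 1[OF u f])
    qed
    then show ?thesis using x(2) y(2) v by simp
  qed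
  show ?thesis
  proof (intro ext)
    fix u v show "\<phi> u v = \<psi> u v"
      using 2 hsD(1)[OF \<phi>, of u v] hsD(1)[OF \<psi>, of u v] by (cases "u \<in> carrier H \<and> v \<in> carrier K") auto
  qed
qed

text \<open>The functional sends \<open>(u, v)\<close> to the inner product of \<open>c\<close> with
  the coefficients of \<open>u \<otimes> v\<close>; conjugate-linearity and boundedness are then
  those of the inner product of \<open>l2\<close>.\<close>

lemma hs_of_coeff:
  assumes c: "c \<in> carrier (l2 (E \<times> F))"
  shows "\<exists>\<phi>\<in>hs_functionals H K. tensor_coeff \<phi> = c"
proof -
  interpret L: hilbert_space "l2 (E \<times> F)" by (rule hilbert_space_l2)
  define \<phi> where "\<phi> u v = (if u \<in> carrier H \<and> v \<in> carrier K
    then cinner (l2 (E \<times> F)) c (prod_coeff u v) else 0)" for u v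
  note pc = prod_coeff_l2
  have ef: "\<phi> e f = c (e, f)" if e: "e \<in> E" and f: "f \<in> F" for e f
  proof -
    have "\<phi> e f = (\<Sum>\<^sub>\<infinity>p\<in>E \<times> F. c p * cnj (prod_coeff e f p))"
      using E(3)[OF e] F(3)[OF f] by (simp add: \<phi>_def)
    also have "\<dots> = (\<Sum>\<^sub>\<infinity>p\<in>{(e, f)}. c p)"
      by (rule infsum_cong_neutral)
        (use e f in \<open>auto simp: prod_coeff_def EE FF split: if_splits\<close>)
    finally show ?thesis by simp
  qed
  have tc: "tensor_coeff \<phi> = c"
    using c ef by (auto simp: tensor_coeff_def fun_eq_iff in_l2_iff)
  have "\<phi> \<in> hs_functionals H K"
  proof (rule hsI[of _ "hnorm (l2 (E \<times> F)) c"])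
    fix u u' v assume uv: "u \<in> carrier H" "u' \<in> carrier H" "v \<in> carrier K"
    have "prod_coeff (u \<oplus>\<^bsub>H\<^esub> u') v = prod_coeff u v \<oplus>\<^bsub>l2 (E \<times> F)\<^esub> prod_coeff u' v"
      using uv by (auto simp: prod_coeff_def H.cinner_simps E(3) fun_eq_iff algebra_simps)
    then show "\<phi> (u \<oplus>\<^bsub>H\<^esub> u') v = \<phi> u v + \<phi> u' v"
      using uv L.cinner_add_right[OF pc(1)[OF uv(1,3)] pc(1)[OF uv(2,3)] c] by (simp add: \<phi>_def del: l2_sel)
  next
    fix u v v' assume uv: "u \<in> carrier H" "v \<in> carrier K" "v' \<in> carrier K"
    have "prod_coeff u (v \<oplus>\<^bsub>K\<^esub> v') = prod_coeff u v \<oplus>\<^bsub>l2 (E \<times> F)\<^esub> prod_coeff u v'"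
      using uv by (auto simp: prod_coeff_def K.cinner_simps F(3) fun_eq_iff algebra_simps)
    then show "\<phi> u (v \<oplus>\<^bsub>K\<^esub> v') = \<phi> u v + \<phi> u v'"
      using uv L.cinner_add_right[OF pc(1)[OF uv(1,2)] pc(1)[OF uv(1,3)] c] by (simp add: \<phi>_def del: l2_sel)
  next
    fix a u v assume uv: "u \<in> carrier H" "v \<in> carrier K"
    have "prod_coeff (a \<odot>\<^bsub>H\<^esub> u) v = a \<odot>\<^bsub>l2 (E \<times> F)\<^esub> prod_coeff u v"
      using uv by (auto simp: prod_coeff_def H.cinner_simps E(3) fun_eq_iff)
    then show "\<phi> (a \<odot>\<^bsub>H\<^esub> u) v = cnj a * \<phi> u v"
      using uv L.cinner_smult_right[OF c pc(1)[OF uv]] by (simp add: \<phi>_def del: l2_sel)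
    have "prod_coeff u (a \<odot>\<^bsub>K\<^esub> v) = a \<odot>\<^bsub>l2 (E \<times> F)\<^esub> prod_coeff u v"
      using uv by (auto simp: prod_coeff_def K.cinner_simps F(3) fun_eq_iff)
    then show "\<phi> u (a \<odot>\<^bsub>K\<^esub> v) = cnj a * \<phi> u v"
      using uv L.cinner_smult_right[OF c pc(1)[OF uv]] by (simp add: \<phi>_def del: l2_sel)
  next
    fix u v assume uv: "u \<in> carrier H" "v \<in> carrier K"
    have "cmod (\<phi> u v) \<le> hnorm (l2 (E \<times> F)) c * hnorm (l2 (E \<times> F)) (prod_coeff u v)"
      using L.Cauchy_Schwarz[OF c pc(1)[OF uv]] uv by (simp add: \<phi>_def del: l2_sel)
    also have "\<dots> \<le> hnorm (l2 (E \<times> F)) c * (hnorm H u * hnorm K v)"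
      by (rule mult_left_mono[OF pc(2)[OF uv] L.hnorm_nonneg[OF c]])
    finally show "cmod (\<phi> u v) \<le> hnorm (l2 (E \<times> F)) c * hnorm H u * hnorm K v"
      by (simp add: mult.assoc)
  qed (use c tc in \<open>auto simp: \<phi>_def\<close>)
  then show ?thesis using tc by blast
qed

section \<open>The Hilbert space tensor product and its two coordinate decompositions\<close>

lemma hilbert_tensor_sel [simp]:
  "carrier (hilbert_tensor H K) = hs_functionals H K"
  "\<zero>\<^bsub>hilbert_tensor H K\<^esub> = (\<lambda>u v. 0)"
  "\<phi> \<oplus>\<^bsub>hilbert_tensor H K\<^esub> \<psi> = (\<lambda>u v. \<phi> u v + \<psi> u v)"
  "c \<odot>\<^bsub>hilbert_tensor H K\<^esub> \<phi> = (\<lambda>u v. c * \<phi> u v)"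
  by (simp_all add: hilbert_tensor_def)

lemma cinner_hilbert_tensor:
  "cinner (hilbert_tensor H K) \<phi> \<psi> = cinner (l2 (E \<times> F)) (tensor_coeff \<phi>) (tensor_coeff \<psi>)"
  by (simp add: hilbert_tensor_def) (rule infsum_cong, auto simp: tensor_coeff_def)

lemma hilbert_space_tensor: "hilbert_space (hilbert_tensor H K)"
proof (rule hilbert_space_iso[OF hilbert_space_l2[of "E \<times> F"], of tensor_coeff])
  have eq: "\<phi> e f = tensor_coeff \<phi> (e, f)" if "e \<in> E" "f \<in> F" for \<phi> e f
    using that by (simp add: tensor_coeff_def)
  show "bij_betw tensor_coeff (carrier (hilbert_tensor H K)) (carrier (l2 (E \<times> F)))"
  proof (rule bij_betwI')
    fix \<phi> \<psi> assume "\<phi> \<in> carrier (hilbert_tensor H K)" "\<psi> \<in> carrier (hilbert_tensor H K)"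
    then show "(tensor_coeff \<phi> = tensor_coeff \<psi>) = (\<phi> = \<psi>)"
      using hs_ext[of \<phi> \<psi>] by (auto simp: eq)
  next
    fix c assume "c \<in> carrier (l2 (E \<times> F))"
    then show "\<exists>\<phi>\<in>carrier (hilbert_tensor H K). c = tensor_coeff \<phi>"
      using hs_of_coeff[of c] by auto
  qed (simp add: hsD(7))
  fix \<phi> \<psi> c assume \<phi>: "\<phi> \<in> carrier (hilbert_tensor H K)"
  then have \<phi>': "\<phi> \<in> hs_functionals H K" by simp
  obtain C where C: "\<And>u v. \<lbrakk>u \<in> carrier H; v \<in> carrier K\<rbrakk> \<Longrightarrow> cmod (\<phi> u v) \<le> C * hnorm H u * hnorm K v"
    using hsD(6)[OF \<phi>'] by blast
  show tc: "tensor_coeff (c \<odot>\<^bsub>hilbert_tensor H K\<^esub> \<phi>) = c \<odot>\<^bsub>l2 (E \<times> F)\<^esub> tensor_coeff \<phi>"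
    by (auto simp: tensor_coeff_def fun_eq_iff)
  have "(\<lambda>u v. c * \<phi> u v) \<in> hs_functionals H K"
  proof (rule hsI[of _ "cmod c * C"])
    show "tensor_coeff (\<lambda>u v. c * \<phi> u v) \<in> carrier (l2 (E \<times> F))"
      using tc l2_smult_closed[OF hsD(7)[OF \<phi>']] by simp
    fix u v assume "u \<in> carrier H" "v \<in> carrier K"
    then show "cmod (c * \<phi> u v) \<le> cmod c * C * hnorm H u * hnorm K v"
      using mult_left_mono[OF C, of u v "cmod c"] by (simp add: norm_mult mult.assoc)
  qed (use hsD[OF \<phi>'] in \<open>auto simp: algebra_simps\<close>)
  then show "c \<odot>\<^bsub>hilbert_tensor H K\<^esub> \<phi> \<in> carrier (hilbert_tensor H K)"
    by simp
  assume \<psi>: "\<psi> \<in> carrier (hilbert_tensor H K)"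
  then have \<psi>': "\<psi> \<in> hs_functionals H K" by simp
  obtain D where D: "\<And>u v. \<lbrakk>u \<in> carrier H; v \<in> carrier K\<rbrakk> \<Longrightarrow> cmod (\<psi> u v) \<le> D * hnorm H u * hnorm K v"
    using hsD(6)[OF \<psi>'] by blast
  show ta: "tensor_coeff (\<phi> \<oplus>\<^bsub>hilbert_tensor H K\<^esub> \<psi>) = tensor_coeff \<phi> \<oplus>\<^bsub>l2 (E \<times> F)\<^esub> tensor_coeff \<psi>"
    by (auto simp: tensor_coeff_def fun_eq_iff)
  have "(\<lambda>u v. \<phi> u v + \<psi> u v) \<in> hs_functionals H K"
  proof (rule hsI[of _ "C + D"])
    show "tensor_coeff (\<lambda>u v. \<phi> u v + \<psi> u v) \<in> carrier (l2 (E \<times> F))"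
      using ta l2_add_closed[OF hsD(7)[OF \<phi>'] hsD(7)[OF \<psi>']] by simp
    fix u v assume uv: "u \<in> carrier H" "v \<in> carrier K"
    show "cmod (\<phi> u v + \<psi> u v) \<le> (C + D) * hnorm H u * hnorm K v"
      using norm_triangle_ineq[of "\<phi> u v" "\<psi> u v"] C[OF uv] D[OF uv] by (simp add: distrib_right)
  qed (use hsD[OF \<phi>'] hsD[OF \<psi>'] in \<open>auto simp: algebra_simps\<close>)
  then show "\<phi> \<oplus>\<^bsub>hilbert_tensor H K\<^esub> \<psi> \<in> carrier (hilbert_tensor H K)"
    by simp
  show "cinner (hilbert_tensor H K) \<phi> \<psi> = cinner (l2 (E \<times> F)) (tensor_coeff \<phi>) (tensor_coeff \<psi>)"
    by (rule cinner_hilbert_tensor)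
next
  have z: "tensor_coeff (\<lambda>u v. 0) = (\<lambda>p. 0)"
    by (auto simp: tensor_coeff_def)
  then show "tensor_coeff \<zero>\<^bsub>hilbert_tensor H K\<^esub> = \<zero>\<^bsub>l2 (E \<times> F)\<^esub>"
    by simp
  have "(\<lambda>u v. 0) \<in> hs_functionals H K"
    by (rule hsI[of _ 0]) (auto simp: z in_l2_iff)
  then show "\<zero>\<^bsub>hilbert_tensor H K\<^esub> \<in> carrier (hilbert_tensor H K)"
    by simp
qed

lemma tensor_vec_apply [simp]:
  "\<lbrakk>u \<in> carrier H; v \<in> carrier K\<rbrakk> \<Longrightarrow> tensor_vec H K x y u v = cinner H x u * cinner K y v"
  by (simp add: tensor_vec_def)

lemma tensor_vec_closed [simp]:
  assumes x: "x \<in> carrier H" and y: "y \<in> carrier K"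
  shows "tensor_vec H K x y \<in> hs_functionals H K"
proof (rule hsI[of _ "hnorm H x * hnorm K y"])
  have "tensor_coeff (tensor_vec H K x y) = prod_coeff x y"
    by (auto simp: tensor_coeff_def prod_coeff_def E(3) F(3) fun_eq_iff)
  then show "tensor_coeff (tensor_vec H K x y) \<in> carrier (l2 (E \<times> F))"
    using prod_coeff_l2(1)[OF x y] by simp
  fix u v assume uv: "u \<in> carrier H" "v \<in> carrier K"
  have "cmod (cinner H x u) * cmod (cinner K y v) \<le> (hnorm H x * hnorm H u) * (hnorm K y * hnorm K v)"
    using uv x y H.Cauchy_Schwarz[of x u] K.Cauchy_Schwarz[of y v] H.hnorm_nonneg
    by (intro mult_mono) auto
  then show "cmod (tensor_vec H K x y u v) \<le> hnorm H x * hnorm K y * hnorm H u * hnorm K v"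
    using uv by (simp add: norm_mult mult_ac)
qed (use x y in \<open>auto simp: tensor_vec_def H.cinner_simps K.cinner_simps algebra_simps\<close>)

text \<open>The slice map \<open>1 \<otimes> \<langle>\<cdot>, v\<rangle>\<close>: it takes
  \<open>x \<otimes> y\<close> to the multiple of \<open>x\<close> by \<open>cinner K y v\<close>
  (\<open>coord_tensor_vec\<close>), and for basis vectors \<open>v\<close> it is adjoint to
  \<open>x \<mapsto> x \<otimes> v\<close>.\<close>

definition coord :: "'k \<Rightarrow> ('h \<Rightarrow> 'k \<Rightarrow> complex) \<Rightarrow> 'h" where
  "coord v \<phi> = (SOME y. y \<in> carrier H \<and> (\<forall>u\<in>carrier H. \<phi> u v = cinner H y u))"

definition coord' :: "'h \<Rightarrow> ('h \<Rightarrow> 'k \<Rightarrow> complex) \<Rightarrow> 'k" where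
  "coord' u \<phi> = (SOME y. y \<in> carrier K \<and> (\<forall>v\<in>carrier K. \<phi> u v = cinner K y v))"

lemma coord:
  assumes "\<phi> \<in> hs_functionals H K" "v \<in> carrier K"
  shows "coord v \<phi> \<in> carrier H" "\<And>u. u \<in> carrier H \<Longrightarrow> cinner H (coord v \<phi>) u = \<phi> u v"
proof -
  have "coord v \<phi> \<in> carrier H \<and> (\<forall>u\<in>carrier H. \<phi> u v = cinner H (coord v \<phi>) u)"
    unfolding coord_def by (rule someI2_bex[OF hs_left[OF assms]]) blast
  then show "coord v \<phi> \<in> carrier H" "\<And>u. u \<in> carrier H \<Longrightarrow> cinner H (coord v \<phi>) u = \<phi> u v"
    by auto
qed

lemma coord':
  assumes "\<phi> \<in> hs_functionals H K" "u \<in> carrier H"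
  shows "coord' u \<phi> \<in> carrier K" "\<And>v. v \<in> carrier K \<Longrightarrow> cinner K (coord' u \<phi>) v = \<phi> u v"
proof -
  have "coord' u \<phi> \<in> carrier K \<and> (\<forall>v\<in>carrier K. \<phi> u v = cinner K (coord' u \<phi>) v)"
    unfolding coord'_def by (rule someI2_bex[OF hs_right[OF assms]]) blast
  then show "coord' u \<phi> \<in> carrier K" "\<And>v. v \<in> carrier K \<Longrightarrow> cinner K (coord' u \<phi>) v = \<phi> u v"
    by auto
qed

lemma coord_tensor_vec:
  assumes "x \<in> carrier H" "y \<in> carrier K" "v \<in> carrier K"
  shows "coord v (tensor_vec H K x y) = cinner K y v \<odot>\<^bsub>H\<^esub> x"
  using assms coord[OF tensor_vec_closed[OF assms(1,2)] assms(3)]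
  by (intro H.cinner_extl) (auto simp: H.cinner_simps)

lemma coord'_tensor_vec:
  assumes "x \<in> carrier H" "y \<in> carrier K" "u \<in> carrier H"
  shows "coord' u (tensor_vec H K x y) = cinner H x u \<odot>\<^bsub>K\<^esub> y"
  using assms coord'[OF tensor_vec_closed[OF assms(1,2)] assms(3)]
  by (intro K.cinner_extl) (auto simp: K.cinner_simps)

text \<open>A basis of \<open>K\<close> splits \<open>H \<otimes> K\<close> into copies of
  \<open>H\<close>. Inclusions and slices are adjoint because the coefficients of
  \<open>x \<otimes> f\<close> vanish off the column of \<open>f\<close>, where the sum over pairs
  reduces to Parseval in \<open>H\<close>.\<close>

sublocale amplification H "hilbert_tensor H K" "some_onb K" "\<lambda>f x. tensor_vec H K x f" coord
proof (rule amplification.intro[OF H.hilbert_space_axioms hilbert_space_tensor amplification_axioms.intro])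
  fix f x \<phi> assume f: "f \<in> F" and x: "x \<in> carrier H" and \<phi>: "\<phi> \<in> carrier (hilbert_tensor H K)"
  have \<phi>': "\<phi> \<in> hs_functionals H K" using \<phi> by simp
  note c = coord[OF \<phi>' F(3)[OF f]]
  have "cinner (hilbert_tensor H K) (tensor_vec H K x f) \<phi>
      = (\<Sum>\<^sub>\<infinity>p\<in>E \<times> F. tensor_coeff (tensor_vec H K x f) p * cnj (tensor_coeff \<phi> p))"
    by (simp add: cinner_hilbert_tensor)
  also have "\<dots> = (\<Sum>\<^sub>\<infinity>p\<in>E \<times> {f}. cinner H x (fst p) * cnj (\<phi> (fst p) f))"
    by (rule infsum_cong_neutral)
      (use f E(3) F(3) in \<open>auto simp: tensor_coeff_def FF split: if_splits\<close>)
  also have "\<dots> = (\<Sum>\<^sub>\<infinity>e\<in>E. cinner H x e * cnj (\<phi> e f))"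
    by (rule infsum_reindex_bij_witness[where i = "\<lambda>e. (e, f)" and j = fst]) auto
  also have "\<dots> = cinner (l2 E) (onb_coeff H E x) (onb_coeff H E (coord f \<phi>))"
    using c E(3) by (auto simp: onb_coeff_def intro!: infsum_cong)
  also have "\<dots> = cinner H x (coord f \<phi>)"
    by (rule H.parseval[OF E(1) x c(1), symmetric])
  finally show "cinner (hilbert_tensor H K) (tensor_vec H K x f) \<phi> = cinner H x (coord f \<phi>)" .
next
  fix f g x assume fg: "f \<in> F" "g \<in> F" and x: "x \<in> carrier H"
  then show "coord f (tensor_vec H K x g) = (if f = g then x else \<zero>\<^bsub>H\<^esub>)"
    using F by (auto simp: coord_tensor_vec orthonormal_def)
next
  fix \<phi> assume \<phi>: "\<phi> \<in> carrier (hilbert_tensor H K)" and 0: "\<And>f. f \<in> F \<Longrightarrow> coord f \<phi> = \<zero>\<^bsub>H\<^esub>"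
  have \<phi>': "\<phi> \<in> hs_functionals H K" using \<phi> by simp
  interpret T: hilbert_space "hilbert_tensor H K" by (rule hilbert_space_tensor)
  have "\<phi> e f = 0" if "e \<in> E" "f \<in> F" for e f
    using coord(2)[OF \<phi>' F(3)[OF that(2)] E(3)[OF that(1)]] 0[OF that(2)] E(3)[OF that(1)]
    by (simp add: H.cinner_simps)
  moreover have "(\<lambda>u v. 0) \<in> hs_functionals H K"
    using T.M.zero_closed by simp
  ultimately show "\<phi> = \<zero>\<^bsub>hilbert_tensor H K\<^esub>"
    using hs_ext[OF \<phi>'] by simp
qed (use F(3) coord in auto)

text \<open>The symmetric splitting into copies of \<open>K\<close>, in which amplifying
  \<open>Y\<close> gives \<open>1 \<otimes> Y\<close>. It is interpreted only locally, so that
  \<open>amp\<close> and \<open>mats\<close> keep referring to the copies of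
  \<open>H\<close>.\<close>

lemma amplification': "amplification K (hilbert_tensor H K) E (\<lambda>e y. tensor_vec H K e y) coord'"
proof (rule amplification.intro[OF K.hilbert_space_axioms hilbert_space_tensor amplification_axioms.intro])
  fix e y \<phi> assume e: "e \<in> E" and y: "y \<in> carrier K" and \<phi>: "\<phi> \<in> carrier (hilbert_tensor H K)"
  have \<phi>': "\<phi> \<in> hs_functionals H K" using \<phi> by simp
  note c = coord'[OF \<phi>' E(3)[OF e]]
  have "((\<lambda>f. cinner H (coord f (tensor_vec H K e y)) (coord f \<phi>))
      has_sum cinner (hilbert_tensor H K) (tensor_vec H K e y) \<phi>) F"
    using e y \<phi> E(3) by (intro parseval_C) auto
  then have "cinner (hilbert_tensor H K) (tensor_vec H K e y) \<phi>
      = (\<Sum>\<^sub>\<infinity>f\<in>F. cinner H (coord f (tensor_vec H K e y)) (coord f \<phi>))"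
    by (simp add: infsumI)
  also have "\<dots> = cinner (l2 F) (onb_coeff K F y) (onb_coeff K F (coord' e \<phi>))"
  proof -
    have "cinner H (coord f (tensor_vec H K e y)) (coord f \<phi>) = cinner K y f * cnj (cinner K (coord' e \<phi>) f)"
      if f: "f \<in> F" for f
      using coord[OF \<phi>' F(3)[OF f]] c(2)[OF F(3)[OF f]] y E(3)[OF e] F(3)[OF f]
        H.cinner_commute[of e "coord f \<phi>"] by (simp add: coord_tensor_vec H.cinner_simps)
    then show ?thesis
      by (auto simp: onb_coeff_def intro!: infsum_cong)
  qed
  also have "\<dots> = cinner K y (coord' e \<phi>)"
    by (rule K.parseval[OF F(1) y c(1), symmetric])
  finally show "cinner (hilbert_tensor H K) (tensor_vec H K e y) \<phi> = cinner K y (coord' e \<phi>)" .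
next
  fix e g y assume eg: "e \<in> E" "g \<in> E" and y: "y \<in> carrier K"
  then show "coord' e (tensor_vec H K g y) = (if e = g then y else \<zero>\<^bsub>K\<^esub>)"
    using E by (auto simp: coord'_tensor_vec orthonormal_def)
next
  fix \<phi> assume \<phi>: "\<phi> \<in> carrier (hilbert_tensor H K)" and 0: "\<And>e. e \<in> E \<Longrightarrow> coord' e \<phi> = \<zero>\<^bsub>K\<^esub>"
  have \<phi>': "\<phi> \<in> hs_functionals H K" using \<phi> by simp
  interpret T: hilbert_space "hilbert_tensor H K" by (rule hilbert_space_tensor)
  have "\<phi> e f = 0" if "e \<in> E" "f \<in> F" for e f
    using coord'(2)[OF \<phi>' E(3)[OF that(1)] F(3)[OF that(2)]] 0[OF that(1)] F(3)[OF that(2)]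
    by (simp add: K.cinner_simps)
  moreover have "(\<lambda>u v. 0) \<in> hs_functionals H K"
    using T.M.zero_closed by simp
  ultimately show "\<phi> = \<zero>\<^bsub>hilbert_tensor H K\<^esub>"
    using hs_ext[OF \<phi>'] by simp
qed (use E(3) coord' in auto)

lemma tensor_op_eqI:
  assumes Z: "Z \<in> bounded_ops (hilbert_tensor H K)"
    and eq: "\<And>x y. \<lbrakk>x \<in> carrier H; y \<in> carrier K\<rbrakk> \<Longrightarrow> Z (tensor_vec H K x y) = tensor_vec H K (X x) (Y y)"
  shows "tensor_op H K X Y = Z"
  unfolding tensor_op_def
proof (rule the_equality)
  show "Z \<in> bounded_ops (hilbert_tensor H K) \<and> (\<forall>x\<in>carrier H. \<forall>y\<in>carrier K. Z (tensor_vec H K x y) = tensor_vec H K (X x) (Y y))"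
    using assms by blast
  fix Z' assume Z': "Z' \<in> bounded_ops (hilbert_tensor H K) \<and>
    (\<forall>x\<in>carrier H. \<forall>y\<in>carrier K. Z' (tensor_vec H K x y) = tensor_vec H K (X x) (Y y))"
  show "Z' = Z"
    by (rule op_eqI_J) (use Z' Z eq F(3) in auto)
qed

text \<open>The operator is the product of \<open>X \<otimes> 1\<close>, amplified over the basis of
  \<open>K\<close>, and \<open>1 \<otimes> Y\<close>, amplified over the basis of \<open>H\<close>;
  \<open>tensor_op_eqI\<close> identifies it with the definite description.\<close>

lemma tensor_op:
  assumes X: "X \<in> bounded_ops H" and Y: "Y \<in> bounded_ops K"
  shows "tensor_op H K X Y \<in> bounded_ops (hilbert_tensor H K)"
    and "\<And>x y. \<lbrakk>x \<in> carrier H; y \<in> carrier K\<rbrakk>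
      \<Longrightarrow> tensor_op H K X Y (tensor_vec H K x y) = tensor_vec H K (X x) (Y y)"
proof -
  interpret A: amplification K "hilbert_tensor H K" E "\<lambda>e y. tensor_vec H K e y" coord'
    by (rule amplification')
  define Z where "Z = op_mult (hilbert_tensor H K) (amp X) (A.amp Y)"
  have Z: "Z \<in> bounded_ops (hilbert_tensor H K)"
    using X Y by (simp add: Z_def)
  have ZXY: "Z (tensor_vec H K x y) = tensor_vec H K (X x) (Y y)" if xy: "x \<in> carrier H" "y \<in> carrier K" for x y
  proof -
    have tv: "tensor_vec H K x y \<in> carrier (hilbert_tensor H K)" "tensor_vec H K x (Y y) \<in> carrier (hilbert_tensor H K)"
      "tensor_vec H K (X x) (Y y) \<in> carrier (hilbert_tensor H K)"
      using X Y xy by simp_all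
    have "A.amp Y (tensor_vec H K x y) = tensor_vec H K x (Y y)"
    proof (rule A.C_ext[OF bounded_ops_closed[OF A.amp_closed[OF Y] tv(1)] tv(2)])
      fix e assume e: "e \<in> E"
      show "coord' e (A.amp Y (tensor_vec H K x y)) = coord' e (tensor_vec H K x (Y y))"
        unfolding A.C_amp[OF Y tv(1) e] using Y xy E(3)[OF e]
        by (simp add: coord'_tensor_vec bounded_ops_smult)
    qed
    moreover have "amp X (tensor_vec H K x (Y y)) = tensor_vec H K (X x) (Y y)"
    proof (rule C_ext[OF bounded_ops_closed[OF amp_closed[OF X] tv(2)] tv(3)])
      fix f assume f: "f \<in> F"
      show "coord f (amp X (tensor_vec H K x (Y y))) = coord f (tensor_vec H K (X x) (Y y))"
        unfolding C_amp[OF X tv(2) f] using X Y xy F(3)[OF f]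
        by (simp add: coord_tensor_vec bounded_ops_smult)
    qed
    ultimately show ?thesis
      using xy by (simp add: Z_def)
  qed
  have "tensor_op H K X Y = Z"
    by (rule tensor_op_eqI[OF Z ZXY])
  then show "tensor_op H K X Y \<in> bounded_ops (hilbert_tensor H K)"
    and "\<And>x y. \<lbrakk>x \<in> carrier H; y \<in> carrier K\<rbrakk>
      \<Longrightarrow> tensor_op H K X Y (tensor_vec H K x y) = tensor_vec H K (X x) (Y y)"
    using Z ZXY by auto
qed

lemma tensor_vec_smult:
  "\<lbrakk>x \<in> carrier H; y \<in> carrier K\<rbrakk> \<Longrightarrow> tensor_vec H K (c \<odot>\<^bsub>H\<^esub> x) y = tensor_vec H K x (c \<odot>\<^bsub>K\<^esub> y)"
  by (auto simp: tensor_vec_def fun_eq_iff H.cinner_simps K.cinner_simps)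

text \<open>\<open>mats N\<close> is the commutant of the amplified commutant of \<open>N\<close>,
  hence a von Neumann algebra, and it contains the generators because the entries of
  \<open>X \<otimes> Y\<close> are scalar multiples of \<open>X\<close>. Conversely, each block of a
  matrix over \<open>N\<close> is an elementary tensor, so \<open>mats_subset_closed\<close> applies
  to every algebra that contains the generators.\<close>

lemma von_neumann_tensor_eq_mats:
  assumes N: "von_neumann_algebra H N" and NN: "commutant H (commutant H N) = N"
  shows "von_neumann_tensor H K N (bounded_ops K) = mats N"
proof
  have Nb: "N \<subseteq> bounded_ops H" and Nsm: "\<And>c A. A \<in> N \<Longrightarrow> op_smult H c A \<in> N"
    using N by (auto simp: von_neumann_algebra_def)
  have adj: "adj_closed_set H (commutant H N)"
    unfolding adj_closed_set_def
    using H.commutant_adj[OF von_neumann_algebra_adj_closed[OF N]] by auto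
  then have cb: "commutant H N \<subseteq> bounded_ops H" by (simp add: adj_closed_set_def)
  have "mats N = commutant (hilbert_tensor H K) (amp ` commutant H N)"
    using mats_commutant[OF cb] NN by simp
  then have vN: "von_neumann_algebra (hilbert_tensor H K) (mats N)"
    using T.von_neumann_algebra_commutant[OF amp_adj_closed_set[OF adj]] by simp
  have "tensor_op H K X Y \<in> mats N" if XY: "X \<in> N" "Y \<in> bounded_ops K" for X Y
    unfolding mats_def
  proof (intro CollectI conjI ballI)
    have Xb: "X \<in> bounded_ops H" using XY Nb by blast
    note t = tensor_op[OF Xb XY(2)]
    show "tensor_op H K X Y \<in> bounded_ops (hilbert_tensor H K)" by (rule t(1))
    fix f g assume fg: "f \<in> F" "g \<in> F"
    have "entry f g (tensor_op H K X Y) = op_smult H (cinner K (Y g) f) X"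
    proof (rule H.ops_eqI)
      fix x assume x: "x \<in> carrier H"
      show "entry f g (tensor_op H K X Y) x = op_smult H (cinner K (Y g) f) X x"
        using x fg F(3) t(2)[OF x F(3)[OF fg(2)]] Xb XY(2) by (simp add: coord_tensor_vec)
    qed (use fg t(1) Xb in auto)
    then show "entry f g (tensor_op H K X Y) \<in> N"
      using Nsm[OF XY(1)] by simp
  qed
  then have "{tensor_op H K X Y |X Y. X \<in> N \<and> Y \<in> bounded_ops K} \<subseteq> mats N" by blast
  then show "von_neumann_tensor H K N (bounded_ops K) \<subseteq> mats N"
    unfolding von_neumann_tensor_def generated_von_neumann_algebra_def using vN by blast
  show "mats N \<subseteq> von_neumann_tensor H K N (bounded_ops K)"
    unfolding von_neumann_tensor_def generated_von_neumann_algebra_def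
  proof (intro subsetI InterI, elim CollectE conjE)
    fix S A assume S: "S \<in> mats N" and A: "von_neumann_algebra (hilbert_tensor H K) A"
      and gen: "{tensor_op H K X Y |X Y. X \<in> N \<and> Y \<in> bounded_ops K} \<subseteq> A"
    show "S \<in> A"
    proof (rule mats_subset_closed[OF A])
      show "S \<in> bounded_ops (hilbert_tensor H K)" using S by (simp add: mats_def)
      fix f g assume fg: "f \<in> F" "g \<in> F"
      define X where "X = entry f g S"
      have X: "X \<in> N" "X \<in> bounded_ops H" using S fg Nb by (auto simp: X_def mats_def)
      \<comment> \<open>The matrix unit taking the basis vector \<open>g\<close> to
        \<open>f\<close>; tensored with \<open>X\<close> it is the block of \<open>S\<close> in row
        \<open>f\<close> and column \<open>g\<close>.\<close>
      define Y where "Y = (\<lambda>y\<in>carrier K. cinner K y g \<odot>\<^bsub>K\<^esub> f)"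
      have Y: "Y \<in> bounded_ops K"
        unfolding Y_def
      proof (rule K.bounded_opsI[of _ "hnorm K g * hnorm K f"])
        fix y assume y: "y \<in> carrier K"
        have "cmod (cinner K y g) * hnorm K f \<le> hnorm K y * hnorm K g * hnorm K f"
          using K.Cauchy_Schwarz[OF y F(3)[OF fg(2)]] K.hnorm_nonneg[OF F(3)[OF fg(1)]] by (rule mult_right_mono)
        then show "hnorm K (cinner K y g \<odot>\<^bsub>K\<^esub> f) \<le> hnorm K g * hnorm K f * hnorm K y"
          using F(3)[OF fg(1)] by (simp add: K.hnorm_smult mult_ac)
      qed (use F(3) fg in \<open>auto simp: K.cinner_simps algebra_simps intro!: K.cinner_extl\<close>)
      have "tensor_op H K X Y = (\<lambda>w\<in>carrier (hilbert_tensor H K). tensor_vec H K (X (coord g w)) f)"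
      proof (rule tensor_op_eqI)
        obtain b where b: "b > 0" "\<And>x. x \<in> carrier H \<Longrightarrow> hnorm H (X x) \<le> b * hnorm H x"
          using H.bounded_ops_bound[OF X(2)] by blast
        show "(\<lambda>w\<in>carrier (hilbert_tensor H K). tensor_vec H K (X (coord g w)) f) \<in> bounded_ops (hilbert_tensor H K)"
        proof (rule T.bounded_opsI[of _ b])
          fix w assume w: "w \<in> carrier (hilbert_tensor H K)"
          have "hnorm H (X (coord g w)) \<le> b * hnorm (hilbert_tensor H K) w"
            by (rule order_trans[OF b(2)[OF C_closed[OF fg(2) w]] mult_left_mono[OF hnorm_C_le[OF fg(2) w]]])
              (use b(1) in simp)
          then show "hnorm (hilbert_tensor H K) (tensor_vec H K (X (coord g w)) f) \<le> b * hnorm (hilbert_tensor H K) w"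
            using hnorm_J[OF fg(1)] X(2) C_closed[OF fg(2) w] by simp
          show "tensor_vec H K (X (coord g w)) f \<in> carrier (hilbert_tensor H K)"
            using J_closed[OF fg(1)] X(2) C_closed[OF fg(2) w] by simp
        next
          fix v w assume vw: "v \<in> carrier (hilbert_tensor H K)" "w \<in> carrier (hilbert_tensor H K)"
          show "tensor_vec H K (X (coord g (v \<oplus>\<^bsub>hilbert_tensor H K\<^esub> w))) f
            = tensor_vec H K (X (coord g v)) f \<oplus>\<^bsub>hilbert_tensor H K\<^esub> tensor_vec H K (X (coord g w)) f"
            unfolding C_add[OF fg(2) vw]
            using C_closed[OF fg(2) vw(1)] C_closed[OF fg(2) vw(2)] X(2) J_add[OF fg(1)]
            by (simp add: bounded_ops_add del: hilbert_tensor_sel)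
        next
          fix c w assume w: "w \<in> carrier (hilbert_tensor H K)"
          show "tensor_vec H K (X (coord g (c \<odot>\<^bsub>hilbert_tensor H K\<^esub> w))) f
            = c \<odot>\<^bsub>hilbert_tensor H K\<^esub> tensor_vec H K (X (coord g w)) f"
            unfolding C_smult[OF fg(2) w]
            using C_closed[OF fg(2) w] X(2) J_smult[OF fg(1)]
            by (simp add: bounded_ops_smult del: hilbert_tensor_sel)
        qed
        fix x y assume xy: "x \<in> carrier H" "y \<in> carrier K"
        show "(\<lambda>w\<in>carrier (hilbert_tensor H K). tensor_vec H K (X (coord g w)) f) (tensor_vec H K x y)
          = tensor_vec H K (X x) (Y y)"
          using xy fg F(3) X(2) by (simp add: Y_def coord_tensor_vec bounded_ops_smult tensor_vec_smult)
      qed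
      moreover have "tensor_op H K X Y \<in> A"
        using gen X(1) Y by blast
      ultimately show "(\<lambda>w\<in>carrier (hilbert_tensor H K). tensor_vec H K (entry f g S (coord g w)) f) \<in> A"
        unfolding X_def by simp
    qed
  qed
qed

end

section \<open>Isometries and unitaries intertwining two families of operators\<close>

text \<open>A pair holds the images of one algebra element under two representations on the same
  space, so that intertwiners can be discussed without naming the algebra; \<open>prod.swap\<close>
  exchanges the representations.\<close>

definition adj_closed_pairs :: "'a hilbert \<Rightarrow> (('a \<Rightarrow> 'a) \<times> ('a \<Rightarrow> 'a)) set \<Rightarrow> bool" where
  "adj_closed_pairs H G \<longleftrightarrow> G \<subseteq> bounded_ops H \<times> bounded_ops H
    \<and> (\<forall>(a, b)\<in>G. (op_adj H a, op_adj H b) \<in> G)"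

definition intertwines :: "'a hilbert \<Rightarrow> (('a \<Rightarrow> 'a) \<times> ('a \<Rightarrow> 'a)) set \<Rightarrow> ('a \<Rightarrow> 'a) \<Rightarrow> bool" where
  "intertwines H G V \<longleftrightarrow> V \<in> bounded_ops H \<and> (\<forall>(a, b)\<in>G. \<forall>x\<in>carrier H. V (a x) = b (V x))"

definition isometry_op :: "'a hilbert \<Rightarrow> ('a \<Rightarrow> 'a) \<Rightarrow> bool" where
  "isometry_op H V \<longleftrightarrow> V \<in> bounded_ops H \<and> (\<forall>x\<in>carrier H. op_adj H V (V x) = x)"

lemma intertwinesD:
  "\<lbrakk>intertwines H G V; (a, b) \<in> G; x \<in> carrier H\<rbrakk> \<Longrightarrow> V (a x) = b (V x)"
  by (auto simp: intertwines_def)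

lemma adj_closed_pairsD:
  assumes "adj_closed_pairs H G" "(a, b) \<in> G"
  shows "a \<in> bounded_ops H" "b \<in> bounded_ops H" "(op_adj H a, op_adj H b) \<in> G"
  using assms by (auto simp: adj_closed_pairs_def)

lemma adj_closed_pairs_swap: "adj_closed_pairs H G \<Longrightarrow> adj_closed_pairs H (prod.swap ` G)"
  by (auto simp: adj_closed_pairs_def subset_eq)

context hilbert_space
begin

lemma unitary_opD:
  assumes "unitary_op H U"
  shows "U \<in> bounded_ops H" "\<And>x. x \<in> carrier H \<Longrightarrow> op_adj H U (U x) = x"
    "\<And>x. x \<in> carrier H \<Longrightarrow> U (op_adj H U x) = x"
proof -
  have 1: "op_mult H (op_adj H U) U = op_one H" and 2: "op_mult H U (op_adj H U) = op_one H"
    and 3: "U \<in> bounded_ops H"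
    using assms by (auto simp: unitary_op_def)
  show "U \<in> bounded_ops H" by (rule 3)
  fix x assume x: "x \<in> carrier H"
  show "op_adj H U (U x) = x" using fun_cong[OF 1, of x] x by simp
  show "U (op_adj H U x) = x" using fun_cong[OF 2, of x] x by simp
qed

lemma unitary_opI:
  assumes "U \<in> bounded_ops H" "\<And>x. x \<in> carrier H \<Longrightarrow> op_adj H U (U x) = x"
    "\<And>x. x \<in> carrier H \<Longrightarrow> U (op_adj H U x) = x"
  shows "unitary_op H U"
proof -
  have "op_mult H (op_adj H U) U = op_one H" "op_mult H U (op_adj H U) = op_one H"
    by (rule ops_eqI; use assms in simp)+
  then show ?thesis using assms(1) by (simp add: unitary_op_def)
qed

lemma intertwines_adj:
  assumes G: "adj_closed_pairs H G" and V: "intertwines H G V"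
  shows "intertwines H (prod.swap ` G) (op_adj H V)"
proof -
  have Vb: "V \<in> bounded_ops H" using V by (simp add: intertwines_def)
  have "op_adj H V (b x) = a (op_adj H V x)" if ab: "(a, b) \<in> G" and x: "x \<in> carrier H" for a b x
  proof (rule cinner_extr)
    note p = adj_closed_pairsD[OF G ab]
    fix z assume z: "z \<in> carrier H"
    have "cinner H z (op_adj H V (b x)) = cinner H (op_adj H b (V z)) x"
      using p Vb x z by (simp add: cinner_adj cinner_adj')
    also have "\<dots> = cinner H (V (op_adj H a z)) x"
      using intertwinesD[OF V p(3) z] by simp
    also have "\<dots> = cinner H (op_adj H a z) (op_adj H V x)"
      using p Vb x z by (simp add: cinner_adj)
    also have "\<dots> = cinner H z (a (op_adj H V x))"
      using p Vb x z by (intro cinner_adj') auto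
    finally show "cinner H z (op_adj H V (b x)) = cinner H z (a (op_adj H V x))" .
  qed (use Vb x adj_closed_pairsD[OF G ab] in auto)
  then show ?thesis using Vb by (auto simp: intertwines_def)
qed

text \<open>A trivial orthogonal complement stands for density: the difference of the adjoints maps
  every vector into that complement.\<close>

lemma bounded_ops_eqI_dense:
  assumes S: "S \<subseteq> carrier H" "orth H S \<subseteq> {\<zero>}" and P: "P \<in> bounded_ops H" "Q \<in> bounded_ops H"
    and eq: "\<And>s. s \<in> S \<Longrightarrow> P s = Q s"
  shows "P = Q"
proof -
  have "op_adj H P y = op_adj H Q y" if y: "y \<in> carrier H" for y
  proof -
    have "cinner H (op_adj H P y \<ominus> op_adj H Q y) s = 0" if s: "s \<in> S" for s
      using S(1) s P y eq[OF s] by (auto simp: cinner_simps cinner_adj')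
    then have "op_adj H P y \<ominus> op_adj H Q y \<in> orth H S"
      using P y by (simp add: orth_def)
    then have "op_adj H P y \<ominus> op_adj H Q y = \<zero>" using S(2) by blast
    then show ?thesis using minus_eq_zero_iff[of "op_adj H P y" "op_adj H Q y"] P y by simp
  qed
  then have "op_adj H P = op_adj H Q" using P by (intro ops_eqI) auto
  from arg_cong[OF this, of "op_adj H"] show ?thesis using P by simp
qed

text \<open>The contraction \<open>g\<close> lives only on \<open>S\<close>. Instead of extending it
  by continuity, its adjoint is built directly, with \<open>D v\<close> representing
  \<open>s \<mapsto> \<langle>g s, v\<rangle>\<close>. Taking \<open>D v\<close> in the closure of
  \<open>S\<close> makes it unique, whence linearity.\<close>

lemma contraction_adjoint_ex:
  assumes S: "S \<subseteq> carrier H" "\<zero> \<in> S" "\<And>x y. x \<in> S \<Longrightarrow> y \<in> S \<Longrightarrow> x \<oplus> y \<in> S"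
      "\<And>c x. x \<in> S \<Longrightarrow> c \<odot> x \<in> S"
    and g: "\<And>s. s \<in> S \<Longrightarrow> g s \<in> carrier H" "\<And>s t. s \<in> S \<Longrightarrow> t \<in> S \<Longrightarrow> g (s \<oplus> t) = g s \<oplus> g t"
      "\<And>c s. s \<in> S \<Longrightarrow> g (c \<odot> s) = c \<odot> g s" "\<And>s. s \<in> S \<Longrightarrow> hnorm H (g s) \<le> hnorm H s"
  shows "\<exists>D\<in>bounded_ops H. (\<forall>v\<in>carrier H. D v \<in> orth H (orth H S))
    \<and> (\<forall>s\<in>S. \<forall>v\<in>carrier H. cinner H s (D v) = cinner H (g s) v)"
proof -
  have Sc: "s \<in> carrier H" if "s \<in> S" for s using S(1) that by blast
  have "\<exists>y\<in>carrier H. (\<exists>s. (\<forall>n::nat. s n \<in> S) \<and> (\<lambda>n. hnorm H (s n \<ominus> y)) \<longlonglongrightarrow> 0)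
      \<and> (\<forall>x\<in>S. cinner H (g x) v = cinner H x y)" if v: "v \<in> carrier H" for v
  proof (rule riesz_approx[OF S])
    fix x assume x: "x \<in> S"
    have "cmod (cinner H (g x) v) \<le> hnorm H (g x) * hnorm H v"
      using Cauchy_Schwarz g(1)[OF x] v by blast
    also have "\<dots> \<le> hnorm H v * hnorm H x"
      using mult_right_mono[OF g(4)[OF x] hnorm_nonneg[OF v]] by (simp add: mult.commute)
    finally show "cmod (cinner H (g x) v) \<le> hnorm H v * hnorm H x" .
  qed (use g v in \<open>auto simp: cinner_simps\<close>)
  then obtain D where D: "\<And>v. v \<in> carrier H \<Longrightarrow> D v \<in> carrier H"
    "\<And>v. v \<in> carrier H \<Longrightarrow> \<exists>s. (\<forall>n::nat. s n \<in> S) \<and> (\<lambda>n. hnorm H (s n \<ominus> D v)) \<longlonglongrightarrow> 0"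
    "\<And>v x. v \<in> carrier H \<Longrightarrow> x \<in> S \<Longrightarrow> cinner H (g x) v = cinner H x (D v)"
    by metis
  have D2: "D v \<in> orth H (orth H S)" if v: "v \<in> carrier H" for v
  proof -
    obtain s where s: "\<And>n::nat. s n \<in> S" "(\<lambda>n. hnorm H (s n \<ominus> D v)) \<longlonglongrightarrow> 0" using D(2)[OF v] by blast
    have "s n \<in> orth H (orth H S)" for n
      using orth_orth_superset[OF S(1)] s(1) by blast
    then show ?thesis
      by (rule orth_closed[OF orth_subset _ D(1)[OF v] s(2)])
  qed
  have uniq: "x = y" if x: "x \<in> orth H (orth H S)" and y: "y \<in> orth H (orth H S)"
    and eq: "\<And>s. s \<in> S \<Longrightarrow> cinner H s x = cinner H s y" for x y
  proof -
    have xy: "x \<in> carrier H" "y \<in> carrier H" using x y by (simp_all add: orth_def)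
    have "cinner H (x \<ominus> y) s = 0" if "s \<in> S" for s
      using eq[OF that] cinner_commute[of x s] cinner_commute[of y s] xy Sc[OF that] by (simp add: cinner_simps)
    then have "x \<ominus> y \<in> orth H S" using xy by (simp add: orth_def)
    moreover have "x \<ominus> y \<in> orth H (orth H S)"
      by (rule orth_diff[OF orth_subset x y])
    ultimately have "x \<ominus> y = \<zero>" by (rule orth_orth_inter)
    then show ?thesis using xy minus_eq_zero_iff by blast
  qed
  \<comment> \<open>\<open>D v\<close> is only a limit of elements of \<open>S\<close>, so the
    estimate is made at \<open>s n\<close>, where \<open>g\<close> is controlled, and then passed to
    the limit.\<close>
  have bound: "hnorm H (D v) \<le> 1 * hnorm H v" if v: "v \<in> carrier H" for v
  proof (cases "hnorm H (D v) = 0")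
    case False
    obtain s where s: "\<And>n::nat. s n \<in> S" "(\<lambda>n. hnorm H (s n \<ominus> D v)) \<longlonglongrightarrow> 0" using D(2)[OF v] by blast
    have "(\<lambda>n. cinner H (s n) (D v)) \<longlonglongrightarrow> cinner H (D v) (D v)"
      using s Sc D(1)[OF v] by (intro cinner_tendsto_left) auto
    from tendsto_norm[OF this] have l1: "(\<lambda>n. cmod (cinner H (s n) (D v))) \<longlonglongrightarrow> cmod (cinner H (D v) (D v))" .
    have "(\<lambda>n. hnorm H (s n)) \<longlonglongrightarrow> hnorm H (D v)"
      using s Sc D(1)[OF v] by (intro hnorm_tendsto) auto
    then have l2: "(\<lambda>n. hnorm H (s n) * hnorm H v) \<longlonglongrightarrow> hnorm H (D v) * hnorm H v"
      by (rule tendsto_mult_right)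
    have le: "cmod (cinner H (s n) (D v)) \<le> hnorm H (s n) * hnorm H v" for n
    proof -
      have "cmod (cinner H (g (s n)) v) \<le> hnorm H (g (s n)) * hnorm H v"
        using Cauchy_Schwarz g(1)[OF s(1)] v by blast
      also have "\<dots> \<le> hnorm H (s n) * hnorm H v"
        by (rule mult_right_mono[OF g(4)[OF s(1)] hnorm_nonneg[OF v]])
      finally show ?thesis using D(3)[OF v s(1)] by simp
    qed
    have "cmod (cinner H (D v) (D v)) \<le> hnorm H (D v) * hnorm H v"
      by (rule LIMSEQ_le[OF l1 l2]) (use le in blast)
    moreover have "cmod (cinner H (D v) (D v)) = hnorm H (D v) * hnorm H (D v)"
      using D(1)[OF v] by (simp add: cinner_self_real power2_eq_square norm_mult hnorm_nonneg)
    ultimately show ?thesis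
      using False hnorm_nonneg[OF D(1)[OF v]] by simp
  qed (use hnorm_nonneg[OF v] in simp)
  have "(\<lambda>v\<in>carrier H. D v) \<in> bounded_ops H"
  proof (rule bounded_opsI[of D 1])
    fix x y assume xy: "x \<in> carrier H" "y \<in> carrier H"
    show "D (x \<oplus> y) = D x \<oplus> D y"
      using xy D2 D(1) Sc g(1)
      by (intro uniq orth_add[OF orth_subset]) (auto simp: cinner_simps D(3)[symmetric])
  next
    fix c x assume x: "x \<in> carrier H"
    show "D (c \<odot> x) = c \<odot> D x"
      using x D2 D(1) Sc g(1)
      by (intro uniq orth_smult[OF orth_subset]) (auto simp: cinner_simps D(3)[symmetric])
  qed (use D bound in auto)
  then show ?thesis
    using D2 D(3) by (intro bexI[of _ "\<lambda>v\<in>carrier H. D v"]) auto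
qed

text \<open>Polar decomposition: the isometry extends \<open>s v \<mapsto> A v\<close> with \<open>s = (A\<^sup>* A)\<^sup>1\<^sup>/\<^sup>2\<close>.\<close>

lemma isometry_of_injective:
  assumes G: "adj_closed_pairs H G" and A: "intertwines H G A"
    and inj: "\<And>x. x \<in> carrier H \<Longrightarrow> A x = \<zero> \<Longrightarrow> x = \<zero>"
  shows "\<exists>V. isometry_op H V \<and> intertwines H G V"
proof -
  have Ab[simp]: "A \<in> bounded_ops H" using A by (simp add: intertwines_def)
  obtain s where s: "op_pos H s" "op_mult H s s = op_mult H (op_adj H A) A"
    "\<And>Z. \<lbrakk>Z \<in> bounded_ops H; op_mult H Z (op_mult H (op_adj H A) A) = op_mult H (op_mult H (op_adj H A) A) Z\<rbrakk>
      \<Longrightarrow> op_mult H Z s = op_mult H s Z"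
    using op_sqrt[OF op_pos_adj_mult[OF Ab]] by blast
  have sb[simp]: "s \<in> bounded_ops H" using s(1) by simp
  have ss: "s (s x) = op_adj H A (A x)" if "x \<in> carrier H" for x
    using op_mult_eqD[OF s(2) that] by simp
  have sA: "cinner H (s x) (s y) = cinner H (A x) (A y)" if "x \<in> carrier H" "y \<in> carrier H" for x y
    using selfadj_cinner[OF op_pos_selfadj[OF s(1)], of "s x" y] that
    by (simp add: ss cinner_adj')
  have snorm: "hnorm H (s x) = hnorm H (A x)" if "x \<in> carrier H" for x
    using sA[OF that that] by (simp add: hnorm_def)
  have s0: "x = \<zero>" if x: "x \<in> carrier H" "s x = \<zero>" for x
  proof (rule inj[OF x(1)])
    have "hnorm H (A x) = 0"
      using snorm[OF x(1)] x(2) hnorm_eq_0[of \<zero>] by simp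
    then show "A x = \<zero>"
      using hnorm_eq_0[of "A x"] x(1) by simp
  qed
  have sinj: "x = y" if xy: "x \<in> carrier H" "y \<in> carrier H" "s x = s y" for x y
  proof -
    have "s (x \<ominus> y) = \<zero>" using xy minus_eq_zero_iff[of "s x" "s y"] by (simp add: bounded_ops_diff)
    then have "x \<ominus> y = \<zero>" using s0 xy by simp
    then show ?thesis using minus_eq_zero_iff xy by simp
  qed
  define S where "S = s ` carrier H"
  define g where "g u = A (inv_into (carrier H) s u)" for u
  have gs: "g (s x) = A x" if "x \<in> carrier H" for x
    unfolding g_def using that sinj by (simp add: inv_into_f_f inj_on_def)
  have Sc: "S \<subseteq> carrier H" by (auto simp: S_def)
  \<comment> \<open>An injective selfadjoint operator has dense range.\<close>
  have S_orth: "orth H S \<subseteq> {\<zero>}"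
  proof
    fix x assume x: "x \<in> orth H S"
    then have xc: "x \<in> carrier H" by (simp add: orth_def)
    have "cinner H (s x) y = 0" if y: "y \<in> carrier H" for y
      using selfadj_cinner[OF op_pos_selfadj[OF s(1)] xc y] orthD[OF x, of "s y"] y by (simp add: S_def)
    then have "s x = \<zero>"
      using xc by (intro cinner_extl) (auto simp: cinner_simps)
    then show "x \<in> {\<zero>}" using s0[OF xc] by simp
  qed
  have "\<exists>D\<in>bounded_ops H. (\<forall>v\<in>carrier H. D v \<in> orth H (orth H S))
    \<and> (\<forall>u\<in>S. \<forall>v\<in>carrier H. cinner H u (D v) = cinner H (g u) v)"
  proof (rule contraction_adjoint_ex[OF Sc])
    show "\<zero> \<in> S" unfolding S_def by (rule image_eqI[of _ _ \<zero>]) (simp_all add: bounded_ops_zero)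
    fix x y c assume x: "x \<in> S"
    then obtain x' where x': "x = s x'" "x' \<in> carrier H" by (auto simp: S_def)
    have cx: "c \<odot> x = s (c \<odot> x')" using x' by (simp add: bounded_ops_smult)
    show "c \<odot> x \<in> S" unfolding cx S_def using x' by simp
    show "g x \<in> carrier H" using x' by (simp add: gs)
    have "g (c \<odot> x) = A (c \<odot> x')" unfolding cx by (rule gs) (use x' in simp)
    then show "g (c \<odot> x) = c \<odot> g x" using x' by (simp add: gs bounded_ops_smult)
    show "hnorm H (g x) \<le> hnorm H x" using x' by (simp add: gs snorm)
    assume y: "y \<in> S"
    then obtain y' where y': "y = s y'" "y' \<in> carrier H" by (auto simp: S_def)
    have xy: "x \<oplus> y = s (x' \<oplus> y')" using x' y' by (simp add: bounded_ops_add)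
    show "x \<oplus> y \<in> S" unfolding xy S_def using x' y' by simp
    have "g (x \<oplus> y) = A (x' \<oplus> y')" unfolding xy by (rule gs) (use x' y' in simp)
    then show "g (x \<oplus> y) = g x \<oplus> g y" using x' y' by (simp add: gs bounded_ops_add)
  qed
  then obtain D where D: "D \<in> bounded_ops H" "\<And>u v. u \<in> S \<Longrightarrow> v \<in> carrier H \<Longrightarrow> cinner H u (D v) = cinner H (g u) v"
    by blast
  define V where "V = op_adj H D"
  have Vb[simp]: "V \<in> bounded_ops H" and Vadj: "op_adj H V = D"
    using D(1) by (simp_all add: V_def)
  have Vs: "V (s x) = A x" if x: "x \<in> carrier H" for x
  proof (rule cinner_extl)
    fix z assume z: "z \<in> carrier H"
    have "cinner H (V (s x)) z = cinner H (s x) (D z)"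
      using x z D(1) by (simp add: V_def cinner_adj')
    also have "\<dots> = cinner H (A x) z"
      using D(2)[of "s x" z] x z by (simp add: S_def gs)
    finally show "cinner H (V (s x)) z = cinner H (A x) z" .
  qed (use x in auto)
  have "op_mult H D V = op_one H"
  proof (rule bounded_ops_eqI_dense[OF Sc S_orth])
    fix u assume u: "u \<in> S"
    then obtain x where x: "u = s x" "x \<in> carrier H" by (auto simp: S_def)
    have uc: "u \<in> carrier H" using x by simp
    have "cinner H (D (V u) \<ominus> u) t = 0" if t: "t \<in> S" for t
    proof -
      obtain y where y: "t = s y" "y \<in> carrier H" using t by (auto simp: S_def)
      have "cinner H (D (V u)) t = cinner H (V u) (V t)"
        using uc y by (simp add: Vadj[symmetric] cinner_adj')
      then show ?thesis
        using x y D(1) by (simp add: cinner_simps Vs sA)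
    qed
    then have "D (V u) \<ominus> u \<in> orth H S"
      using uc D(1) by (simp add: orth_def)
    then have "D (V u) \<ominus> u = \<zero>" using S_orth by blast
    then show "op_mult H D V u = op_one H u"
      using minus_eq_zero_iff[of "D (V u)" u] uc D(1) by simp
  qed (use D(1) in auto)
  then have iso: "isometry_op H V"
    unfolding isometry_op_def Vadj using op_mult_eqD[of H D V "op_one H" "op_one H"] by auto
  have "V (a x) = b (V x)" if ab: "(a, b) \<in> G" and x: "x \<in> carrier H" for a b x
  proof -
    note p = adj_closed_pairsD[OF G ab]
    have Aadj: "op_adj H A (b z) = a (op_adj H A z)" if "z \<in> carrier H" for z
      using intertwinesD[OF intertwines_adj[OF G A], of b a z] ab that by force
    \<comment> \<open>\<open>A\<close> intertwines \<open>a\<close> with \<open>b\<close>, and its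
      adjoint intertwines them back, so \<open>a\<close> commutes with the product of the adjoint of
      \<open>A\<close> and \<open>A\<close>; the commutation clause of the square root then
      applies.\<close>
    have "op_mult H a s = op_mult H s a"
      by (rule s(3)[OF p(1)], rule ops_eqI) (use p intertwinesD[OF A ab] Aadj in auto)
    from op_mult_eqD[OF this] have as: "a (s z) = s (a z)" if "z \<in> carrier H" for z using that .
    have "op_mult H V a = op_mult H b V"
    proof (rule bounded_ops_eqI_dense[OF Sc S_orth])
      fix u assume "u \<in> S"
      then obtain z where z: "u = s z" "z \<in> carrier H" by (auto simp: S_def)
      then show "op_mult H V a u = op_mult H b V u"
        using p as[OF z(2)] intertwinesD[OF A ab z(2)] by (simp add: Vs)
    qed (use p in auto)
    then show ?thesis by (rule op_mult_eqD[OF _ x])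
  qed
  then show ?thesis
    using iso by (auto simp: intertwines_def)
qed

text \<open>The Cantor--Bernstein argument for representations: \<open>U\<close> is \<open>W\<close> on a closed invariant subspace \<open>P\<close>
  and \<open>V\<^sup>*\<close> on its complement, where \<open>P = (V ((W P)\<^sup>\<bottom>))\<^sup>\<bottom>\<close>.\<close>

lemma unitary_of_isometries:
  assumes G: "adj_closed_pairs H G" and W: "isometry_op H W" "intertwines H G W"
    and V: "isometry_op H V" "intertwines H (prod.swap ` G) V"
  shows "\<exists>U. unitary_op H U \<and> intertwines H G U"
proof -
  have [simp]: "V \<in> bounded_ops H" "W \<in> bounded_ops H"
    using V(1) W(1) by (auto simp: isometry_op_def)
  define V' W' where "V' = op_adj H V" and "W' = op_adj H W"
  have [simp]: "V' \<in> bounded_ops H" "W' \<in> bounded_ops H"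
    by (simp_all add: V'_def W'_def)
  have VV[simp]: "V' (V x) = x" and WW[simp]: "W' (W x) = x" if "x \<in> carrier H" for x
    using that V(1) W(1) by (auto simp: isometry_op_def V'_def W'_def)
  have V'c: "cinner H (V' x) y = cinner H x (V y)" and W'c: "cinner H (W' x) y = cinner H x (W y)"
    if "x \<in> carrier H" "y \<in> carrier H" for x y
    using that by (simp_all add: V'_def W'_def cinner_adj')
  define \<Phi> where "\<Phi> S = orth H (V ` orth H (W ` S))" for S
  \<comment> \<open>Each of the two complements reverses inclusion, so \<open>\<Phi>\<close> is
    monotone. Its least fixed point corresponds to the set on which the Cantor-Bernstein bijection
    uses the first injection.\<close>
  have mono: "mono \<Phi>"
    unfolding \<Phi>_def by (intro monoI orth_antimono image_mono) auto
  define P where "P = lfp \<Phi>"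
  have P: "P = orth H (V ` orth H (W ` P))"
    using lfp_unfold[OF mono] by (simp add: P_def \<Phi>_def)
  have Pc: "P \<subseteq> carrier H"
    by (subst P) (rule orth_subset)
  have inv: "a x \<in> P" if ab: "(a, b) \<in> G" and x: "x \<in> P" for a b x
  proof -
    \<comment> \<open>Invariance is proved by induction on the least fixed point: \<open>Q\<close>
      collects the vectors that every first component of a pair sends into \<open>P\<close>, and
      \<open>\<Phi> Q \<subseteq> Q\<close> gives \<open>P \<subseteq> Q\<close>.\<close>
    define Q where "Q = {v \<in> carrier H. \<forall>(a, b)\<in>G. a v \<in> P}"
    have "\<Phi> Q \<subseteq> Q"
    proof
      fix v assume v: "v \<in> \<Phi> Q"
      then have vc: "v \<in> carrier H" by (simp add: \<Phi>_def orth_def)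
      have "a v \<in> P" if ab: "(a, b) \<in> G" for a b
      proof -
        note p = adj_closed_pairsD[OF G ab]
        have "cinner H (a v) (V y) = 0" if y: "y \<in> orth H (W ` P)" for y
        proof -
          have yc: "y \<in> carrier H" using y by (simp add: orth_def)
          have "op_adj H b y \<in> orth H (W ` Q)"
          proof -
            have "cinner H (op_adj H b y) (W q) = 0" if q: "q \<in> Q" for q
            proof -
              have qc: "q \<in> carrier H" and aq: "a q \<in> P" using q ab by (auto simp: Q_def)
              have "cinner H (op_adj H b y) (W q) = cinner H y (b (W q))"
                using p yc qc by (simp add: cinner_adj')
              also have "\<dots> = cinner H y (W (a q))"
                using intertwinesD[OF W(2) ab qc] by simp
              also have "\<dots> = 0"
                using orthD[OF y, of "W (a q)"] aq by blast
              finally show ?thesis .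
            qed
            then show ?thesis using p yc by (auto simp: orth_def)
          qed
          then have "cinner H v (V (op_adj H b y)) = 0"
            using v unfolding \<Phi>_def by (intro orthD[OF _ imageI])
          moreover have "V (op_adj H b y) = op_adj H a (V y)"
            using intertwinesD[OF V(2) _ yc, of "op_adj H b" "op_adj H a"] p(3) by force
          ultimately show ?thesis
            using p vc yc by (simp add: cinner_adj)
        qed
        then have "a v \<in> orth H (V ` orth H (W ` P))"
          using p vc by (auto simp: orth_def)
        then show ?thesis using P by blast
      qed
      then show "v \<in> Q" using vc by (auto simp: Q_def)
    qed
    then have "P \<subseteq> Q" unfolding P_def by (rule lfp_lowerbound)
    then show ?thesis using x ab by (auto simp: Q_def)
  qed
  have Poo: "orth H (orth H P) = P"
  proof
    define X where "X = V ` orth H (W ` P)"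
    have PX: "P = orth H X" using P by (simp add: X_def)
    have "X \<subseteq> carrier H" by (auto simp: X_def orth_def)
    then have "X \<subseteq> orth H P" unfolding PX by (rule orth_orth_superset)
    then have "orth H (orth H P) \<subseteq> orth H X" by (rule orth_antimono)
    then show "orth H (orth H P) \<subseteq> P" using PX by simp
  qed (rule orth_orth_superset[OF Pc])
  obtain p where p: "selfadj H p" "\<And>x. x \<in> carrier H \<Longrightarrow> p x \<in> orth H (orth H P)"
    "\<And>x. x \<in> carrier H \<Longrightarrow> x \<ominus> p x \<in> orth H P"
    using projection_ex[OF Pc] by blast
  have [simp]: "p \<in> bounded_ops H" using p(1) by simp
  have pP: "p x \<in> P" if "x \<in> carrier H" for x using p(2)[OF that] Poo by simp
  have pid: "p x = x" if "x \<in> P" for x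
    using projection_id[OF p] Poo that by simp
  have pp[simp]: "p (p x) = p x" if "x \<in> carrier H" for x
    using pid pP that by blast
  have p0: "p x = \<zero> \<longleftrightarrow> x \<in> orth H P" if x: "x \<in> carrier H" for x
  proof
    assume "p x = \<zero>"
    moreover have "x = x \<ominus> \<zero>" using x by (intro cinner_extl) (simp_all add: cinner_simps)
    ultimately show "x \<in> orth H P" using p(3)[OF x] by simp
  next
    assume "x \<in> orth H P"
    then have "x \<ominus> (x \<ominus> p x) \<in> orth H P" using orth_diff[OF Pc _ p(3)[OF x]] by blast
    moreover have "x \<ominus> (x \<ominus> p x) = p x" using x by (intro cinner_extl) (simp_all add: cinner_simps)
    ultimately show "p x = \<zero>" using orth_orth_inter p(2)[OF x] by metis
  qed
  \<comment> \<open>As \<open>W\<close> is isometric, \<open>W p W'\<close> projects onto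
    \<open>W P\<close>; so \<open>q\<close> projects onto the complement to which \<open>V\<close>
    is applied in \<open>\<Phi>\<close>.\<close>
  define q where "q = op_minus H (op_one H) (op_mult H W (op_mult H p W'))"
  have qb[simp]: "q \<in> bounded_ops H" by (simp add: q_def)
  have qx: "q x = x \<ominus> W (p (W' x))" if "x \<in> carrier H" for x
    using that by (simp add: q_def)
  have q_sa: "cinner H (q x) y = cinner H x (q y)" if "x \<in> carrier H" "y \<in> carrier H" for x y
  proof -
    have "cinner H (W (p (W' x))) y = cinner H (p (W' x)) (W' y)"
      using that by (simp add: W'_def cinner_adj)
    also have "\<dots> = cinner H (W' x) (p (W' y))"
      using that by (intro selfadj_cinner[OF p(1)]) auto
    also have "\<dots> = cinner H x (W (p (W' y)))"
      using that by (intro W'c) auto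
    finally show ?thesis using that by (simp add: qx cinner_simps)
  qed
  have qq[simp]: "q (q x) = q x" if "x \<in> carrier H" for x
    using that by (intro cinner_extl) (simp_all add: qx bounded_ops_diff cinner_simps)
  have ran_q: "y \<in> orth H (W ` P) \<longleftrightarrow> q y = y" if y: "y \<in> carrier H" for y
  proof -
    have "y \<in> orth H (W ` P) \<longleftrightarrow> W' y \<in> orth H P"
      using y Pc W'c[OF y] by (auto simp: orth_def subset_eq)
    also have "\<dots> \<longleftrightarrow> p (W' y) = \<zero>" using p0[of "W' y"] y by simp
    also have "\<dots> \<longleftrightarrow> q y = y"
    proof
      assume "p (W' y) = \<zero>"
      then show "q y = y"
        using y by (intro cinner_extl) (simp_all add: qx bounded_ops_zero cinner_simps)
    next
      assume *: "q y = y"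
      have "p (W' y) = p (W' (q y))" using * by simp
      also have "\<dots> = \<zero>"
        using y by (intro cinner_extl) (simp_all add: qx bounded_ops_diff cinner_simps)
      finally show "p (W' y) = \<zero>" .
    qed
    finally show ?thesis .
  qed
  have P_iff: "x \<in> P \<longleftrightarrow> q (V' x) = \<zero>" if x: "x \<in> carrier H" for x
  proof
    assume "x \<in> P"
    then have xo: "x \<in> orth H (V ` orth H (W ` P))" using P by simp
    have "cinner H (q (V' x)) z = 0" if z: "z \<in> carrier H" for z
    proof -
      have "q z \<in> orth H (W ` P)" using ran_q[of "q z"] z by simp
      then have "cinner H x (V (q z)) = 0" by (intro orthD[OF xo imageI])
      then show ?thesis using x z by (simp add: q_sa V'c)
    qed
    then show "q (V' x) = \<zero>" using x by (intro cinner_extl) (auto simp: cinner_simps)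
  next
    assume 0: "q (V' x) = \<zero>"
    have "cinner H x (V y) = 0" if y: "y \<in> orth H (W ` P)" for y
    proof -
      have yc: "y \<in> carrier H" using y by (simp add: orth_def)
      have "cinner H x (V y) = cinner H (V' x) (q y)"
        using x yc y ran_q[OF yc] by (simp add: V'c)
      also have "\<dots> = cinner H (q (V' x)) y" using x yc by (simp add: q_sa)
      finally show ?thesis using 0 yc by (simp add: cinner_simps)
    qed
    then have "x \<in> orth H (V ` orth H (W ` P))" using x by (auto simp: orth_def)
    then show "x \<in> P" using P by simp
  qed
  \<comment> \<open>The fixed-point equation as an operator identity: the complement of
    \<open>P\<close> is the image under \<open>V\<close> of the range of \<open>q\<close>.\<close>
  have compl: "x \<ominus> p x = V (q (V' x))" if x: "x \<in> carrier H" for x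
  proof -
    define e where "e = V (q (V' x))"
    have ec: "e \<in> carrier H" using x by (simp add: e_def)
    have "q (V' (x \<ominus> e)) = \<zero>"
      using x by (intro cinner_extl) (simp_all add: e_def bounded_ops_diff cinner_simps)
    then have 1: "x \<ominus> e \<in> P" using P_iff[of "x \<ominus> e"] x ec by simp
    have 2: "e \<in> orth H P"
    proof -
      have "cinner H e u = 0" if u: "u \<in> P" for u
      proof -
        have uc: "u \<in> carrier H" using u Pc by blast
        have "cinner H e u = cinner H (q (V' x)) (V' u)"
          using x uc by (simp add: e_def V'_def cinner_adj)
        also have "\<dots> = cinner H (V' x) (q (V' u))" using x uc by (simp add: q_sa)
        finally show ?thesis using P_iff[OF uc] u x by (simp add: cinner_simps)
      qed
      then show ?thesis using ec by (simp add: orth_def)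
    qed
    have "p x = p (x \<ominus> e) \<oplus> p e"
    proof -
      have "x = (x \<ominus> e) \<oplus> e" using x ec by (intro cinner_extl) (simp_all add: cinner_simps)
      then show ?thesis using bounded_ops_add[of p H "x \<ominus> e" e] x ec by simp
    qed
    also have "\<dots> = x \<ominus> e" using pid[OF 1] p0[OF ec] 2 x ec by simp
    finally show ?thesis
      unfolding e_def[symmetric] using x ec by (intro cinner_extl) (simp_all add: cinner_simps)
  qed
  define U where "U = op_add H (op_mult H W p) (op_mult H V' (op_minus H (op_one H) p))"
  define U' where "U' = op_add H (op_mult H p W') (op_mult H (op_minus H (op_one H) p) V)"
  have Ub[simp]: "U \<in> bounded_ops H" "U' \<in> bounded_ops H" by (simp_all add: U_def U'_def)
  have Ux: "U x = W (p x) \<oplus> V' (x \<ominus> p x)" and U'x: "U' x = p (W' x) \<oplus> (V x \<ominus> p (V x))" if "x \<in> carrier H" for x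
    using that by (simp_all add: U_def U'_def)
  have Uadj: "op_adj H U = U'"
  proof (rule adj_eqI)
    fix x y assume xy: "x \<in> carrier H" "y \<in> carrier H"
    have "cinner H (p x) (W' y) = cinner H x (p (W' y))" "cinner H (p x) (V y) = cinner H x (p (V y))"
      using xy by (simp_all add: selfadj_cinner[OF p(1)])
    then show "cinner H (U x) y = cinner H x (U' y)"
      using xy by (simp add: Ux U'x cinner_simps V'c bounded_ops_diff W'_def cinner_adj)
  qed auto
  have qWp: "q (W (p x)) = \<zero>" if "x \<in> carrier H" for x
    using that by (intro cinner_extl) (simp_all add: qx cinner_simps)
  have pWq: "p (W' (q x)) = \<zero>" if "x \<in> carrier H" for x
    using that by (intro cinner_extl) (simp_all add: qx bounded_ops_diff cinner_simps)
  have U'U: "U' (U x) = x" if x: "x \<in> carrier H" for x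
  proof -
    have Ux': "U x = W (p x) \<oplus> q (V' x)" using x by (simp add: Ux compl)
    have "p (W' (U x)) = p x"
      unfolding Ux' using x pWq[of "V' x"] by (simp add: bounded_ops_add)
    moreover have "V (U x) \<ominus> p (V (U x)) = x \<ominus> p x"
      using x qWp[OF x] compl[of "V (U x)"] by (simp add: Ux' bounded_ops_add compl)
    ultimately have "U' (U x) = p x \<oplus> (x \<ominus> p x)"
      using x by (simp add: U'x)
    also have "\<dots> = x" using x by (intro cinner_extl) (simp_all add: cinner_simps)
    finally show ?thesis .
  qed
  have UU': "U (U' y) = y" if y: "y \<in> carrier H" for y
  proof -
    have U'y: "U' y = p (W' y) \<oplus> V (q y)" using y by (simp add: U'x compl)
    have "V (q y) \<ominus> p (V (q y)) = V (q y)" using compl[of "V (q y)"] y by simp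
    then have pV: "p (V (q y)) = \<zero>"
    proof -
      assume *: "V (q y) \<ominus> p (V (q y)) = V (q y)"
      have "p (V (q y)) = V (q y) \<ominus> (V (q y) \<ominus> p (V (q y)))"
        using y by (intro cinner_extl) (simp_all add: cinner_simps)
      also have "\<dots> = V (q y) \<ominus> V (q y)" using * by simp
      also have "\<dots> = \<zero>" using y minus_eq_zero_iff by simp
      finally show ?thesis .
    qed
    have "p (U' y) = p (W' y)" using y pV by (simp add: U'y bounded_ops_add)
    moreover have "U' y \<ominus> p (W' y) = V (q y)"
      unfolding U'y using y by (intro cinner_extl) (simp_all add: cinner_simps)
    ultimately have "U (U' y) = W (p (W' y)) \<oplus> q y" using y Ux[of "U' y"] by simp
    also have "\<dots> = y" using y by (intro cinner_extl) (simp_all add: qx cinner_simps)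
    finally show ?thesis .
  qed
  have "unitary_op H U"
    by (rule unitary_opI) (use Uadj U'U UU' in auto)
  moreover have "intertwines H G U"
  proof -
    have "U (a x) = b (U x)" if ab: "(a, b) \<in> G" and x: "x \<in> carrier H" for a b x
    proof -
      note pr = adj_closed_pairsD[OF G ab]
      have pa: "p (a x) = a (p x)"
        by (rule projection_commute[OF Pc p pr(1) inv[OF ab] inv[OF pr(3)] x])
      have V'a: "V' (a z) = b (V' z)" if "z \<in> carrier H" for z
        using intertwinesD[OF intertwines_adj[OF adj_closed_pairs_swap[OF G] V(2)], of a b z] ab that
        by (force simp: V'_def)
      have "U (a x) = W (a (p x)) \<oplus> V' (a (x \<ominus> p x))"
        using x pr by (simp add: Ux pa bounded_ops_diff)
      also have "\<dots> = b (W (p x)) \<oplus> b (V' (x \<ominus> p x))"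
        using intertwinesD[OF W(2) ab, of "p x"] V'a[of "x \<ominus> p x"] x by simp
      also have "\<dots> = b (U x)" using x pr by (simp add: Ux bounded_ops_add)
      finally show ?thesis .
    qed
    then show ?thesis by (auto simp: intertwines_def)
  qed
  ultimately show ?thesis by blast
qed

end

section \<open>Normalising unitaries and automorphisms\<close>

definition op_conj :: "'a hilbert \<Rightarrow> ('a \<Rightarrow> 'a) \<Rightarrow> ('a \<Rightarrow> 'a) \<Rightarrow> 'a \<Rightarrow> 'a" where
  "op_conj H U X = op_mult H (op_mult H U X) (op_adj H U)"

lemma (in hilbert_space) op_conj:
  assumes "U \<in> bounded_ops H"
  shows "X \<in> bounded_ops H \<Longrightarrow> op_conj H U X \<in> bounded_ops H"
    "x \<in> carrier H \<Longrightarrow> op_conj H U X x = U (X (op_adj H U x))"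
  using assms by (simp_all add: op_conj_def)

lemma (in hilbert_space) op_conj_inverse:
  assumes U: "unitary_op H U" and X: "X \<in> bounded_ops H"
  shows "op_conj H (op_adj H U) (op_conj H U X) = X" "op_conj H U (op_conj H (op_adj H U) X) = X"
  using unitary_opD[OF U] X by (auto intro!: ops_eqI simp: op_conj)

context amplification
begin

lemma entry_in_matsI:
  assumes "S \<in> bounded_ops T" "\<And>f g. f \<in> F \<Longrightarrow> g \<in> F \<Longrightarrow> entry f g S \<in> N"
  shows "S \<in> mats N"
  using assms by (simp add: mats_def)

lemma zero_op_mem:
  assumes "von_neumann_algebra H N" "Z \<in> bounded_ops H" "\<And>x. x \<in> carrier H \<Longrightarrow> Z x = \<zero>\<^bsub>H\<^esub>"
  shows "Z \<in> N"
proof -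
  have "op_smult H 0 (op_one H) \<in> N" using assms(1) by (simp add: von_neumann_algebra_def)
  moreover have "Z = op_smult H 0 (op_one H)" using assms(2,3) by (intro H.ops_eqI) auto
  ultimately show ?thesis by simp
qed

lemma amp_in_mats:
  assumes N: "von_neumann_algebra H N" and X: "X \<in> N"
  shows "amp X \<in> mats N"
proof (rule entry_in_matsI)
  have Xb: "X \<in> bounded_ops H" using N X by (auto simp: von_neumann_algebra_def)
  then show "amp X \<in> bounded_ops T" by simp
  fix f g assume fg: "f \<in> F" "g \<in> F"
  show "entry f g (amp X) \<in> N"
  proof (cases "f = g")
    case True
    then have "entry f g (amp X) = X"
      using fg Xb by (intro H.ops_eqI) (auto simp: C_J)
    then show ?thesis using X by simp
  next
    case False
    then show ?thesis using fg Xb by (intro zero_op_mem[OF N]) (auto simp: C_J)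
  qed
qed

lemma unit_in_mats:
  assumes N: "von_neumann_algebra H N" and hk: "h \<in> F" "k \<in> F"
  shows "(\<lambda>w\<in>carrier T. J h (C k w)) \<in> mats N"
proof (rule entry_in_matsI)
  show b: "(\<lambda>w\<in>carrier T. J h (C k w)) \<in> bounded_ops T"
    by (rule T.bounded_opsI[of _ 1]) (use hk in \<open>auto simp: J_add J_smult C_add C_smult hnorm_J hnorm_C_le\<close>)
  fix f g assume fg: "f \<in> F" "g \<in> F"
  have e: "entry f g (\<lambda>w\<in>carrier T. J h (C k w)) x = (if f = h \<and> k = g then x else \<zero>\<^bsub>H\<^esub>)" if "x \<in> carrier H" for x
    using fg hk that by (simp add: C_J)
  show "entry f g (\<lambda>w\<in>carrier T. J h (C k w)) \<in> N"
  proof (cases "f = h \<and> k = g")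
    case True
    then have "entry f g (\<lambda>w\<in>carrier T. J h (C k w)) = op_one H"
      using fg b e by (intro H.ops_eqI) (auto simp del: entry_apply)
    then show ?thesis using N by (simp add: von_neumann_algebra_def)
  next
    case False
    then show ?thesis using fg b e by (intro zero_op_mem[OF N]) (auto simp del: entry_apply)
  qed
qed

text \<open>Conjugation carries the commutant of \<open>mats N\<close> into itself. Commuting with
  the matrix units forces the conjugated operator to act by one and the same \<open>Y\<close> in
  every coordinate, and commuting with \<open>amp n\<close> puts \<open>Y\<close> in the commutant
  of \<open>N\<close>.\<close>

lemma op_conj_amp_ex:
  assumes N: "von_neumann_algebra H N" and V: "unitary_op T V" and k: "k \<in> F"
    and norm: "\<And>S. S \<in> mats N \<Longrightarrow> op_conj T (op_adj T V) S \<in> mats N"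
    and X: "X \<in> commutant H N"
  shows "\<exists>Y\<in>commutant H N. op_conj T V (amp X) = amp Y"
proof -
  note u = T.unitary_opD[OF V]
  have Nb: "N \<subseteq> bounded_ops H" using N by (simp add: von_neumann_algebra_def)
  have Xb[simp]: "X \<in> bounded_ops H" using X by simp
  define Z where "Z = op_conj T V (amp X)"
  have Zb[simp]: "Z \<in> bounded_ops T" using u(1) by (simp add: Z_def T.op_conj)
  have comm: "Z (S w) = S (Z w)" if S: "S \<in> mats N" and w: "w \<in> carrier T" for S w
  proof -
    have Sb: "S \<in> bounded_ops T" using S by (simp add: mats_def)
    define S' where "S' = op_conj T (op_adj T V) S"
    have S': "S' \<in> mats N" using norm[OF S] by (simp add: S'_def)
    then have S'b: "S' \<in> bounded_ops T" by (simp add: mats_def)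
    have S'x: "S' x = op_adj T V (S (V x))" if "x \<in> carrier T" for x
      using u(1) that by (simp add: S'_def T.op_conj)
    have "op_mult T S' (amp X) = op_mult T (amp X) S'"
      unfolding mats_commute[OF S'b Xb]
    proof (intro ballI)
      fix f g assume "f \<in> F" "g \<in> F"
      then have "entry f g S' \<in> N" using S' by (simp add: mats_def)
      then show "op_mult H (entry f g S') X = op_mult H X (entry f g S')"
        using X unfolding commutant_def by auto
    qed
    from op_mult_eqD[OF this] have c: "S' (amp X x) = amp X (S' x)" if "x \<in> carrier T" for x using that .
    define x where "x = op_adj T V w"
    have x: "x \<in> carrier T" using u(1) w by (simp add: x_def)
    have Vx: "V x = w" using u(3)[OF w] by (simp add: x_def)
    have "Z (S w) = V (amp X (op_adj T V (S (V x))))"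
      using u(1) w Sb by (simp add: Z_def T.op_conj Vx)
    also have "\<dots> = V (S' (amp X x))" using S'x[OF x] c[OF x] by simp
    also have "\<dots> = S (V (amp X x))"
      using S'x[of "amp X x"] x u Sb by simp
    also have "\<dots> = S (Z w)" using u(1) w by (simp add: Z_def T.op_conj x_def)
    finally show ?thesis .
  qed
  define Y where "Y = entry k k Z"
  have Yb[simp]: "Y \<in> bounded_ops H" using k by (simp add: Y_def)
  have "Z = amp Y"
  proof (rule op_eqI_J)
    fix g x assume g: "g \<in> F" and x: "x \<in> carrier H"
    have "Z ((\<lambda>w\<in>carrier T. J g (C k w)) (J k x)) = (\<lambda>w\<in>carrier T. J g (C k w)) (Z (J k x))"
      by (rule comm[OF unit_in_mats[OF N g k]]) (use k x in simp)
    then show "Z (J g x) = amp Y (J g x)"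
      using g k x by (simp add: C_J Y_def)
  qed auto
  moreover have "Y \<in> commutant H N"
  proof (rule H.commutantI[OF Yb Nb])
    fix n x assume n: "n \<in> N" and x: "x \<in> carrier H"
    have nb: "n \<in> bounded_ops H" using n Nb by blast
    have "Z (amp n (J k x)) = amp n (Z (J k x))"
      by (rule comm[OF amp_in_mats[OF N n]]) (use k x in simp)
    from arg_cong[OF this, of "C k"] show "Y (n x) = n (Y x)"
      using nb k x by (simp add: Y_def)
  qed
  ultimately show ?thesis by (auto simp: Z_def)
qed

lemma singular_matsI:
  assumes N: "von_neumann_algebra H N" and M: "von_neumann_algebra H M"
    and NN: "commutant H (commutant H N) = N" and MM: "commutant H (commutant H M) = M"
    and aut: "\<And>\<theta>. \<lbrakk>star_automorphism H (commutant H N) \<theta>; \<forall>X\<in>commutant H M. \<theta> X = X\<rbrakk>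
      \<Longrightarrow> \<forall>Y\<in>commutant H N. \<theta> Y = Y"
    and NM: "N \<subseteq> M"
  shows "singular_in T (mats N) (mats M)"
  unfolding singular_in_def op_conj_def[symmetric]
proof (intro ballI impI)
  fix U assume UM: "U \<in> mats M" and U: "unitary_op T U" and img: "op_conj T U ` mats N = mats N"
  note u = T.unitary_opD[OF U]
  define R where "R = commutant H N"
  have Rb: "X \<in> bounded_ops H" if "X \<in> R" for X using that by (simp add: R_def)
  have adjN: "adj_closed_set H N" by (rule von_neumann_algebra_adj_closed[OF N])
  have matsN: "mats N = commutant T (amp ` R)" and matsM: "mats M = commutant T (amp ` commutant H M)"
    using mats_commutant[of "commutant H N"] mats_commutant[of "commutant H M"] NN MM
    by (simp_all add: R_def subset_eq)
  show "U \<in> mats N"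
  \<comment> \<open>Without coordinates \<open>amp\<close> need not be injective, so no automorphism
    could be read off; but then membership in \<open>mats N\<close> puts no condition on
    entries.\<close>
  proof (cases "F = {}")
    case True
    then show ?thesis using u(1) unfolding mats_def by blast
  next
    case False
    then obtain k where k: "k \<in> F" by blast
    have U': "unitary_op T (op_adj T U)" using U by (auto simp: unitary_op_def)
    have norm1: "op_conj T U S \<in> mats N" if "S \<in> mats N" for S using img that by blast
    have norm2: "op_conj T (op_adj T U) S \<in> mats N" if S: "S \<in> mats N" for S
    proof -
      obtain S' where "S' \<in> mats N" "S = op_conj T U S'" using img S by blast
      then show ?thesis using T.op_conj_inverse(1)[OF U, of S'] by (simp add: mats_def)
    qed
    have ex: "\<exists>Y\<in>R. op_conj T U (amp X) = amp Y" if "X \<in> R" for X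
      using op_conj_amp_ex[OF N U k norm2] that by (simp add: R_def)
    \<comment> \<open>Conjugation by the adjoint supplies the preimages that make the extracted
      \<open>\<theta>\<close> surjective.\<close>
    have ex': "\<exists>Y\<in>R. op_conj T (op_adj T U) (amp X) = amp Y" if "X \<in> R" for X
      using op_conj_amp_ex[OF N U' k _ that[unfolded R_def]] norm1 u(1) by (simp add: R_def)
    from bchoice[of R "\<lambda>X Y. Y \<in> R \<and> op_conj T U (amp X) = amp Y"] ex
    obtain \<theta> where \<theta>: "\<And>X. X \<in> R \<Longrightarrow> \<theta> X \<in> R" "\<And>X. X \<in> R \<Longrightarrow> op_conj T U (amp X) = amp (\<theta> X)" by blast
    have ampU: "amp (\<theta> X) x = U (amp X (op_adj T U x))" if "X \<in> R" "x \<in> carrier T" for X x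
      using T.op_conj(2)[OF u(1) that(2)] \<theta>(2)[OF that(1)] by metis
    have eqI: "\<theta> X = Y" if "X \<in> R" "Y \<in> R" "\<And>x. x \<in> carrier T \<Longrightarrow> U (amp X (op_adj T U x)) = amp Y x" for X Y
    proof (rule amp_inj[OF False])
      show "amp (\<theta> X) = amp Y"
        by (rule T.ops_eqI) (use that \<theta>(1) Rb ampU in auto)
    qed (use that \<theta>(1) Rb in auto)
    note Rops = H.commutant_ops[OF adjN, folded R_def]
    have "star_automorphism H R \<theta>"
      unfolding star_automorphism_def
    proof (intro conjI ballI allI)
      show "bij_betw \<theta> R R"
      proof (rule bij_betwI')
        fix X Y assume XY: "X \<in> R" "Y \<in> R"
        show "(\<theta> X = \<theta> Y) = (X = Y)"
        proof
          assume "\<theta> X = \<theta> Y"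
          then have "op_conj T U (amp X) = op_conj T U (amp Y)" using \<theta>(2) XY by simp
          then have "amp X = amp Y"
            using T.op_conj_inverse(1)[OF U amp_closed[OF Rb[OF XY(1)]]]
              T.op_conj_inverse(1)[OF U amp_closed[OF Rb[OF XY(2)]]] by metis
          then show "X = Y" using amp_inj[OF False] XY Rb by blast
        qed simp
      next
        fix Y assume Y: "Y \<in> R"
        obtain X where X: "X \<in> R" "op_conj T (op_adj T U) (amp Y) = amp X" using ex'[OF Y] by blast
        have "op_conj T U (amp X) = amp Y"
          using T.op_conj_inverse(2)[OF U amp_closed[OF Rb[OF Y]]] X(2) by simp
        then have "Y = \<theta> X" using amp_inj[OF False] \<theta> X(1) Y Rb by metis
        then show "\<exists>X\<in>R. Y = \<theta> X" using X(1) by blast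
      qed (rule \<theta>(1))
    next
      fix X Y assume XY: "X \<in> R" "Y \<in> R"
      show "\<theta> (op_add H X Y) = op_add H (\<theta> X) (\<theta> Y)"
        using XY u \<theta>(1) Rb
        by (intro eqI Rops) (auto simp: amp_add ampU bounded_ops_add)
      show "\<theta> (op_mult H X Y) = op_mult H (\<theta> X) (\<theta> Y)"
        using XY u \<theta>(1) Rb
        by (intro eqI Rops) (auto simp: amp_mult ampU)
    next
      fix c X assume X: "X \<in> R"
      show "\<theta> (op_smult H c X) = op_smult H c (\<theta> X)"
        using X u \<theta>(1) Rb Rops(4)[OF X X] Rops(4)[OF \<theta>(1)[OF X] X]
        by (intro eqI) (auto simp: amp_smult ampU bounded_ops_smult)
    next
      fix X assume X: "X \<in> R"
      show "\<theta> (op_adj H X) = op_adj H (\<theta> X)"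
      proof (rule eqI)
        show "op_adj H X \<in> R" "op_adj H (\<theta> X) \<in> R"
          using Rops(5)[OF X X] Rops(5)[OF \<theta>(1)[OF X] X] by auto
        have "op_adj T (amp (\<theta> X)) = op_conj T U (op_adj T (amp X))"
        proof (rule T.adj_eqI)
          fix x y assume xy: "x \<in> carrier T" "y \<in> carrier T"
          show "cinner T (amp (\<theta> X) x) y = cinner T x (op_conj T U (op_adj T (amp X)) y)"
            using xy X u Rb by (simp add: ampU T.op_conj T.cinner_adj T.cinner_adj'[symmetric])
        qed (use X \<theta>(1) Rb u T.op_conj in auto)
        then show "U (amp (op_adj H X) (op_adj T U x)) = amp (op_adj H (\<theta> X)) x" if "x \<in> carrier T" for x
          using that X \<theta>(1) Rb u by (simp add: amp_adj T.op_conj)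
      qed
    qed
    moreover have "\<forall>X\<in>commutant H M. \<theta> X = X"
    proof
      fix X assume X: "X \<in> commutant H M"
      have XR: "X \<in> R" using X commutant_antimono[OF NM] by (auto simp: R_def)
      show "\<theta> X = X"
      proof (rule eqI[OF XR XR])
        fix x assume x: "x \<in> carrier T"
        have "U (amp X (op_adj T U x)) = amp X (U (op_adj T U x))"
          using commutantD[of U T "amp ` commutant H M" "amp X" "op_adj T U x"] UM X x u(1) by (simp add: matsM)
        then show "U (amp X (op_adj T U x)) = amp X x" using u(3)[OF x] by simp
      qed
    qed
    ultimately have \<theta>id: "\<theta> Y = Y" if "Y \<in> R" for Y
      using aut[of \<theta>] that by (simp add: R_def)
    have "U \<in> commutant T (amp ` R)"
    proof (rule T.commutantI[OF u(1)])
      fix s x assume "s \<in> amp ` R" and x: "x \<in> carrier T"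
      then obtain Y where Y: "Y \<in> R" "s = amp Y" by blast
      have "amp Y (U x) = U (amp Y (op_adj T U (U x)))"
        using ampU[OF Y(1), of "U x"] \<theta>id[OF Y(1)] u(1) x by simp
      then show "U (s x) = s (U x)" using u(2)[OF x] Y(2) by simp
    qed (use Rb in auto)
    then show ?thesis by (simp add: matsN)
  qed
qed

end

section \<open>Intertwiners of an automorphism\<close>

context hilbert_space
begin

text \<open>Zorn for the operator order. The limit of a chain is a weak limit and so stays in the
  commutant; the premise \<open>lim\<close> offers the known properties of that limit, so that an
  application has to check only the extra conditions that define its family.\<close>

lemma maximal_op:
  assumes N: "N \<subseteq> bounded_ops H" and c: "c > 0" and ne: "\<P> \<noteq> {}"
    and sub: "\<And>A. A \<in> \<P> \<Longrightarrow> A \<in> commutant H N" "\<And>A. A \<in> \<P> \<Longrightarrow> op_pos H A"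
      "\<And>A x. A \<in> \<P> \<Longrightarrow> x \<in> carrier H \<Longrightarrow> Re (cinner H (A x) x) \<le> c * (hnorm H x)\<^sup>2"
    and lim: "\<And>C B F. \<lbrakk>C \<subseteq> \<P>; C \<noteq> {}; \<And>A B. A \<in> C \<Longrightarrow> B \<in> C \<Longrightarrow> op_le H A B \<or> op_le H B A;
        F \<noteq> bot; eventually (\<lambda>A. A \<in> C) F; B \<in> commutant H N; op_pos H B;
        \<And>x y. x \<in> carrier H \<Longrightarrow> y \<in> carrier H \<Longrightarrow> ((\<lambda>A. cinner H (A x) y) \<longlongrightarrow> cinner H (B x) y) F;
        \<And>A. A \<in> C \<Longrightarrow> op_le H A B; \<And>U. (\<And>A. A \<in> C \<Longrightarrow> op_le H A U) \<Longrightarrow> op_le H B U\<rbrakk> \<Longrightarrow> B \<in> \<P>"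
  shows "\<exists>A\<in>\<P>. \<forall>B\<in>\<P>. op_le H A B \<longrightarrow> B = A"
proof (rule predicate_Zorn)
  show "partial_order_on \<P> (relation_of (op_le H) \<P>)"
    using sub(2) op_le_refl op_le_trans selfadj_antisym
    by (intro partial_order_on_relation_ofI) (auto dest: op_pos_selfadj)
  fix C assume C: "C \<in> Chains (relation_of (op_le H) \<P>)"
  have chain: "op_le H A B \<or> op_le H B A" if "A \<in> C" "B \<in> C" for A B
    using C that by (auto simp: Chains_def relation_of_def)
  show "\<exists>u\<in>\<P>. \<forall>a\<in>C. op_le H a u"
  proof (cases "C = {}")
    case True
    then show ?thesis using ne by auto
  next
    case False
    have CP: "C \<subseteq> \<P>" using C by (auto simp: Chains_def relation_of_def)
    have "\<exists>B F. op_pos H B \<and> (\<forall>x\<in>carrier H. Re (cinner H (B x) x) \<le> c * (hnorm H x)\<^sup>2)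
      \<and> F \<noteq> bot \<and> eventually (\<lambda>A. A \<in> C) F
      \<and> (\<forall>x\<in>carrier H. \<forall>y\<in>carrier H. ((\<lambda>A. cinner H (A x) y) \<longlongrightarrow> cinner H (B x) y) F)
      \<and> (\<forall>A\<in>C. op_le H A B) \<and> (\<forall>U. (\<forall>A\<in>C. op_le H A U) \<longrightarrow> op_le H B U)"
      by (rule chain_limit[OF False c]) (use CP sub chain in auto)
    then obtain B F where B: "op_pos H B" "F \<noteq> bot" "eventually (\<lambda>A. A \<in> C) F"
      "\<And>x y. x \<in> carrier H \<Longrightarrow> y \<in> carrier H \<Longrightarrow> ((\<lambda>A. cinner H (A x) y) \<longlongrightarrow> cinner H (B x) y) F"
      "\<And>A. A \<in> C \<Longrightarrow> op_le H A B" "\<And>U. (\<forall>A\<in>C. op_le H A U) \<Longrightarrow> op_le H B U"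
      by blast
    have "eventually (\<lambda>A. A \<in> commutant H N) F"
      using B(3) by eventually_elim (use CP sub(1) in blast)
    then have "B \<in> commutant H N"
      using B(1) by (intro weak_operator_closed_limit[OF closedin_commutant[OF N] _ B(2) _ B(4)]) auto
    then have "B \<in> \<P>"
      by (intro lim[OF CP False chain B(2,3) _ B(1,4,5) B(6)]) auto
    then show ?thesis using B(5) by blast
  qed
qed

text \<open>By continuity, an operator that is nonzero at \<open>x\<close> has no zero on some small
  ball that contains \<open>x\<close> and is centred in the countable dense set. One operator chosen
  for each ball that admits one therefore suffices.\<close>

lemma countable_faithful:
  assumes sep: "separable_hilbert H" and D: "\<D> \<subseteq> bounded_ops H" "\<D> \<noteq> {}"
    and faithful: "\<And>x. \<lbrakk>x \<in> carrier H; x \<noteq> \<zero>\<rbrakk> \<Longrightarrow> \<exists>D\<in>\<D>. D x \<noteq> \<zero>"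
  shows "\<exists>D. (\<forall>n::nat. D n \<in> \<D>) \<and> (\<forall>x\<in>carrier H. x \<noteq> \<zero> \<longrightarrow> (\<exists>n. D n x \<noteq> \<zero>))"
proof -
  obtain C where C: "countable C" "C \<subseteq> carrier H" "mtopology closure_of C = carrier H"
    using sep by (auto simp: separable_hilbert_def separable_space_def)
  define good where "good p D \<longleftrightarrow> D \<in> \<D> \<and> (\<forall>z\<in>carrier H. hdist H (fst p) z < 1 / real (Suc (snd p)) \<longrightarrow> D z \<noteq> \<zero>)" for p D
  define I where "I = {p \<in> C \<times> (UNIV :: nat set). \<exists>D. good p D}"
  define d where "d p = (SOME D. good p D)" for p
  have d: "good p (d p)" if "p \<in> I" for p
  proof -
    have "\<exists>D. good p D" using that by (simp add: I_def)
    then show ?thesis unfolding d_def by (rule someI_ex)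
  qed
  \<comment> \<open>The fallback element keeps the enumerated set nonempty even if no ball
    qualifies.\<close>
  obtain D0 where D0: "D0 \<in> \<D>" using D(2) by blast
  define E where "E = insert D0 (d ` I)"
  have "countable I"
    using C(1) by (auto simp: I_def intro: countable_subset[of _ "C \<times> UNIV"])
  then have E: "countable E" "E \<noteq> {}" "E \<subseteq> \<D>"
    using D0 d by (auto simp: E_def good_def)
  have "\<exists>n. from_nat_into E n x \<noteq> \<zero>" if x: "x \<in> carrier H" "x \<noteq> \<zero>" for x
  proof -
    obtain A where A: "A \<in> \<D>" "A x \<noteq> \<zero>" using faithful[OF x] by blast
    then have Ab: "A \<in> bounded_ops H" using D(1) by blast
    obtain k where k: "k > 0" "\<And>x. x \<in> carrier H \<Longrightarrow> hnorm H (A x) \<le> k * hnorm H x"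
      using bounded_ops_bound[OF Ab] by blast
    define r where "r = hnorm H (A x) / k"
    have "hnorm H (A x) > 0"
      using hnorm_eq_0[of "A x"] hnorm_nonneg[of "A x"] A(2) Ab x(1) by simp
    then have r: "r > 0" using k(1) by (simp add: r_def)
    have near: "A z \<noteq> \<zero>" if z: "z \<in> carrier H" "hdist H x z < r" for z
    proof
      assume "A z = \<zero>"
      then have "A x = A (x \<ominus> z)"
        using x(1) z(1) Ab by (intro cinner_extl) (simp_all add: bounded_ops_diff cinner_simps)
      then have "hnorm H (A x) \<le> k * hdist H x z"
        using k(2)[of "x \<ominus> z"] x(1) z(1) by (simp add: hdist_def)
      also have "\<dots> < k * r" using z(2) k(1) by simp
      finally show False using k(1) by (simp add: r_def)
    qed
    \<comment> \<open>Half of \<open>r\<close>, because the distance from \<open>x\<close> to the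
      centre \<open>y\<close> and the radius of the ball around \<open>y\<close> add up.\<close>
    obtain n where n: "1 / real (Suc n) < r / 2"
      using nat_approx_posE[of "r / 2"] r by auto
    have "x \<in> mtopology closure_of C" using C(3) x(1) by simp
    then obtain y where y: "y \<in> C" "hdist H x y < 1 / real (Suc n)"
      unfolding metric_closure_of by (auto simp: mball_def) (metis of_nat_0_less_iff zero_less_Suc zero_less_divide_1_iff of_nat_Suc)
    have yc: "y \<in> carrier H" using y(1) C(2) by blast
    have "good (y, n) A"
      unfolding good_def
    proof (intro conjI ballI impI A(1))
      fix z assume z: "z \<in> carrier H" "hdist H (fst (y, n)) z < 1 / real (Suc (snd (y, n)))"
      have "hdist H x z \<le> hdist H x y + hdist H y z" by (rule triangle[OF x(1) yc z(1)])
      then have "hdist H x z < r" using y(2) z(2) n by simp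
      then show "A z \<noteq> \<zero>" by (rule near[OF z(1)])
    qed
    then have yn: "(y, n) \<in> I" using y(1) by (auto simp: I_def)
    have "hdist H y x < 1 / real (Suc n)" using y(2) commute by simp
    then have "d (y, n) x \<noteq> \<zero>"
      using d[OF yn] x(1) by (simp add: good_def)
    moreover have "d (y, n) \<in> E" using yn by (simp add: E_def)
    then obtain m where "from_nat_into E m = d (y, n)"
      using from_nat_into_surj[OF E(1)] by blast
    ultimately show ?thesis by metis
  qed
  then show ?thesis
    using from_nat_into[OF E(2)] E(3) by (intro exI[of _ "from_nat_into E"]) blast
qed

end

section \<open>Order properties of an automorphism of a commutant, and its intertwiners on
  \<open>H\<close>\<close>

locale commutant_automorphism = hilbert_space H for H :: "'a hilbert" (structure) +
  fixes N :: "('a \<Rightarrow> 'a) set" and \<theta> :: "('a \<Rightarrow> 'a) \<Rightarrow> 'a \<Rightarrow> 'a"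
  assumes N: "adj_closed_set H N" and aut: "star_automorphism H (commutant H N) \<theta>"
begin

abbreviation "R \<equiv> commutant H N"

lemma aut_simps:
  "X \<in> R \<Longrightarrow> \<theta> X \<in> R" "X \<in> R \<Longrightarrow> \<theta> X \<in> bounded_ops H"
  "\<lbrakk>X \<in> R; Y \<in> R\<rbrakk> \<Longrightarrow> \<theta> (op_add H X Y) = op_add H (\<theta> X) (\<theta> Y)"
  "\<lbrakk>X \<in> R; Y \<in> R\<rbrakk> \<Longrightarrow> \<theta> (op_mult H X Y) = op_mult H (\<theta> X) (\<theta> Y)"
  "X \<in> R \<Longrightarrow> \<theta> (op_smult H c X) = op_smult H c (\<theta> X)"
  "X \<in> R \<Longrightarrow> \<theta> (op_adj H X) = op_adj H (\<theta> X)"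
proof -
  have "\<theta> X \<in> R" if "X \<in> R" for X
    using aut that by (auto simp: star_automorphism_def bij_betw_def)
  then show "X \<in> R \<Longrightarrow> \<theta> X \<in> R" "X \<in> R \<Longrightarrow> \<theta> X \<in> bounded_ops H"
    using commutant_bounded by blast+
qed (use aut in \<open>auto simp: star_automorphism_def\<close>)

lemma R_ops:
  "op_one H \<in> R" "\<lbrakk>X \<in> R; Y \<in> R\<rbrakk> \<Longrightarrow> op_add H X Y \<in> R" "\<lbrakk>X \<in> R; Y \<in> R\<rbrakk> \<Longrightarrow> op_mult H X Y \<in> R"
  "X \<in> R \<Longrightarrow> op_smult H c X \<in> R" "X \<in> R \<Longrightarrow> op_adj H X \<in> R" "\<lbrakk>X \<in> R; Y \<in> R\<rbrakk> \<Longrightarrow> op_minus H X Y \<in> R"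
proof -
  have 1: "op_one H \<in> R"
    using von_neumann_algebra_commutant[OF N] by (simp add: von_neumann_algebra_def)
  show "op_one H \<in> R" by (rule 1)
  show "\<lbrakk>X \<in> R; Y \<in> R\<rbrakk> \<Longrightarrow> op_add H X Y \<in> R" by (rule commutant_ops(2)[OF N])
  show "\<lbrakk>X \<in> R; Y \<in> R\<rbrakk> \<Longrightarrow> op_mult H X Y \<in> R" by (rule commutant_ops(3)[OF N])
  show "X \<in> R \<Longrightarrow> op_smult H c X \<in> R" by (rule commutant_ops(4)[OF N _ 1])
  show "X \<in> R \<Longrightarrow> op_adj H X \<in> R" by (rule commutant_ops(5)[OF N _ 1])
  show "\<lbrakk>X \<in> R; Y \<in> R\<rbrakk> \<Longrightarrow> op_minus H X Y \<in> R" by (rule commutant_ops(6)[OF N])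
qed

lemma aut_minus: "\<lbrakk>X \<in> R; Y \<in> R\<rbrakk> \<Longrightarrow> \<theta> (op_minus H X Y) = op_minus H (\<theta> X) (\<theta> Y)"
  by (simp add: op_minus_def aut_simps R_ops)

lemma aut_surj: "Y \<in> R \<Longrightarrow> \<exists>X\<in>R. \<theta> X = Y"
  using aut unfolding star_automorphism_def bij_betw_def by (metis imageE)

text \<open>Surjectivity supplies \<open>E\<close> whose image is the identity; applying
  \<open>\<theta>\<close> to the product of the identity and \<open>E\<close> then identifies the
  image of the identity.\<close>

lemma aut_one: "\<theta> (op_one H) = op_one H"
proof -
  obtain E where E: "E \<in> R" "\<theta> E = op_one H" using aut_surj[OF R_ops(1)] by blast
  have "\<theta> (op_mult H (op_one H) E) = op_mult H (\<theta> (op_one H)) (\<theta> E)"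
    by (rule aut_simps(4)[OF R_ops(1) E(1)])
  then show ?thesis
    using E aut_simps(2)[OF R_ops(1)] by simp
qed

text \<open>With \<open>aut_le\<close> available for both maps, \<open>\<theta>\<close> is an order
  isomorphism, which takes the place of normality in \<open>dominated_ex\<close>.\<close>

lemma inverse_aut: "commutant_automorphism H N (inv_into R \<theta>)"
proof
  define \<iota> where "\<iota> = inv_into R \<theta>"
  have bij: "bij_betw \<theta> R R" using aut by (simp add: star_automorphism_def)
  have \<iota>: "\<iota> X \<in> R" "\<theta> (\<iota> X) = X" if "X \<in> R" for X
    using bij that by (auto simp: \<iota>_def bij_betw_def inv_into_into f_inv_into_f)
  have eqI: "\<iota> X = Y" if "Y \<in> R" "\<theta> Y = X" for X Y
    using bij that by (auto simp: \<iota>_def bij_betw_def)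
  have "star_automorphism H R \<iota>"
    unfolding star_automorphism_def
  proof (intro conjI ballI allI)
    show "bij_betw \<iota> R R" unfolding \<iota>_def by (rule bij_betw_inv_into[OF bij])
  qed (auto intro!: eqI simp: aut_simps R_ops \<iota>)
  then show "star_automorphism H R (inv_into R \<theta>)" by (simp add: \<iota>_def)
qed (rule N)

text \<open>A square root makes positivity algebraic, and the commutation clause of
  \<open>op_sqrt\<close> keeps that root in the commutant, where \<open>\<theta>\<close> respects
  products and adjoints.\<close>

lemma aut_pos:
  assumes X: "X \<in> R" "op_pos H X"
  shows "op_pos H (\<theta> X)"
proof -
  obtain S where S: "op_pos H S" "op_mult H S S = X"
    "\<And>Z. \<lbrakk>Z \<in> bounded_ops H; op_mult H Z X = op_mult H X Z\<rbrakk> \<Longrightarrow> op_mult H Z S = op_mult H S Z"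
    using op_sqrt[OF X(2)] by blast
  have "S \<in> R"
    unfolding commutant_def
  proof (intro CollectI conjI ballI)
    fix n assume n: "n \<in> N"
    have "op_mult H n S = op_mult H S n"
    proof (rule S(3))
      show "n \<in> bounded_ops H" using n N by (auto simp: adj_closed_set_def)
      show "op_mult H n X = op_mult H X n" using X(1) n unfolding commutant_def by auto
    qed
    then show "op_mult H S n = op_mult H n S" ..
  qed (use S(1) in simp)
  have "op_adj H (\<theta> S) = \<theta> S"
    using aut_simps(6)[OF \<open>S \<in> R\<close>] op_pos_selfadj[OF S(1)] by (simp add: selfadj_def)
  then have "\<theta> X = op_mult H (op_adj H (\<theta> S)) (\<theta> S)"
    using S(2) aut_simps(4)[OF \<open>S \<in> R\<close> \<open>S \<in> R\<close>] by simp
  then show ?thesis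
    using op_pos_adj_mult[OF aut_simps(2)[OF \<open>S \<in> R\<close>]] by simp
qed

lemma aut_selfadj: "X \<in> R \<Longrightarrow> selfadj H X \<Longrightarrow> selfadj H (\<theta> X)"
  using aut_simps(2,6)[of X] by (simp add: selfadj_def)

lemma aut_le:
  assumes "X \<in> R" "Y \<in> R" "selfadj H X" "selfadj H Y" "op_le H X Y"
  shows "op_le H (\<theta> X) (\<theta> Y)"
proof -
  have "op_pos H (\<theta> (op_minus H Y X))"
    using assms by (intro aut_pos R_ops) (simp_all add: op_pos_minus_iff)
  then show ?thesis
    using assms aut_selfadj by (simp add: aut_minus op_pos_minus_iff)
qed

text \<open>The functional \<open>\<phi> A = \<langle>\<theta> A \<xi>, \<xi>\<rangle>\<close> is cut down to a positive element \<open>b\<close> below which it is dominated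
  by a vector functional \<open>\<omega> A = \<langle>A \<eta>, \<eta>\<rangle>\<close>; both cuts are made by Zorn's lemma.\<close>

lemma dominated_ex:
  assumes \<xi>: "\<xi> \<in> carrier H" "\<xi> \<noteq> \<zero>"
  shows "\<exists>b \<eta>. b \<in> R \<and> op_pos H b \<and> op_le H b (op_one H) \<and> \<eta> \<in> carrier H
    \<and> Re (cinner H (\<theta> b \<xi>) \<xi>) > 0
    \<and> (\<forall>y\<in>R. op_pos H y \<longrightarrow> op_le H y b \<longrightarrow> Re (cinner H (\<theta> y \<xi>) \<xi>) \<le> Re (cinner H (y \<eta>) \<eta>))"
proof -
  interpret inv: commutant_automorphism H N "inv_into R \<theta>" by (rule inverse_aut)
  have Nb: "N \<subseteq> bounded_ops H" using N by (simp add: adj_closed_set_def)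
  define \<phi> where "\<phi> A = Re (cinner H (\<theta> A \<xi>) \<xi>)" for A
  have \<phi>_add: "\<phi> (op_add H A B) = \<phi> A + \<phi> B" if "A \<in> R" "B \<in> R" for A B
    using that \<xi>(1) aut_simps(2) by (simp add: \<phi>_def aut_simps cinner_simps)
  have \<phi>_minus: "\<phi> (op_minus H A B) = \<phi> A - \<phi> B" if "A \<in> R" "B \<in> R" for A B
    using that \<xi>(1) aut_simps(2) by (simp add: \<phi>_def aut_minus cinner_simps)
  have \<phi>_nonneg: "0 \<le> \<phi> A" if "A \<in> R" "op_pos H A" for A
    using aut_pos[OF that] \<xi>(1) by (simp add: \<phi>_def op_pos_def)
  have \<phi>_mono: "\<phi> A \<le> \<phi> B" if "A \<in> R" "B \<in> R" "op_pos H A" "op_pos H B" "op_le H A B" for A B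
    using aut_le[OF that(1,2) _ _ that(5)] that \<xi>(1) by (simp add: \<phi>_def op_le_def)
  define zop where "zop = op_smult H 0 (op_one H)"
  have zop: "zop \<in> R" "op_pos H zop" "\<And>x. x \<in> carrier H \<Longrightarrow> zop x = \<zero>"
    using R_ops(1) R_ops(4)[of "op_one H" 0] selfadj_smult[OF selfadj_one, of 0]
    by (auto simp: zop_def op_pos_def cinner_simps)
  have \<phi>_zero: "\<phi> A = 0" if "A \<in> R" "\<And>x. x \<in> carrier H \<Longrightarrow> A x = \<zero>" for A
  proof -
    have "A = zop" using that zop by (intro ops_eqI) auto
    then show ?thesis
      using \<xi>(1) aut_simps(2)[OF R_ops(1)] R_ops(1) by (simp add: \<phi>_def zop_def aut_simps cinner_simps)
  qed
  have one: "op_pos H (op_one H)" by (simp add: op_pos_def cinner_self_nonneg)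
  have le_one: "op_le H A (op_one H) \<longleftrightarrow> (\<forall>x\<in>carrier H. Re (cinner H (A x) x) \<le> 1 * (hnorm H x)\<^sup>2)" for A
    by (simp add: op_le_def hnorm_power2)
  have cancel: "Re (cinner H (B x) x) = 0" if "op_add H A B = A" "A \<in> R" "B \<in> R" "x \<in> carrier H" for A B x
  proof -
    have "cinner H (op_add H A B x) x = cinner H (A x) x + cinner H (B x) x"
      using that(2-4) by (simp add: cinner_simps)
    then show ?thesis using that(1) by simp
  qed
  \<comment> \<open>A maximal \<open>z\<close> among the positive contractions killed by
    \<open>\<phi>\<close> is split off. Below \<open>e = 1 - z\<close> a positive element on which
    \<open>\<phi>\<close> vanishes must be zero, since otherwise it could be added to
    \<open>z\<close>.\<close>
  define P1 where "P1 = {A \<in> R. op_pos H A \<and> op_le H A (op_one H) \<and> \<phi> A = 0}"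
  have "\<exists>A\<in>P1. \<forall>B\<in>P1. op_le H A B \<longrightarrow> B = A"
  proof (rule maximal_op[OF Nb zero_less_one])
    have "zop \<in> P1" using zop \<phi>_zero[OF zop(1,3)] by (auto simp: P1_def op_le_def cinner_simps cinner_self_nonneg)
    then show "P1 \<noteq> {}" by blast
    fix C B F assume C: "C \<subseteq> P1" "C \<noteq> {}" "\<And>A B. A \<in> C \<Longrightarrow> B \<in> C \<Longrightarrow> op_le H A B \<or> op_le H B A"
      and B: "B \<in> R" "op_pos H B" and lub: "\<And>U. (\<And>A. A \<in> C \<Longrightarrow> op_le H A U) \<Longrightarrow> op_le H B U"
    have CR: "A \<in> R" "op_pos H A" "op_le H A (op_one H)" "\<phi> A = 0" if "A \<in> C" for A
      using C(1) that by (auto simp: P1_def)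
    have ple: "op_le H (\<theta> A) (op_one H)" if "A \<in> C" for A
      using aut_le[OF CR(1)[OF that] R_ops(1) _ _ CR(3)[OF that]] CR(2)[OF that] aut_one by simp
    \<comment> \<open>\<open>\<phi>\<close> is not known to be continuous. The limit
      \<open>B'\<close> of the image chain is a weak limit of images whose form at
      \<open>\<xi>\<close> is zero, and its preimage \<open>B0\<close> is an upper bound of
      \<open>C\<close>; so the least upper bound \<open>B\<close> satisfies
      \<open>\<phi> B \<le> 0\<close>.\<close>
    define C' where "C' = \<theta> ` C"
    have "\<exists>B' F'. op_pos H B' \<and> (\<forall>x\<in>carrier H. Re (cinner H (B' x) x) \<le> 1 * (hnorm H x)\<^sup>2)
      \<and> F' \<noteq> bot \<and> eventually (\<lambda>A. A \<in> C') F'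
      \<and> (\<forall>x\<in>carrier H. \<forall>y\<in>carrier H. ((\<lambda>A. cinner H (A x) y) \<longlongrightarrow> cinner H (B' x) y) F')
      \<and> (\<forall>A\<in>C'. op_le H A B') \<and> (\<forall>U. (\<forall>A\<in>C'. op_le H A U) \<longrightarrow> op_le H B' U)"
    proof (rule chain_limit)
      show "C' \<noteq> {}" using C(2) by (simp add: C'_def)
      show "op_pos H A" if "A \<in> C'" for A using that aut_pos CR by (auto simp: C'_def)
      show "Re (cinner H (A x) x) \<le> 1 * (hnorm H x)\<^sup>2" if "A \<in> C'" "x \<in> carrier H" for A x
        using that ple le_one by (auto simp: C'_def)
      fix X Y assume "X \<in> C'" "Y \<in> C'"
      then obtain A B where AB: "A \<in> C" "X = \<theta> A" "B \<in> C" "Y = \<theta> B" by (auto simp: C'_def)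
      have "selfadj H A" "selfadj H B" using CR(2) AB by auto
      then show "op_le H X Y \<or> op_le H Y X"
        using C(3)[OF AB(1,3)] aut_le CR(1) AB by blast
    qed simp
    then obtain B' F' where B': "op_pos H B'" "F' \<noteq> bot" "eventually (\<lambda>A. A \<in> C') F'"
      "\<And>x y. x \<in> carrier H \<Longrightarrow> y \<in> carrier H \<Longrightarrow> ((\<lambda>A. cinner H (A x) y) \<longlongrightarrow> cinner H (B' x) y) F'"
      "\<And>A. A \<in> C' \<Longrightarrow> op_le H A B'" by blast
    have "eventually (\<lambda>A. A \<in> R) F'"
      using B'(3) by eventually_elim (use CR(1) aut_simps(1) in \<open>auto simp: C'_def\<close>)
    then have B'R: "B' \<in> R"
      using B'(1) by (intro weak_operator_closed_limit[OF closedin_commutant[OF Nb] _ B'(2) _ B'(4)]) auto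
    obtain B0 where B0: "B0 \<in> R" "\<theta> B0 = B'" using aut_surj[OF B'R] by blast
    have inv\<theta>: "inv_into R \<theta> (\<theta> A) = A" if "A \<in> R" for A
      using aut that by (auto simp: star_automorphism_def bij_betw_def)
    have B0pos: "op_pos H B0"
      using inv.aut_pos[OF B'R B'(1)] inv\<theta>[OF B0(1)] B0(2) by simp
    have "op_le H A B0" if A: "A \<in> C" for A
    proof -
      have "op_le H (inv_into R \<theta> (\<theta> A)) (inv_into R \<theta> B')"
        by (rule inv.aut_le) (use A B'(1,5) B'R CR aut_simps(1) aut_pos in \<open>auto simp: C'_def\<close>)
      then show ?thesis using inv\<theta>[OF B0(1)] inv\<theta>[OF CR(1)[OF A]] B0(2) by simp
    qed
    then have "op_le H B B0" by (rule lub)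
    then have "\<phi> B \<le> Re (cinner H (B' \<xi>) \<xi>)"
      using \<phi>_mono[OF B(1) B0(1) B(2) B0pos] B0(2) by (simp add: \<phi>_def)
    moreover have "Re (cinner H (B' \<xi>) \<xi>) \<le> 0"
    proof (rule tendsto_upperbound[OF tendsto_Re[OF B'(4)[OF \<xi>(1) \<xi>(1)]] _ B'(2)])
      show "eventually (\<lambda>A. Re (cinner H (A \<xi>) \<xi>) \<le> 0) F'"
        using B'(3) by eventually_elim (use CR(4) in \<open>auto simp: C'_def \<phi>_def\<close>)
    qed
    moreover have "op_le H B (op_one H)" by (rule lub) (rule CR(3))
    ultimately show "B \<in> P1"
      using B \<phi>_nonneg[OF B] by (simp add: P1_def)
  qed (auto simp: P1_def le_one)
  then obtain z where z: "z \<in> P1" "\<And>B. B \<in> P1 \<Longrightarrow> op_le H z B \<Longrightarrow> B = z" by blast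
  have zR: "z \<in> R" "op_pos H z" "op_le H z (op_one H)" "\<phi> z = 0" using z(1) by (auto simp: P1_def)
  define e where "e = op_minus H (op_one H) z"
  have eR: "e \<in> R" using R_ops zR by (simp add: e_def)
  have epos: "op_pos H e" using zR by (simp add: e_def op_pos_minus_iff)
  have e1: "op_le H e (op_one H)" using zR(1,2) by (auto simp: e_def op_le_def op_pos_def cinner_simps)
  have fact1: "Re (cinner H (y x) x) = 0"
    if y: "y \<in> R" "op_pos H y" "op_le H y e" "\<phi> y \<le> 0" and x: "x \<in> carrier H" for y x
  proof -
    have "op_add H z y \<in> P1"
      unfolding P1_def
    proof (intro CollectI conjI)
      show "op_add H z y \<in> R" by (rule R_ops(2)[OF zR(1) y(1)])
      show "op_pos H (op_add H z y)" using zR(1,2) y(1,2) by (auto simp: op_pos_def cinner_simps)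
      show "op_le H (op_add H z y) (op_one H)" using zR(1) y(1,3) by (auto simp: op_le_def e_def cinner_simps)
      show "\<phi> (op_add H z y) = 0" using \<phi>_add[OF zR(1) y(1)] zR(4) y(4) \<phi>_nonneg[OF y(1,2)] by simp
    qed
    moreover have "op_le H z (op_add H z y)" using zR(1) y(1,2) by (auto simp: op_le_def op_pos_def cinner_simps)
    ultimately have "op_add H z y = z" by (rule z(2))
    then show ?thesis by (rule cancel[OF _ zR(1) y(1) x])
  qed
  have \<phi>e: "\<phi> e > 0"
  proof -
    have "\<phi> e = \<phi> (op_one H)" using \<phi>_minus[OF R_ops(1) zR(1)] zR(4) by (simp add: e_def)
    also have "\<dots> = (hnorm H \<xi>)\<^sup>2" using \<xi>(1) by (simp add: \<phi>_def aut_one hnorm_power2)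
    finally show ?thesis using hnorm_eq_0[OF \<xi>(1)] \<xi>(2) by simp
  qed
  obtain v where v: "v \<in> carrier H" "Re (cinner H (e v) v) > 0"
  proof -
    have "\<exists>v\<in>carrier H. Re (cinner H (e v) v) > 0"
    proof (rule ccontr)
      assume *: "\<not> ?thesis"
      have "e = zop"
      proof (rule selfadj_antisym)
        show "op_le H e zop" using * zop(3) by (auto simp: op_le_def cinner_simps not_less)
        show "op_le H zop e" using epos zop(3) by (auto simp: op_le_def op_pos_def cinner_simps)
      qed (use epos zop in auto)
      then show False using \<phi>e \<phi>_zero[OF zop(1,3)] by simp
    qed
    then show ?thesis using that by blast
  qed
  \<comment> \<open>Scales \<open>v\<close> so that \<open>\<omega> e = \<phi> e + 1\<close>: the
    vector functional must strictly exceed \<open>\<phi>\<close> at \<open>e\<close> for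
    \<open>\<phi> b\<close> to come out positive.\<close>
  define t where "t = sqrt ((\<phi> e + 1) / Re (cinner H (e v) v))"
  define \<eta> where "\<eta> = complex_of_real t \<odot> v"
  have \<eta>: "\<eta> \<in> carrier H" using v(1) by (simp add: \<eta>_def)
  define \<omega> where "\<omega> A = Re (cinner H (A \<eta>) \<eta>)" for A
  have "\<omega> e = t * (t * Re (cinner H (e v) v))"
    using v(1) eR by (simp add: \<omega>_def \<eta>_def bounded_ops_smult cinner_simps)
  also have "\<dots> = \<phi> e + 1"
    using v(2) \<phi>e by (simp add: t_def flip: mult.assoc)
  finally have \<omega>e: "\<omega> e > \<phi> e" by simp
  have \<omega>_add: "\<omega> (op_add H A B) = \<omega> A + \<omega> B" if "A \<in> R" "B \<in> R" for A B
    using that \<eta> by (simp add: \<omega>_def cinner_simps)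
  \<comment> \<open>A maximal \<open>x0\<close> below \<open>e\<close> with
    \<open>\<omega> x0 \<le> \<phi> x0\<close> is removed from \<open>e\<close>; a positive
    \<open>y\<close> below \<open>b = e - x0\<close> with \<open>\<phi> y > \<omega> y\<close> could
    be added to \<open>x0\<close>. Chains are easier here: \<open>\<omega>\<close> passes to weak
    limits, and \<open>\<phi>\<close> is monotone.\<close>
  define P2 where "P2 = {A \<in> R. op_pos H A \<and> op_le H A e \<and> \<omega> A \<le> \<phi> A}"
  have "\<exists>A\<in>P2. \<forall>B\<in>P2. op_le H A B \<longrightarrow> B = A"
  proof (rule maximal_op[OF Nb zero_less_one])
    have "zop \<in> P2"
      using zop \<phi>_zero[OF zop(1,3)] epos \<eta> by (auto simp: P2_def op_le_def op_pos_def \<omega>_def cinner_simps)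
    then show "P2 \<noteq> {}" by blast
    fix A x assume A: "A \<in> P2" and x: "x \<in> carrier H"
    have "op_le H A (op_one H)" using A e1 op_le_trans by (auto simp: P2_def)
    then show "Re (cinner H (A x) x) \<le> 1 * (hnorm H x)\<^sup>2" using x by (simp add: le_one)
  next
    fix C B and F :: "('a \<Rightarrow> 'a) filter" assume C: "C \<subseteq> P2" and F: "F \<noteq> bot" "eventually (\<lambda>A. A \<in> C) F"
      and B: "B \<in> R" "op_pos H B"
      and lim: "\<And>x y. x \<in> carrier H \<Longrightarrow> y \<in> carrier H \<Longrightarrow> ((\<lambda>A. cinner H (A x) y) \<longlongrightarrow> cinner H (B x) y) F"
      and ub: "\<And>A. A \<in> C \<Longrightarrow> op_le H A B" and lub: "\<And>U. (\<And>A. A \<in> C \<Longrightarrow> op_le H A U) \<Longrightarrow> op_le H B U"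
    have "\<omega> B \<le> \<phi> B"
      unfolding \<omega>_def
    proof (rule tendsto_upperbound[OF tendsto_Re[OF lim[OF \<eta> \<eta>]] _ F(1)])
      show "eventually (\<lambda>A. Re (cinner H (A \<eta>) \<eta>) \<le> \<phi> B) F"
        using F(2)
      proof eventually_elim
        case (elim A)
        then have "\<omega> A \<le> \<phi> A" "\<phi> A \<le> \<phi> B"
          using C ub[OF elim] B by (auto simp: P2_def intro!: \<phi>_mono)
        then show ?case by (simp add: \<omega>_def)
      qed
    qed
    moreover have "op_le H B e" by (rule lub) (use C in \<open>auto simp: P2_def\<close>)
    ultimately show "B \<in> P2" using B by (simp add: P2_def)
  qed (auto simp: P2_def)
  then obtain x0 where x0: "x0 \<in> P2" "\<And>B. B \<in> P2 \<Longrightarrow> op_le H x0 B \<Longrightarrow> B = x0" by blast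
  have x0R: "x0 \<in> R" "op_pos H x0" "op_le H x0 e" "\<omega> x0 \<le> \<phi> x0" using x0(1) by (auto simp: P2_def)
  define b where "b = op_minus H e x0"
  have bR: "b \<in> R" using R_ops eR x0R by (simp add: b_def)
  have bpos: "op_pos H b" using x0R epos by (simp add: b_def op_pos_minus_iff)
  have be: "op_le H b e" using x0R eR by (auto simp: b_def op_le_def op_pos_def cinner_simps)
  \<comment> \<open>Otherwise \<open>fact1\<close> makes the form of \<open>b\<close> vanish at
    \<open>\<eta>\<close>, so that
    \<open>\<omega> e = \<omega> x0 \<le> \<phi> x0 = \<phi> e\<close>, against the choice of
    \<open>t\<close>.\<close>
  have \<phi>b: "\<phi> b > 0"
  proof (rule ccontr)
    assume "\<not> \<phi> b > 0"
    then have "Re (cinner H (b \<eta>) \<eta>) = 0" "\<phi> b = 0"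
      using fact1[OF bR bpos be _ \<eta>] \<phi>_nonneg[OF bR bpos] by auto
    moreover have "\<phi> b = \<phi> e - \<phi> x0" using \<phi>_minus[OF eR x0R(1)] by (simp add: b_def)
    moreover have "Re (cinner H (b \<eta>) \<eta>) = \<omega> e - \<omega> x0" using \<eta> eR x0R(1) by (simp add: b_def \<omega>_def cinner_simps)
    ultimately show False using x0R(4) \<omega>e by simp
  qed
  have "\<phi> y \<le> \<omega> y" if y: "y \<in> R" "op_pos H y" "op_le H y b" for y
  proof (rule ccontr)
    assume less: "\<not> \<phi> y \<le> \<omega> y"
    have "op_add H x0 y \<in> P2"
      unfolding P2_def
    proof (intro CollectI conjI)
      show "op_add H x0 y \<in> R" by (rule R_ops(2)[OF x0R(1) y(1)])
      show "op_pos H (op_add H x0 y)" using x0R(1,2) y(1,2) by (auto simp: op_pos_def cinner_simps)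
      show "op_le H (op_add H x0 y) e" using x0R(1) y(1,3) eR by (auto simp: op_le_def b_def cinner_simps)
      show "\<omega> (op_add H x0 y) \<le> \<phi> (op_add H x0 y)"
        using \<phi>_add[OF x0R(1) y(1)] \<omega>_add[OF x0R(1) y(1)] x0R(4) less by simp
    qed
    moreover have "op_le H x0 (op_add H x0 y)" using x0R(1) y(1,2) by (auto simp: op_le_def op_pos_def cinner_simps)
    ultimately have eq: "op_add H x0 y = x0" by (rule x0(2))
    have y0: "Re (cinner H (y x) x) = 0" if "x \<in> carrier H" for x
      using cancel[OF eq x0R(1) y(1) that] .
    have "y = zop"
      by (rule selfadj_antisym) (use y0 y(2) zop in \<open>auto simp: op_le_def cinner_simps\<close>)
    then show False
      using less y0[OF \<eta>] \<phi>_zero[OF zop(1,3)] by (simp add: \<omega>_def)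
  qed
  then show ?thesis
    using bR bpos op_le_trans[OF be e1] \<eta> \<phi>b unfolding \<phi>_def \<omega>_def by blast
qed

text \<open>\<open>D\<close> is the adjoint of the contraction
  \<open>x (b \<eta>) \<mapsto> \<theta> x (\<theta> b \<xi>)\<close>, with \<open>x\<close> in the
  commutant, whose boundedness is the domination inequality. That contraction turns \<open>z\<close>
  into \<open>\<theta> z\<close>, so its adjoint intertwines in the opposite direction; and
  \<open>\<langle>b \<eta>, D \<xi>\<rangle> = \<langle>\<theta> b \<xi>, \<xi>\<rangle>\<close> is
  nonzero.\<close>

lemma intertwiner_ex:
  assumes \<xi>: "\<xi> \<in> carrier H" "\<xi> \<noteq> \<zero>"
  shows "\<exists>D\<in>bounded_ops H. (\<forall>z\<in>R. \<forall>x\<in>carrier H. D (\<theta> z x) = z (D x)) \<and> D \<xi> \<noteq> \<zero>"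
proof -
  obtain b \<eta> where b: "b \<in> R" "op_pos H b" "op_le H b (op_one H)" and \<eta>: "\<eta> \<in> carrier H"
    and b\<xi>: "Re (cinner H (\<theta> b \<xi>) \<xi>) > 0"
    and dom: "\<And>y. \<lbrakk>y \<in> R; op_pos H y; op_le H y b\<rbrakk> \<Longrightarrow> Re (cinner H (\<theta> y \<xi>) \<xi>) \<le> Re (cinner H (y \<eta>) \<eta>)"
    using dominated_ex[OF \<xi>] by blast
  have [simp]: "b \<in> bounded_ops H" "\<theta> b \<in> bounded_ops H" using b(1) aut_simps(2) by auto
  have bnorm: "(hnorm H (b x))\<^sup>2 \<le> Re (cinner H (b x) x)" if "x \<in> carrier H" for x
  proof -
    have "Re (cinner H (b y) y) \<le> 1 * (hnorm H y)\<^sup>2" if "y \<in> carrier H" for y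
      using b(3) that by (simp add: op_le_def hnorm_power2)
    then show ?thesis using op_pos_bound(1)[OF b(2) zero_less_one that] by simp
  qed
  have contr: "hnorm H (\<theta> x (\<theta> b \<xi>)) \<le> hnorm H (x (b \<eta>))" if x: "x \<in> R" for x
  proof -
    have xb[simp]: "x \<in> bounded_ops H" "\<theta> x \<in> bounded_ops H" using x aut_simps(2) by auto
    obtain k where k: "k > 0" "\<And>v. v \<in> carrier H \<Longrightarrow> hnorm H (x v) \<le> k * hnorm H v"
      using bounded_ops_bound[OF xb(1)] by blast
    define a where "a = op_mult H b (op_mult H (op_mult H (op_adj H x) x) b)"
    have aR: "a \<in> R" using R_ops b(1) x by (simp add: a_def)
    have aq: "cinner H (a v) v = cinner H (x (b v)) (x (b v))" if "v \<in> carrier H" for v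
      using that selfadj_cinner[OF op_pos_selfadj[OF b(2)], of "op_adj H x (x (b v))" v]
      by (simp add: a_def cinner_adj')
    \<comment> \<open>Domination is available only below \<open>b\<close>. With \<open>k\<close> a
      bound for \<open>x\<close>, the positive element \<open>a\<close> is at most
      \<open>k\<^sup>2\<close> times the square of \<open>b\<close>, hence at most
      \<open>k\<^sup>2\<close> times \<open>b\<close>, as \<open>b\<close> is a positive
      contraction.\<close>
    define y where "y = op_smult H (complex_of_real (1 / k\<^sup>2)) a"
    have yR: "y \<in> R" unfolding y_def by (rule R_ops(4)[OF aR])
    have "op_adj H a = a"
      using b(2) op_pos_selfadj[OF b(2)] by (simp add: a_def adj_mult selfadj_def op_mult_assoc)
    then have "selfadj H a" using aR by (simp add: selfadj_def)
    then have "selfadj H y" unfolding y_def by (rule selfadj_smult)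
    have yq: "Re (cinner H (y v) v) = (hnorm H (x (b v)))\<^sup>2 / k\<^sup>2" if "v \<in> carrier H" for v
      using that aR by (simp add: y_def cinner_simps aq hnorm_power2 del: of_real_divide of_real_power)
    have "op_pos H y" using \<open>selfadj H y\<close> by (simp add: op_pos_def yq)
    moreover have "op_le H y b"
      unfolding op_le_def
    proof
      fix v assume v: "v \<in> carrier H"
      have "(hnorm H (x (b v)))\<^sup>2 \<le> (k * hnorm H (b v))\<^sup>2"
        using k(2)[of "b v"] v by (intro power_mono) (auto simp: hnorm_nonneg)
      also have "\<dots> \<le> k\<^sup>2 * Re (cinner H (b v) v)"
        using bnorm[OF v] by (simp add: power_mult_distrib mult_left_mono)
      finally show "Re (cinner H (y v) v) \<le> Re (cinner H (b v) v)"
        using k(1) by (simp add: yq[OF v] pos_divide_le_eq mult.commute)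
    qed
    ultimately have "Re (cinner H (\<theta> y \<xi>) \<xi>) \<le> Re (cinner H (y \<eta>) \<eta>)"
      by (rule dom[OF yR])
    moreover have "Re (cinner H (\<theta> y \<xi>) \<xi>) = (hnorm H (\<theta> x (\<theta> b \<xi>)))\<^sup>2 / k\<^sup>2"
    proof -
      have sb: "selfadj H (\<theta> b)" by (rule aut_selfadj[OF b(1) op_pos_selfadj[OF b(2)]])
      have \<theta>a: "\<theta> a = op_mult H (\<theta> b) (op_mult H (op_mult H (op_adj H (\<theta> x)) (\<theta> x)) (\<theta> b))"
        using b(1) x R_ops by (simp add: a_def aut_simps)
      have "cinner H (\<theta> a \<xi>) \<xi> = cinner H (\<theta> x (\<theta> b \<xi>)) (\<theta> x (\<theta> b \<xi>))"
        using \<xi>(1) selfadj_cinner[OF sb, of "op_adj H (\<theta> x) (\<theta> x (\<theta> b \<xi>))" \<xi>]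
        by (simp add: \<theta>a cinner_adj')
      then show ?thesis
        using \<xi>(1) aR aut_simps(2)[OF aR]
        by (simp add: y_def aut_simps cinner_simps hnorm_power2 del: of_real_divide of_real_power)
    qed
    ultimately have "(hnorm H (\<theta> x (\<theta> b \<xi>)))\<^sup>2 \<le> (hnorm H (x (b \<eta>)))\<^sup>2"
      using yq[OF \<eta>] k(1) by (simp add: divide_le_cancel)
    then show ?thesis
      by (rule power2_le_imp_le) (use \<eta> x in \<open>simp add: hnorm_nonneg\<close>)
  qed
  define S where "S = (\<lambda>x. x (b \<eta>)) ` R"
  have Sc: "S \<subseteq> carrier H" using \<eta> by (auto simp: S_def)
  \<comment> \<open>Different \<open>x\<close> may give the same vector \<open>x (b \<eta>)\<close>;
    \<open>contr\<close> applied to their difference shows that the choice does not matter.\<close>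
  define g where "g u = \<theta> (SOME x. x \<in> R \<and> x (b \<eta>) = u) (\<theta> b \<xi>)" for u
  have gs: "g (x (b \<eta>)) = \<theta> x (\<theta> b \<xi>)" if x: "x \<in> R" for x
  proof -
    define x' where "x' = (SOME y. y \<in> R \<and> y (b \<eta>) = x (b \<eta>))"
    have x': "x' \<in> R" "x' (b \<eta>) = x (b \<eta>)"
      using someI[of "\<lambda>y. y \<in> R \<and> y (b \<eta>) = x (b \<eta>)" x] x by (auto simp: x'_def)
    have "hnorm H (\<theta> (op_minus H x' x) (\<theta> b \<xi>)) \<le> hnorm H (op_minus H x' x (b \<eta>))"
      by (rule contr[OF R_ops(6)[OF x'(1) x]])
    also have "op_minus H x' x (b \<eta>) = \<zero>"
      using x' x \<eta> minus_eq_zero_iff[of "x (b \<eta>)" "x (b \<eta>)"] by simp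
    finally have "hnorm H (\<theta> x' (\<theta> b \<xi>) \<ominus> \<theta> x (\<theta> b \<xi>)) \<le> 0"
      using x' x \<xi>(1) aut_simps(2) hnorm_eq_0[of \<zero>] by (simp add: aut_minus)
    then have "\<theta> x' (\<theta> b \<xi>) \<ominus> \<theta> x (\<theta> b \<xi>) = \<zero>"
      using hnorm_nonneg[of "\<theta> x' (\<theta> b \<xi>) \<ominus> \<theta> x (\<theta> b \<xi>)"] hnorm_eq_0[of "\<theta> x' (\<theta> b \<xi>) \<ominus> \<theta> x (\<theta> b \<xi>)"]
        x' x \<xi>(1) aut_simps(2) by simp
    then have "\<theta> x' (\<theta> b \<xi>) = \<theta> x (\<theta> b \<xi>)"
      using minus_eq_zero_iff[of "\<theta> x' (\<theta> b \<xi>)" "\<theta> x (\<theta> b \<xi>)"] x' x \<xi>(1) aut_simps(2) by simp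
    then show ?thesis by (simp add: g_def x'_def)
  qed
  have "\<exists>D\<in>bounded_ops H. (\<forall>v\<in>carrier H. D v \<in> orth H (orth H S))
    \<and> (\<forall>u\<in>S. \<forall>v\<in>carrier H. cinner H u (D v) = cinner H (g u) v)"
  proof (rule contraction_adjoint_ex[OF Sc])
    show "\<zero> \<in> S"
      unfolding S_def using R_ops(1) R_ops(4)[of "op_one H" 0] \<eta>
      by (intro image_eqI[of _ _ "op_smult H 0 (op_one H)"]) auto
    fix u w c assume u: "u \<in> S"
    then obtain x where x: "x \<in> R" "u = x (b \<eta>)" by (auto simp: S_def)
    have cu: "c \<odot> u = op_smult H c x (b \<eta>)" using x \<eta> by simp
    show "c \<odot> u \<in> S" unfolding cu S_def using R_ops(4)[OF x(1)] by blast
    show "g u \<in> carrier H" using gs[OF x(1)] x(2) aut_simps(2)[OF x(1)] \<xi>(1) by simp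
    show "g (c \<odot> u) = c \<odot> g u"
      unfolding cu gs[OF R_ops(4)[OF x(1)]] using x gs[OF x(1)] \<xi>(1) by (simp add: aut_simps)
    show "hnorm H (g u) \<le> hnorm H u" using contr[OF x(1)] gs[OF x(1)] x(2) by simp
    assume w: "w \<in> S"
    then obtain y where y: "y \<in> R" "w = y (b \<eta>)" by (auto simp: S_def)
    have uw: "u \<oplus> w = op_add H x y (b \<eta>)" using x y \<eta> by simp
    show "u \<oplus> w \<in> S" unfolding uw S_def using R_ops(2)[OF x(1) y(1)] by blast
    show "g (u \<oplus> w) = g u \<oplus> g w"
      unfolding uw gs[OF R_ops(2)[OF x(1) y(1)]] using x y gs \<xi>(1) by (simp add: aut_simps)
  qed
  then obtain D where D: "D \<in> bounded_ops H" "\<And>v. v \<in> carrier H \<Longrightarrow> D v \<in> orth H (orth H S)"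
    "\<And>u v. u \<in> S \<Longrightarrow> v \<in> carrier H \<Longrightarrow> cinner H u (D v) = cinner H (g u) v"
    by blast
  have Sinv: "z u \<in> S" if "z \<in> R" "u \<in> S" for z u
  proof -
    obtain x where x: "x \<in> R" "u = x (b \<eta>)" using \<open>u \<in> S\<close> by (auto simp: S_def)
    then have "z u = op_mult H z x (b \<eta>)" using \<eta> by simp
    then show ?thesis using R_ops(3)[OF that(1) x(1)] by (auto simp: S_def)
  qed
  have "D (\<theta> z v) = z (D v)" if z: "z \<in> R" and v: "v \<in> carrier H" for z v
  proof -
    have zb[simp]: "z \<in> bounded_ops H" "\<theta> z \<in> bounded_ops H" using z aut_simps(2) by auto
    have "op_adj H z x \<in> orth H S" if "x \<in> orth H S" for x
      by (rule orth_invariant[OF _ Sc _ that]) (use Sinv[OF z] in auto)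
    then have "z (D v) \<in> orth H (orth H S)"
      by (intro orth_invariant[OF zb(1) orth_subset _ D(2)[OF v]])
    then have 1: "D (\<theta> z v) \<ominus> z (D v) \<in> orth H (orth H S)"
      using D(2) v by (intro orth_diff[OF orth_subset]) auto
    have "cinner H u (D (\<theta> z v)) = cinner H u (z (D v))" if u: "u \<in> S" for u
    proof -
      obtain x where x: "x \<in> R" "u = x (b \<eta>)" using u by (auto simp: S_def)
      have uc: "u \<in> carrier H" using u Sc by blast
      have zu: "op_adj H z u = op_mult H (op_adj H z) x (b \<eta>)" using x \<eta> by simp
      have "cinner H u (z (D v)) = cinner H (op_adj H z u) (D v)"
        using uc D(1) v by (simp add: cinner_adj')
      also have "\<dots> = cinner H (g (op_adj H z u)) v"
        by (rule D(3)[OF Sinv[OF R_ops(5)[OF z] u] v])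
      also have "\<dots> = cinner H (op_adj H (\<theta> z) (\<theta> x (\<theta> b \<xi>))) v"
        unfolding zu gs[OF R_ops(3)[OF R_ops(5)[OF z] x(1)]]
        using x(1) z \<xi>(1) R_ops(5)[OF z] by (simp add: aut_simps)
      also have "\<dots> = cinner H (g u) (\<theta> z v)"
        using x gs[OF x(1)] \<xi>(1) v aut_simps(2)[OF x(1)] by (simp add: cinner_adj')
      also have "\<dots> = cinner H u (D (\<theta> z v))"
        using D(3)[OF u, of "\<theta> z v"] v by simp
      finally show ?thesis ..
    qed
    note eq = this
    have "D (\<theta> z v) \<ominus> z (D v) \<in> orth H S"
      unfolding orth_def
    proof (intro CollectI conjI ballI)
      fix u assume u: "u \<in> S"
      have uc: "u \<in> carrier H" using u Sc by blast
      have "cinner H u (D (\<theta> z v) \<ominus> z (D v)) = 0"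
        using eq[OF u] uc D(1) v by (simp add: cinner_simps)
      then show "cinner H (D (\<theta> z v) \<ominus> z (D v)) u = 0"
        using cinner_commute[of "D (\<theta> z v) \<ominus> z (D v)" u] uc D(1) v by simp
    qed (use D(1) v in simp)
    then have "D (\<theta> z v) \<ominus> z (D v) = \<zero>" using orth_orth_inter 1 by blast
    then show ?thesis using minus_eq_zero_iff[of "D (\<theta> z v)" "z (D v)"] D(1) v by simp
  qed
  moreover have "D \<xi> \<noteq> \<zero>"
  proof
    assume 0: "D \<xi> = \<zero>"
    have b\<eta>: "op_one H (b \<eta>) \<in> S" unfolding S_def using R_ops(1) by blast
    have "cinner H (g (op_one H (b \<eta>))) \<xi> = 0"
      using D(3)[OF b\<eta> \<xi>(1)] 0 \<eta> by (simp add: cinner_simps)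
    then have "cinner H (\<theta> b \<xi>) \<xi> = 0"
      unfolding gs[OF R_ops(1)] using \<xi>(1) by (simp add: aut_one)
    then show False using b\<xi> by simp
  qed
  ultimately show ?thesis using D(1) by blast
qed

end

section \<open>A unitary on the amplification that implements the automorphism\<close>

context amplification
begin

text \<open>The vectors \<open>D n (C f w)\<close>, for all \<open>n\<close> and \<open>f\<close>,
  become the coordinates of one vector. As \<open>F\<close> is infinite,
  \<open>nat \<times> F\<close> has the cardinality of \<open>F\<close>, so they can be indexed by
  \<open>F\<close>; weights make the list square-summable, and it determines \<open>w\<close>
  because the family \<open>D\<close> is separating.\<close>

lemma injective_amplification:
  assumes inf: "infinite F" and D: "\<And>n::nat. D n \<in> bounded_ops H"
    and faithful: "\<And>x. \<lbrakk>x \<in> carrier H; x \<noteq> \<zero>\<^bsub>H\<^esub>\<rbrakk> \<Longrightarrow> \<exists>n. D n x \<noteq> \<zero>\<^bsub>H\<^esub>"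
  shows "\<exists>A\<in>bounded_ops T. (\<forall>w\<in>carrier T. A w = \<zero>\<^bsub>T\<^esub> \<longrightarrow> w = \<zero>\<^bsub>T\<^esub>)
    \<and> (\<forall>z\<in>bounded_ops H. \<forall>z'\<in>bounded_ops H. (\<forall>n. \<forall>x\<in>carrier H. D n (z' x) = z (D n x))
        \<longrightarrow> (\<forall>w\<in>carrier T. A (amp z' w) = amp z (A w)))"
proof -
  have "\<exists>k>0. \<forall>x\<in>carrier H. hnorm H (D n x) \<le> k * hnorm H x" for n
    using H.bounded_ops_bound[OF D[of n]] by metis
  then obtain k where k: "\<And>n. k n > 0" "\<And>n x. x \<in> carrier H \<Longrightarrow> hnorm H (D n x) \<le> k n * hnorm H x"
    by metis
  \<comment> \<open>Gives \<open>D' n\<close> norm at most \<open>(1/2) ^ n\<close>; the squares of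
    these bounds sum to at most \<open>4\<close>, the square of the bound \<open>2\<close> passed to
    \<open>op_ex\<close>.\<close>
  define c where "c n = (1/2) ^ n / k n" for n
  define D' where "D' n = op_smult H (complex_of_real (c n)) (D n)" for n
  have c: "c n > 0" for n using k(1) by (simp add: c_def)
  have D'b[simp]: "D' n \<in> bounded_ops H" for n using D by (simp add: D'_def)
  have D'x: "D' n x = complex_of_real (c n) \<odot>\<^bsub>H\<^esub> D n x" if "x \<in> carrier H" for n x
    using that by (simp add: D'_def)
  have D'n: "(hnorm H (D' n x))\<^sup>2 \<le> (1/4) ^ n * (hnorm H x)\<^sup>2" if x: "x \<in> carrier H" for n x
  proof -
    have "hnorm H (D' n x) = c n * hnorm H (D n x)"
      using x D c[of n] by (simp add: D'x H.hnorm_smult)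
    also have "\<dots> \<le> c n * (k n * hnorm H x)"
      using k(2)[OF x] c[of n] by (intro mult_left_mono) auto
    also have "\<dots> = (1/2) ^ n * hnorm H x" using k(1)[of n] by (simp add: c_def)
    finally have "(hnorm H (D' n x))\<^sup>2 \<le> ((1/2) ^ n * hnorm H x)\<^sup>2"
      using x by (intro power_mono) (auto simp: H.hnorm_nonneg)
    also have "\<dots> = (1/4) ^ n * (hnorm H x)\<^sup>2"
      by (simp add: power_mult_distrib power2_eq_square flip: power_mult_distrib)
    finally show ?thesis .
  qed
  have "\<exists>\<beta>. bij_betw \<beta> ((UNIV :: nat set) \<times> F) F"
    using card_of_Times_infinite[OF inf, of "UNIV :: nat set"] infinite_iff_card_of_nat[of F] inf
    by (simp add: card_of_ordIso)
  then obtain \<beta> where \<beta>: "bij_betw \<beta> ((UNIV :: nat set) \<times> F) F" by blast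
  define \<gamma> where "\<gamma> = inv_into (UNIV \<times> F) \<beta>"
  have \<gamma>: "bij_betw \<gamma> F (UNIV \<times> F)" unfolding \<gamma>_def by (rule bij_betw_inv_into[OF \<beta>])
  have \<gamma>F: "snd (\<gamma> g) \<in> F" if "g \<in> F" for g
    using bij_betwE[OF \<gamma>] that by (auto simp: mem_Times_iff)
  have \<gamma>\<beta>: "\<gamma> (\<beta> (n, f)) = (n, f)" "\<beta> (n, f) \<in> F" if "f \<in> F" for n f
    using \<beta> that by (auto simp: \<gamma>_def bij_betw_def)
  have "\<exists>A\<in>bounded_ops T. \<forall>w\<in>carrier T. \<forall>g\<in>F. C g (A w) = D' (fst (\<gamma> g)) (C (snd (\<gamma> g)) w)"
  proof (rule op_ex[of _ 2])
    fix G w assume G: "finite G" "G \<subseteq> F" and w: "w \<in> carrier T"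
    define a where "a p = (1/4::real) ^ fst p * (hnorm H (C (snd p) w))\<^sup>2" for p :: "nat \<times> 'f"
    have a: "a p \<ge> 0" for p by (simp add: a_def)
    define A B where "A = fst ` \<gamma> ` G" and "B = snd ` \<gamma> ` G"
    have fin: "finite A" "finite B" using G by (auto simp: A_def B_def)
    have BF: "B \<subseteq> F" using G \<gamma>F by (auto simp: B_def)
    have inj: "inj_on \<gamma> G" using \<gamma> G(2) by (auto simp: bij_betw_def inj_on_subset)
    have "(\<Sum>g\<in>G. (hnorm H (D' (fst (\<gamma> g)) (C (snd (\<gamma> g)) w)))\<^sup>2) \<le> (\<Sum>g\<in>G. a (\<gamma> g))"
      unfolding a_def using G \<gamma>F w by (intro sum_mono D'n) auto
    also have "\<dots> = (\<Sum>p\<in>\<gamma> ` G. a p)"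
      using inj by (simp add: sum.reindex)
    also have "\<dots> \<le> (\<Sum>p\<in>A \<times> B. a p)"
    proof (rule sum_mono2)
      show "\<gamma> ` G \<subseteq> A \<times> B" unfolding A_def B_def by (rule subset_fst_snd)
    qed (use fin a in auto)
    also have "\<dots> = (\<Sum>n\<in>A. (1/4) ^ n) * (\<Sum>f\<in>B. (hnorm H (C f w))\<^sup>2)"
      by (simp add: sum_product sum.cartesian_product case_prod_beta a_def)
    also have "\<dots> \<le> 4 * (hnorm T w)\<^sup>2"
    proof (rule mult_mono)
      have "(\<Sum>n\<in>A. (1/4::real) ^ n) \<le> (\<Sum>n. (1/4) ^ n)"
        using fin by (intro sum_le_suminf summable_geometric) auto
      also have "\<dots> \<le> 4" by (simp add: suminf_geometric)
      finally show "(\<Sum>n\<in>A. (1/4::real) ^ n) \<le> 4" .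
      show "(\<Sum>f\<in>B. (hnorm H (C f w))\<^sup>2) \<le> (hnorm T w)\<^sup>2"
        by (rule bessel[OF fin(2) BF w])
    qed (auto intro: sum_nonneg)
    finally show "(\<Sum>g\<in>G. (hnorm H (D' (fst (\<gamma> g)) (C (snd (\<gamma> g)) w)))\<^sup>2) \<le> (2 * hnorm T w)\<^sup>2"
      by (simp add: power_mult_distrib)
  qed (use \<gamma>F D'b in \<open>auto simp: C_add C_smult bounded_ops_add bounded_ops_smult simp del: fst_conv snd_conv\<close>)
  then obtain A where A: "A \<in> bounded_ops T"
    "\<And>w g. w \<in> carrier T \<Longrightarrow> g \<in> F \<Longrightarrow> C g (A w) = D' (fst (\<gamma> g)) (C (snd (\<gamma> g)) w)"
    by blast
  have "w = \<zero>\<^bsub>T\<^esub>" if w: "w \<in> carrier T" "A w = \<zero>\<^bsub>T\<^esub>" for w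
  proof (rule C_total[OF w(1)])
    fix f assume f: "f \<in> F"
    show "C f w = \<zero>\<^bsub>H\<^esub>"
    proof (rule ccontr)
      assume "C f w \<noteq> \<zero>\<^bsub>H\<^esub>"
      then obtain n where n: "D n (C f w) \<noteq> \<zero>\<^bsub>H\<^esub>" using faithful[of "C f w"] f w(1) by auto
      have "C (\<beta> (n, f)) (A w) = D' n (C f w)" using A(2)[OF w(1) \<gamma>\<beta>(2)[OF f]] \<gamma>\<beta>(1)[OF f] by simp
      moreover have "C (\<beta> (n, f)) (A w) = \<zero>\<^bsub>H\<^esub>"
      proof -
        let ?C = "C (\<beta> (n, f))"
        have c0: "?C \<zero>\<^bsub>T\<^esub> \<in> carrier H" by (rule C_closed[OF \<gamma>\<beta>(2)[OF f] T.M.zero_closed])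
        have "?C \<zero>\<^bsub>T\<^esub> \<oplus>\<^bsub>H\<^esub> ?C \<zero>\<^bsub>T\<^esub> = ?C (\<zero>\<^bsub>T\<^esub> \<oplus>\<^bsub>T\<^esub> \<zero>\<^bsub>T\<^esub>)"
          by (rule C_add[OF \<gamma>\<beta>(2)[OF f] T.M.zero_closed T.M.zero_closed, symmetric])
        then have "?C \<zero>\<^bsub>T\<^esub> \<oplus>\<^bsub>H\<^esub> ?C \<zero>\<^bsub>T\<^esub> = ?C \<zero>\<^bsub>T\<^esub>" by simp
        then show ?thesis using c0 w(2) H.M.add.l_cancel_one'[OF c0 c0] by simp
      qed
      moreover have "D' n (C f w) = complex_of_real (c n) \<odot>\<^bsub>H\<^esub> D n (C f w)"
        by (rule D'x[OF C_closed[OF f w(1)]])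
      ultimately have "complex_of_real (c n) \<odot>\<^bsub>H\<^esub> D n (C f w) = \<zero>\<^bsub>H\<^esub>" by argo
      then have "hnorm H (complex_of_real (c n) \<odot>\<^bsub>H\<^esub> D n (C f w)) = 0"
        by (simp add: H.hnorm_eq_0)
      then have "hnorm H (D n (C f w)) = 0"
        using c[of n] D f w(1) by (simp add: H.hnorm_smult)
      then show False using n D f w(1) H.hnorm_eq_0[of "D n (C f w)"] by simp
    qed
  qed
  moreover have "A (amp z' w) = amp z (A w)"
    if z: "z \<in> bounded_ops H" "z' \<in> bounded_ops H" "\<forall>n. \<forall>x\<in>carrier H. D n (z' x) = z (D n x)" and w: "w \<in> carrier T"
    for z z' w
  proof (rule C_ext)
    fix g assume g: "g \<in> F"
    define n f where "n = fst (\<gamma> g)" and "f = snd (\<gamma> g)"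
    have f: "f \<in> F" using \<gamma>F[OF g] by (simp add: f_def)
    have Cf: "C f w \<in> carrier H" using f w by simp
    have "C g (A (amp z' w)) = D' n (C f (amp z' w))" using A(2)[OF _ g] z w by (simp add: n_def f_def)
    also have "\<dots> = complex_of_real (c n) \<odot>\<^bsub>H\<^esub> D n (z' (C f w))" using z w f by (simp add: D'x)
    also have "\<dots> = complex_of_real (c n) \<odot>\<^bsub>H\<^esub> z (D n (C f w))" using z(3) Cf by simp
    also have "\<dots> = z (D' n (C f w))" using z D Cf by (simp add: D'x bounded_ops_smult)
    also have "\<dots> = C g (amp z (A w))" using A w g z(1) by (simp add: n_def f_def)
    finally show "C g (A (amp z' w)) = C g (amp z (A w))" .
  qed (use A(1) z w in auto)
  ultimately show ?thesis using A(1) by blast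
qed

definition aut_pairs :: "('h \<Rightarrow> 'h) set \<Rightarrow> (('h \<Rightarrow> 'h) \<Rightarrow> 'h \<Rightarrow> 'h) \<Rightarrow> (('t \<Rightarrow> 't) \<times> ('t \<Rightarrow> 't)) set" where
  "aut_pairs R \<theta> = (\<lambda>z. (amp z, amp (\<theta> z))) ` R"

text \<open>The relation \<open>D (\<theta> z) = z D\<close> leads from the representation
  \<open>amp (\<theta> z)\<close> to \<open>amp z\<close>, hence the swapped pairs.\<close>

lemma automorphism_isometry:
  assumes inf: "infinite F" and sep: "separable_hilbert H" and N: "adj_closed_set H N"
    and \<theta>: "star_automorphism H (commutant H N) \<theta>"
  shows "adj_closed_pairs T (aut_pairs (commutant H N) \<theta>)"
    and "\<exists>V. isometry_op T V \<and> intertwines T (prod.swap ` aut_pairs (commutant H N) \<theta>) V"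
proof -
  interpret a: commutant_automorphism H N \<theta>
    using N \<theta> by unfold_locales
  show G: "adj_closed_pairs T (aut_pairs a.R \<theta>)"
    unfolding adj_closed_pairs_def aut_pairs_def
    using a.aut_simps a.R_ops(5) by (auto simp: amp_adj[symmetric])
  define \<D> where "\<D> = {D \<in> bounded_ops H. \<forall>z\<in>a.R. \<forall>x\<in>carrier H. D (\<theta> z x) = z (D x)}"
  have zero: "op_smult H 0 (op_one H) \<in> \<D>"
    using a.aut_simps(2) by (auto simp: \<D>_def H.bounded_ops_zero)
  have "\<exists>D. (\<forall>n::nat. D n \<in> \<D>) \<and> (\<forall>x\<in>carrier H. x \<noteq> \<zero>\<^bsub>H\<^esub> \<longrightarrow> (\<exists>n. D n x \<noteq> \<zero>\<^bsub>H\<^esub>))"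
  proof (rule H.countable_faithful[OF sep])
    show "\<D> \<noteq> {}" using zero by blast
    show "\<exists>D\<in>\<D>. D x \<noteq> \<zero>\<^bsub>H\<^esub>" if "x \<in> carrier H" "x \<noteq> \<zero>\<^bsub>H\<^esub>" for x
      using a.intertwiner_ex[OF that] unfolding \<D>_def by blast
  qed (auto simp: \<D>_def)
  then obtain D where D: "\<And>n::nat. D n \<in> \<D>" "\<And>x. x \<in> carrier H \<Longrightarrow> x \<noteq> \<zero>\<^bsub>H\<^esub> \<Longrightarrow> \<exists>n. D n x \<noteq> \<zero>\<^bsub>H\<^esub>"
    by blast
  have Db: "D n \<in> bounded_ops H" for n using D(1) by (simp add: \<D>_def)
  obtain A where A: "A \<in> bounded_ops T" "\<And>w. w \<in> carrier T \<Longrightarrow> A w = \<zero>\<^bsub>T\<^esub> \<Longrightarrow> w = \<zero>\<^bsub>T\<^esub>"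
    "\<And>z z' w. \<lbrakk>z \<in> bounded_ops H; z' \<in> bounded_ops H; \<forall>n. \<forall>x\<in>carrier H. D n (z' x) = z (D n x); w \<in> carrier T\<rbrakk>
      \<Longrightarrow> A (amp z' w) = amp z (A w)"
    using injective_amplification[OF inf Db D(2)] by blast
  have "intertwines T (prod.swap ` aut_pairs a.R \<theta>) A"
  proof -
    have "A (amp (\<theta> z) w) = amp z (A w)" if "z \<in> a.R" "w \<in> carrier T" for z w
      using that D(1) a.aut_simps(2) by (intro A(3)) (auto simp: \<D>_def)
    then show ?thesis using A(1) by (auto simp: intertwines_def aut_pairs_def)
  qed
  then show "\<exists>V. isometry_op T V \<and> intertwines T (prod.swap ` aut_pairs a.R \<theta>) V"
    using T.isometry_of_injective[OF adj_closed_pairs_swap[OF G] _ A(2)] by blast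
qed

text \<open>The isometry in the opposite direction comes from \<open>automorphism_isometry\<close>
  for the inverse automorphism, whose swapped pairs are the original pairs of
  \<open>\<theta>\<close>.\<close>

lemma automorphism_unitary:
  assumes inf: "infinite F" and sep: "separable_hilbert H" and N: "adj_closed_set H N"
    and \<theta>: "star_automorphism H (commutant H N) \<theta>"
  shows "\<exists>U. unitary_op T U \<and> (\<forall>z\<in>commutant H N. \<forall>w\<in>carrier T. U (amp z w) = amp (\<theta> z) (U w))"
proof -
  interpret a: commutant_automorphism H N \<theta>
    using N \<theta> by unfold_locales
  note 1 = automorphism_isometry[OF inf sep N \<theta>]
  define \<iota> where "\<iota> = inv_into a.R \<theta>"
  have \<iota>: "star_automorphism H a.R \<iota>"
    using a.inverse_aut by (simp add: \<iota>_def commutant_automorphism_def commutant_automorphism_axioms_def)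
  have bij: "bij_betw \<theta> a.R a.R" using \<theta> by (simp add: star_automorphism_def)
  have "prod.swap ` aut_pairs a.R \<iota> = aut_pairs a.R \<theta>"
  proof -
    have "aut_pairs a.R \<iota> = (\<lambda>z. (amp z, amp (\<iota> z))) ` \<theta> ` a.R"
      using bij by (simp add: aut_pairs_def bij_betw_def)
    also have "\<dots> = (\<lambda>z. (amp (\<theta> z), amp z)) ` a.R"
      unfolding image_image using bij by (intro image_cong) (auto simp: \<iota>_def bij_betw_def)
    finally show ?thesis by (simp add: aut_pairs_def image_image)
  qed
  then obtain W where W: "isometry_op T W" "intertwines T (aut_pairs a.R \<theta>) W"
    using automorphism_isometry(2)[OF inf sep N \<iota>] by auto
  obtain V where V: "isometry_op T V" "intertwines T (prod.swap ` aut_pairs a.R \<theta>) V"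
    using 1(2) by blast
  obtain U where "unitary_op T U" "intertwines T (aut_pairs a.R \<theta>) U"
    using T.unitary_of_isometries[OF 1(1) W V] by blast
  then show ?thesis by (auto simp: intertwines_def aut_pairs_def)
qed

lemma automorphism_trivial:
  assumes inf: "infinite F" and sep: "separable_hilbert H"
    and N: "von_neumann_algebra H N" and M: "von_neumann_algebra H M" and NM: "N \<subseteq> M"
    and NN: "commutant H (commutant H N) = N" and MM: "commutant H (commutant H M) = M"
    and sing: "singular_in T (mats N) (mats M)"
    and \<theta>: "star_automorphism H (commutant H N) \<theta>" and fixM: "\<forall>X\<in>commutant H M. \<theta> X = X"
  shows "\<forall>Y\<in>commutant H N. \<theta> Y = Y"
proof -
  have adjN: "adj_closed_set H N" by (rule von_neumann_algebra_adj_closed[OF N])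
  interpret a: commutant_automorphism H N \<theta>
    using adjN \<theta> by unfold_locales
  obtain U where U: "unitary_op T U" and int: "\<And>z w. z \<in> a.R \<Longrightarrow> w \<in> carrier T \<Longrightarrow> U (amp z w) = amp (\<theta> z) (U w)"
    using automorphism_unitary[OF inf sep adjN \<theta>] by blast
  note u = T.unitary_opD[OF U]
  have Rb: "X \<in> bounded_ops H" if "X \<in> a.R" for X using that by simp
  have ampR: "amp ` a.R \<subseteq> bounded_ops T" using Rb by auto
  have int': "op_adj T U (amp (\<theta> z) w) = amp z (op_adj T U w)" if z: "z \<in> a.R" and w: "w \<in> carrier T" for z w
  proof -
    have "U (amp z (op_adj T U w)) = amp (\<theta> z) w"
      using int[OF z, of "op_adj T U w"] u w by simp
    then show ?thesis using u(2)[of "amp z (op_adj T U w)"] u(1) Rb[OF z] w by simp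
  qed
  have matsN: "mats N = commutant T (amp ` a.R)"
    using mats_commutant[of a.R] NN Rb by (simp add: subset_eq)
  have matsM: "mats M = commutant T (amp ` commutant H M)"
    using mats_commutant[of "commutant H M"] MM by (simp add: subset_eq)
  have UM: "U \<in> mats M"
    unfolding matsM
  proof (rule T.commutantI[OF u(1)])
    fix s x assume "s \<in> amp ` commutant H M" and x: "x \<in> carrier T"
    then obtain X where X: "X \<in> commutant H M" "s = amp X" by blast
    have "X \<in> a.R" using X(1) commutant_antimono[OF NM] by blast
    then show "U (s x) = s (U x)" using int[of X x] fixM X x by simp
  qed auto
  \<comment> \<open>Normalising means equality of sets, so conjugation by \<open>U\<close> and by
    its adjoint are treated separately. They permute the amplified commutant by
    \<open>\<theta>\<close> and by its inverse, and so preserve what commutes with it.\<close>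
  have c1: "op_conj T U S \<in> mats N" if S: "S \<in> mats N" for S
    unfolding matsN
  proof (rule T.commutantI[OF _ ampR])
    have Sb[simp]: "S \<in> bounded_ops T" using S by (simp add: mats_def)
    show "op_conj T U S \<in> bounded_ops T" using u(1) by (simp add: T.op_conj)
    fix s x assume "s \<in> amp ` a.R" and x: "x \<in> carrier T"
    then obtain Y where Y: "Y \<in> a.R" "s = amp Y" by blast
    obtain z where z: "z \<in> a.R" "\<theta> z = Y" using a.aut_surj[OF Y(1)] by blast
    have sx: "s x \<in> carrier T" using Y Rb x by simp
    have "op_conj T U S (s x) = U (S (op_adj T U (amp (\<theta> z) x)))"
      using T.op_conj(2)[OF u(1) sx] Y(2) z(2) by simp
    also have "\<dots> = U (S (amp z (op_adj T U x)))" using int'[OF z(1) x] by simp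
    also have "\<dots> = U (amp z (S (op_adj T U x)))"
      using commutantD[of S T "amp ` a.R" "amp z" "op_adj T U x"] S matsN z(1) u(1) x by simp
    also have "\<dots> = amp (\<theta> z) (U (S (op_adj T U x)))" using int[OF z(1)] u(1) x by simp
    also have "\<dots> = s (op_conj T U S x)" using T.op_conj(2)[OF u(1) x] Y(2) z(2) by simp
    finally show "op_conj T U S (s x) = s (op_conj T U S x)" .
  qed
  have c2: "op_conj T (op_adj T U) S \<in> mats N" if S: "S \<in> mats N" for S
    unfolding matsN
  proof (rule T.commutantI[OF _ ampR])
    have Sb[simp]: "S \<in> bounded_ops T" using S by (simp add: mats_def)
    show "op_conj T (op_adj T U) S \<in> bounded_ops T" using u(1) by (simp add: T.op_conj)
    fix s x assume "s \<in> amp ` a.R" and x: "x \<in> carrier T"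
    then obtain z where z: "z \<in> a.R" "s = amp z" by blast
    have sx: "s x \<in> carrier T" using z Rb x by simp
    have cj: "op_conj T (op_adj T U) S y = op_adj T U (S (U y))" if "y \<in> carrier T" for y
      using T.op_conj(2)[of "op_adj T U" y S] u(1) that by simp
    have "op_conj T (op_adj T U) S (s x) = op_adj T U (S (amp (\<theta> z) (U x)))"
      using cj[OF sx] int[OF z(1) x] z(2) by simp
    also have "\<dots> = op_adj T U (amp (\<theta> z) (S (U x)))"
      using commutantD[of S T "amp ` a.R" "amp (\<theta> z)" "U x"] S matsN a.aut_simps(1)[OF z(1)] u(1) x by simp
    also have "\<dots> = amp z (op_adj T U (S (U x)))" using int'[OF z(1)] u(1) x by simp
    also have "\<dots> = s (op_conj T (op_adj T U) S x)" using cj[OF x] z(2) by simp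
    finally show "op_conj T (op_adj T U) S (s x) = s (op_conj T (op_adj T U) S x)" .
  qed
  have "op_conj T U ` mats N = mats N"
  proof
    show "op_conj T U ` mats N \<subseteq> mats N" using c1 by blast
    show "mats N \<subseteq> op_conj T U ` mats N"
    proof
      fix S assume S: "S \<in> mats N"
      then have "S = op_conj T U (op_conj T (op_adj T U) S)"
        using T.op_conj_inverse(2)[OF U] by (simp add: mats_def)
      then show "S \<in> op_conj T U ` mats N" using c2[OF S] by blast
    qed
  qed
  then have "U \<in> mats N"
    using sing UM U unfolding singular_in_def op_conj_def[symmetric] by blast
  then have UN: "U \<in> commutant T (amp ` a.R)" by (simp add: matsN)
  show ?thesis
  proof
    fix Y assume Y: "Y \<in> a.R"
    have "amp (\<theta> Y) = amp Y"
    proof (rule T.ops_eqI)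
      fix w assume w: "w \<in> carrier T"
      have w': "op_adj T U w \<in> carrier T" using u(1) w by simp
      have "amp (\<theta> Y) (U (op_adj T U w)) = amp Y (U (op_adj T U w))"
        using int[OF Y w'] commutantD[OF UN imageI[OF Y] w'] by simp
      then show "amp (\<theta> Y) w = amp Y w" using u(3)[OF w] by simp
    qed (use Y Rb a.aut_simps(2) in auto)
    moreover have "F \<noteq> {}" using inf by auto
    ultimately show "\<theta> Y = Y" using amp_inj Rb[OF Y] a.aut_simps(2)[OF Y] by blast
  qed
qed

end

section \<open>The equivalence of the three conditions\<close>

lemma singular_tensorI:
  assumes "hilbert_space H" "hilbert_space K"
    and N: "von_neumann_algebra H N" and M: "von_neumann_algebra H M" and NM: "N \<subseteq> M"
    and NN: "commutant H (commutant H N) = N" and MM: "commutant H (commutant H M) = M"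
    and rigid: "\<forall>\<theta>. star_automorphism H (commutant H N) \<theta> \<longrightarrow>
      (\<forall>X\<in>commutant H M. \<theta> X = X) \<longrightarrow> (\<forall>Y\<in>commutant H N. \<theta> Y = Y)"
  shows "singular_in (hilbert_tensor H K) (von_neumann_tensor H K N (bounded_ops K))
    (von_neumann_tensor H K M (bounded_ops K))"
proof -
  interpret two_hilbert_spaces H K
    by (intro two_hilbert_spaces.intro assms(1,2))
  show ?thesis
    unfolding von_neumann_tensor_eq_mats[OF N NN] von_neumann_tensor_eq_mats[OF M MM]
    using rigid by (intro singular_matsI[OF N M NN MM _ NM]) auto
qed

text \<open>Stated for any \<open>K\<close> with an infinite basis so that it serves both
  \<open>ell2\<close> itself and its copy inside the type of complete singularity.\<close>

lemma singular_tensorD: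
  assumes "hilbert_space H" "hilbert_space K" and inf: "infinite (some_onb K)" and sep: "separable_hilbert H"
    and N: "von_neumann_algebra H N" and M: "von_neumann_algebra H M" and NM: "N \<subseteq> M"
    and NN: "commutant H (commutant H N) = N" and MM: "commutant H (commutant H M) = M"
    and sing: "singular_in (hilbert_tensor H K) (von_neumann_tensor H K N (bounded_ops K))
      (von_neumann_tensor H K M (bounded_ops K))"
  shows "\<forall>\<theta>. star_automorphism H (commutant H N) \<theta> \<longrightarrow>
    (\<forall>X\<in>commutant H M. \<theta> X = X) \<longrightarrow> (\<forall>Y\<in>commutant H N. \<theta> Y = Y)"
proof -
  interpret two_hilbert_spaces H K
    by (intro two_hilbert_spaces.intro assms(1,2))
  show ?thesis
    using automorphism_trivial[OF inf sep N M NM NN MM]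
      sing[unfolded von_neumann_tensor_eq_mats[OF N NN] von_neumann_tensor_eq_mats[OF M MM]] by blast
qed

theorem theorem3p1:
  fixes H :: "'h hilbert" and M N :: "('h \<Rightarrow> 'h) set"
  assumes "hilbert_space H" and "separable_hilbert H"
    and "von_neumann_algebra H M" and "von_neumann_subalgebra H N M"
  shows "(completely_singular_in TYPE('k + (nat \<Rightarrow> complex)) H N M \<longleftrightarrow>
            singular_in (hilbert_tensor H ell2)
              (von_neumann_tensor H ell2 N (bounded_ops ell2))
              (von_neumann_tensor H ell2 M (bounded_ops ell2)))
       \<and> (singular_in (hilbert_tensor H ell2)
              (von_neumann_tensor H ell2 N (bounded_ops ell2))
              (von_neumann_tensor H ell2 M (bounded_ops ell2)) \<longleftrightarrow>
            (\<forall>\<theta>. star_automorphism H (commutant H N) \<theta> \<longrightarrow>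
              (\<forall>X\<in>commutant H M. \<theta> X = X) \<longrightarrow> (\<forall>Y\<in>commutant H N. \<theta> Y = Y)))"
proof -
  have N: "von_neumann_algebra H N" and NM: "N \<subseteq> M"
    using assms(4) by (auto simp: von_neumann_subalgebra_def)
  note M = assms(3)
  interpret L: two_hilbert_spaces H ell2
    by (intro two_hilbert_spaces.intro assms(1) hilbert_space_ell2)
  \<comment> \<open>The double commutant identity concerns \<open>H\<close> alone; the amplification
    by \<open>ell2\<close> lends the infinitely many coordinates used in its proof.\<close>
  have NN: "commutant H (commutant H N) = N" and MM: "commutant H (commutant H M) = M"
    by (rule L.double_commutant[OF N infinite_some_onb_ell2] L.double_commutant[OF M infinite_some_onb_ell2])+
  define rigid where "rigid \<longleftrightarrow> (\<forall>\<theta>. star_automorphism H (commutant H N) \<theta> \<longrightarrow>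
    (\<forall>X\<in>commutant H M. \<theta> X = X) \<longrightarrow> (\<forall>Y\<in>commutant H N. \<theta> Y = Y))"
  note to_singular = singular_tensorI[OF assms(1) _ N M NM NN MM, folded rigid_def]
    and to_rigid = singular_tensorD[OF assms(1) _ _ assms(2) N M NM NN MM, folded rigid_def]
  have "singular_in (hilbert_tensor H ell2) (von_neumann_tensor H ell2 N (bounded_ops ell2))
      (von_neumann_tensor H ell2 M (bounded_ops ell2)) \<longleftrightarrow> rigid"
    using to_singular[OF hilbert_space_ell2] to_rigid[OF hilbert_space_ell2 infinite_some_onb_ell2] by blast
  moreover have "completely_singular_in TYPE('k + (nat \<Rightarrow> complex)) H N M \<longleftrightarrow> rigid"
  proof
    \<comment> \<open>The right summand of the type carries a copy of \<open>ell2\<close>, so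
      complete singularity always includes an infinite-dimensional space, to which
      \<open>to_rigid\<close> applies.\<close>
    define K :: "('k + (nat \<Rightarrow> complex)) hilbert" where "K = copy_hilbert Inr projr ell2"
    have K: "hilbert_space K"
      unfolding K_def by (rule hilbert_space_copy[OF hilbert_space_ell2]) simp
    have inf: "infinite (some_onb K)"
      unfolding K_def by (rule infinite_some_onb_copy_ell2) simp
    assume "completely_singular_in TYPE('k + (nat \<Rightarrow> complex)) H N M"
    then show rigid
      using to_rigid[OF K inf] K by (simp add: completely_singular_in_def)
  next
    assume rigid
    then show "completely_singular_in TYPE('k + (nat \<Rightarrow> complex)) H N M"
      unfolding completely_singular_in_def by (intro allI impI to_singular)
  qed
  ultimately show ?thesis
    unfolding rigid_def by blast
qed

end
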